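(* Let $n \geqslant 2$, let $(M, g)$ be an $n$-dimensional complete connected Riemannian manifold, and let $f : M \rightarrow \mathbb{R}$ be a smooth function such that \[ \operatorname{Ric}_{g} + \operatorname{Hess} f \geqslant (n - 1)Hg \] on $M$ for some constant $H > 0$. If $|f| \leqslant k$ on $M$ for some constant $k \geqslant 0$, then $M$ is compact. Moreover, \[ \operatorname{diam}(M, g) \leqslant \frac{\pi}{\sqrt{H}} \sqrt{1 + \frac{8k}{(n - 1) \pi}}. \]
   Context: Manifolds are smooth and without boundary. $\operatorname{Ric}_g$ is the Ricci tensor of $(M,g)$ (with the sign convention that round spheres have positive Ricci curvature). The gradient and Hessian of $f$ are defined by $g(\nabla f, X) = df(X)$ and $\operatorname{Hess} f(X, Y) = g(\nabla_X \nabla f, Y)$. The inequality between symmetric $2$-tensors means $\operatorname{Ric}_g(v,v) + \operatorname{Hess} f(v,v) \geqslant (n-1)H\, g(v,v)$ for every tangent vector $v$. $\operatorname{diam}(M,g)$ is the diameter with respect to the Riemannian distance. *)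

theory Defs
  imports "HOL-Analysis.Analysis"
begin

section \<open>Smooth maps between open subsets of normed spaces\<close>

text \<open>Meaningful for open \<open>S\<close> and finite-dimensional domain: all iterated directional derivatives
  up to the given order exist as Frechet derivatives and are continuous on \<open>S\<close>.\<close>

fun times_diff_on :: "nat \<Rightarrow> 'b::real_normed_vector set \<Rightarrow> ('b \<Rightarrow> 'c::real_normed_vector) \<Rightarrow> bool" where
  "times_diff_on 0 S F \<longleftrightarrow> continuous_on S F"
| "times_diff_on (Suc m) S F \<longleftrightarrow>
     (\<forall>x\<in>S. F differentiable (at x)) \<and>
     (\<forall>v. times_diff_on m S (\<lambda>x. frechet_derivative F (at x) v))"

definition smooth_on :: "'b::real_normed_vector set \<Rightarrow> ('b \<Rightarrow> 'c::real_normed_vector) \<Rightarrow> bool" where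
  "smooth_on S F \<longleftrightarrow> (\<forall>m. times_diff_on m S F)"


section \<open>Smooth manifolds\<close>

text \<open>A chart is an open domain \<open>U\<close> together with a coordinate map, whose values outside \<open>U\<close> are
  irrelevant. The dimension of the manifold is \<open>CARD('n)\<close>.\<close>

type_synonym ('a, 'n) chart = "'a set \<times> ('a \<Rightarrow> real^'n)"

definition chart_dom :: "('a, 'n) chart \<Rightarrow> 'a set" where
  "chart_dom c = fst c"

definition chart_map :: "('a, 'n) chart \<Rightarrow> 'a \<Rightarrow> real^'n" where
  "chart_map c = snd c"

definition chart_img :: "('a, 'n) chart \<Rightarrow> (real^'n) set" where
  "chart_img c = chart_map c ` chart_dom c"

definition chart_inv :: "('a, 'n) chart \<Rightarrow> real^'n \<Rightarrow> 'a" where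
  "chart_inv c = inv_into (chart_dom c) (chart_map c)"

definition transition :: "('a, 'n) chart \<Rightarrow> ('a, 'n) chart \<Rightarrow> real^'n \<Rightarrow> real^'n" where
  "transition c c' = chart_map c' \<circ> chart_inv c"

text \<open>The domain of \<open>transition c c'\<close>.\<close>

definition overlap :: "('a, 'n) chart \<Rightarrow> ('a, 'n) chart \<Rightarrow> (real^'n) set" where
  "overlap c c' = chart_map c ` (chart_dom c \<inter> chart_dom c')"

text \<open>The manifold is the whole type \<open>'a\<close>; its smooth structure is given by an atlas, which need
  not be maximal.\<close>

locale smooth_manifold =
  fixes A :: "('a::{t2_space, second_countable_topology}, 'n::finite) chart set"
  assumes open_dom: "c \<in> A \<Longrightarrow> open (chart_dom c)"
    and open_img: "c \<in> A \<Longrightarrow> open (chart_img c)"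
    and chart_homeomorphism:
      "c \<in> A \<Longrightarrow> homeomorphism (chart_dom c) (chart_img c) (chart_map c) (chart_inv c)"
    and covers: "(\<Union>c\<in>A. chart_dom c) = UNIV"
    and smooth_transition:
      "c \<in> A \<Longrightarrow> c' \<in> A \<Longrightarrow> smooth_on (overlap c c') (transition c c')"

definition smooth_function :: "('a, 'n::finite) chart set \<Rightarrow> ('a \<Rightarrow> real) \<Rightarrow> bool" where
  "smooth_function A f \<longleftrightarrow> (\<forall>c\<in>A. smooth_on (chart_img c) (f \<circ> chart_inv c))"


section \<open>Riemannian metrics\<close>

text \<open>A tangent vector at a point is represented, in each chart around the point, by the vector
  of its components with respect to the coordinate basis. A Riemannian metric is a smooth
  symmetric positive definite covariant 2-tensor: \<open>g c x\<close> is the matrix of its components in the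
  chart \<open>c\<close> at the point with coordinates \<open>x \<in> chart_img c\<close>, and these matrices satisfy the
  transformation law under changes of coordinates.\<close>

type_synonym ('a, 'n) metric_tensor = "('a, 'n) chart \<Rightarrow> real^'n \<Rightarrow> real^'n^'n"

definition jacobian_matrix :: "(real^'n \<Rightarrow> real^'n) \<Rightarrow> real^'n \<Rightarrow> real^'n^'n" where
  "jacobian_matrix F x = matrix (frechet_derivative F (at x))"

text \<open>The inner product of two vectors at \<open>x\<close> for a metric with component matrices \<open>G\<close>.\<close>

definition metric_inner :: "(real^'n \<Rightarrow> real^'n^'n) \<Rightarrow> real^'n \<Rightarrow> real^'n \<Rightarrow> real^'n \<Rightarrow> real" where
  "metric_inner G x u v = u \<bullet> (G x *v v)"

locale riemannian_manifold = smooth_manifold A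
  for A :: "('a::{t2_space, second_countable_topology}, 'n::finite) chart set" +
  fixes g :: "('a, 'n) metric_tensor"
  assumes metric_smooth: "c \<in> A \<Longrightarrow> smooth_on (chart_img c) (g c)"
    and metric_symmetric: "c \<in> A \<Longrightarrow> x \<in> chart_img c \<Longrightarrow> transpose (g c x) = g c x"
    and metric_positive: "c \<in> A \<Longrightarrow> x \<in> chart_img c \<Longrightarrow> v \<noteq> 0 \<Longrightarrow> 0 < metric_inner (g c) x v v"
    and metric_transform:
      "c \<in> A \<Longrightarrow> c' \<in> A \<Longrightarrow> x \<in> overlap c c' \<Longrightarrow>
        g c x = transpose (jacobian_matrix (transition c c') x)
                ** g c' (transition c c' x) ** jacobian_matrix (transition c c') x"


section \<open>Levi-Civita connection, curvature, gradient and Hessian in coordinates\<close>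

text \<open>Throughout this section \<open>G\<close> stands for the component matrices of a metric in one chart.\<close>

definition partial_deriv :: "'n::finite \<Rightarrow> (real^'n \<Rightarrow> 'c::real_normed_vector) \<Rightarrow> real^'n \<Rightarrow> 'c" where
  "partial_deriv i F x = frechet_derivative F (at x) (axis i 1)"

definition christoffel :: "(real^'n \<Rightarrow> real^'n^'n) \<Rightarrow> real^'n::finite \<Rightarrow> 'n \<Rightarrow> 'n \<Rightarrow> 'n \<Rightarrow> real" where
  "christoffel G x k i j =
     1/2 * (\<Sum>l\<in>UNIV. matrix_inv (G x) $ k $ l *
       (partial_deriv i (\<lambda>y. G y $ j $ l) x + partial_deriv j (\<lambda>y. G y $ i $ l) x
         - partial_deriv l (\<lambda>y. G y $ i $ j) x))"

text \<open>The covariant derivative of the vector field \<open>W\<close> along the vector \<open>u\<close> at \<open>x\<close>.\<close>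

definition cov_deriv ::
  "(real^'n \<Rightarrow> real^'n^'n) \<Rightarrow> real^'n::finite \<Rightarrow> (real^'n \<Rightarrow> real^'n) \<Rightarrow> real^'n \<Rightarrow> real^'n" where
  "cov_deriv G u W x = frechet_derivative W (at x) u
     + (\<chi> k. \<Sum>i\<in>UNIV. \<Sum>j\<in>UNIV. christoffel G x k i j * u $ i * W x $ j)"

text \<open>\<open>R(u,v)w = \<nabla>\<^sub>u \<nabla>\<^sub>v w - \<nabla>\<^sub>v \<nabla>\<^sub>u w\<close>, where \<open>u\<close>, \<open>v\<close>, \<open>w\<close> are extended to vector fields
  with constant coefficients; the term with the bracket of \<open>u\<close> and \<open>v\<close> then vanishes.\<close>

definition riemann_curv ::
  "(real^'n \<Rightarrow> real^'n^'n) \<Rightarrow> real^'n::finite \<Rightarrow> real^'n \<Rightarrow> real^'n \<Rightarrow> real^'n \<Rightarrow> real^'n" where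
  "riemann_curv G x u v w =
     cov_deriv G u (cov_deriv G v (\<lambda>_. w)) x - cov_deriv G v (cov_deriv G u (\<lambda>_. w)) x"

text \<open>\<open>Ric(v,w)\<close> is the trace of \<open>u \<mapsto> R(u,v)w\<close>; this is positive on round spheres.\<close>

definition ricci :: "(real^'n \<Rightarrow> real^'n^'n) \<Rightarrow> real^'n::finite \<Rightarrow> real^'n \<Rightarrow> real^'n \<Rightarrow> real" where
  "ricci G x v w = trace (matrix (\<lambda>u. riemann_curv G x u v w))"

definition gradient :: "(real^'n \<Rightarrow> real^'n^'n) \<Rightarrow> (real^'n::finite \<Rightarrow> real) \<Rightarrow> real^'n \<Rightarrow> real^'n" where
  "gradient G h x = (THE w. \<forall>v. metric_inner G x w v = frechet_derivative h (at x) v)"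

definition hessian ::
  "(real^'n \<Rightarrow> real^'n^'n) \<Rightarrow> (real^'n::finite \<Rightarrow> real) \<Rightarrow> real^'n \<Rightarrow> real^'n \<Rightarrow> real^'n \<Rightarrow> real" where
  "hessian G h x u v = metric_inner G x (cov_deriv G u (gradient G h) x) v"


section \<open>Riemannian distance and diameter\<close>

text \<open>Continuously differentiable on the closed interval, with one-sided derivatives at the ends.\<close>

definition C1_curve_on ::
  "('a, 'n::finite) chart set \<Rightarrow> real \<Rightarrow> real \<Rightarrow> (real \<Rightarrow> 'a) \<Rightarrow> bool" where
  "C1_curve_on A a b \<gamma> \<longleftrightarrow>
     (\<forall>c\<in>A. \<exists>D. continuous_on {t\<in>{a..b}. \<gamma> t \<in> chart_dom c} D \<and>
        (\<forall>t\<in>{a..b}. \<gamma> t \<in> chart_dom c \<longrightarrow>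
           ((chart_map c \<circ> \<gamma>) has_vector_derivative D t) (at t within {a..b})))"

text \<open>\<open>T\<close> contains the break points: the curve is continuously differentiable on every closed
  subinterval without break points in its interior. (Differentiability off \<open>T\<close> alone would
  admit curves of infinite length.)\<close>

definition piecewise_C1_path ::
  "('a::topological_space, 'n::finite) chart set \<Rightarrow> (real \<Rightarrow> 'a) \<Rightarrow> bool" where
  "piecewise_C1_path A \<gamma> \<longleftrightarrow> path \<gamma> \<and>
     (\<exists>T. finite T \<and>
       (\<forall>a b. 0 \<le> a \<longrightarrow> a < b \<longrightarrow> b \<le> 1 \<longrightarrow> {a<..<b} \<inter> T = {} \<longrightarrow> C1_curve_on A a b \<gamma>))"

text \<open>The speed is computed in an arbitrarily chosen chart around \<open>\<gamma> t\<close>; it does not depend on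
  the choice by the transformation law of the metric.\<close>

definition some_chart :: "('a, 'n) chart set \<Rightarrow> 'a \<Rightarrow> ('a, 'n) chart" where
  "some_chart A p = (SOME c. c \<in> A \<and> p \<in> chart_dom c)"

definition speed ::
  "('a, 'n::finite) chart set \<Rightarrow> ('a, 'n) metric_tensor \<Rightarrow> (real \<Rightarrow> 'a) \<Rightarrow> real \<Rightarrow> real" where
  "speed A g \<gamma> t =
     (let c = some_chart A (\<gamma> t); v = vector_derivative (chart_map c \<circ> \<gamma>) (at t)
      in sqrt (metric_inner (g c) (chart_map c (\<gamma> t)) v v))"

definition curve_length ::
  "('a, 'n::finite) chart set \<Rightarrow> ('a, 'n) metric_tensor \<Rightarrow> (real \<Rightarrow> 'a) \<Rightarrow> real" where
  "curve_length A g \<gamma> = integral {0..1} (speed A g \<gamma>)"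

text \<open>Meaningful on connected manifolds, where the set of curves is nonempty.\<close>

definition riem_dist ::
  "('a::topological_space, 'n::finite) chart set \<Rightarrow> ('a, 'n) metric_tensor \<Rightarrow> 'a \<Rightarrow> 'a \<Rightarrow> real" where
  "riem_dist A g p q =
     Inf {curve_length A g \<gamma> |\<gamma>. piecewise_C1_path A \<gamma> \<and> pathstart \<gamma> = p \<and> pathfinish \<gamma> = q}"

definition riem_complete ::
  "('a::topological_space, 'n::finite) chart set \<Rightarrow> ('a, 'n) metric_tensor \<Rightarrow> bool" where
  "riem_complete A g \<longleftrightarrow> Metric_space.mcomplete UNIV (riem_dist A g)"

text \<open>Extended-real-valued, so that an unbounded distance has diameter \<open>\<infinity>\<close>.\<close>

definition riem_diameter ::
  "('a::topological_space, 'n::finite) chart set \<Rightarrow> ('a, 'n) metric_tensor \<Rightarrow> ereal" where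
  "riem_diameter A g = (SUP p. SUP q. ereal (riem_dist A g p q))"

end

theory Submission
  imports Defs
begin

text \<open>
  Let \<open>\<ell> = d p q\<close>. By Hopf--Rinow there is a chain of equally spaced points from \<open>p\<close> to \<open>q\<close>
  whose distances add up to \<open>\<ell>\<close>, and consecutive points, being close, are joined by minimising
  geodesics inside one chart. The chain minimises the sum of the squared distances, hence the
  energy. The first variation shows that the geodesics fit together without corners; the second
  variation along \<open>sin (\<pi> t / \<ell>)\<close> times the normal part of a parallel orthonormal frame gives
  \<open>\<integral> (n - 1) \<phi>'\<^sup>2 - \<phi>\<^sup>2 Ric(\<gamma>', \<gamma>') \<ge> 0\<close>. The curvature hypothesis replaces \<open>Ric(\<gamma>', \<gamma>')\<close> by
  \<open>(n - 1) H - (f \<circ> \<gamma>)''\<close>; two integrations by parts move both derivatives from \<open>f \<circ> \<gamma>\<close> to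
  \<open>\<phi>\<^sup>2\<close>, and \<open>\<bar>f\<bar> \<le> k\<close> then yields \<open>H \<ell>\<^sup>2 \<le> \<pi>\<^sup>2 + 8 k \<pi> / (n - 1)\<close>.
\<close>

section \<open>Smooth functions on open sets\<close>

text \<open>Minimising geodesics usually come from an exponential map, hence from smooth dependence
  of an ODE on its initial data. Here a short geodesic solves a boundary value problem by Banach's
  fixed point theorem, and a long one occurs only as a chain of short ones. Tensors are given chart
  by chart, so each segment stays in one chart and all coordinate changes happen at the nodes. The
  nodes are moved with vanishing covariant acceleration: this survives a change of chart and leaves
  no boundary terms in the second variation. The constant: for
  \<open>\<phi> = sin (\<pi> t / \<ell>)\<close> both \<open>\<phi>\<^sup>2\<close> and its
  derivative vanish at the ends, so no bound on the gradient of \<open>f\<close> enters. The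
  integrals of \<open>\<phi>'\<^sup>2\<close>, \<open>\<phi>\<^sup>2\<close> and
  \<open>\<bar>(\<phi>\<^sup>2)''\<bar>\<close> are \<open>\<pi>\<^sup>2 / (2 \<ell>)\<close>,
  \<open>\<ell> / 2\<close> and \<open>4 \<pi> / \<ell>\<close>; multiplication by
  \<open>2 \<ell> / (n - 1)\<close> produces the 8.\<close>

definition dir_deriv :: "('a::real_normed_vector \<Rightarrow> 'b::real_normed_vector) \<Rightarrow> 'a \<Rightarrow> 'a \<Rightarrow> 'b"
  where "dir_deriv F v x = frechet_derivative F (at x) v"

lemma times_diff_on_SucD: "times_diff_on (Suc m) S F \<Longrightarrow> times_diff_on m S F"
proof (induction m arbitrary: F)
  case 0
  then show ?case
    by (simp add: differentiable_imp_continuous_on differentiable_at_imp_differentiable_on)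
qed simp

text \<open>Openness lets the induction run: derivatives at points of \<open>S\<close> see only
  values near them, so the derivatives agree on \<open>S\<close> as well and the induction
  hypothesis applies to them.\<close>

lemma times_diff_on_cong:
  assumes "open S" "\<And>x. x \<in> S \<Longrightarrow> F x = G x" "times_diff_on m S F"
  shows "times_diff_on m S G"
  using assms(2,3)
proof (induction m arbitrary: F G)
  case 0
  then show ?case using continuous_on_cong by fastforce
next
  case (Suc m)
  have d: "(G has_derivative frechet_derivative F (at x)) (at x)" if "x \<in> S" for x
    by (rule has_derivative_transform_within_open[of F])
       (use Suc.prems that assms(1) frechet_derivative_works in auto)
  then have e: "frechet_derivative F (at x) v = frechet_derivative G (at x) v" if "x \<in> S" for x v
    using frechet_derivative_at[OF d[OF that]] by simp
  have "times_diff_on m S (\<lambda>x. frechet_derivative G (at x) v)" for v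
    using Suc.IH[OF e] Suc.prems(2) by simp
  then show ?case
    using d unfolding times_diff_on.simps differentiable_def by blast
qed

lemma smooth_on_cong:
  "open S \<Longrightarrow> (\<And>x. x \<in> S \<Longrightarrow> F x = G x) \<Longrightarrow> smooth_on S F \<Longrightarrow> smooth_on S G"
  unfolding smooth_on_def using times_diff_on_cong by metis

lemma smooth_on_dir_deriv: "smooth_on S F \<Longrightarrow> smooth_on S (dir_deriv F v)"
  unfolding smooth_on_def dir_deriv_def by (metis times_diff_on.simps(2))

lemma smooth_on_has_derivative:
  assumes "smooth_on S F" "x \<in> S"
  shows "(F has_derivative (\<lambda>h. dir_deriv F h x)) (at x)"
proof -
  have "times_diff_on (Suc 0) S F"
    using assms(1) unfolding smooth_on_def by blast
  then show ?thesis
    using assms(2) unfolding dir_deriv_def by (simp add: frechet_derivative_works)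
qed

lemma smooth_on_imp_continuous_on: "smooth_on S F \<Longrightarrow> continuous_on S F"
  unfolding smooth_on_def by (metis times_diff_on.simps(1))

lemma dir_deriv_unique: "(F has_derivative F') (at x) \<Longrightarrow> dir_deriv F v x = F' v"
  unfolding dir_deriv_def using frechet_derivative_at by metis

lemma dir_deriv_cong: "open S \<Longrightarrow> x \<in> S \<Longrightarrow> (\<And>y. y \<in> S \<Longrightarrow> F y = G y) \<Longrightarrow> smooth_on S F \<Longrightarrow> dir_deriv G v x = dir_deriv F v x"
  by (rule dir_deriv_unique, rule has_derivative_transform_within_open[of F])
     (auto intro: smooth_on_has_derivative)

lemma times_diff_on_const: "times_diff_on m S (\<lambda>x. c)"
  by (induction m arbitrary: c) auto

lemma smooth_on_const: "smooth_on S (\<lambda>x. c)"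
  by (simp add: smooth_on_def times_diff_on_const)

lemma times_diff_on_add:
  assumes "open S"
  shows "times_diff_on m S F \<Longrightarrow> times_diff_on m S G \<Longrightarrow> times_diff_on m S (\<lambda>x. F x + G x)"
proof (induction m arbitrary: F G)
  case 0
  then show ?case by (auto intro: continuous_intros)
next
  case (Suc m)
  have d: "((\<lambda>x. F x + G x) has_derivative (\<lambda>v. frechet_derivative F (at x) v + frechet_derivative G (at x) v)) (at x)"
    if "x \<in> S" for x
    using Suc.prems that by (intro has_derivative_add) (simp_all add: frechet_derivative_works[symmetric])
  have e: "frechet_derivative F (at x) v + frechet_derivative G (at x) v
     = frechet_derivative (\<lambda>x. F x + G x) (at x) v" if "x \<in> S" for x v
    using frechet_derivative_at[OF d[OF that]] by metis
  have 1: "times_diff_on m S (\<lambda>x. frechet_derivative F (at x) v + frechet_derivative G (at x) v)" for v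
    using Suc by simp
  have "times_diff_on m S (\<lambda>x. frechet_derivative (\<lambda>x. F x + G x) (at x) v)" for v
    by (rule times_diff_on_cong[OF assms _ 1]) (rule e)
  then show ?case
    using d unfolding times_diff_on.simps differentiable_def by blast
qed

lemma smooth_on_add: "open S \<Longrightarrow> smooth_on S F \<Longrightarrow> smooth_on S G \<Longrightarrow> smooth_on S (\<lambda>x. F x + G x)"
  by (simp add: smooth_on_def times_diff_on_add)

text \<open>The Leibniz rule leaves two products, each with one factor differentiated once;
  \<open>times_diff_on_SucD\<close> lowers the order of the other factor, so that the induction
  hypothesis covers both.\<close>

lemma (in bounded_bilinear) times_diff_on_prod:
  assumes "open S"
  shows "times_diff_on m S F \<Longrightarrow> times_diff_on m S G \<Longrightarrow> times_diff_on m S (\<lambda>x. prod (F x) (G x))"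
proof (induction m arbitrary: F G)
  case 0
  then show ?case by (auto intro: continuous_on)
next
  case (Suc m)
  have d: "((\<lambda>x. prod (F x) (G x)) has_derivative
     (\<lambda>v. prod (F x) (frechet_derivative G (at x) v) + prod (frechet_derivative F (at x) v) (G x))) (at x)"
    if "x \<in> S" for x
    using Suc.prems that by (auto intro!: FDERIV simp: frechet_derivative_works[symmetric])
  have e: "prod (F x) (frechet_derivative G (at x) v) + prod (frechet_derivative F (at x) v) (G x)
     = frechet_derivative (\<lambda>x. prod (F x) (G x)) (at x) v" if "x \<in> S" for x v
    using frechet_derivative_at[OF d[OF that]] by metis
  have 1: "times_diff_on m S (\<lambda>x. prod (F x) (frechet_derivative G (at x) v) + prod (frechet_derivative F (at x) v) (G x))" for v
    using Suc.prems times_diff_on_SucD[OF Suc.prems(1)] times_diff_on_SucD[OF Suc.prems(2)]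
    by (intro times_diff_on_add[OF assms] Suc.IH) auto
  have "times_diff_on m S (\<lambda>x. frechet_derivative (\<lambda>x. prod (F x) (G x)) (at x) v)" for v
    by (rule times_diff_on_cong[OF assms _ 1]) (rule e)
  then show ?case
    using d unfolding times_diff_on.simps differentiable_def by blast
qed

lemma (in bounded_bilinear) smooth_on_prod:
  "open S \<Longrightarrow> smooth_on S F \<Longrightarrow> smooth_on S G \<Longrightarrow> smooth_on S (\<lambda>x. prod (F x) (G x))"
  by (simp add: smooth_on_def times_diff_on_prod)

lemmas smooth_on_mult = bounded_bilinear.smooth_on_prod[OF bounded_bilinear_mult]
lemmas smooth_on_scaleR = bounded_bilinear.smooth_on_prod[OF bounded_bilinear_scaleR]

lemma times_diff_on_linear:
  assumes "bounded_linear L"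
  shows "times_diff_on m S F \<Longrightarrow> open S \<Longrightarrow> times_diff_on m S (\<lambda>x. L (F x))"
proof (induction m arbitrary: F)
  case 0
  then show ?case using assms by (auto intro: bounded_linear.continuous_on)
next
  case (Suc m)
  have d: "((\<lambda>x. L (F x)) has_derivative (\<lambda>v. L (frechet_derivative F (at x) v))) (at x)"
    if "x \<in> S" for x
    using Suc.prems that by (auto intro!: bounded_linear.has_derivative[OF assms] simp: frechet_derivative_works[symmetric])
  have e: "L (frechet_derivative F (at x) v) = frechet_derivative (\<lambda>x. L (F x)) (at x) v" if "x \<in> S" for x v
    using frechet_derivative_at[OF d[OF that]] by metis
  have 1: "times_diff_on m S (\<lambda>x. L (frechet_derivative F (at x) v))" for v
    using Suc.prems by (intro Suc.IH) auto
  have "times_diff_on m S (\<lambda>x. frechet_derivative (\<lambda>x. L (F x)) (at x) v)" for v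
    by (rule times_diff_on_cong[OF Suc.prems(2) _ 1]) (rule e)
  then show ?case
    using d unfolding times_diff_on.simps differentiable_def by blast
qed

lemma smooth_on_linear: "bounded_linear L \<Longrightarrow> open S \<Longrightarrow> smooth_on S F \<Longrightarrow> smooth_on S (\<lambda>x. L (F x))"
  by (simp add: smooth_on_def times_diff_on_linear)

lemma dir_deriv_linear: "bounded_linear L \<Longrightarrow> smooth_on S F \<Longrightarrow> x \<in> S \<Longrightarrow> dir_deriv (\<lambda>x. L (F x)) v x = L (dir_deriv F v x)"
  by (rule dir_deriv_unique, rule bounded_linear.has_derivative, assumption, rule smooth_on_has_derivative)

lemma smooth_on_sum:
  "open S \<Longrightarrow> (\<And>i. i \<in> I \<Longrightarrow> smooth_on S (F i)) \<Longrightarrow> smooth_on S (\<lambda>x. \<Sum>i\<in>I. F i x)"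
  by (induction I rule: infinite_finite_induct) (auto intro: smooth_on_const smooth_on_add)

lemma smooth_on_prod:
  fixes F :: "'i \<Rightarrow> 'b::real_normed_vector \<Rightarrow> real"
  shows "open S \<Longrightarrow> (\<And>i. i \<in> I \<Longrightarrow> smooth_on S (F i)) \<Longrightarrow> smooth_on S (\<lambda>x. \<Prod>i\<in>I. F i x)"
  by (induction I rule: infinite_finite_induct) (auto intro: smooth_on_const smooth_on_mult)

text \<open>The derivative of \<open>1/F\<close> is built from \<open>1/F\<close> itself and the
  derivative of \<open>F\<close>, so the induction can keep \<open>F\<close> fixed.\<close>

lemma times_diff_on_inverse:
  fixes F :: "'b::real_normed_vector \<Rightarrow> real"
  assumes "open S" "\<And>x. x \<in> S \<Longrightarrow> F x \<noteq> 0"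
  shows "times_diff_on m S F \<Longrightarrow> times_diff_on m S (\<lambda>x. inverse (F x))"
proof (induction m)
  case 0
  then show ?case using assms(2) by (auto intro: continuous_on_inverse)
next
  case (Suc m)
  have d: "((\<lambda>x. inverse (F x)) has_derivative
     (\<lambda>v. - (inverse (F x) * (inverse (F x) * frechet_derivative F (at x) v)))) (at x)"
    if "x \<in> S" for x
  proof -
    have "(F has_derivative frechet_derivative F (at x)) (at x)"
      using Suc.prems that by (simp add: frechet_derivative_works)
    from Deriv.has_derivative_inverse[OF assms(2)[OF that] this] show ?thesis
      by (simp add: mult_ac)
  qed
  have e: "(-1) * (inverse (F x) * (inverse (F x) * frechet_derivative F (at x) v))
     = frechet_derivative (\<lambda>x. inverse (F x)) (at x) v" if "x \<in> S" for x v
    using frechet_derivative_at[OF d[OF that], symmetric] by (simp add: mult_ac)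
  have i: "times_diff_on m S (\<lambda>x. inverse (F x))"
    using Suc times_diff_on_SucD by blast
  have 1: "times_diff_on m S (\<lambda>x. (-1) * (inverse (F x) * (inverse (F x) * frechet_derivative F (at x) v)))" for v
    using Suc.prems i
    by (intro bounded_bilinear.times_diff_on_prod[OF bounded_bilinear_mult] times_diff_on_const assms) auto
  have "times_diff_on m S (\<lambda>x. frechet_derivative (\<lambda>x. inverse (F x)) (at x) v)" for v
    by (rule times_diff_on_cong[OF assms(1) _ 1]) (rule e)
  then show ?case
    using d unfolding times_diff_on.simps differentiable_def by blast
qed

lemma smooth_on_inverse:
  fixes F :: "'b::real_normed_vector \<Rightarrow> real"
  shows "open S \<Longrightarrow> (\<And>x. x \<in> S \<Longrightarrow> F x \<noteq> 0) \<Longrightarrow> smooth_on S F \<Longrightarrow> smooth_on S (\<lambda>x. inverse (F x))"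
  by (simp add: smooth_on_def times_diff_on_inverse)

section \<open>Linearity in the direction and derivatives along curves\<close>

lemma linear_dir_deriv: "smooth_on S F \<Longrightarrow> x \<in> S \<Longrightarrow> linear (\<lambda>v. dir_deriv F v x)"
  using smooth_on_has_derivative has_derivative_linear by blast

text \<open>Smoothness speaks of fixed directions only. Along a curve the direction moves too; this
  expansion puts its motion into scalar coefficients.\<close>

lemma dir_deriv_Basis:
  fixes F :: "'b::euclidean_space \<Rightarrow> 'c::real_normed_vector"
  assumes "smooth_on S F" "x \<in> S"
  shows "dir_deriv F v x = (\<Sum>e\<in>Basis. (v \<bullet> e) *\<^sub>R dir_deriv F e x)"
proof -
  interpret linear "\<lambda>v. dir_deriv F v x" by (rule linear_dir_deriv[OF assms])
  show ?thesis
    using sum[of "\<lambda>e. (v \<bullet> e) *\<^sub>R e" Basis] by (simp add: euclidean_representation scale)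
qed

lemma dir_deriv_dir_deriv_Basis:
  fixes F :: "'b::euclidean_space \<Rightarrow> 'c::real_normed_vector"
  assumes "open S" "smooth_on S F" "x \<in> S"
  shows "dir_deriv (dir_deriv F v) w x = (\<Sum>e\<in>Basis. (v \<bullet> e) *\<^sub>R dir_deriv (dir_deriv F e) w x)"
proof -
  have sm: "smooth_on S (\<lambda>x. \<Sum>e\<in>Basis. (v \<bullet> e) *\<^sub>R dir_deriv F e x)"
    by (rule smooth_on_sum[OF assms(1)], rule smooth_on_linear[OF bounded_linear_scaleR_right assms(1)],
        rule smooth_on_dir_deriv[OF assms(2)])
  have "dir_deriv (dir_deriv F v) w x = dir_deriv (\<lambda>x. \<Sum>e\<in>Basis. (v \<bullet> e) *\<^sub>R dir_deriv F e x) w x"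
    by (rule dir_deriv_cong[OF assms(1,3) _ sm]) (rule dir_deriv_Basis[OF assms(2), symmetric])
  also have "\<dots> = (\<Sum>e\<in>Basis. (v \<bullet> e) *\<^sub>R dir_deriv (dir_deriv F e) w x)"
    by (rule dir_deriv_unique, rule has_derivative_sum, rule has_derivative_scaleR_right,
        rule smooth_on_has_derivative[OF smooth_on_dir_deriv[OF assms(2)] assms(3)])
  finally show ?thesis .
qed

lemma dir_deriv_curve:
  assumes "smooth_on S F" "x t \<in> S" "(x has_vector_derivative x') (at t within T)"
  shows "((\<lambda>t. F (x t)) has_vector_derivative dir_deriv F x' (x t)) (at t within T)"
  using vector_derivative_diff_chain_within[OF assms(3) has_derivative_at_withinI[OF smooth_on_has_derivative[OF assms(1,2)]]]
  by (simp add: o_def)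

text \<open>The first term comes from the moving direction, the second from the moving base point.
  It yields the second derivative of \<open>f\<close> along a geodesic and the acceleration of a
  curve after a change of chart.\<close>

lemma dir_deriv_moving_curve:
  fixes F :: "'b::euclidean_space \<Rightarrow> 'c::real_normed_vector"
  assumes "open S" "smooth_on S F" "x t \<in> S" "(x has_vector_derivative x') (at t within T)"
    "(v has_vector_derivative v') (at t within T)" "t \<in> T" "\<And>t. t \<in> T \<Longrightarrow> x t \<in> S"
  shows "((\<lambda>t. dir_deriv F (v t) (x t)) has_vector_derivative dir_deriv F v' (x t) + dir_deriv (dir_deriv F (v t)) x' (x t)) (at t within T)"
proof -
  have "((\<lambda>t. v t \<bullet> e) has_vector_derivative v' \<bullet> e) (at t within T)" for e
    using bounded_linear.has_vector_derivative[OF bounded_linear_inner_left assms(5)] .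
  then have "((\<lambda>t. v t \<bullet> e) has_field_derivative v' \<bullet> e) (at t within T)" for e
    by (simp add: has_real_derivative_iff_has_vector_derivative)
  then have "((\<lambda>t. \<Sum>e\<in>Basis. (v t \<bullet> e) *\<^sub>R dir_deriv F e (x t)) has_vector_derivative
     (\<Sum>e\<in>Basis. (v t \<bullet> e) *\<^sub>R dir_deriv (dir_deriv F e) x' (x t) + (v' \<bullet> e) *\<^sub>R dir_deriv F e (x t))) (at t within T)"
    by (intro has_vector_derivative_sum has_vector_derivative_scaleR dir_deriv_curve[OF smooth_on_dir_deriv[OF assms(2)]] assms)
  then have "((\<lambda>t. dir_deriv F (v t) (x t)) has_vector_derivative
     (\<Sum>e\<in>Basis. (v t \<bullet> e) *\<^sub>R dir_deriv (dir_deriv F e) x' (x t) + (v' \<bullet> e) *\<^sub>R dir_deriv F e (x t))) (at t within T)"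
    by (rule has_vector_derivative_transform[OF assms(6), rotated])
       (use dir_deriv_Basis[OF assms(2)] assms(7) in auto)
  also have "(\<Sum>e\<in>Basis. (v t \<bullet> e) *\<^sub>R dir_deriv (dir_deriv F e) x' (x t) + (v' \<bullet> e) *\<^sub>R dir_deriv F e (x t))
      = dir_deriv F v' (x t) + dir_deriv (dir_deriv F (v t)) x' (x t)"
    unfolding dir_deriv_dir_deriv_Basis[OF assms(1-3), of "v t" x'] dir_deriv_Basis[OF assms(2,3), of v'] by (simp add: sum.distrib)
  finally show ?thesis .
qed

lemma continuous_on_dir_deriv:
  fixes F :: "'b::euclidean_space \<Rightarrow> 'c::real_normed_vector"
  assumes "smooth_on S F" "continuous_on T x" "continuous_on T v" "x ` T \<subseteq> S"
  shows "continuous_on T (\<lambda>t. dir_deriv F (v t) (x t))"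
proof -
  have "continuous_on T (\<lambda>t. dir_deriv F e (x t))" for e
    using continuous_on_compose2[OF smooth_on_imp_continuous_on[OF smooth_on_dir_deriv[OF assms(1)]] assms(2,4)] .
  then have "continuous_on T (\<lambda>t. \<Sum>e\<in>Basis. (v t \<bullet> e) *\<^sub>R dir_deriv F e (x t))"
    using assms by (intro continuous_intros) auto
  then show ?thesis
    using dir_deriv_Basis[OF assms(1)] assms(4) by (subst continuous_on_cong[OF refl]) (auto simp: image_subset_iff)
qed

lemma continuous_on_dir_deriv_dir_deriv:
  fixes F :: "'b::euclidean_space \<Rightarrow> 'c::real_normed_vector"
  assumes "open S" "smooth_on S F" "continuous_on T x" "continuous_on T v" "continuous_on T w" "x ` T \<subseteq> S"
  shows "continuous_on T (\<lambda>t. dir_deriv (dir_deriv F (v t)) (w t) (x t))"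
proof -
  have "continuous_on T (\<lambda>t. \<Sum>e\<in>Basis. (v t \<bullet> e) *\<^sub>R dir_deriv (dir_deriv F e) (w t) (x t))"
    using assms by (intro continuous_intros continuous_on_dir_deriv[OF smooth_on_dir_deriv[OF assms(2)]]) auto
  then show ?thesis
    using dir_deriv_dir_deriv_Basis[OF assms(1,2)] assms(6) by (subst continuous_on_cong[OF refl]) (auto simp: image_subset_iff)
qed

text \<open>The left-hand side is symmetric in \<open>v\<close> and \<open>w\<close>, the right-hand
  side is a mixed derivative in a fixed order. The mean value theorem is applied in direction
  \<open>v\<close> to the difference in direction \<open>w\<close>, and then in direction
  \<open>w\<close>.\<close>

lemma second_difference_mvt:
  fixes F :: "'b::real_normed_vector \<Rightarrow> real"
  assumes sm: "smooth_on S F" and h: "0 < h"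
    and S: "\<And>a b. 0 \<le> a \<Longrightarrow> a \<le> h \<Longrightarrow> 0 \<le> b \<Longrightarrow> b \<le> h \<Longrightarrow> x + a *\<^sub>R v + b *\<^sub>R w \<in> S"
  shows "\<exists>a b. 0 < a \<and> a < h \<and> 0 < b \<and> b < h \<and>
    F (x + h *\<^sub>R v + h *\<^sub>R w) - F (x + h *\<^sub>R v) - F (x + h *\<^sub>R w) + F x = h * h * dir_deriv (dir_deriv F v) w (x + a *\<^sub>R v + b *\<^sub>R w)"
proof -
  have line: "((\<lambda>s. x + s *\<^sub>R v + b *\<^sub>R w) has_vector_derivative v) (at s within {0..h})"
             "((\<lambda>s. x + b *\<^sub>R v + s *\<^sub>R w) has_vector_derivative w) (at s within {0..h})"
             "((\<lambda>s. x + s *\<^sub>R v) has_vector_derivative v) (at s within {0..h})" for s b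
    by (auto intro!: derivative_eq_intros)
  have d1: "((\<lambda>s. F (x + s *\<^sub>R v + h *\<^sub>R w) - F (x + s *\<^sub>R v)) has_vector_derivative
      (dir_deriv F v (x + s *\<^sub>R v + h *\<^sub>R w) - dir_deriv F v (x + s *\<^sub>R v))) (at s within {0..h})" if "0 \<le> s" "s \<le> h" for s
    using dir_deriv_curve[OF sm, of "\<lambda>s. x + s *\<^sub>R v + h *\<^sub>R w" s] dir_deriv_curve[OF sm, of "\<lambda>s. x + s *\<^sub>R v" s]
      line S[of s h] S[of s 0] that h
    by (intro has_vector_derivative_diff) auto
  obtain a where a: "0 < a" "a < h" "(F (x + h *\<^sub>R v + h *\<^sub>R w) - F (x + h *\<^sub>R v)) - (F (x + h *\<^sub>R w) - F x)
      = (dir_deriv F v (x + a *\<^sub>R v + h *\<^sub>R w) - dir_deriv F v (x + a *\<^sub>R v)) * h"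
    using mvt_simple[OF h, of "\<lambda>s. F (x + s *\<^sub>R v + h *\<^sub>R w) - F (x + s *\<^sub>R v)"
       "\<lambda>s t. (dir_deriv F v (x + s *\<^sub>R v + h *\<^sub>R w) - dir_deriv F v (x + s *\<^sub>R v)) * t"] d1
    by (auto simp: has_vector_derivative_def mult_ac)
  have d2: "((\<lambda>s. dir_deriv F v (x + a *\<^sub>R v + s *\<^sub>R w)) has_vector_derivative
      dir_deriv (dir_deriv F v) w (x + a *\<^sub>R v + s *\<^sub>R w)) (at s within {0..h})" if "0 \<le> s" "s \<le> h" for s
    using line S[of a s] that a by (intro dir_deriv_curve[OF smooth_on_dir_deriv[OF sm]]) auto
  obtain b where "0 < b" "b < h" "dir_deriv F v (x + a *\<^sub>R v + h *\<^sub>R w) - dir_deriv F v (x + a *\<^sub>R v)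
      = dir_deriv (dir_deriv F v) w (x + a *\<^sub>R v + b *\<^sub>R w) * h"
    using mvt_simple[OF h, of "\<lambda>s. dir_deriv F v (x + a *\<^sub>R v + s *\<^sub>R w)"
       "\<lambda>s t. dir_deriv (dir_deriv F v) w (x + a *\<^sub>R v + s *\<^sub>R w) * t"] d2
    by (auto simp: has_vector_derivative_def mult_ac)
  with a show ?thesis
    by (intro exI[of _ a] exI[of _ b]) (auto simp: algebra_simps)
qed

text \<open>Both orders are found near \<open>x\<close> from the same second difference; as the
  parallelogram shrinks, continuity of the mixed derivatives equates them at
  \<open>x\<close>.\<close>

lemma dir_deriv_dir_deriv_commute_real:
  fixes F :: "'b::real_normed_vector \<Rightarrow> real"
  assumes "open S" "smooth_on S F" "x \<in> S"
  shows "dir_deriv (dir_deriv F v) w x = dir_deriv (dir_deriv F w) v x"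
proof -
  have "\<bar>dir_deriv (dir_deriv F v) w x - dir_deriv (dir_deriv F w) v x\<bar> \<le> e" if e: "e > 0" for e
  proof -
    have "\<exists>d>0. \<forall>y. dist y x < d \<longrightarrow> \<bar>dir_deriv (dir_deriv F p) q y - dir_deriv (dir_deriv F p) q x\<bar> < e/2" for p q
    proof -
      have "isCont (dir_deriv (dir_deriv F p) q) x"
        using smooth_on_imp_continuous_on[OF smooth_on_dir_deriv[OF smooth_on_dir_deriv[OF assms(2)]]] assms
        by (simp add: continuous_on_eq_continuous_at)
      then show ?thesis using half_gt_zero[OF e] unfolding continuous_at_eps_delta dist_real_def by blast
    qed
    then obtain d1 d2 where d: "d1 > 0" "d2 > 0"
      and d1: "\<And>y. dist y x < d1 \<Longrightarrow> \<bar>dir_deriv (dir_deriv F v) w y - dir_deriv (dir_deriv F v) w x\<bar> < e/2"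
      and d2: "\<And>y. dist y x < d2 \<Longrightarrow> \<bar>dir_deriv (dir_deriv F w) v y - dir_deriv (dir_deriv F w) v x\<bar> < e/2"
      by metis
    obtain d3 where d3: "d3 > 0" "ball x d3 \<subseteq> S"
      using assms open_contains_ball by metis
    \<comment> \<open>Small enough for the whole parallelogram to lie in the three balls; the added
      1 keeps the denominator positive if both directions vanish.\<close>
    define h where "h = min d1 (min d2 d3) / (2 * (norm v + norm w + 1))"
    have np: "norm v + norm w + 1 > 0" by (smt (verit) norm_ge_zero)
    have h: "h > 0" using d d3 np by (simp add: h_def)
    have n: "norm (a *\<^sub>R v + b *\<^sub>R w) < min d1 (min d2 d3)" if "0 \<le> a" "a \<le> h" "0 \<le> b" "b \<le> h" for a b
    proof -
      have "norm (a *\<^sub>R v + b *\<^sub>R w) \<le> h * norm v + h * norm w"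
        using that by (intro norm_triangle_le add_mono) (auto simp: mult_right_mono)
      also have "\<dots> < 2 * h * (norm v + norm w + 1)"
        using h by (simp add: algebra_simps) (smt (verit) mult_nonneg_nonneg norm_ge_zero)
      also have "\<dots> = min d1 (min d2 d3)"
      proof -
        have "2 * (m / (2 * N)) * N = m" if "N > 0" for m N :: real using that by simp
        from this[OF np] show ?thesis unfolding h_def .
      qed
      finally show ?thesis .
    qed
    have S: "x + a *\<^sub>R v + b *\<^sub>R w \<in> S" "x + b *\<^sub>R w + a *\<^sub>R v \<in> S" "dist (x + a *\<^sub>R v + b *\<^sub>R w) x < min d1 d2"
       "dist (x + b *\<^sub>R w + a *\<^sub>R v) x < min d1 d2"
      if "0 \<le> a" "a \<le> h" "0 \<le> b" "b \<le> h" for a b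
    proof -
      have D: "dist (x + a *\<^sub>R v + b *\<^sub>R w) x < min d1 (min d2 d3)" "x + b *\<^sub>R w + a *\<^sub>R v = x + a *\<^sub>R v + b *\<^sub>R w"
        using n[OF that] by (auto simp: dist_norm add_ac)
      then show "x + a *\<^sub>R v + b *\<^sub>R w \<in> S" "x + b *\<^sub>R w + a *\<^sub>R v \<in> S" "dist (x + a *\<^sub>R v + b *\<^sub>R w) x < min d1 d2"
       "dist (x + b *\<^sub>R w + a *\<^sub>R v) x < min d1 d2"
        using d3(2) unfolding D(2) by (auto simp: ball_def dist_commute)
    qed
    from second_difference_mvt[OF assms(2) h S(1)] obtain a b where ab: "0 < a" "a < h" "0 < b" "b < h" 
      "F (x + h *\<^sub>R v + h *\<^sub>R w) - F (x + h *\<^sub>R v) - F (x + h *\<^sub>R w) + F x = h * h * dir_deriv (dir_deriv F v) w (x + a *\<^sub>R v + b *\<^sub>R w)"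
      by blast
    from second_difference_mvt[OF assms(2) h S(2)] obtain a' b' where ab': "0 < a'" "a' < h" "0 < b'" "b' < h" 
      "F (x + h *\<^sub>R w + h *\<^sub>R v) - F (x + h *\<^sub>R w) - F (x + h *\<^sub>R v) + F x = h * h * dir_deriv (dir_deriv F w) v (x + a' *\<^sub>R w + b' *\<^sub>R v)"
      by blast
    have c: "x + h *\<^sub>R w + h *\<^sub>R v = x + h *\<^sub>R v + h *\<^sub>R w" by (simp add: add_ac)
    have "h * h * dir_deriv (dir_deriv F w) v (x + a' *\<^sub>R w + b' *\<^sub>R v) = h * h * dir_deriv (dir_deriv F v) w (x + a *\<^sub>R v + b *\<^sub>R w)"
      unfolding ab'(5)[symmetric] ab(5)[symmetric] c by simp
    then have "dir_deriv (dir_deriv F v) w (x + a *\<^sub>R v + b *\<^sub>R w) = dir_deriv (dir_deriv F w) v (x + a' *\<^sub>R w + b' *\<^sub>R v)"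
      using h by simp
    moreover have "\<bar>dir_deriv (dir_deriv F v) w (x + a *\<^sub>R v + b *\<^sub>R w) - dir_deriv (dir_deriv F v) w x\<bar> < e/2"
      using d1 S(3)[of a b] ab by simp
    moreover have "\<bar>dir_deriv (dir_deriv F w) v (x + a' *\<^sub>R w + b' *\<^sub>R v) - dir_deriv (dir_deriv F w) v x\<bar> < e/2"
      using d2 S(4)[of b' a'] ab' by simp
    ultimately show ?thesis by linarith
  qed
  then show ?thesis
    by (metis abs_le_zero_iff dense_ge eq_iff_diff_eq_0)
qed

lemma dir_deriv_dir_deriv_commute:
  fixes F :: "'b::real_normed_vector \<Rightarrow> 'c::euclidean_space"
  assumes "open S" "smooth_on S F" "x \<in> S"
  shows "dir_deriv (dir_deriv F v) w x = dir_deriv (dir_deriv F w) v x"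
proof (rule euclidean_eqI)
  fix b :: 'c
  have s: "smooth_on S (\<lambda>x. F x \<bullet> b)"
    by (rule smooth_on_linear[OF bounded_linear_inner_left assms(1,2)])
  have "dir_deriv (dir_deriv (\<lambda>x. F x \<bullet> b) v) w x = dir_deriv (dir_deriv F v) w x \<bullet> b" for v w
  proof -
    have "dir_deriv (dir_deriv (\<lambda>x. F x \<bullet> b) v) w x = dir_deriv (\<lambda>x. dir_deriv F v x \<bullet> b) w x"
      by (rule dir_deriv_cong[OF assms(1,3)])
         (use dir_deriv_linear[OF bounded_linear_inner_left assms(2)] in
           \<open>auto intro: smooth_on_linear[OF bounded_linear_inner_left assms(1)] smooth_on_dir_deriv assms\<close>)
    also have "\<dots> = dir_deriv (dir_deriv F v) w x \<bullet> b"
      by (rule dir_deriv_linear[OF bounded_linear_inner_left smooth_on_dir_deriv[OF assms(2)] assms(3)])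
    finally show ?thesis .
  qed
  then show "dir_deriv (dir_deriv F v) w x \<bullet> b = dir_deriv (dir_deriv F w) v x \<bullet> b"
    using dir_deriv_dir_deriv_commute_real[OF assms(1) s assms(3)] by metis
qed

section \<open>Local Riemannian geometry in a chart\<close>

lemma bounded_bilinear_matrix_vector:
  "bounded_bilinear ((*v) :: real^'n::finite^'m::finite \<Rightarrow> real^'n \<Rightarrow> real^'m)"
  unfolding bilinear_conv_bounded_bilinear[symmetric] bilinear_def
  by (auto intro!: linearI simp: matrix_vector_mult_add_rdistrib matrix_vector_right_distrib
      scaleR_matrix_vector_assoc matrix_vector_mult_scaleR)

lemma bounded_bilinear_form:
  "bounded_bilinear (\<lambda>u v. u \<bullet> ((M::real^'n::finite^'n) *v v))"
  unfolding bilinear_conv_bounded_bilinear[symmetric] bilinear_def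
  by (auto intro!: linearI simp: matrix_vector_right_distrib matrix_vector_mult_scaleR
      inner_add_left inner_add_right)

text \<open>The Christoffel symbols as a vector-valued bilinear form, so that identities can be
  proved between vectors instead of index sums.\<close>

definition christoffel_form :: "(real^'n \<Rightarrow> real^'n^'n) \<Rightarrow> real^'n::finite \<Rightarrow> real^'n \<Rightarrow> real^'n \<Rightarrow> real^'n" where
  "christoffel_form G x u v = (\<chi> k. \<Sum>i\<in>UNIV. \<Sum>j\<in>UNIV. christoffel G x k i j * u $ i * v $ j)"

definition christoffel_vec :: "(real^'n \<Rightarrow> real^'n^'n) \<Rightarrow> 'n \<Rightarrow> 'n \<Rightarrow> real^'n::finite \<Rightarrow> real^'n" where
  "christoffel_vec G i j x = (\<chi> k. christoffel G x k i j)"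

definition metric_deriv :: "(real^'n \<Rightarrow> real^'n^'n) \<Rightarrow> real^'n::finite \<Rightarrow> real^'n \<Rightarrow> real^'n \<Rightarrow> real^'n \<Rightarrow> real" where
  "metric_deriv G x h u v = u \<bullet> (dir_deriv G h x *v v)"

definition metric_deriv2 :: "(real^'n \<Rightarrow> real^'n^'n) \<Rightarrow> real^'n::finite \<Rightarrow> real^'n \<Rightarrow> real^'n \<Rightarrow> real^'n \<Rightarrow> real^'n \<Rightarrow> real" where
  "metric_deriv2 G x h k u v = u \<bullet> (dir_deriv (dir_deriv G h) k x *v v)"

definition christoffel_form_deriv :: "(real^'n \<Rightarrow> real^'n^'n) \<Rightarrow> real^'n::finite \<Rightarrow> real^'n \<Rightarrow> real^'n \<Rightarrow> real^'n \<Rightarrow> real^'n" where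
  "christoffel_form_deriv G x h u v = dir_deriv (\<lambda>y. christoffel_form G y u v) h x"

lemma christoffel_form_christoffel_vec: "christoffel_form G x u v = (\<Sum>i\<in>UNIV. \<Sum>j\<in>UNIV. (u $ i * v $ j) *\<^sub>R christoffel_vec G i j x)"
  by (simp add: vec_eq_iff christoffel_form_def christoffel_vec_def sum_component mult_ac)

lemma bounded_bilinear_ip: "bounded_bilinear (metric_inner G x)"
  unfolding metric_inner_def by (rule bounded_bilinear_form)

lemma bilinear_sum_coords:
  "bounded_bilinear (\<lambda>u v :: real^'n::finite. \<Sum>i\<in>UNIV. \<Sum>j\<in>UNIV. (u $ i * v $ j) *\<^sub>R (X i j :: real^'n))"
  unfolding bilinear_conv_bounded_bilinear[symmetric] bilinear_def
  by (auto intro!: linearI simp: algebra_simps sum.distrib scaleR_sum_right)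

lemma bounded_bilinear_christoffel_form: "bounded_bilinear (christoffel_form G x)"
  using bilinear_sum_coords[of "\<lambda>i j. christoffel_vec G i j x"] by (simp add: christoffel_form_christoffel_vec[abs_def])

lemmas ip_simps =
  bounded_bilinear.add_left[OF bounded_bilinear_ip] bounded_bilinear.add_right[OF bounded_bilinear_ip]
  bounded_bilinear.diff_left[OF bounded_bilinear_ip] bounded_bilinear.diff_right[OF bounded_bilinear_ip]
  bounded_bilinear.minus_left[OF bounded_bilinear_ip] bounded_bilinear.minus_right[OF bounded_bilinear_ip]
  bounded_bilinear.zero_left[OF bounded_bilinear_ip] bounded_bilinear.zero_right[OF bounded_bilinear_ip]
  bounded_bilinear.scaleR_left[OF bounded_bilinear_ip] bounded_bilinear.scaleR_right[OF bounded_bilinear_ip]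
lemmas christoffel_form_simps =
  bounded_bilinear.add_left[OF bounded_bilinear_christoffel_form] bounded_bilinear.add_right[OF bounded_bilinear_christoffel_form]
  bounded_bilinear.diff_left[OF bounded_bilinear_christoffel_form] bounded_bilinear.diff_right[OF bounded_bilinear_christoffel_form]
  bounded_bilinear.minus_left[OF bounded_bilinear_christoffel_form] bounded_bilinear.minus_right[OF bounded_bilinear_christoffel_form]
  bounded_bilinear.zero_left[OF bounded_bilinear_christoffel_form] bounded_bilinear.zero_right[OF bounded_bilinear_christoffel_form]
  bounded_bilinear.scaleR_left[OF bounded_bilinear_christoffel_form] bounded_bilinear.scaleR_right[OF bounded_bilinear_christoffel_form]

lemma matrix_inv_inverse:
  assumes "invertible (M::real^'n::finite^'n)"
  shows "M ** matrix_inv M = mat 1" "matrix_inv M ** M = mat 1"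
  using someI_ex[of "\<lambda>A'. M ** A' = mat 1 \<and> A' ** M = mat 1"] assms
  unfolding matrix_inv_def invertible_def by auto

lemma smooth_on_vec:
  fixes F :: "'b::real_normed_vector \<Rightarrow> real^'n::finite"
  assumes "open S" "\<And>k. smooth_on S (\<lambda>x. F x $ k)"
  shows "smooth_on S F"
proof -
  have r: "F x = (\<Sum>k\<in>UNIV. F x $ k *\<^sub>R axis k 1)" for x
    by (metis (no_types) basis_expansion scalar_mult_eq_scaleR sum.cong)
  have "smooth_on S (\<lambda>x. \<Sum>k\<in>UNIV. F x $ k *\<^sub>R axis k 1)"
    by (rule smooth_on_sum[OF assms(1)], rule smooth_on_scaleR[OF assms(1) assms(2) smooth_on_const])
  then show ?thesis by (rule smooth_on_cong[OF assms(1) r[symmetric]])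
qed

text \<open>One coordinate patch with its metric, detached from the manifold. Every chart is an
  instance, and the tensor calculus is done here.\<close>

locale local_metric =
  fixes S :: "(real^'n::finite) set" and G :: "real^'n \<Rightarrow> real^'n^'n"
  assumes open_S: "open S"
    and smooth_G: "smooth_on S G"
    and sym_G: "x \<in> S \<Longrightarrow> transpose (G x) = G x"
    and pos_G: "x \<in> S \<Longrightarrow> v \<noteq> 0 \<Longrightarrow> 0 < metric_inner G x v v"
begin

abbreviation "ip \<equiv> metric_inner G"

lemma ip_sym: "x \<in> S \<Longrightarrow> ip x u v = ip x v u"
  unfolding metric_inner_def using sym_G by (metis dot_lmul_matrix inner_commute transpose_matrix_vector)

lemma ip_nonneg: "x \<in> S \<Longrightarrow> 0 \<le> ip x v v"
  using pos_G by (cases "v = 0") (auto simp: ip_simps less_imp_le)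

lemma ip_eq_0: "x \<in> S \<Longrightarrow> ip x v v = 0 \<longleftrightarrow> v = 0"
  using pos_G by (force simp: ip_simps)

lemma ip_eqI: "x \<in> S \<Longrightarrow> (\<And>w. ip x u w = ip x v w) \<Longrightarrow> u = v"
  using ip_eq_0[of x "u - v"] by (simp add: ip_simps)

lemma dir_deriv_G_sym: "x \<in> S \<Longrightarrow> transpose (dir_deriv G h x) = dir_deriv G h x"
proof -
  assume x: "x \<in> S"
  have b: "bounded_linear (transpose :: real^'n^'n \<Rightarrow> real^'n^'n)"
    by (intro linear_conv_bounded_linear[THEN iffD1] linearI) (auto simp: transpose_def vec_eq_iff)
  have "dir_deriv G h x = dir_deriv (\<lambda>x. transpose (G x)) h x"
    by (rule dir_deriv_cong[OF open_S x sym_G smooth_on_linear[OF b open_S smooth_G]])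
  also have "\<dots> = transpose (dir_deriv G h x)" by (rule dir_deriv_linear[OF b smooth_G x])
  finally show ?thesis by simp
qed

lemma metric_deriv_sym: "x \<in> S \<Longrightarrow> metric_deriv G x h u v = metric_deriv G x h v u"
  unfolding metric_deriv_def using dir_deriv_G_sym by (metis dot_lmul_matrix inner_commute transpose_matrix_vector)

lemma metric_deriv2_commute: "x \<in> S \<Longrightarrow> metric_deriv2 G x h k u v = metric_deriv2 G x k h u v"
  unfolding metric_deriv2_def by (simp add: dir_deriv_dir_deriv_commute[OF open_S smooth_G, of x h k])

lemma invertible_G: "x \<in> S \<Longrightarrow> invertible (G x)"
  unfolding invertible_left_inverse matrix_left_invertible_ker
  using ip_eq_0[of x] unfolding metric_inner_def by (metis inner_zero_right)

lemma smooth_G_component: "smooth_on S (\<lambda>x. G x $ i $ j)"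
  by (rule smooth_on_linear[OF _ open_S smooth_G])
     (intro bounded_linear_compose[OF bounded_linear_vec_nth] bounded_linear_vec_nth)

text \<open>Cramer's rule makes each entry of the inverse a quotient of determinants, which are
  polynomials in the entries.\<close>

lemma smooth_matrix_inv: "smooth_on S (\<lambda>x. matrix_inv (G x) $ k $ l)"
proof -
  \<comment> \<open>\<open>G x\<close> with column \<open>k\<close> replaced by the
    \<open>l\<close>-th unit vector.\<close>
  let ?C = "\<lambda>x. (\<chi> i j. if j = k then (axis l 1 :: real^'n) $ i else G x $ i $ j) :: real^'n^'n"
  have sm: "smooth_on S (\<lambda>x. det (M x))" if "\<And>i j. smooth_on S (\<lambda>x. M x $ i $ j)" for M :: "real^'n \<Rightarrow> real^'n^'n"
    unfolding det_def
    by (rule smooth_on_sum[OF open_S], rule smooth_on_mult[OF open_S smooth_on_const], rule smooth_on_prod[OF open_S that])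
  have s: "smooth_on S (\<lambda>x. ?C x $ i $ j)" for i j
    by (cases "j = k") (simp_all add: smooth_on_const smooth_G_component)
  have nz: "det (G x) \<noteq> 0" if "x \<in> S" for x
    using invertible_G[OF that] by (simp add: invertible_det_nz)
  have e: "det (?C x) * inverse (det (G x)) = matrix_inv (G x) $ k $ l" if x: "x \<in> S" for x
  proof -
    have "G x *v (matrix_inv (G x) *v axis l 1) = axis l 1"
      using matrix_inv_inverse[OF invertible_G[OF x]] by (simp add: matrix_vector_mul_assoc)
    then have "matrix_inv (G x) *v axis l 1 = (\<chi> k. det (\<chi> i j. if j = k then (axis l 1 :: real^'n) $ i else G x $ i $ j) / det (G x))"
      using cramer[OF nz[OF x]] by blast
    then have "(matrix_inv (G x) *v axis l 1) $ k = det (?C x) / det (G x)" by simp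
    moreover have "(matrix_inv (G x) *v axis l 1) $ k = matrix_inv (G x) $ k $ l"
      by (simp add: matrix_vector_mul_component axis_def inner_axis if_distrib sum.delta inner_vec_def cong: if_cong)
    ultimately show ?thesis by (simp add: divide_inverse)
  qed
  have sm2: "smooth_on S (\<lambda>x. det (?C x) * inverse (det (G x)))"
    using sm[OF s] sm[OF smooth_G_component] nz
    by (intro smooth_on_mult[OF open_S] smooth_on_inverse[OF open_S])
  show ?thesis by (rule smooth_on_cong[OF open_S _ sm2]) (rule e)
qed

section \<open>Christoffel symbols: smoothness, the Koszul formula, compatibility with the
  metric\<close>

lemma partial_deriv_G: "x \<in> S \<Longrightarrow> partial_deriv i (\<lambda>y. G y $ j $ l) x = dir_deriv G (axis i 1) x $ j $ l"
  unfolding partial_deriv_def dir_deriv_def[symmetric]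
  by (rule dir_deriv_linear[OF _ smooth_G])
     (intro bounded_linear_compose[OF bounded_linear_vec_nth] bounded_linear_vec_nth)

text \<open>Twice the Christoffel symbol of the first kind.\<close>

definition christoffel_lower :: "real^'n \<Rightarrow> 'n \<Rightarrow> 'n \<Rightarrow> 'n \<Rightarrow> real" where
  "christoffel_lower x i j l = dir_deriv G (axis i 1) x $ j $ l + dir_deriv G (axis j 1) x $ i $ l - dir_deriv G (axis l 1) x $ i $ j"

lemma christoffel_vec_christoffel_lower: "x \<in> S \<Longrightarrow> christoffel_vec G i j x = (1/2) *\<^sub>R (matrix_inv (G x) *v (\<chi> l. christoffel_lower x i j l))"
  by (simp add: christoffel_vec_def christoffel_def vec_eq_iff partial_deriv_G christoffel_lower_def matrix_vector_mult_def)

lemma smooth_christoffel_vec: "smooth_on S (christoffel_vec G i j)"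
proof (rule smooth_on_vec[OF open_S])
  fix k
  have "smooth_on S (\<lambda>x. dir_deriv G a x $ i $ j)" for a i j
    by (rule smooth_on_linear[OF _ open_S smooth_on_dir_deriv[OF smooth_G]])
       (intro bounded_linear_compose[OF bounded_linear_vec_nth] bounded_linear_vec_nth)
  then have "smooth_on S (\<lambda>x. dir_deriv G (axis i 1) x $ j $ l + dir_deriv G (axis j 1) x $ i $ l + (-1) * dir_deriv G (axis l 1) x $ i $ j)" for l
    by (intro smooth_on_add[OF open_S] smooth_on_mult[OF open_S] smooth_on_const)
  then have "smooth_on S (\<lambda>x. 1/2 * (\<Sum>l\<in>UNIV. matrix_inv (G x) $ k $ l * 
      (dir_deriv G (axis i 1) x $ j $ l + dir_deriv G (axis j 1) x $ i $ l + (-1) * dir_deriv G (axis l 1) x $ i $ j)))"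
    by (intro smooth_on_mult[OF open_S smooth_on_const] smooth_on_sum[OF open_S] smooth_on_mult[OF open_S smooth_matrix_inv])
  then show "smooth_on S (\<lambda>x. christoffel_vec G i j x $ k)"
    by (rule smooth_on_cong[OF open_S, rotated]) (simp add: christoffel_vec_def christoffel_def partial_deriv_G)
qed

lemma smooth_christoffel_form: "smooth_on S (\<lambda>x. christoffel_form G x u v)"
  unfolding christoffel_form_christoffel_vec
  by (intro smooth_on_sum[OF open_S] smooth_on_linear[OF bounded_linear_scaleR_right open_S] smooth_christoffel_vec)

lemma christoffel_form_deriv_christoffel_vec: "x \<in> S \<Longrightarrow> christoffel_form_deriv G x h u v = (\<Sum>i\<in>UNIV. \<Sum>j\<in>UNIV. (u $ i * v $ j) *\<^sub>R dir_deriv (christoffel_vec G i j) h x)"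
  unfolding christoffel_form_deriv_def christoffel_form_christoffel_vec
  by (rule dir_deriv_unique, rule has_derivative_sum, rule has_derivative_sum, rule has_derivative_scaleR_right,
        rule smooth_on_has_derivative[OF smooth_christoffel_vec])

lemma bounded_bilinear_christoffel_form_deriv:
  assumes "x \<in> S"
  shows "bounded_bilinear (christoffel_form_deriv G x h)"
proof -
  have "christoffel_form_deriv G x h = (\<lambda>u v. \<Sum>i\<in>UNIV. \<Sum>j\<in>UNIV. (u $ i * v $ j) *\<^sub>R dir_deriv (christoffel_vec G i j) h x)"
    by (intro ext christoffel_form_deriv_christoffel_vec assms)
  then show ?thesis using bilinear_sum_coords[of "\<lambda>i j. dir_deriv (christoffel_vec G i j) h x"] by simp
qed

text \<open>The Koszul formula for fields with constant coefficients, whose brackets vanish.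
  Symmetry, compatibility with the metric and the transformation law are deduced from it without
  further index sums.\<close>

lemma ip_christoffel_form_koszul:
  assumes x: "x \<in> S"
  shows "2 * ip x w (christoffel_form G x u v) = metric_deriv G x u v w + metric_deriv G x v u w - metric_deriv G x w u v"
proof -
  have D: "metric_deriv G x h a b = (\<Sum>i\<in>UNIV. \<Sum>j\<in>UNIV. \<Sum>l\<in>UNIV. h $ i * a $ j * b $ l * dir_deriv G (axis i 1) x $ j $ l)" for h a b
  proof -
    have "dir_deriv G h x = (\<Sum>i\<in>UNIV. h $ i *\<^sub>R dir_deriv G (axis i 1) x)"
    proof -
      interpret linear "\<lambda>v. dir_deriv G v x" by (rule linear_dir_deriv[OF smooth_G x])
      have "h = (\<Sum>i\<in>UNIV. h $ i *\<^sub>R axis i 1)"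
        by (metis (no_types) basis_expansion scalar_mult_eq_scaleR sum.cong)
      then have "dir_deriv G h x = dir_deriv G (\<Sum>i\<in>UNIV. h $ i *\<^sub>R axis i 1) x" by simp
      also have "\<dots> = (\<Sum>i\<in>UNIV. h $ i *\<^sub>R dir_deriv G (axis i 1) x)"
        by (simp only: sum scaleR)
      finally show ?thesis .
    qed
    then have "metric_deriv G x h a b = (\<Sum>j\<in>UNIV. a $ j * (\<Sum>l\<in>UNIV. (\<Sum>i\<in>UNIV. h $ i * dir_deriv G (axis i 1) x $ j $ l) * b $ l))"
      by (simp add: metric_deriv_def inner_vec_def matrix_vector_mult_def sum_component)
    also have "\<dots> = (\<Sum>j\<in>UNIV. \<Sum>l\<in>UNIV. \<Sum>i\<in>UNIV. h $ i * a $ j * b $ l * dir_deriv G (axis i 1) x $ j $ l)"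
      by (simp add: sum_distrib_left sum_distrib_right mult_ac)
    also have "\<dots> = (\<Sum>j\<in>UNIV. \<Sum>i\<in>UNIV. \<Sum>l\<in>UNIV. h $ i * a $ j * b $ l * dir_deriv G (axis i 1) x $ j $ l)"
      by (rule sum.cong[OF refl], rule sum.swap)
    also have "\<dots> = (\<Sum>i\<in>UNIV. \<Sum>j\<in>UNIV. \<Sum>l\<in>UNIV. h $ i * a $ j * b $ l * dir_deriv G (axis i 1) x $ j $ l)"
      by (rule sum.swap)
    finally show ?thesis .
  qed
  have G: "G x *v christoffel_vec G i j x = (1/2) *\<^sub>R (\<chi> l. christoffel_lower x i j l)" for i j
    using matrix_inv_inverse[OF invertible_G[OF x]]
    by (simp add: christoffel_vec_christoffel_lower[OF x] matrix_vector_mult_scaleR matrix_vector_mul_assoc)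
  have "2 * ip x w (christoffel_form G x u v) = (\<Sum>i\<in>UNIV. \<Sum>j\<in>UNIV. u $ i * v $ j * (2 * (w \<bullet> (G x *v christoffel_vec G i j x))))"
  proof -
    have "linear (ip x w)"
      using bounded_bilinear.bounded_linear_right[OF bounded_bilinear_ip] bounded_linear.linear by blast
    then show ?thesis
      unfolding christoffel_form_christoffel_vec metric_inner_def[symmetric]
      by (simp add: linear_sum linear_scale sum_distrib_left mult_ac)
  qed
  also have "\<dots> = (\<Sum>i\<in>UNIV. \<Sum>j\<in>UNIV. \<Sum>l\<in>UNIV. u $ i * v $ j * w $ l * christoffel_lower x i j l)"
    unfolding G by (simp add: inner_vec_def sum_distrib_left mult_ac)
  also have "\<dots> = (\<Sum>i\<in>UNIV. \<Sum>j\<in>UNIV. \<Sum>l\<in>UNIV. u $ i * v $ j * w $ l * dir_deriv G (axis i 1) x $ j $ l)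
     + (\<Sum>i\<in>UNIV. \<Sum>j\<in>UNIV. \<Sum>l\<in>UNIV. u $ i * v $ j * w $ l * dir_deriv G (axis j 1) x $ i $ l)
     - (\<Sum>i\<in>UNIV. \<Sum>j\<in>UNIV. \<Sum>l\<in>UNIV. u $ i * v $ j * w $ l * dir_deriv G (axis l 1) x $ i $ j)"
    by (simp add: christoffel_lower_def sum.distrib sum_subtractf algebra_simps)
  also have "(\<Sum>i\<in>UNIV. \<Sum>j\<in>UNIV. \<Sum>l\<in>UNIV. u $ i * v $ j * w $ l * dir_deriv G (axis i 1) x $ j $ l) = metric_deriv G x u v w"
    unfolding D ..
  also have "(\<Sum>i\<in>UNIV. \<Sum>j\<in>UNIV. \<Sum>l\<in>UNIV. u $ i * v $ j * w $ l * dir_deriv G (axis j 1) x $ i $ l) = metric_deriv G x v u w"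
    unfolding D by (subst sum.swap) (simp add: mult_ac)
  also have "(\<Sum>i\<in>UNIV. \<Sum>j\<in>UNIV. \<Sum>l\<in>UNIV. u $ i * v $ j * w $ l * dir_deriv G (axis l 1) x $ i $ j) = metric_deriv G x w u v"
  proof -
    have "(\<Sum>i\<in>UNIV. \<Sum>j\<in>UNIV. \<Sum>l\<in>UNIV. u $ i * v $ j * w $ l * dir_deriv G (axis l 1) x $ i $ j)
      = (\<Sum>i\<in>UNIV. \<Sum>l\<in>UNIV. \<Sum>j\<in>UNIV. u $ i * v $ j * w $ l * dir_deriv G (axis l 1) x $ i $ j)"
      by (rule sum.cong[OF refl], rule sum.swap)
    also have "\<dots> = (\<Sum>l\<in>UNIV. \<Sum>i\<in>UNIV. \<Sum>j\<in>UNIV. u $ i * v $ j * w $ l * dir_deriv G (axis l 1) x $ i $ j)"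
      by (rule sum.swap)
    finally show ?thesis unfolding D by (simp add: mult_ac)
  qed
  finally show ?thesis .
qed

lemma christoffel_form_sym: "x \<in> S \<Longrightarrow> christoffel_form G x u v = christoffel_form G x v u"
proof (rule ip_eqI)
  fix w assume x: "x \<in> S"
  have "2 * ip x w (christoffel_form G x u v) = 2 * ip x w (christoffel_form G x v u)"
    unfolding ip_christoffel_form_koszul[OF x] using metric_deriv_sym[OF x, of w u v] by simp
  then show "ip x (christoffel_form G x u v) w = ip x (christoffel_form G x v u) w"
    using ip_sym[OF x, of w "christoffel_form G x u v"] ip_sym[OF x, of w "christoffel_form G x v u"] by simp
qed

text \<open>In the sum of the Koszul formulas for \<open>v, h, u\<close> and for
  \<open>u, h, v\<close> the derivatives in directions \<open>u\<close> and \<open>v\<close>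
  cancel.\<close>

lemma christoffel_form_compat:
  assumes x: "x \<in> S"
  shows "metric_deriv G x h u v = ip x (christoffel_form G x h u) v + ip x u (christoffel_form G x h v)"
  using ip_christoffel_form_koszul[OF x, of v h u] ip_christoffel_form_koszul[OF x, of u h v] ip_sym[OF x, of "christoffel_form G x h u" v]
    metric_deriv_sym[OF x, of h v u] metric_deriv_sym[OF x, of v h u] metric_deriv_sym[OF x, of u h v] by simp

section \<open>Derivatives and continuity of tensor expressions along curves\<close>

lemma ip_curve:
  assumes "(x has_vector_derivative x') (at t within T)" "(u has_vector_derivative u') (at t within T)"
     "(v has_vector_derivative v') (at t within T)" "x t \<in> S"
  shows "((\<lambda>t. ip (x t) (u t) (v t)) has_vector_derivative
    (metric_deriv G (x t) x' (u t) (v t) + ip (x t) u' (v t) + ip (x t) (u t) v')) (at t within T)"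
  unfolding metric_inner_def metric_deriv_def
  by (rule has_vector_derivative_eq_rhs,
      rule bounded_bilinear.has_vector_derivative[OF bounded_bilinear_inner assms(2)],
      rule bounded_bilinear.has_vector_derivative[OF bounded_bilinear_matrix_vector],
      rule dir_deriv_curve[OF smooth_G assms(4,1)], rule assms(3)) (simp add: inner_add_right)

lemma metric_deriv_curve:
  assumes "(x has_vector_derivative x') (at t within T)" "(h has_vector_derivative h') (at t within T)"
     "(u has_vector_derivative u') (at t within T)" 
     "(v has_vector_derivative v') (at t within T)" "t \<in> T" "\<And>t. t \<in> T \<Longrightarrow> x t \<in> S"
  shows "((\<lambda>t. metric_deriv G (x t) (h t) (u t) (v t)) has_vector_derivative
    (metric_deriv2 G (x t) (h t) x' (u t) (v t) + metric_deriv G (x t) h' (u t) (v t)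
     + metric_deriv G (x t) (h t) u' (v t) + metric_deriv G (x t) (h t) (u t) v')) (at t within T)"
  unfolding metric_deriv_def metric_deriv2_def
  by (rule has_vector_derivative_eq_rhs,
      rule bounded_bilinear.has_vector_derivative[OF bounded_bilinear_inner assms(3)],
      rule bounded_bilinear.has_vector_derivative[OF bounded_bilinear_matrix_vector],
      rule dir_deriv_moving_curve[OF open_S smooth_G assms(6)[OF assms(5)] assms(1,2,5,6)], assumption, rule assms(4))
     (simp add: inner_add_right matrix_vector_mult_add_rdistrib)

lemma christoffel_form_curve:
  assumes "(x has_vector_derivative x') (at t within T)" "(u has_vector_derivative u') (at t within T)"
     "(v has_vector_derivative v') (at t within T)" "x t \<in> S"
  shows "((\<lambda>t. christoffel_form G (x t) (u t) (v t)) has_vector_derivative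
    (christoffel_form_deriv G (x t) x' (u t) (v t) + christoffel_form G (x t) u' (v t) + christoffel_form G (x t) (u t) v')) (at t within T)"
proof -
  have c: "((\<lambda>t. w t $ i) has_field_derivative w' $ i) (at t within T)" if "(w has_vector_derivative w') (at t within T)" for w w' i
    using bounded_linear.has_vector_derivative[OF bounded_linear_vec_nth that]
    by (simp add: has_real_derivative_iff_has_vector_derivative)
  have "((\<lambda>t. christoffel_form G (x t) (u t) (v t)) has_vector_derivative
     (\<Sum>i\<in>UNIV. \<Sum>j\<in>UNIV. (u t $ i * v t $ j) *\<^sub>R dir_deriv (christoffel_vec G i j) x' (x t)
        + (u' $ i * v t $ j + v' $ j * u t $ i) *\<^sub>R christoffel_vec G i j (x t))) (at t within T)"
    unfolding christoffel_form_christoffel_vec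
    by (intro has_vector_derivative_sum has_vector_derivative_scaleR DERIV_mult
        dir_deriv_curve[OF smooth_christoffel_vec] c assms)
  then show ?thesis
    unfolding christoffel_form_deriv_christoffel_vec[OF assms(4)] christoffel_form_christoffel_vec by (simp add: sum.distrib scaleR_add_left add_ac mult_ac)
qed

lemma continuous_on_ip:
  assumes "continuous_on T x" "continuous_on T u" "continuous_on T v" "x ` T \<subseteq> S"
  shows "continuous_on T (\<lambda>t. ip (x t) (u t) (v t))"
  unfolding metric_inner_def
  by (intro continuous_intros assms bounded_bilinear.continuous_on[OF bounded_bilinear_matrix_vector]
     continuous_on_compose2[OF smooth_on_imp_continuous_on[OF smooth_G]])

lemma continuous_on_metric_deriv:
  assumes "continuous_on T x" "continuous_on T h" "continuous_on T u" "continuous_on T v" "x ` T \<subseteq> S"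
  shows "continuous_on T (\<lambda>t. metric_deriv G (x t) (h t) (u t) (v t))"
  unfolding metric_deriv_def
  by (intro continuous_intros assms bounded_bilinear.continuous_on[OF bounded_bilinear_matrix_vector]
     continuous_on_dir_deriv[OF smooth_G])

lemma continuous_on_metric_deriv2:
  assumes "continuous_on T x" "continuous_on T h" "continuous_on T k" "continuous_on T u" "continuous_on T v" "x ` T \<subseteq> S"
  shows "continuous_on T (\<lambda>t. metric_deriv2 G (x t) (h t) (k t) (u t) (v t))"
  unfolding metric_deriv2_def
  by (intro continuous_intros assms bounded_bilinear.continuous_on[OF bounded_bilinear_matrix_vector]
     continuous_on_dir_deriv_dir_deriv[OF open_S smooth_G])

lemma continuous_on_christoffel_form:
  assumes "continuous_on T x" "continuous_on T u" "continuous_on T v" "x ` T \<subseteq> S"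
  shows "continuous_on T (\<lambda>t. christoffel_form G (x t) (u t) (v t))"
  unfolding christoffel_form_christoffel_vec
  by (intro continuous_intros assms continuous_on_compose2[OF smooth_on_imp_continuous_on[OF smooth_christoffel_vec]])

lemma continuous_on_christoffel_form_deriv:
  assumes "continuous_on T x" "continuous_on T h" "continuous_on T u" "continuous_on T v" "x ` T \<subseteq> S"
  shows "continuous_on T (\<lambda>t. christoffel_form_deriv G (x t) (h t) (u t) (v t))"
proof -
  have "continuous_on T (\<lambda>t. \<Sum>i\<in>UNIV. \<Sum>j\<in>UNIV. (u t $ i * v t $ j) *\<^sub>R dir_deriv (christoffel_vec G i j) (h t) (x t))"
    by (intro continuous_intros assms continuous_on_dir_deriv[OF smooth_christoffel_vec])
  then show ?thesis
    using christoffel_form_deriv_christoffel_vec assms(5) by (subst continuous_on_cong[OF refl]) (auto simp: image_subset_iff)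
qed

end

section \<open>Curvature identities\<close>

lemma cov_deriv_christoffel_form: "cov_deriv G u W x = dir_deriv W u x + christoffel_form G x u (W x)"
  by (simp add: cov_deriv_def dir_deriv_def christoffel_form_def)

lemma riemann_curv_christoffel_form:
  "riemann_curv G x u v w = christoffel_form_deriv G x u v w - christoffel_form_deriv G x v u w + christoffel_form G x u (christoffel_form G x v w) - christoffel_form G x v (christoffel_form G x u w)"
proof -
  have "cov_deriv G v (\<lambda>_. w) = (\<lambda>y. christoffel_form G y v w)" for v
    by (simp add: cov_deriv_christoffel_form[abs_def] dir_deriv_def)
  then show ?thesis
    by (simp add: riemann_curv_def cov_deriv_christoffel_form christoffel_form_deriv_def)
qed

lemma line_derivative: "((\<lambda>t. x + t *\<^sub>R h) has_vector_derivative h) (at 0)"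
  by (auto intro!: derivative_eq_intros)

lemma dir_deriv_line:
  assumes "smooth_on U F" "x \<in> U"
  shows "((\<lambda>t. F (x + t *\<^sub>R h)) has_vector_derivative dir_deriv F h x) (at 0)"
  using dir_deriv_curve[OF assms(1), where x = "\<lambda>t. x + t *\<^sub>R h" and t = 0, OF _ line_derivative] assms(2) by simp

lemma matrix_entry: "(M :: real^'n::finite^'n) $ a $ b = axis a 1 \<bullet> (M *v axis b 1)"
  by (simp add: matrix_vector_mult_basis column_def inner_axis')

context local_metric
begin

lemmas christoffel_form_deriv_simps = 
  bounded_bilinear.add_left[OF bounded_bilinear_christoffel_form_deriv] bounded_bilinear.add_right[OF bounded_bilinear_christoffel_form_deriv]
  bounded_bilinear.diff_left[OF bounded_bilinear_christoffel_form_deriv] bounded_bilinear.diff_right[OF bounded_bilinear_christoffel_form_deriv]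
  bounded_bilinear.minus_left[OF bounded_bilinear_christoffel_form_deriv] bounded_bilinear.minus_right[OF bounded_bilinear_christoffel_form_deriv]
  bounded_bilinear.zero_left[OF bounded_bilinear_christoffel_form_deriv] bounded_bilinear.zero_right[OF bounded_bilinear_christoffel_form_deriv]
  bounded_bilinear.scaleR_left[OF bounded_bilinear_christoffel_form_deriv] bounded_bilinear.scaleR_right[OF bounded_bilinear_christoffel_form_deriv]

lemma christoffel_form_deriv_sym: 
  assumes "x \<in> S" shows "christoffel_form_deriv G x h u v = christoffel_form_deriv G x h v u"
  unfolding christoffel_form_deriv_def by (rule dir_deriv_cong[OF open_S assms _ smooth_christoffel_form]) (rule christoffel_form_sym)

lemma line_in_open:
  assumes "open (U::(real^'n) set)" "x \<in> U"
  obtains T where "open T" "(0::real) \<in> T" "\<And>t. t \<in> T \<Longrightarrow> x + t *\<^sub>R h \<in> U"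
proof
  show "open ((\<lambda>t. x + t *\<^sub>R h) -` U)"
    by (rule open_vimage[OF assms(1)]) (intro continuous_intros)
qed (use assms in auto)

text \<open>This is \<open>christoffel_form_compat\<close> differentiated along the line through
  \<open>x\<close> in direction \<open>k\<close>.\<close>

lemma metric_deriv2_christoffel_form:
  assumes x: "x \<in> S"
  shows "metric_deriv2 G x h k u v = metric_deriv G x k (christoffel_form G x h u) v + ip x (christoffel_form_deriv G x k h u) v
     + metric_deriv G x k u (christoffel_form G x h v) + ip x u (christoffel_form_deriv G x k h v)"
proof -
  have L: "bounded_linear (\<lambda>M::real^'n^'n. u \<bullet> (M *v v))"
    by (rule bounded_linear_compose[OF bounded_linear_inner_right bounded_bilinear.bounded_linear_left[OF bounded_bilinear_matrix_vector]])
  have d1: "((\<lambda>t. metric_deriv G (x + t *\<^sub>R k) h u v) has_vector_derivative metric_deriv2 G x h k u v) (at 0)"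
    using dir_deriv_line[OF smooth_on_linear[OF L open_S smooth_on_dir_deriv[OF smooth_G, of h]] x, of k]
      dir_deriv_linear[OF L smooth_on_dir_deriv[OF smooth_G] x]
    by (simp add: metric_deriv_def metric_deriv2_def)
  have g: "((\<lambda>t. christoffel_form G (x + t *\<^sub>R k) h w) has_vector_derivative christoffel_form_deriv G x k h w) (at 0)" for w
    using christoffel_form_curve[OF line_derivative has_vector_derivative_const has_vector_derivative_const, of x k h w] x
    by (simp add: christoffel_form_simps)
  have d2: "((\<lambda>t. ip (x + t *\<^sub>R k) (christoffel_form G (x + t *\<^sub>R k) h u) v + ip (x + t *\<^sub>R k) u (christoffel_form G (x + t *\<^sub>R k) h v)) 
     has_vector_derivative (metric_deriv G x k (christoffel_form G x h u) v + ip x (christoffel_form_deriv G x k h u) v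
     + (metric_deriv G x k u (christoffel_form G x h v) + ip x u (christoffel_form_deriv G x k h v)))) (at 0)"
    using ip_curve[OF line_derivative g has_vector_derivative_const, of x k u v]
      ip_curve[OF line_derivative has_vector_derivative_const g, of x k u v] x
    by (intro has_vector_derivative_add) (simp_all add: ip_simps)
  \<comment> \<open>The compatibility identity holds on \<open>S\<close> only; for parameters in
    \<open>T\<close> the line stays there.\<close>
  obtain T where T: "open T" "(0::real) \<in> T" "\<And>t. t \<in> T \<Longrightarrow> x + t *\<^sub>R k \<in> S"
    using line_in_open[OF open_S x] by blast
  have "((\<lambda>t. metric_deriv G (x + t *\<^sub>R k) h u v) has_vector_derivative (metric_deriv G x k (christoffel_form G x h u) v + ip x (christoffel_form_deriv G x k h u) v
     + (metric_deriv G x k u (christoffel_form G x h v) + ip x u (christoffel_form_deriv G x k h v)))) (at 0)"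
    by (rule has_vector_derivative_transform_within_open[OF d2 T(1,2)]) (simp add: christoffel_form_compat[OF T(3)])
  from vector_derivative_unique_at[OF d1 this] show ?thesis by simp
qed

text \<open>Second derivatives of \<open>G\<close> commute. Written with
  \<open>metric_deriv2_christoffel_form\<close>, the difference of the two orders is twice the
  left-hand side.\<close>

lemma riemann_skew0:
  assumes x: "x \<in> S"
  shows "ip x (riemann_curv G x u v w) w = 0"
proof -
  have "metric_deriv2 G x v u w w = 2 * ip x (christoffel_form G x u (christoffel_form G x v w)) w + 2 * ip x (christoffel_form G x v w) (christoffel_form G x u w)
     + 2 * ip x (christoffel_form_deriv G x u v w) w" for u v
    using ip_sym[OF x, of w "christoffel_form_deriv G x u v w"] ip_sym[OF x, of w "christoffel_form G x u (christoffel_form G x v w)"]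
      ip_sym[OF x, of "christoffel_form G x u w" "christoffel_form G x v w"]
    by (simp add: metric_deriv2_christoffel_form[OF x] christoffel_form_compat[OF x])
  from this[of v u] this[of u v] show ?thesis
    using metric_deriv2_commute[OF x, of u v w w] ip_sym[OF x, of "christoffel_form G x u w" "christoffel_form G x v w"]
    by (simp add: riemann_curv_christoffel_form ip_simps)
qed

lemma riemann_add: "x \<in> S \<Longrightarrow> riemann_curv G x u v (w + z) = riemann_curv G x u v w + riemann_curv G x u v z"
  by (simp add: riemann_curv_christoffel_form christoffel_form_simps christoffel_form_deriv_simps)

text \<open>Polarisation of \<open>riemann_skew0\<close>.\<close>

lemma riemann_skew:
  assumes x: "x \<in> S"
  shows "ip x (riemann_curv G x u v w) z = - ip x (riemann_curv G x u v z) w"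
  using riemann_skew0[OF x, of u v "w + z"] riemann_skew0[OF x, of u v w] riemann_skew0[OF x, of u v z]
  by (simp add: riemann_add[OF x] ip_simps)

lemma christoffel_form_deriv_linear1:
  assumes "x \<in> S"
  shows "christoffel_form_deriv G x (h + k) u v = christoffel_form_deriv G x h u v + christoffel_form_deriv G x k u v" "christoffel_form_deriv G x (r *\<^sub>R h) u v = r *\<^sub>R christoffel_form_deriv G x h u v"
proof -
  interpret linear "\<lambda>h. dir_deriv (\<lambda>y. christoffel_form G y u v) h x" by (rule linear_dir_deriv[OF smooth_christoffel_form assms])
  show "christoffel_form_deriv G x (h + k) u v = christoffel_form_deriv G x h u v + christoffel_form_deriv G x k u v" "christoffel_form_deriv G x (r *\<^sub>R h) u v = r *\<^sub>R christoffel_form_deriv G x h u v"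
    unfolding christoffel_form_deriv_def by (rule add, rule scale)
qed

lemma linear_riemann: "x \<in> S \<Longrightarrow> linear (\<lambda>u. riemann_curv G x u v w)"
  by (rule linearI) (simp_all add: riemann_curv_christoffel_form christoffel_form_simps christoffel_form_deriv_simps christoffel_form_deriv_linear1 algebra_simps)

lemma riemann_same: "x \<in> S \<Longrightarrow> riemann_curv G x v v w = 0"
  by (simp add: riemann_curv_christoffel_form)

text \<open>The left-hand side is the second \<open>s\<close>-derivative at \<open>0\<close> of the squared speed of
  \<open>u + s V - (s\<^sup>2/2) \<Gamma>(V, V)\<close>, with \<open>p = u'\<close> and \<open>W = V'\<close>. The covariant acceleration of this
  variation vanishes at \<open>s = 0\<close>, so there are no boundary terms and \<open>u\<close> need not be a geodesic.\<close>

lemma second_variation_identity: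
  assumes x: "x \<in> S"
  shows "2 * ip x W W + 2 * ip x p (- christoffel_form_deriv G x p V V - 2 *\<^sub>R christoffel_form G x V W) + 4 * metric_deriv G x V p W
      + metric_deriv2 G x V V p p + metric_deriv G x (- christoffel_form G x V V) p p
    = 2 * ip x (W + christoffel_form G x p V) (W + christoffel_form G x p V) - 2 * ip x (riemann_curv G x V p p) V"
proof -
  have 1: "metric_deriv2 G x V V p p = 2 * ip x (christoffel_form G x V (christoffel_form G x V p)) p + 2 * ip x (christoffel_form G x V p) (christoffel_form G x V p)
     + 2 * ip x (christoffel_form_deriv G x V V p) p"
    using ip_sym[OF x, of p "christoffel_form_deriv G x V V p"] ip_sym[OF x, of p "christoffel_form G x V (christoffel_form G x V p)"]
    by (simp add: metric_deriv2_christoffel_form[OF x] christoffel_form_compat[OF x])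
  have 2: "metric_deriv G x (- christoffel_form G x V V) p p = - 2 * ip x (christoffel_form G x p (christoffel_form G x V V)) p"
    using ip_sym[OF x, of p "christoffel_form G x (christoffel_form G x V V) p"] christoffel_form_sym[OF x, of "christoffel_form G x V V" p]
    by (simp add: christoffel_form_compat[OF x] christoffel_form_simps ip_simps)
  have 3: "metric_deriv G x V p W = ip x (christoffel_form G x V p) W + ip x p (christoffel_form G x V W)"
    by (rule christoffel_form_compat[OF x])
  \<comment> \<open>Skew-symmetry exchanges \<open>p\<close> and \<open>V\<close>, so that the
    derivatives of \<Gamma> are paired with \<open>p\<close>, as in the terms on the left-hand
    side.\<close>
  have 4: "- ip x (riemann_curv G x V p p) V = ip x (christoffel_form_deriv G x V p V) p - ip x (christoffel_form_deriv G x p V V) p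
     + ip x (christoffel_form G x V (christoffel_form G x p V)) p - ip x (christoffel_form G x p (christoffel_form G x V V)) p"
    unfolding riemann_skew[OF x, of V p p V] by (simp add: riemann_curv_christoffel_form ip_simps)
  show ?thesis
    using 4 unfolding 1 2 3
    using ip_sym[OF x, of p "christoffel_form_deriv G x p V V"] ip_sym[OF x, of W "christoffel_form G x p V"]
      christoffel_form_deriv_sym[OF x, of V V p] christoffel_form_sym[OF x, of V p] 
    by (simp add: ip_simps)
qed

section \<open>Orthonormal frames, traces and the Hessian\<close>

lemma frame_inverse:
  fixes e :: "'n \<Rightarrow> real^'n"
  assumes x: "x \<in> S" and on: "\<And>a b. ip x (e a) (e b) = (if a = b then 1 else 0)"
  defines "P \<equiv> \<chi> i a. e a $ i"
  shows "P *v axis a 1 = e a" "axis a 1 \<bullet> ((transpose P ** G x) *v y) = ip x (e a) y"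
    "P ** (transpose P ** G x) = mat 1"
proof -
  show P: "P *v axis a 1 = e a" for a
    by (simp add: P_def vec_eq_iff matrix_vector_mult_def axis_def if_distrib cong: if_cong)
  show Q: "axis a 1 \<bullet> ((transpose P ** G x) *v y) = ip x (e a) y" for a y
    unfolding metric_inner_def P[symmetric] matrix_vector_mul_assoc[symmetric]
    by (metis dot_lmul_matrix inner_commute transpose_matrix_vector)
  \<comment> \<open>Orthonormality says that \<open>transpose P ** G x\<close> is a left inverse of
    \<open>P\<close>; for square matrices it is then a right inverse, which is completeness of the
    frame.\<close>
  have "(transpose P ** G x) ** P = mat 1"
  proof -
    have "((transpose P ** G x) ** P) $ a $ b = (mat 1 :: real^'n^'n) $ a $ b" for a b
    proof -
      have "((transpose P ** G x) ** P) $ a $ b = axis a 1 \<bullet> ((transpose P ** G x) *v (P *v axis b 1))"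
        by (simp only: matrix_vector_mul_assoc matrix_entry)
      then show ?thesis by (simp only: Q P on) (simp add: mat_def)
    qed
    then show ?thesis by (simp add: vec_eq_iff)
  qed
  then show "P ** (transpose P ** G x) = mat 1"
    using matrix_left_right_inverse by blast
qed

lemma frame_expand:
  fixes e :: "'n \<Rightarrow> real^'n"
  assumes x: "x \<in> S" and on: "\<And>a b. ip x (e a) (e b) = (if a = b then 1 else 0)"
  shows "v = (\<Sum>a\<in>UNIV. ip x (e a) v *\<^sub>R e a)"
proof -
  define P :: "real^'n^'n" where "P = (\<chi> i a. e a $ i)"
  note F = frame_inverse[OF x on, folded P_def]
  have "v = P *v ((transpose P ** G x) *v v)"
    using F(3) by (simp add: matrix_vector_mul_assoc)
  also have "\<dots> = P *v (\<Sum>a\<in>UNIV. ((transpose P ** G x) *v v) $ a *\<^sub>R axis a 1)"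
    by (metis (no_types) basis_expansion scalar_mult_eq_scaleR sum.cong)
  also have "\<dots> = (\<Sum>a\<in>UNIV. ((transpose P ** G x) *v v) $ a *\<^sub>R e a)"
    by (simp add: linear_sum[OF matrix_vector_mul_linear] matrix_vector_mult_scaleR F(1))
  also have "\<dots> = (\<Sum>a\<in>UNIV. ip x (e a) v *\<^sub>R e a)"
    using F(2) by (simp add: inner_axis')
  finally show ?thesis .
qed

lemma frame_norm:
  fixes e :: "'n \<Rightarrow> real^'n"
  assumes x: "x \<in> S" and on: "\<And>a b. ip x (e a) (e b) = (if a = b then 1 else 0)"
  shows "ip x v v = (\<Sum>a\<in>UNIV. (ip x (e a) v)\<^sup>2)"
proof -
  have l: "linear (\<lambda>u. ip x u v)"
    using bounded_bilinear.bounded_linear_left[OF bounded_bilinear_ip] bounded_linear.linear by blast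
  have "ip x v v = ip x (\<Sum>a\<in>UNIV. ip x (e a) v *\<^sub>R e a) v"
    using frame_expand[OF x on, of v] by simp
  also have "\<dots> = (\<Sum>a\<in>UNIV. (ip x (e a) v)\<^sup>2)"
    by (simp add: linear_sum[OF l] ip_simps power2_eq_square)
  finally show ?thesis .
qed

text \<open>The trace is invariant under the change of basis \<open>P\<close>, and in the frame the
  diagonal entries of the endomorphism are read off with \<open>ip\<close>.\<close>

lemma trace_frame:
  fixes e :: "'n \<Rightarrow> real^'n"
  assumes x: "x \<in> S" and on: "\<And>a b. ip x (e a) (e b) = (if a = b then 1 else 0)" and L: "linear L"
  shows "trace (matrix L) = (\<Sum>a\<in>UNIV. ip x (e a) (L (e a)))"
proof -
  define P :: "real^'n^'n" where "P = (\<chi> i a. e a $ i)"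
  note F = frame_inverse[OF x on, folded P_def]
  let ?Q = "transpose P ** G x"
  have "trace (matrix L) = trace ((matrix L ** P) ** ?Q)"
    using F(3) by (simp add: matrix_mul_assoc[symmetric])
  also have "\<dots> = trace (?Q ** (matrix L ** P))" by (rule trace_mul_sym)
  also have "\<dots> = (\<Sum>a\<in>UNIV. axis a 1 \<bullet> ((?Q ** (matrix L ** P)) *v axis a 1))"
    unfolding trace_def
    by (rule sum.cong[OF refl]) (rule matrix_entry)
  also have "\<dots> = (\<Sum>a\<in>UNIV. ip x (e a) (L (e a)))"
  proof (rule sum.cong[OF refl])
    fix a
    have "(?Q ** (matrix L ** P)) *v axis a 1 = ?Q *v (matrix L *v (P *v axis a 1))"
      by (simp only: matrix_vector_mul_assoc)
    also have "\<dots> = ?Q *v L (e a)"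
      using fun_cong[OF matrix_vector_mul(2)[OF L]] by (simp only: F(1))
    finally show "axis a 1 \<bullet> ((?Q ** (matrix L ** P)) *v axis a 1) = ip x (e a) (L (e a))"
      by (simp only: F(2))
  qed
  finally show ?thesis .
qed

lemma ricci_frame:
  fixes e :: "'n \<Rightarrow> real^'n"
  assumes x: "x \<in> S" and on: "\<And>a b. ip x (e a) (e b) = (if a = b then 1 else 0)"
  shows "ricci G x v w = (\<Sum>a\<in>UNIV. ip x (riemann_curv G x (e a) v w) (e a))"
  unfolding ricci_def trace_frame[OF x on linear_riemann[OF x]] using ip_sym[OF x] by metis

text \<open>The frame grows by one vector at a time: a vector is \<open>ip\<close>-orthogonal to
  \<open>e a\<close> iff it is Euclidean-orthogonal to \<open>G x *v e a\<close>, and fewer than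
  \<open>CARD('n)\<close> such vectors leave room for a nonzero \<open>w\<close>.\<close>

lemma orthonormal_frame_exists:
  assumes x: "x \<in> S"
  obtains e :: "'n \<Rightarrow> real^'n" where "\<And>a b. ip x (e a) (e b) = (if a = b then 1 else 0)"
proof -
  have "\<exists>e :: 'n \<Rightarrow> real^'n. \<forall>a\<in>I. \<forall>b\<in>I. ip x (e a) (e b) = (if a = b then 1 else 0)" if "finite I" for I
    using that
  proof (induction I)
    case (insert c I)
    then obtain e :: "'n \<Rightarrow> real^'n" where e: "\<forall>a\<in>I. \<forall>b\<in>I. ip x (e a) (e b) = (if a = b then 1 else 0)" by blast
    have "card ((\<lambda>a. G x *v e a) ` I) < CARD('n)"
      using card_image_le[OF insert.hyps(1), of "\<lambda>a. G x *v e a"] psubset_card_mono[of UNIV I] insert.hyps(2) by (metis (no_types) UNIV_I finite le_less_trans psubsetI subset_UNIV)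
    then have "dim (span ((\<lambda>a. G x *v e a) ` I)) < DIM(real^'n)"
      using dim_le_card'[of "(\<lambda>a. G x *v e a) ` I"] insert.hyps by (simp add: dim_span)
    then obtain w where w: "w \<noteq> 0" "\<And>y. y \<in> span ((\<lambda>a. G x *v e a) ` I) \<Longrightarrow> orthogonal w y"
      using orthogonal_to_subspace_exists[of "(\<lambda>a. G x *v e a) ` I"] by (metis dim_span)
    then have w0: "ip x w (e a) = 0" if "a \<in> I" for a
      using that span_base unfolding metric_inner_def orthogonal_def by blast
    define n where "n = sqrt (ip x w w)"
    have n: "n > 0" "n * n = ip x w w"
      using pos_G[OF x w(1)] by (auto simp: n_def)
    have "ip x ((1/n) *\<^sub>R w) ((1/n) *\<^sub>R w) = 1"
      using n(1) unfolding ip_simps n(2)[symmetric] by simp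
    moreover have "ip x ((1/n) *\<^sub>R w) (e a) = 0 \<and> ip x (e a) ((1/n) *\<^sub>R w) = 0" if "a \<in> I" for a
      using w0[OF that] ip_sym[OF x, of w "e a"] by (simp add: ip_simps)
    ultimately have "\<forall>a\<in>insert c I. \<forall>b\<in>insert c I. ip x ((e(c := (1/n) *\<^sub>R w)) a) ((e(c := (1/n) *\<^sub>R w)) b) = (if a = b then 1 else 0)"
      using e insert.hyps by (auto simp: fun_upd_def)
    then show ?case by blast
  qed auto
  from this[of UNIV] that show ?thesis by auto
qed

text \<open>Differentiating the defining identity of the gradient along \<open>u\<close> and
  cancelling with \<open>christoffel_form_compat\<close> removes the gradient. If
  \<open>u = v\<close> is the velocity of a geodesic, the right-hand side is the second derivative
  of \<open>h\<close> along it.\<close>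

lemma hessian_eq:
  assumes h: "smooth_on S h" and x: "x \<in> S"
  shows "hessian G h x u v = dir_deriv (dir_deriv h v) u x - dir_deriv h (christoffel_form G x u v) x"
proof -
  \<comment> \<open>An explicit formula for the gradient; the definition by \<open>THE\<close> does
    not show smoothness.\<close>
  define gr where "gr y = matrix_inv (G y) *v (\<chi> i. dir_deriv h (axis i 1) y)" for y
  have gr: "ip y (gr y) v = dir_deriv h v y" if y: "y \<in> S" for y v
  proof -
    have "ip y (gr y) v = v \<bullet> (\<chi> i. dir_deriv h (axis i 1) y)"
      using ip_sym[OF y, of "gr y" v] matrix_inv_inverse[OF invertible_G[OF y]]
      by (simp add: metric_inner_def gr_def matrix_vector_mul_assoc)
    also have "\<dots> = dir_deriv h (\<Sum>i\<in>UNIV. v $ i *\<^sub>R axis i 1) y"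
    proof -
      interpret linear "\<lambda>v. dir_deriv h v y" by (rule linear_dir_deriv[OF h y])
      show ?thesis by (simp add: sum scale inner_vec_def)
    qed
    also have "(\<Sum>i\<in>UNIV. v $ i *\<^sub>R axis i 1) = v"
      by (metis (no_types) basis_expansion scalar_mult_eq_scaleR sum.cong)
    finally show ?thesis .
  qed
  have grad: "gradient G h y = gr y" if y: "y \<in> S" for y
    unfolding gradient_def dir_deriv_def[symmetric]
    by (rule the_equality) (use gr[OF y] ip_eqI[OF y] in auto)
  have smgr: "smooth_on S gr"
    unfolding gr_def
    by (rule smooth_on_vec[OF open_S])
       (simp add: matrix_vector_mult_def, intro smooth_on_sum[OF open_S] smooth_on_mult[OF open_S] smooth_matrix_inv smooth_on_dir_deriv h)
  have ddgr: "dir_deriv (gradient G h) u x = dir_deriv gr u x"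
    by (rule dir_deriv_cong[OF open_S x _ smgr]) (rule grad[symmetric])
  obtain T where T: "open T" "(0::real) \<in> T" "\<And>t. t \<in> T \<Longrightarrow> x + t *\<^sub>R u \<in> S"
    using line_in_open[OF open_S x] by blast
  have g: "((\<lambda>t. gr (x + t *\<^sub>R u)) has_vector_derivative dir_deriv gr u x) (at 0)"
    by (rule dir_deriv_line[OF smgr x])
  have d1: "((\<lambda>t. ip (x + t *\<^sub>R u) (gr (x + t *\<^sub>R u)) v) has_vector_derivative 
      (metric_deriv G x u (gr x) v + ip x (dir_deriv gr u x) v)) (at 0)"
    using ip_curve[OF line_derivative g has_vector_derivative_const, of x u v] x by (simp add: ip_simps)
  have d2: "((\<lambda>t. dir_deriv h v (x + t *\<^sub>R u)) has_vector_derivative dir_deriv (dir_deriv h v) u x) (at 0)"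
    by (rule dir_deriv_line[OF smooth_on_dir_deriv[OF h] x])
  have "((\<lambda>t. dir_deriv h v (x + t *\<^sub>R u)) has_vector_derivative (metric_deriv G x u (gr x) v + ip x (dir_deriv gr u x) v)) (at 0)"
    by (rule has_vector_derivative_transform_within_open[OF d1 T(1,2)]) (rule gr[OF T(3)])
  from vector_derivative_unique_at[OF d2 this]
  have "dir_deriv (dir_deriv h v) u x = metric_deriv G x u (gr x) v + ip x (dir_deriv gr u x) v" .
  then show ?thesis
    using gr[OF x, of "christoffel_form G x u v"]
    by (simp add: hessian_def cov_deriv_christoffel_form ddgr grad[OF x] christoffel_form_compat[OF x] ip_simps)
qed

end

section \<open>Christoffel symbols under a change of coordinates\<close>

lemma dir_deriv_inj_of_isometry:
  fixes G G' :: "real^'n \<Rightarrow> real^'n^'n::finite"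
  assumes "local_metric S G" "x \<in> S" "smooth_on S0 \<tau>" "x \<in> S0"
    "\<And>u v. metric_inner G x u v = metric_inner G' (\<tau> x) (dir_deriv \<tau> u x) (dir_deriv \<tau> v x)"
  shows "inj (\<lambda>v. dir_deriv \<tau> v x)" "surj (\<lambda>v. dir_deriv \<tau> v x)"
proof -
  interpret local_metric S G by fact
  have l: "linear (\<lambda>v. dir_deriv \<tau> v x)" by (rule linear_dir_deriv[OF assms(3,4)])
  have "v = 0" if "dir_deriv \<tau> v x = 0" for v
    using assms(5)[of v v] that ip_eq_0[OF assms(2), of v] by (simp add: ip_simps)
  then show "inj (\<lambda>v. dir_deriv \<tau> v x)" using linear_injective_0[OF l] by blast
  then show "surj (\<lambda>v. dir_deriv \<tau> v x)" using linear_injective_imp_surjective[OF l] by auto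
qed

text \<open>The inhomogeneous transformation law of the Christoffel symbols. The isometry identity
  is differentiated and put into the Koszul formula; of the second derivatives of \<tau> only one
  kind survives, the others cancel by symmetry.\<close>

lemma christoffel_form_transform:
  fixes G G' :: "real^'n \<Rightarrow> real^'n^'n::finite"
  assumes L: "local_metric S G" and L': "local_metric S' G'"
    and S0: "open S0" "S0 \<subseteq> S" "\<And>y. y \<in> S0 \<Longrightarrow> \<tau> y \<in> S'" and sm: "smooth_on S0 \<tau>"
    and iso: "\<And>y u v. y \<in> S0 \<Longrightarrow> metric_inner G y u v = metric_inner G' (\<tau> y) (dir_deriv \<tau> u y) (dir_deriv \<tau> v y)"
    and x: "x \<in> S0"
  shows "dir_deriv \<tau> (christoffel_form G x u v) x = christoffel_form G' (\<tau> x) (dir_deriv \<tau> u x) (dir_deriv \<tau> v x) + dir_deriv (dir_deriv \<tau> u) v x"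
proof -
  interpret M: local_metric S G by fact
  interpret M': local_metric S' G' by fact
  let ?d = "\<lambda>v. dir_deriv \<tau> v x"
  have xS: "x \<in> S" and tx: "\<tau> x \<in> S'" using x S0 by auto
  have D: "metric_deriv G x h u v = metric_deriv G' (\<tau> x) (?d h) (?d u) (?d v) + M'.ip (\<tau> x) (dir_deriv (dir_deriv \<tau> u) h x) (?d v)
     + M'.ip (\<tau> x) (?d u) (dir_deriv (dir_deriv \<tau> v) h x)" for h u v
  proof -
    obtain T where T: "open T" "(0::real) \<in> T" "\<And>t. t \<in> T \<Longrightarrow> x + t *\<^sub>R h \<in> S0"
      using M.line_in_open[OF S0(1) x] by blast
    have c: "((\<lambda>t. \<tau> (x + t *\<^sub>R h)) has_vector_derivative ?d h) (at 0)"
      by (rule dir_deriv_line[OF sm x])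
    have c2: "((\<lambda>t. dir_deriv \<tau> u (x + t *\<^sub>R h)) has_vector_derivative dir_deriv (dir_deriv \<tau> u) h x) (at 0)" for u
      by (rule dir_deriv_line[OF smooth_on_dir_deriv[OF sm] x])
    have d1: "((\<lambda>t. M'.ip (\<tau> (x + t *\<^sub>R h)) (dir_deriv \<tau> u (x + t *\<^sub>R h)) (dir_deriv \<tau> v (x + t *\<^sub>R h))) has_vector_derivative
       (metric_deriv G' (\<tau> x) (?d h) (?d u) (?d v) + M'.ip (\<tau> x) (dir_deriv (dir_deriv \<tau> u) h x) (?d v)
     + M'.ip (\<tau> x) (?d u) (dir_deriv (dir_deriv \<tau> v) h x))) (at 0)"
      using M'.ip_curve[OF c c2 c2, of u v] tx by simp
    have "((\<lambda>t. M.ip (x + t *\<^sub>R h) u v) has_vector_derivative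
       (metric_deriv G' (\<tau> x) (?d h) (?d u) (?d v) + M'.ip (\<tau> x) (dir_deriv (dir_deriv \<tau> u) h x) (?d v)
     + M'.ip (\<tau> x) (?d u) (dir_deriv (dir_deriv \<tau> v) h x))) (at 0)"
      by (rule has_vector_derivative_transform_within_open[OF d1 T(1,2)]) (simp add: iso[OF T(3)])
    moreover have "((\<lambda>t. M.ip (x + t *\<^sub>R h) u v) has_vector_derivative metric_deriv G x h u v) (at 0)"
      using M.ip_curve[OF line_derivative has_vector_derivative_const has_vector_derivative_const, of x h u v] xS
      by (simp add: ip_simps)
    ultimately show ?thesis using vector_derivative_unique_at by blast
  qed
  have sy: "dir_deriv (dir_deriv \<tau> a) b x = dir_deriv (dir_deriv \<tau> b) a x" for a b by (rule dir_deriv_dir_deriv_commute[OF S0(1) sm x])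
  have lin: "linear (\<lambda>v. dir_deriv \<tau> v x)" by (rule linear_dir_deriv[OF sm x])
  have "M'.ip (\<tau> x) (?d w) (?d (christoffel_form G x u v)) = M'.ip (\<tau> x) (?d w) (christoffel_form G' (\<tau> x) (?d u) (?d v) + dir_deriv (dir_deriv \<tau> u) v x)" for w
  proof -
    have "2 * M'.ip (\<tau> x) (?d w) (?d (christoffel_form G x u v)) = 2 * M.ip x w (christoffel_form G x u v)" by (simp add: iso[OF x])
    also have "\<dots> = 2 * M'.ip (\<tau> x) (?d w) (christoffel_form G' (\<tau> x) (?d u) (?d v)) + 2 * M'.ip (\<tau> x) (?d w) (dir_deriv (dir_deriv \<tau> u) v x)"
      unfolding M.ip_christoffel_form_koszul[OF xS] D M'.ip_christoffel_form_koszul[OF tx]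
      using sy[of u v] sy[of w u] sy[of w v] M'.ip_sym[OF tx, of "?d w" "dir_deriv (dir_deriv \<tau> u) v x"]
        M'.ip_sym[OF tx, of "dir_deriv (dir_deriv \<tau> u) w x" "?d v"] M'.ip_sym[OF tx, of "dir_deriv (dir_deriv \<tau> v) u x" "?d w"]
      by simp
    finally show ?thesis by (simp add: ip_simps)
  qed
  note 1 = this
  \<comment> \<open>The identity has been tested only against vectors in the image of the
    differential; surjectivity makes these all vectors.\<close>
  have sj: "surj ?d"
    by (rule dir_deriv_inj_of_isometry(2)[OF L xS sm x]) (rule iso[OF x])
  show ?thesis
  proof (rule M'.ip_eqI[OF tx])
    fix w
    obtain w' where w': "w = ?d w'" using sj by (rule surjE)
    show "M'.ip (\<tau> x) (?d (christoffel_form G x u v)) w = M'.ip (\<tau> x) (christoffel_form G' (\<tau> x) (?d u) (?d v) + dir_deriv (dir_deriv \<tau> u) v x) w"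
      unfolding w' M'.ip_sym[OF tx, of _ "?d w'"] by (rule 1)
  qed
qed

section \<open>Short geodesics and parallel transport\<close>

text \<open>Banach's fixed point theorem with the factor fixed at \<open>1/2\<close>, in the form
  shared by the geodesic equation and parallel transport.\<close>

lemma contraction_on_unit_interval:
  fixes F :: "(real \<Rightarrow> 'b::euclidean_space) \<Rightarrow> real \<Rightarrow> 'b"
  assumes M: "0 \<le> M"
    and inv: "\<And>w. continuous_on {0..1} w \<Longrightarrow> (\<And>t. t \<in> {0..1} \<Longrightarrow> norm (w t) \<le> M) \<Longrightarrow>
      continuous_on {0..1} (F w) \<and> (\<forall>t\<in>{0..1}. norm (F w t) \<le> M)"
    and con: "\<And>w z d. continuous_on {0..1} w \<Longrightarrow> (\<And>t. t \<in> {0..1} \<Longrightarrow> norm (w t) \<le> M) \<Longrightarrow>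
      continuous_on {0..1} z \<Longrightarrow> (\<And>t. t \<in> {0..1} \<Longrightarrow> norm (z t) \<le> M) \<Longrightarrow>
      (\<And>t. t \<in> {0..1} \<Longrightarrow> norm (w t - z t) \<le> d) \<Longrightarrow> \<forall>t\<in>{0..1}. norm (F w t - F z t) \<le> d / 2"
  obtains w where "continuous_on {0..1} w" "\<And>t. t \<in> {0..1} \<Longrightarrow> norm (w t) \<le> M" "\<And>t. t \<in> {0..1} \<Longrightarrow> F w t = w t"
proof -
  \<comment> \<open>Elements of \<open>bcontfun\<close> live on the whole line; \<open>c\<close>
    clamps the argument to the unit interval.\<close>
  define c :: "real \<Rightarrow> real" where "c t = max 0 (min 1 t)" for t
  have c: "c t \<in> {0..1}" "t \<in> {0..1} \<Longrightarrow> c t = t" for t by (auto simp: c_def)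
  have cc: "continuous_on UNIV c" unfolding c_def by (intro continuous_intros)
  define S :: "(real \<Rightarrow>\<^sub>C 'b) set" where "S = PiC UNIV (\<lambda>_. cball 0 M)"
  have S: "b \<in> S \<longleftrightarrow> (\<forall>t. norm (apply_bcontfun b t) \<le> M)" for b
    by (auto simp: S_def mem_PiC_iff)
  define T where "T b = Bcontfun (\<lambda>t. F (apply_bcontfun b) (c t))" for b
  have T: "apply_bcontfun (T b) t = F (apply_bcontfun b) (c t)" if "b \<in> S" for b t
  proof -
    have F: "continuous_on {0..1} (F b) \<and> (\<forall>t\<in>{0..1}. norm (F b t) \<le> M)"
      using that by (intro inv) (auto simp: S)
    have "(\<lambda>t. F b (c t)) \<in> bcontfun"
    proof (rule bcontfun_normI)
      show "continuous_on UNIV (\<lambda>t. F b (c t))"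
        using c(1) by (intro continuous_on_compose2[OF conjunct1[OF F] cc]) auto
    qed (use F c(1) in blast)
    then show ?thesis unfolding T_def by (simp add: Bcontfun_inverse)
  qed
  have "\<exists>!b\<in>S. T b = b"
  proof (rule Banach_fix[of S "1/2"])
    show "complete S" unfolding S_def complete_eq_closed by (rule closed_PiC) auto
    have "const_bcontfun 0 \<in> S" using M by (simp add: S const_bcontfun.rep_eq)
    then show "S \<noteq> {}" by blast
    show "T ` S \<subseteq> S"
    proof
      fix y assume "y \<in> T ` S"
      then obtain b where b: "b \<in> S" "y = T b" by blast
      have "\<forall>t\<in>{0..1}. norm (F b t) \<le> M"
        using inv[of b] b(1) by (auto simp: S)
      then show "y \<in> S" using c(1) by (simp add: b S T[OF b(1)])
    qed
    fix x y assume xy: "x \<in> S" "y \<in> S"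
    have "\<forall>t\<in>{0..1}. norm (F x t - F y t) \<le> dist x y / 2"
      using xy dist_bounded[of x _ y] by (intro con) (auto simp: S dist_norm)
    then show "dist (T x) (T y) \<le> 1/2 * dist x y"
      using c(1) by (intro dist_bound) (simp add: T xy dist_norm)
  qed auto
  then obtain b where b: "b \<in> S" "T b = b" by blast
  show thesis
  proof (rule that[of b])
    fix t :: real assume "t \<in> {0..1}"
    then show "F b t = b t" using T[OF b(1), of t] c(2) b(2) by simp
  qed (use b S in auto)
qed

section \<open>Bounds on compact sets, short geodesics and parallel transport\<close>

lemma compact_continuous_bound:
  assumes "compact K" "continuous_on K (f :: _ \<Rightarrow> 'b::real_normed_vector)"
  obtains C where "C \<ge> 0" "\<And>x. x \<in> K \<Longrightarrow> norm (f x) \<le> C"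
proof -
  have "bounded (f ` K)" using compact_continuous_image[OF assms(2,1)] compact_imp_bounded by blast
  then obtain C where "C > 0" "\<forall>x\<in>f ` K. norm x \<le> C" using bounded_pos by blast
  then show thesis using that[of C] by auto
qed

text \<open>On a convex set a bound on the derivative is a Lipschitz bound; the derivative is
  bounded through its finitely many basis directions.\<close>

lemma smooth_lipschitz:
  fixes F :: "'b::euclidean_space \<Rightarrow> 'c::real_normed_vector"
  assumes "smooth_on S F" "compact K" "convex K" "K \<subseteq> S"
  obtains C where "C \<ge> 0" "\<And>x y. x \<in> K \<Longrightarrow> y \<in> K \<Longrightarrow> norm (F x - F y) \<le> C * norm (x - y)"
proof -
  have "\<exists>C\<ge>0. \<forall>x\<in>K. norm (dir_deriv F e x) \<le> C" for e
    using compact_continuous_bound[OF assms(2) continuous_on_subset[OF smooth_on_imp_continuous_on[OF smooth_on_dir_deriv[OF assms(1)]] assms(4)], of e]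
    by metis
  then obtain C where C: "\<And>e. C e \<ge> 0" "\<And>e x. x \<in> K \<Longrightarrow> norm (dir_deriv F e x) \<le> C e" by metis
  have "norm (F x - F y) \<le> (\<Sum>e\<in>Basis. C e) * norm (x - y)" if "x \<in> K" "y \<in> K" for x y
  proof (rule differentiable_bound[OF assms(3) _ _ that, of _ "\<lambda>x h. dir_deriv F h x"])
    fix x assume x: "x \<in> K"
    show "(F has_derivative (\<lambda>h. dir_deriv F h x)) (at x within K)"
      using smooth_on_has_derivative[OF assms(1)] x assms(4) by (blast intro: has_derivative_at_withinI)
    show "onorm (\<lambda>h. dir_deriv F h x) \<le> (\<Sum>e\<in>Basis. C e)"
    proof (rule onorm_le)
      fix h
      have "norm (dir_deriv F h x) \<le> (\<Sum>e\<in>Basis. norm ((h \<bullet> e) *\<^sub>R dir_deriv F e x))"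
        using dir_deriv_Basis[OF assms(1), of x h] x assms(4) norm_sum by (metis subsetD)
      also have "\<dots> \<le> (\<Sum>e\<in>Basis. norm h * C e)"
        using C x by (intro sum_mono) (auto intro!: mult_mono Basis_le_norm)
      finally show "norm (dir_deriv F h x) \<le> (\<Sum>e\<in>Basis. C e) * norm h"
        by (simp add: sum_distrib_left mult.commute)
    qed
  qed
  with C(1) show thesis using that[of "\<Sum>e\<in>Basis. C e"] by (auto intro: sum_nonneg)
qed

context local_metric
begin

text \<open>\<Gamma> is a finite combination of the \<open>christoffel_vec\<close>, each bounded and
  Lipschitz on \<open>K\<close>; one constant serves both estimates.\<close>

lemma christoffel_form_bounds:
  assumes "compact K" "convex K" "K \<subseteq> S"
  obtains C where "C \<ge> 0" "\<And>x u v. x \<in> K \<Longrightarrow> norm (christoffel_form G x u v) \<le> C * norm u * norm v"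
    "\<And>x y u v. x \<in> K \<Longrightarrow> y \<in> K \<Longrightarrow> norm (christoffel_form G x u v - christoffel_form G y u v) \<le> C * norm (x - y) * norm u * norm v"
proof -
  have "\<exists>C\<ge>0. \<forall>x\<in>K. norm (christoffel_vec G i j x) \<le> C" for i j
    using compact_continuous_bound[OF assms(1) continuous_on_subset[OF smooth_on_imp_continuous_on[OF smooth_christoffel_vec] assms(3)], of i j]
    by metis
  then obtain C where C: "\<And>i j. C i j \<ge> 0" "\<And>i j x. x \<in> K \<Longrightarrow> norm (christoffel_vec G i j x) \<le> C i j" by metis
  have "\<exists>C\<ge>0. \<forall>x\<in>K. \<forall>y\<in>K. norm (christoffel_vec G i j x - christoffel_vec G i j y) \<le> C * norm (x - y)" for i j
    using smooth_lipschitz[OF smooth_christoffel_vec assms, of i j] by metis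
  then obtain D where D: "\<And>i j. D i j \<ge> 0" 
    "\<And>i j x y. x \<in> K \<Longrightarrow> y \<in> K \<Longrightarrow> norm (christoffel_vec G i j x - christoffel_vec G i j y) \<le> D i j * norm (x - y)" by metis
  have *: "norm (\<Sum>i\<in>UNIV. \<Sum>j\<in>UNIV. (u $ i * v $ j) *\<^sub>R X i j) \<le> (\<Sum>i\<in>UNIV. \<Sum>j\<in>UNIV. E i j) * r * norm u * norm v"
    if "\<And>i j. norm (X i j) \<le> E i j * r" for X :: "'n \<Rightarrow> 'n \<Rightarrow> real^'n" and E r and u v :: "real^'n"
  proof -
    have "norm (\<Sum>i\<in>UNIV. \<Sum>j\<in>UNIV. (u $ i * v $ j) *\<^sub>R X i j) \<le> (\<Sum>i\<in>UNIV. \<Sum>j\<in>UNIV. norm ((u $ i * v $ j) *\<^sub>R X i j))"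
      by (rule order_trans[OF norm_sum sum_mono[OF norm_sum]])
    also have "\<dots> \<le> (\<Sum>i\<in>UNIV. \<Sum>j\<in>UNIV. (norm u * norm v) * (E i j * r))"
      using that unfolding norm_scaleR
      by (intro sum_mono mult_mono) (auto simp: abs_mult intro!: mult_mono component_le_norm_cart)
    also have "\<dots> = (\<Sum>i\<in>UNIV. \<Sum>j\<in>UNIV. E i j) * r * norm u * norm v"
      by (simp add: sum_distrib_left sum_distrib_right mult_ac)
    finally show ?thesis .
  qed
  define B where "B = (\<Sum>i\<in>UNIV. \<Sum>j\<in>UNIV. C i j + D i j)"
  show thesis
  proof (rule that[of B])
    show "B \<ge> 0" using C(1) D(1) by (auto simp: B_def intro!: sum_nonneg add_nonneg_nonneg)
    show "norm (christoffel_form G x u v) \<le> B * norm u * norm v" if "x \<in> K" for x u v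
      using *[of "\<lambda>i j. christoffel_vec G i j x" "\<lambda>i j. C i j + D i j" 1 u v] C(2)[OF that] D(1)
      by (simp add: christoffel_form_christoffel_vec B_def) (meson add_increasing2 order_trans)
    show "norm (christoffel_form G x u v - christoffel_form G y u v) \<le> B * norm (x - y) * norm u * norm v" if "x \<in> K" "y \<in> K" for x y u v
    proof -
      have "norm (christoffel_vec G i j x - christoffel_vec G i j y) \<le> (C i j + D i j) * norm (x - y)" for i j
        using D(2)[OF that, of i j] mult_nonneg_nonneg[OF C(1)[of i j] norm_ge_zero[of "x - y"]] by (simp add: distrib_right)
      from *[of "\<lambda>i j. christoffel_vec G i j x - christoffel_vec G i j y", OF this, of u v] show ?thesis
        by (simp add: christoffel_form_christoffel_vec B_def sum_subtractf[symmetric] scaleR_diff_right)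
    qed
  qed
qed

text \<open>The unknown is the velocity \<open>w\<close>, so that only continuous functions are
  involved; \<open>u\<close> is recovered by integration. Since \<Gamma> is quadratic in the
  velocity, a short distance makes the nonlinearity small on the ball of radius
  \<open>2 * norm (b - a)\<close>. The bound on \<open>w\<close> is later the smallness that makes
  the geodesic minimal.\<close>

lemma geodesic_bvp:
  assumes C: "C \<ge> 0" "\<And>x u v. x \<in> K \<Longrightarrow> norm (christoffel_form G x u v) \<le> C * norm u * norm v"
    "\<And>x y u v. x \<in> K \<Longrightarrow> y \<in> K \<Longrightarrow> norm (christoffel_form G x u v - christoffel_form G y u v) \<le> C * norm (x - y) * norm u * norm v"
    and K: "cball a (2 * norm (b - a)) \<subseteq> K" "K \<subseteq> S"
    and e: "16 * C * norm (b - a) * (1 + norm (b - a)) \<le> 1"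
  obtains u w where "u 0 = a" "u 1 = b" "\<And>t. t \<in> {0..1} \<Longrightarrow> u t \<in> cball a (2 * norm (b - a))"
    "\<And>t. t \<in> {0..1} \<Longrightarrow> (u has_vector_derivative w t) (at t within {0..1})"
    "\<And>t. t \<in> {0..1} \<Longrightarrow> (w has_vector_derivative - christoffel_form G (u t) (w t) (w t)) (at t within {0..1})"
    "\<And>t. t \<in> {0..1} \<Longrightarrow> norm (w t) \<le> 2 * norm (b - a)"
proof -
  define e where "e = norm (b - a)"
  have e0: "e \<ge> 0" by (simp add: e_def)
  have e1: "16 * (C * e) + 16 * (C * e * e) \<le> 1" using e by (simp add: e_def algebra_simps)
  have Ce: "0 \<le> C * e" "0 \<le> C * e * e" using C(1) e0 by auto
  define U where "U w t = a + integral {0..t} w" for w :: "real \<Rightarrow> real^'n" and t :: real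
  define g where "g w t = christoffel_form G (U w t) (w t) (w t)" for w t
  define h where "h w t = integral {0..t} (g w)" for w t
  \<comment> \<open>The constant added last makes the integral of \<open>F w\<close> equal to
    \<open>b - a\<close>, so a fixed point reaches \<open>b\<close> at time 1; its derivative is the
    geodesic equation.\<close>
  define F where "F w t = (b - a) - h w t + integral {0..1} (h w)" for w t
  have ib: "norm (integral {0..t} f) \<le> B" if "continuous_on {0..1} f" "\<And>t. t \<in> {0..1} \<Longrightarrow> norm (f t) \<le> B" "t \<in> {0..1}"
    for f :: "real \<Rightarrow> real^'n" and B t
  proof -
    have B: "B \<ge> 0" by (rule order_trans[OF norm_ge_zero that(2)[of 0]]) simp
    have "norm (integral {0..t} f) \<le> B * (t - 0)"
      using that by (intro integral_bound continuous_on_subset[OF that(1)]) auto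
    also have "\<dots> \<le> B" using that(3) B by (simp add: mult_left_le)
    finally show ?thesis .
  qed
  have ci: "continuous_on {0..1} (\<lambda>t. integral {0..t} f)" if "continuous_on {0..1} f" for f :: "real \<Rightarrow> real^'n"
    by (rule indefinite_integral_continuous_1[OF integrable_continuous_real[OF that]])
  have U: "continuous_on {0..1} (U w)" "\<And>t. t \<in> {0..1} \<Longrightarrow> U w t \<in> cball a (2 * e)" "U w ` {0..1} \<subseteq> S" "U w ` {0..1} \<subseteq> K"
    if "continuous_on {0..1} w" "\<And>t. t \<in> {0..1} \<Longrightarrow> norm (w t) \<le> 2 * e" for w
  proof -
    show "continuous_on {0..1} (U w)" unfolding U_def by (intro continuous_intros ci that)
    show 1: "U w t \<in> cball a (2 * e)" if "t \<in> {0..1}" for t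
      using ib[OF \<open>continuous_on {0..1} w\<close>, of "2*e" t] that \<open>\<And>t. t \<in> {0..1} \<Longrightarrow> norm (w t) \<le> 2 * e\<close> by (simp add: U_def dist_norm)
    show "U w ` {0..1} \<subseteq> K" using 1 K(1) by (auto simp: e_def)
    then show "U w ` {0..1} \<subseteq> S" using K(2) by blast
  qed
  have gc: "continuous_on {0..1} (g w)" if "continuous_on {0..1} w" "\<And>t. t \<in> {0..1} \<Longrightarrow> norm (w t) \<le> 2 * e" for w
    unfolding g_def using U[OF that] that by (intro continuous_on_christoffel_form) auto
  have gb: "norm (g w t) \<le> 4 * (C * e * e)" if w: "continuous_on {0..1} w" "\<And>t. t \<in> {0..1} \<Longrightarrow> norm (w t) \<le> 2 * e" and t: "t \<in> {0..1}" for w t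
  proof -
    have "norm (g w t) \<le> C * norm (w t) * norm (w t)"
      unfolding g_def using U(4)[OF w] t by (intro C(2)) auto
    also have "\<dots> \<le> C * (2 * e) * (2 * e)"
      using w(2)[OF t] C(1) e0 by (intro mult_mono mult_left_mono) auto
    finally show ?thesis by (simp add: mult_ac)
  qed
  have hc: "continuous_on {0..1} (h w)" if "continuous_on {0..1} w" "\<And>t. t \<in> {0..1} \<Longrightarrow> norm (w t) \<le> 2 * e" for w
    unfolding h_def by (intro ci gc that)
  obtain w where w: "continuous_on {0..1} w" "\<And>t. t \<in> {0..1} \<Longrightarrow> norm (w t) \<le> 2 * e" "\<And>t. t \<in> {0..1} \<Longrightarrow> F w t = w t"
  proof (rule contraction_on_unit_interval[of "2 * e" F])
    show "0 \<le> 2 * e" using e0 by simp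
  next
    fix w :: "real \<Rightarrow> real^'n" assume w: "continuous_on {0..1} w" "\<And>t. t \<in> {0..1} \<Longrightarrow> norm (w t) \<le> 2 * e"
    have hb: "norm (h w t) \<le> 4 * (C * e * e)" if "t \<in> {0..1}" for t
      unfolding h_def by (rule ib[OF gc[OF w] gb[OF w] that])
    have "norm (F w t) \<le> 2 * e" if "t \<in> {0..1}" for t
    proof -
      have "norm (F w t) \<le> e + norm (h w t) + norm (integral {0..1} (h w))"
        unfolding F_def e_def by norm
      also have "\<dots> \<le> e + 4 * (C * e * e) + 4 * (C * e * e)"
        using hb[OF that] ib[OF hc[OF w] hb, of 1] by (intro add_mono) auto
      also have "\<dots> \<le> 2 * e"
        using mult_right_mono[OF e1 e0] Ce e0 mult_nonneg_nonneg[OF Ce(2) e0] by (simp add: algebra_simps)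
      finally show ?thesis .
    qed
    moreover have "continuous_on {0..1} (F w)"
      unfolding F_def by (intro continuous_intros hc w)
    ultimately show "continuous_on {0..1} (F w) \<and> (\<forall>t\<in>{0..1}. norm (F w t) \<le> 2 * e)" by blast
  next
    fix w z :: "real \<Rightarrow> real^'n" and d
    assume w: "continuous_on {0..1} w" "\<And>t. t \<in> {0..1} \<Longrightarrow> norm (w t) \<le> 2 * e"
      and z: "continuous_on {0..1} z" "\<And>t. t \<in> {0..1} \<Longrightarrow> norm (z t) \<le> 2 * e"
      and d: "\<And>t. t \<in> {0..1} \<Longrightarrow> norm (w t - z t) \<le> d"
    have d0: "d \<ge> 0" by (rule order_trans[OF norm_ge_zero d[of 0]]) simp
    have Ud: "norm (U w t - U z t) \<le> d" if "t \<in> {0..1}" for t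
    proof -
      have "U w t - U z t = integral {0..t} (\<lambda>t. w t - z t)"
        using that unfolding U_def
        by (subst Henstock_Kurzweil_Integration.integral_diff)
           (auto intro!: integrable_continuous_real continuous_on_subset[OF w(1)] continuous_on_subset[OF z(1)])
      then show ?thesis using ib[of "\<lambda>t. w t - z t" d t] d that w(1) z(1) by (auto intro: continuous_intros)
    qed
    \<comment> \<open>The term with \<open>e * e\<close> comes from moving the base point, the other
      one from the two velocity slots. In \<open>F\<close> both occur twice, through
      \<open>h\<close> and through its integral; hence the factor 16 in the hypothesis.\<close>
    define q where "q = (4 * (C * e * e) + 4 * (C * e)) * d"
    have gd: "norm (g w t - g z t) \<le> q" if t: "t \<in> {0..1}" for t
    proof -
      have UK: "U w t \<in> K" "U z t \<in> K" using U(4)[OF w] U(4)[OF z] t by auto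
      have "g w t - g z t = (christoffel_form G (U w t) (w t) (w t) - christoffel_form G (U z t) (w t) (w t))
         + christoffel_form G (U z t) (w t - z t) (w t) + christoffel_form G (U z t) (z t) (w t - z t)"
        by (simp add: g_def christoffel_form_simps)
      moreover have "norm (A + B + D) \<le> norm A + norm B + norm D" for A B D :: "real^'n" by norm
      ultimately have "norm (g w t - g z t) \<le> norm (christoffel_form G (U w t) (w t) (w t) - christoffel_form G (U z t) (w t) (w t))
         + norm (christoffel_form G (U z t) (w t - z t) (w t)) + norm (christoffel_form G (U z t) (z t) (w t - z t))"
        by (simp only:)
      also have "\<dots> \<le> C * norm (U w t - U z t) * norm (w t) * norm (w t) + C * norm (w t - z t) * norm (w t) + C * norm (z t) * norm (w t - z t)"
        by (intro add_mono C UK)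
      also have "\<dots> \<le> C * d * (2 * e) * (2 * e) + C * d * (2 * e) + C * (2 * e) * d"
        using w(2)[OF t] z(2)[OF t] d[OF t] Ud[OF t] C(1) e0 d0
        by (intro add_mono mult_mono mult_left_mono mult_nonneg_nonneg) auto
      finally show ?thesis by (simp add: q_def algebra_simps)
    qed
    have hd: "norm (h w t - h z t) \<le> q" if "t \<in> {0..1}" for t
    proof -
      have "h w t - h z t = integral {0..t} (\<lambda>t. g w t - g z t)"
        using that unfolding h_def
        by (subst Henstock_Kurzweil_Integration.integral_diff)
           (auto intro!: integrable_continuous_real continuous_on_subset[OF gc[OF w]] continuous_on_subset[OF gc[OF z]])
      then show ?thesis using ib[of "\<lambda>t. g w t - g z t" q t] gd that gc[OF w] gc[OF z] by (auto intro: continuous_intros)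
    qed
    have Hd: "norm (integral {0..1} (h w) - integral {0..1} (h z)) \<le> q"
    proof -
      have "integral {0..1} (h w) - integral {0..1} (h z) = integral {0..1} (\<lambda>t. h w t - h z t)"
        by (subst Henstock_Kurzweil_Integration.integral_diff)
           (auto intro!: integrable_continuous_real hc w z)
      then show ?thesis using ib[of "\<lambda>t. h w t - h z t" q 1] hd hc[OF w] hc[OF z] by (auto intro: continuous_intros)
    qed
    show "\<forall>t\<in>{0..1}. norm (F w t - F z t) \<le> d / 2"
    proof
      fix t :: real assume t: "t \<in> {0..1}"
      have "norm (F w t - F z t) \<le> norm (h w t - h z t) + norm (integral {0..1} (h w) - integral {0..1} (h z))"
        unfolding F_def by norm
      also have "\<dots> \<le> q + q" using hd[OF t] Hd by linarith
      also have "\<dots> \<le> d / 2"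
        using mult_right_mono[OF e1 d0] by (simp add: q_def algebra_simps)
      finally show "norm (F w t - F z t) \<le> d / 2" .
    qed
  qed blast
  have dw: "(w has_vector_derivative - g w t) (at t within {0..1})" if t: "t \<in> {0..1}" for t
  proof -
    have "(F w has_vector_derivative - g w t) (at t within {0..1})"
      unfolding F_def h_def
      by (rule has_vector_derivative_eq_rhs)
         (rule has_vector_derivative_add has_vector_derivative_diff has_vector_derivative_const
           integral_has_vector_derivative[OF gc[OF w(1,2)] t] | simp)+
    then show ?thesis by (rule has_vector_derivative_transform[OF t, rotated]) (use w(3) in auto)
  qed
  have du: "(U w has_vector_derivative w t) (at t within {0..1})" if t: "t \<in> {0..1}" for t
    unfolding U_def
    by (rule has_vector_derivative_eq_rhs)
       (rule has_vector_derivative_add has_vector_derivative_const integral_has_vector_derivative[OF w(1) t] | simp)+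
  show thesis
  proof (rule that[of "U w" w])
    show "U w 0 = a" by (simp add: U_def)
    have "integral {0..1} w = integral {0..1} (\<lambda>t. (b - a) - h w t + integral {0..1} (h w))"
      by (rule integral_cong) (use w(3) in \<open>auto simp: F_def\<close>)
    also have "\<dots> = b - a"
      using hc[OF w(1,2)]
      by (subst Henstock_Kurzweil_Integration.integral_add Henstock_Kurzweil_Integration.integral_diff,
          (auto intro!: integrable_continuous_real continuous_intros)[2])+ simp
    finally show "U w 1 = b" by (simp add: U_def)
  qed (use U[OF w(1,2)] dw du w(2) in \<open>auto simp: e_def g_def\<close>)
qed

text \<open>The equation is linear, so hypothesis \<open>b\<close> makes the integral operator
  contract on the whole interval at once, without subdivision; it maps the ball of radius
  \<open>2 * norm W0\<close> to itself.\<close>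

lemma parallel_transport_exists:
  assumes u: "continuous_on {0..1} u" "u ` {0..1} \<subseteq> S" and w: "continuous_on {0..1} w"
    and b: "\<And>t v. t \<in> {0..1} \<Longrightarrow> norm (christoffel_form G (u t) (w t) v) \<le> norm v / 2"
  obtains W where "W 0 = W0" "\<And>t. t \<in> {0..1} \<Longrightarrow> (W has_vector_derivative - christoffel_form G (u t) (w t) (W t)) (at t within {0..1})"
proof -
  define F where "F W t = W0 - integral {0..t} (\<lambda>t. christoffel_form G (u t) (w t) (W t))" for W t
  have gc: "continuous_on {0..1} (\<lambda>t. christoffel_form G (u t) (w t) (W t))" if "continuous_on {0..1} W" for W
    by (rule continuous_on_christoffel_form[OF u(1) w that u(2)])
  have ib: "norm (integral {0..t} f) \<le> B" if "continuous_on {0..1} f" "\<And>t. t \<in> {0..1} \<Longrightarrow> norm (f t) \<le> B" "t \<in> {0..1}"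
    for f :: "real \<Rightarrow> real^'n" and B t
  proof -
    have B: "B \<ge> 0" by (rule order_trans[OF norm_ge_zero that(2)[of 0]]) simp
    have "norm (integral {0..t} f) \<le> B * (t - 0)"
      using that by (intro integral_bound continuous_on_subset[OF that(1)]) auto
    also have "\<dots> \<le> B" using that(3) B by (simp add: mult_left_le)
    finally show ?thesis .
  qed
  obtain W where W: "continuous_on {0..1} W" "\<And>t. t \<in> {0..1} \<Longrightarrow> F W t = W t"
  proof (rule contraction_on_unit_interval[of "2 * norm W0" F])
    fix W :: "real \<Rightarrow> real^'n" assume W: "continuous_on {0..1} W" "\<And>t. t \<in> {0..1} \<Longrightarrow> norm (W t) \<le> 2 * norm W0"
    have "norm (F W t) \<le> 2 * norm W0" if "t \<in> {0..1}" for t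
    proof -
      have "norm (integral {0..t} (\<lambda>t. christoffel_form G (u t) (w t) (W t))) \<le> norm W0"
        using W(2) b by (intro ib[OF gc[OF W(1)] _ that]) (smt (verit) field_sum_of_halves)
      then show ?thesis unfolding F_def by norm
    qed
    moreover have "continuous_on {0..1} (F W)"
      unfolding F_def
      by (intro continuous_intros indefinite_integral_continuous_1[OF integrable_continuous_real] gc W)
    ultimately show "continuous_on {0..1} (F W) \<and> (\<forall>t\<in>{0..1}. norm (F W t) \<le> 2 * norm W0)" by blast
  next
    fix W Z :: "real \<Rightarrow> real^'n" and d
    assume W: "continuous_on {0..1} W" and Z: "continuous_on {0..1} Z"
      and d: "\<And>t. t \<in> {0..1} \<Longrightarrow> norm (W t - Z t) \<le> d"
    show "\<forall>t\<in>{0..1}. norm (F W t - F Z t) \<le> d / 2"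
    proof
      fix t :: real assume t: "t \<in> {0..1}"
      have "F Z t - F W t = integral {0..t} (\<lambda>t. christoffel_form G (u t) (w t) (W t) - christoffel_form G (u t) (w t) (Z t))"
        using t unfolding F_def
        by (subst Henstock_Kurzweil_Integration.integral_diff)
           (auto intro!: integrable_continuous_real continuous_on_subset[OF gc[OF W]] continuous_on_subset[OF gc[OF Z]])
      moreover have "norm (christoffel_form G (u t) (w t) (W t) - christoffel_form G (u t) (w t) (Z t)) \<le> d / 2" if "t \<in> {0..1}" for t
        using b[OF that, of "W t - Z t"] d[OF that] by (simp add: christoffel_form_simps)
      moreover have "continuous_on {0..1} (\<lambda>t. christoffel_form G (u t) (w t) (W t) - christoffel_form G (u t) (w t) (Z t))"
        by (intro continuous_intros gc W Z)
      ultimately have "norm (F Z t - F W t) \<le> d / 2"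
        using t by (simp only:) (rule ib)
      then show "norm (F W t - F Z t) \<le> d / 2" by (simp add: norm_minus_commute)
    qed
  qed auto
  show thesis
  proof (rule that[of W])
    show "W 0 = W0" using W(2)[of 0] by (simp add: F_def)
    fix t :: real assume t: "t \<in> {0..1}"
    have "(F W has_vector_derivative - christoffel_form G (u t) (w t) (W t)) (at t within {0..1})"
      unfolding F_def
      by (rule has_vector_derivative_eq_rhs)
         (rule has_vector_derivative_diff has_vector_derivative_const
           integral_has_vector_derivative[OF gc[OF W(1)] t] | simp)+
    then show "(W has_vector_derivative - christoffel_form G (u t) (w t) (W t)) (at t within {0..1})"
      by (rule has_vector_derivative_transform[OF t, rotated]) (use W(2) in auto)
  qed
qed

lemma ip_upper_bound:
  assumes "compact K" "K \<subseteq> S"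
  obtains C where "C > 0" "\<And>x v. x \<in> K \<Longrightarrow> ip x v v \<le> C * (norm v)\<^sup>2"
proof -
  obtain B where B: "B > 0" "\<And>(M::real^'n^'n) (v::real^'n). norm (M *v v) \<le> norm M * norm v * B"
    using bounded_bilinear.pos_bounded[OF bounded_bilinear_matrix_vector] by blast
  obtain D where D: "D \<ge> 0" "\<And>x. x \<in> K \<Longrightarrow> norm (G x) \<le> D"
    using compact_continuous_bound[OF assms(1) continuous_on_subset[OF smooth_on_imp_continuous_on[OF smooth_G] assms(2)]] by metis
  show thesis
  proof (rule that[of "D * B + 1"])
    fix x v assume x: "x \<in> K"
    have "ip x v v \<le> norm v * norm (G x *v v)" unfolding metric_inner_def by (rule norm_cauchy_schwarz)
    also have "\<dots> \<le> norm v * (D * norm v * B)"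
      using D(2)[OF x] B(1)
      by (intro mult_left_mono order_trans[OF B(2)] mult_right_mono) auto
    also have "\<dots> \<le> (D * B + 1) * (norm v)\<^sup>2" by (simp add: power2_eq_square algebra_simps)
    finally show "ip x v v \<le> (D * B + 1) * (norm v)\<^sup>2" .
  qed (use B D in \<open>auto intro: add_nonneg_pos\<close>)
qed

text \<open>The minimum over the product of \<open>K\<close> with the unit sphere, extended by
  homogeneity.\<close>

lemma ip_lower_bound:
  assumes "compact K" "K \<subseteq> S"
  obtains c where "c > 0" "\<And>x v. x \<in> K \<Longrightarrow> c * (norm v)\<^sup>2 \<le> ip x v v"
proof (cases "K = {}")
  case False
  let ?T = "K \<times> sphere (0::real^'n) 1"
  have c: "continuous_on ?T (\<lambda>z. ip (fst z) (snd z) (snd z))"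
    using assms(2) by (intro continuous_on_ip continuous_intros) auto
  have ne: "?T \<noteq> {}" using False by auto
  obtain z where z: "z \<in> ?T" "\<And>y. y \<in> ?T \<Longrightarrow> ip (fst z) (snd z) (snd z) \<le> ip (fst y) (snd y) (snd y)"
    using continuous_attains_inf[OF compact_Times[OF assms(1) compact_sphere] ne c] by blast
  show thesis
  proof (rule that[of "ip (fst z) (snd z) (snd z)"])
    show "0 < ip (fst z) (snd z) (snd z)" using z(1) assms(2) by (intro pos_G) auto
    fix x v assume x: "x \<in> K"
    show "ip (fst z) (snd z) (snd z) * (norm v)\<^sup>2 \<le> ip x v v"
    proof (cases "v = 0")
      case False
      have "ip (fst z) (snd z) (snd z) \<le> ip x ((1 / norm v) *\<^sub>R v) ((1 / norm v) *\<^sub>R v)"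
        using z(2)[of "(x, (1 / norm v) *\<^sub>R v)"] x False by auto
      then show ?thesis using False by (simp add: ip_simps field_simps power2_eq_square)
    qed (simp add: ip_simps)
  qed
qed (use that[of 1] in auto)

text \<open>In \<open>geodesic_minimal\<close> the first bound controls the mixed term of the
  energy, the second the Taylor remainder of the metric.\<close>

lemma metric_lipschitz:
  assumes "compact K" "convex K" "K \<subseteq> S"
  obtains C where "C \<ge> 0" "\<And>x y u v. x \<in> K \<Longrightarrow> y \<in> K \<Longrightarrow> \<bar>ip x u v - ip y u v\<bar> \<le> C * norm (x - y) * norm u * norm v"
    "\<And>x y h u v. x \<in> K \<Longrightarrow> y \<in> K \<Longrightarrow> \<bar>metric_deriv G x h u v - metric_deriv G y h u v\<bar> \<le> C * norm (x - y) * norm h * norm u * norm v"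
proof -
  obtain B where B: "B > 0" "\<And>(M::real^'n^'n) (v::real^'n). norm (M *v v) \<le> norm M * norm v * B"
    using bounded_bilinear.pos_bounded[OF bounded_bilinear_matrix_vector] by blast
  have form: "\<bar>u \<bullet> (M *v v)\<bar> \<le> B * norm M * norm u * norm v" for M :: "real^'n^'n" and u v
  proof -
    have "\<bar>u \<bullet> (M *v v)\<bar> \<le> norm u * norm (M *v v)" by (rule Cauchy_Schwarz_ineq2)
    also have "\<dots> \<le> norm u * (norm M * norm v * B)" by (intro mult_left_mono B) auto
    finally show ?thesis by (simp add: mult_ac)
  qed
  obtain C1 where C1: "C1 \<ge> 0" "\<And>x y. x \<in> K \<Longrightarrow> y \<in> K \<Longrightarrow> norm (G x - G y) \<le> C1 * norm (x - y)"
    using smooth_lipschitz[OF smooth_G assms] by metis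
  have "\<exists>C\<ge>0. \<forall>x\<in>K. \<forall>y\<in>K. norm (dir_deriv G e x - dir_deriv G e y) \<le> C * norm (x - y)" for e
    using smooth_lipschitz[OF smooth_on_dir_deriv[OF smooth_G] assms, of e] by metis
  then obtain C2 where C2: "\<And>e. C2 e \<ge> 0" "\<And>e x y. x \<in> K \<Longrightarrow> y \<in> K \<Longrightarrow> norm (dir_deriv G e x - dir_deriv G e y) \<le> C2 e * norm (x - y)"
    by metis
  define D where "D = (\<Sum>e\<in>Basis. C2 e)"
  have D0: "D \<ge> 0" using C2(1) by (auto simp: D_def intro: sum_nonneg)
  have D: "norm (dir_deriv G h x - dir_deriv G h y) \<le> D * norm (x - y) * norm h" if xy: "x \<in> K" "y \<in> K" for x y h
  proof -
    have "dir_deriv G h x - dir_deriv G h y = (\<Sum>e\<in>Basis. (h \<bullet> e) *\<^sub>R (dir_deriv G e x - dir_deriv G e y))"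
      using xy assms(3) dir_deriv_Basis[OF smooth_G, of x h] dir_deriv_Basis[OF smooth_G, of y h]
      by (simp add: subset_iff scaleR_diff_right sum_subtractf)
    then have "norm (dir_deriv G h x - dir_deriv G h y) \<le> (\<Sum>e\<in>Basis. norm ((h \<bullet> e) *\<^sub>R (dir_deriv G e x - dir_deriv G e y)))"
      by (simp only: norm_sum)
    also have "\<dots> \<le> (\<Sum>e\<in>Basis. norm h * (C2 e * norm (x - y)))"
      using C2 xy unfolding norm_scaleR by (intro sum_mono mult_mono) (auto simp: Basis_le_norm)
    finally show ?thesis by (simp add: D_def sum_distrib_left sum_distrib_right mult_ac)
  qed
  show thesis
  proof (rule that[of "B * (C1 + D)"])
    show "0 \<le> B * (C1 + D)" using B C1 D0 by auto
    fix x y u v :: "real^'n" assume xy: "x \<in> K" "y \<in> K"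
    have 1: "norm (G x - G y) \<le> (C1 + D) * norm (x - y)"
      using C1(2)[OF xy] mult_nonneg_nonneg[OF D0 norm_ge_zero[of "x - y"]] unfolding distrib_right by linarith
    have "\<bar>ip x u v - ip y u v\<bar> = \<bar>u \<bullet> ((G x - G y) *v v)\<bar>"
      by (simp add: metric_inner_def matrix_vector_mult_diff_rdistrib inner_diff_right)
    also have "\<dots> \<le> B * norm (G x - G y) * norm u * norm v" by (rule form)
    also have "\<dots> \<le> B * ((C1 + D) * norm (x - y)) * norm u * norm v"
      using 1 B(1) by (intro mult_right_mono mult_left_mono) auto
    finally show "\<bar>ip x u v - ip y u v\<bar> \<le> B * (C1 + D) * norm (x - y) * norm u * norm v" by (simp add: mult_ac)
    fix h :: "real^'n"
    have 2: "norm (dir_deriv G h x - dir_deriv G h y) \<le> (C1 + D) * norm (x - y) * norm h"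
      using D[OF xy, of h] mult_nonneg_nonneg[OF mult_nonneg_nonneg[OF C1(1) norm_ge_zero[of "x - y"]] norm_ge_zero[of h]]
      unfolding distrib_right by linarith
    have "\<bar>metric_deriv G x h u v - metric_deriv G y h u v\<bar> = \<bar>u \<bullet> ((dir_deriv G h x - dir_deriv G h y) *v v)\<bar>"
      by (simp add: metric_deriv_def matrix_vector_mult_diff_rdistrib inner_diff_right)
    also have "\<dots> \<le> B * norm (dir_deriv G h x - dir_deriv G h y) * norm u * norm v" by (rule form)
    also have "\<dots> \<le> B * ((C1 + D) * norm (x - y) * norm h) * norm u * norm v"
      using 2 B(1) by (intro mult_right_mono mult_left_mono) auto
    finally show "\<bar>metric_deriv G x h u v - metric_deriv G y h u v\<bar> \<le> B * (C1 + D) * norm (x - y) * norm h * norm u * norm v" by (simp add: mult_ac)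
  qed
qed

end

section \<open>Short geodesics minimise length\<close>

text \<open>Values at the points of \<open>T\<close> are left free. Continuity of \<open>h\<close>
  up to both ends of a piece gives one-sided limits, hence integrability; this is the regularity of
  the two-sided derivative of a piecewise continuously differentiable curve.\<close>

definition piecewise_cont :: "real \<Rightarrow> real \<Rightarrow> (real \<Rightarrow> 'b::topological_space) \<Rightarrow> real set \<Rightarrow> bool" where
  "piecewise_cont a b f T \<longleftrightarrow> finite T \<and> (\<forall>c d. a \<le> c \<and> c < d \<and> d \<le> b \<and> {c<..<d} \<inter> T = {} \<longrightarrow>
     (\<exists>h. continuous_on {c..d} h \<and> (\<forall>t\<in>{c<..<d}. f t = h t)))"

lemma piecewise_contD:
  assumes "piecewise_cont a b f T" "a \<le> c" "c < d" "d \<le> b" "{c<..<d} \<inter> T = {}"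
  shows "\<exists>h. continuous_on {c..d} h \<and> (\<forall>t\<in>{c<..<d}. f t = h t)"
  using assms unfolding piecewise_cont_def by blast

text \<open>\<open>F\<close> depends on \<open>t\<close> as well because the integrands mix the
  velocity of a curve with its position.\<close>

lemma piecewise_cont_compose:
  assumes "piecewise_cont a b f T" "continuous_on ({a..b} \<times> UNIV) (\<lambda>(t, y). F t y)"
  shows "piecewise_cont a b (\<lambda>t. F t (f t)) T"
  unfolding piecewise_cont_def
proof (intro conjI allI impI)
  show "finite T" using assms(1) by (simp add: piecewise_cont_def)
  fix c d assume cd: "a \<le> c \<and> c < d \<and> d \<le> b \<and> {c<..<d} \<inter> T = {}"
  then obtain h where h: "continuous_on {c..d} h" "\<And>t. t \<in> {c<..<d} \<Longrightarrow> f t = h t"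
    using piecewise_contD[OF assms(1), of c d] by metis
  have "continuous_on {c..d} (\<lambda>t. (\<lambda>(t, y). F t y) (t, h t))"
    using cd by (intro continuous_on_compose2[OF assms(2)] continuous_intros h) auto
  then show "\<exists>h. continuous_on {c..d} h \<and> (\<forall>t\<in>{c<..<d}. F t (f t) = h t)"
    using h(2) by (intro exI[of _ "\<lambda>t. F t (h t)"]) auto
qed

lemma piecewise_cont_isCont:
  assumes "piecewise_cont a b f T" "t \<in> {a<..<b} - T"
  shows "isCont f t"
proof -
  have "finite (insert a (insert b T))" using assms(1) by (simp add: piecewise_cont_def)
  then obtain d where d: "d > 0" "\<And>x. x \<in> insert a (insert b T) \<Longrightarrow> x \<noteq> t \<Longrightarrow> d \<le> dist t x"
    using finite_set_avoid[of "insert a (insert b T)" t] by blast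
  have T: "{t - d<..<t + d} \<inter> T = {}" using d(2) assms(2) by (force simp: dist_real_def)
  have ab: "a \<le> t - d" "t + d \<le> b" using d(2)[of a] d(2)[of b] assms(2) by (auto simp: dist_real_def)
  obtain h where h: "continuous_on {t - d..t + d} h" "\<And>s. s \<in> {t - d<..<t + d} \<Longrightarrow> f s = h s"
    using piecewise_contD[OF assms(1) ab(1) _ ab(2) T] d(1) by auto
  have "continuous_on {t - d<..<t + d} f"
    by (subst continuous_on_cong[OF refl h(2)]) (auto intro: continuous_on_subset[OF h(1)])
  then show ?thesis using d(1) by (simp add: continuous_on_eq_continuous_at)
qed

lemma piecewise_cont_integrable:
  fixes f :: "real \<Rightarrow> 'b::banach"
  assumes f: "piecewise_cont a b f T"
  shows "f integrable_on {a..b}"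
proof (cases "a \<le> b")
  case True
  have fin: "finite T" using f by (simp add: piecewise_cont_def)
  have piece: "f integrable_on {c..d}" if cd: "a \<le> c" "d \<le> b" "{c<..<d} \<inter> T = {}" for c d
  proof (cases "c < d")
    case True
    obtain h where h: "continuous_on {c..d} h" "\<And>t. t \<in> {c<..<d} \<Longrightarrow> f t = h t"
      using piecewise_contD[OF f cd(1) True cd(2,3)] by blast
    show ?thesis
      by (rule integrable_spike_finite[of "{c, d}" _ _ h]) (use h in \<open>auto intro: integrable_continuous_real\<close>)
  next
    case False
    then show ?thesis using integrable_on_refl[of f d] by (cases "c = d") auto
  qed
  define P where "P p q \<longleftrightarrow> (a \<le> p \<and> q \<le> b \<longrightarrow> f integrable_on {p..q})" for p q
  have "P a b"
  \<comment> \<open>Bisection: near any \<open>x\<close> a small interval meets \<open>T\<close> at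
    most in \<open>x\<close>, and splitting it there leaves two pieces free of break points.\<close>
  proof (rule Bolzano[OF True])
    fix p q r assume "P p q" "P q r" "p \<le> q" "q \<le> r"
    then show "P p r"
      unfolding P_def by (auto intro: Henstock_Kurzweil_Integration.integrable_combine[of p q r])
  next
    fix x
    obtain d where d: "d > 0" "\<And>y. y \<in> T \<Longrightarrow> y \<noteq> x \<Longrightarrow> d \<le> dist x y"
      using finite_set_avoid[OF fin, of x] by metis
    have "f integrable_on {p..q}" if "p \<le> x" "x \<le> q" "q - p < d" "a \<le> p" "q \<le> b" for p q
    proof (rule Henstock_Kurzweil_Integration.integrable_combine[OF that(1,2)])
      show "f integrable_on {p..x}" "f integrable_on {x..q}"
        using that d(2) by (intro piece; force simp: dist_real_def)+
    qed
    then show "\<exists>d>0. \<forall>p q. p \<le> x \<and> x \<le> q \<and> q - p < d \<longrightarrow> P p q"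
      unfolding P_def using d(1) by (intro exI[of _ d]) simp
  qed
  then show ?thesis by (simp add: P_def)
qed (use integrable_on_empty in auto)

section \<open>Comparison of a geodesic with a nearby curve\<close>

context local_metric
begin

text \<open>The mean value theorem gives the derivative at an intermediate point; moving it to
  \<open>x\<close> costs the Lipschitz bound, hence an error quadratic in \<open>h\<close>.\<close>

lemma metric_taylor:
  assumes K: "convex K" "K \<subseteq> S" "x \<in> K" "x + h \<in> K"
    and C: "\<And>x y h u v. x \<in> K \<Longrightarrow> y \<in> K \<Longrightarrow> \<bar>metric_deriv G x h u v - metric_deriv G y h u v\<bar> \<le> C * norm (x - y) * norm h * norm u * norm v"
    and C0: "C \<ge> 0"
  shows "ip x p p + metric_deriv G x h p p - C * (norm h)\<^sup>2 * (norm p)\<^sup>2 \<le> ip (x + h) p p"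
proof -
  have seg: "x + s *\<^sub>R h \<in> K" if "s \<in> {0..1}" for s
    using convexD_alt[OF K(1,3,4), of s] that by (simp add: algebra_simps)
  have "((\<lambda>s. ip (x + s *\<^sub>R h) p p) has_vector_derivative metric_deriv G (x + s *\<^sub>R h) h p p) (at s within {0..1})" if "s \<in> {0..1}" for s
  proof -
    have "((\<lambda>s. x + s *\<^sub>R h) has_vector_derivative h) (at s within {0..1})" by (auto intro!: derivative_eq_intros)
    from ip_curve[OF this has_vector_derivative_const has_vector_derivative_const, of p p] seg[OF that] K(2)
    show ?thesis by (auto simp: ip_simps)
  qed
  then have "\<And>s. 0 \<le> s \<Longrightarrow> s \<le> 1 \<Longrightarrow> ((\<lambda>s. ip (x + s *\<^sub>R h) p p) has_derivative (\<lambda>t. t * metric_deriv G (x + s *\<^sub>R h) h p p)) (at s within {0..1})"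
    by (auto simp: has_vector_derivative_def)
  from mvt_simple[OF zero_less_one this] obtain s where s: "s \<in> {0<..<1}" "ip (x + h) p p - ip x p p = metric_deriv G (x + s *\<^sub>R h) h p p"
    by auto
  have "\<bar>metric_deriv G (x + s *\<^sub>R h) h p p - metric_deriv G x h p p\<bar> \<le> C * norm (s *\<^sub>R h) * norm h * norm p * norm p"
    using C[of "x + s *\<^sub>R h" x h p p] seg[of s] s(1) K(3) by simp
  also have "\<dots> \<le> C * (1 * norm h) * norm h * norm p * norm p"
    using s(1) C0 unfolding norm_scaleR by (intro mult_right_mono mult_left_mono) auto
  finally show ?thesis using s(2) by (simp add: power2_eq_square mult_ac abs_le_iff)
qed

text \<open>Metric compatibility keeps the inner product of two parallel fields constant; the
  velocity of a geodesic is parallel along it, so \<open>P = Q = w\<close> gives constant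
  speed.\<close>

lemma geodesic_constant_speed:
  assumes "\<And>t. t \<in> {0..1} \<Longrightarrow> (u has_vector_derivative w t) (at t within {0..1})"
    "\<And>t. t \<in> {0..1} \<Longrightarrow> (w has_vector_derivative - christoffel_form G (u t) (w t) (w t)) (at t within {0..1})"
    "\<And>t. t \<in> {0..1} \<Longrightarrow> (P has_vector_derivative - christoffel_form G (u t) (w t) (P t)) (at t within {0..1})"
    "\<And>t. t \<in> {0..1} \<Longrightarrow> (Q has_vector_derivative - christoffel_form G (u t) (w t) (Q t)) (at t within {0..1})"
    "\<And>t. t \<in> {0..1} \<Longrightarrow> u t \<in> S" "t \<in> {0..1}"
  shows "ip (u t) (P t) (Q t) = ip (u 0) (P 0) (Q 0)"
proof -
  have "\<exists>c. \<forall>t\<in>{0..1}. ip (u t) (P t) (Q t) = c"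
  proof (rule has_derivative_zero_constant)
    fix t :: real assume t: "t \<in> {0..1}"
    have "((\<lambda>t. ip (u t) (P t) (Q t)) has_vector_derivative 0) (at t within {0..1})"
      by (rule has_vector_derivative_eq_rhs, rule ip_curve[OF assms(1,3,4)[OF t] assms(5)[OF t]])
         (simp add: christoffel_form_compat[OF assms(5)[OF t]] ip_simps)
    then show "((\<lambda>t. ip (u t) (P t) (Q t)) has_derivative (\<lambda>h. 0)) (at t within {0..1})"
      by (simp add: has_vector_derivative_def)
  qed simp
  then show ?thesis using assms(6) by auto
qed

text \<open>The curve \<open>z\<close> is compared with \<open>u \<circ> \<theta>\<close>, where \<open>\<theta>'\<close> is proportional to \<open>\<bar>z'\<bar> + \<epsilon>\<close>. The energy of
  \<open>z\<close> weighted by \<open>1/\<theta>'\<close> is at most \<open>L (L + \<epsilon>)\<close>, so \<open>z\<close> need not be reparametrised by arc length.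
  In the difference of the weighted energies the first-order terms are a total derivative by
  the geodesic equation, and a weighted Poincare inequality absorbs the second-order terms.\<close>

lemma geodesic_minimal:
  assumes K: "convex K" "K \<subseteq> S"
    and lam: "\<And>x v. x \<in> K \<Longrightarrow> lam * (norm v)\<^sup>2 \<le> ip x v v"
    and C0: "C \<ge> 0"
    and C1: "\<And>x y u v. x \<in> K \<Longrightarrow> y \<in> K \<Longrightarrow> \<bar>ip x u v - ip y u v\<bar> \<le> C * norm (x - y) * norm u * norm v"
    and C2: "\<And>x y h u v. x \<in> K \<Longrightarrow> y \<in> K \<Longrightarrow> \<bar>metric_deriv G x h u v - metric_deriv G y h u v\<bar> \<le> C * norm (x - y) * norm h * norm u * norm v"
    and m: "0 \<le> m" "2 * C * m + C * m\<^sup>2 \<le> lam"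
    and uK: "\<And>t. t \<in> {0..1} \<Longrightarrow> u t \<in> K"
    and du: "\<And>t. t \<in> {0..1} \<Longrightarrow> (u has_vector_derivative w t) (at t within {0..1})"
    and dw: "\<And>t. t \<in> {0..1} \<Longrightarrow> (w has_vector_derivative - christoffel_form G (u t) (w t) (w t)) (at t within {0..1})"
    and wm: "\<And>t. t \<in> {0..1} \<Longrightarrow> norm (w t) \<le> m"
    and zK: "\<And>t. t \<in> {0..1} \<Longrightarrow> z t \<in> K"
    and zc: "continuous_on {0..1} z"
    and pw: "piecewise_cont 0 1 zd T"
    and dz: "\<And>t. t \<in> {0<..<1} - T \<Longrightarrow> (z has_vector_derivative zd t) (at t)"
    and ends: "z 0 = u 0" "z 1 = u 1"
  shows "ip (u 0) (w 0) (w 0) \<le> (integral {0..1} (\<lambda>t. sqrt (ip (z t) (zd t) (zd t))))\<^sup>2"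
proof -
  define E where "E = ip (u 0) (w 0) (w 0)"
  have E: "ip (u t) (w t) (w t) = E" if "t \<in> {0..1}" for t
    unfolding E_def by (rule geodesic_constant_speed[OF du dw dw dw _ that]) (use uK K(2) in auto)
  have fin: "finite T" using pw by (simp add: piecewise_cont_def)
  define s where "s t = sqrt (ip (z t) (zd t) (zd t))" for t
  have s0: "s t \<ge> 0" "s t * s t = ip (z t) (zd t) (zd t)" if "t \<in> {0..1}" for t
    using ip_nonneg[of "z t" "zd t"] zK[OF that] K(2) by (auto simp: s_def)
  define L where "L = integral {0..1} s"
  have zc2: "continuous_on ({0..1} \<times> UNIV) (\<lambda>x. z (fst x))"
    by (rule continuous_on_compose2[OF zc]) (auto intro: continuous_intros)
  have ipc: "continuous_on ({0..1} \<times> UNIV) (\<lambda>x. ip (z (fst x)) (snd x) (snd x))"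
    using zK K(2) by (intro continuous_on_ip zc2 continuous_intros) auto
  have pws: "piecewise_cont 0 1 s T"
    unfolding s_def using ipc
    by (intro piecewise_cont_compose[OF pw, where F = "\<lambda>t y. sqrt (ip (z t) y y)"]) (simp add: case_prod_unfold continuous_intros)
  have si: "s integrable_on {0..1}" by (rule piecewise_cont_integrable[OF pws])
  have L0: "L \<ge> 0" unfolding L_def by (rule integral_nonneg[OF si s0(1)])
  \<comment> \<open>The \<epsilon> keeps the weight positive where \<open>z\<close> stands still; it
    is removed at the end.\<close>
  have "E \<le> (L + \<epsilon>) * L" if eps: "\<epsilon> > 0" for \<epsilon>
  proof -
    define q where "q t = (s t + \<epsilon>) / (L + \<epsilon>)" for t
    have Le: "L + \<epsilon> > 0" using L0 eps by simp
    have q0: "q t > 0" if "t \<in> {0..1}" for t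
      unfolding q_def using s0(1)[OF that] eps Le by (intro divide_pos_pos) auto
    have pwq: "piecewise_cont 0 1 q T"
      unfolding q_def
      by (rule piecewise_cont_compose[OF pws, where F = "\<lambda>t y. (y + \<epsilon>) / (L + \<epsilon>)"])
         (use Le in \<open>auto simp: case_prod_unfold intro!: continuous_intros\<close>)
    have iq: "q integrable_on {0..1}" by (rule piecewise_cont_integrable[OF pwq])
    have iq1: "integral {0..1} q = 1"
    proof -
      have "(s has_integral L) {0..1}" using si unfolding L_def by (rule integrable_integral)
      moreover have "((\<lambda>t. \<epsilon>) has_integral \<epsilon>) {0..1::real}"
        using has_integral_const_real[of \<epsilon> 0 1] by simp
      ultimately have "((\<lambda>t. s t + \<epsilon>) has_integral (L + \<epsilon>)) {0..1}" by (rule has_integral_add)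
      from has_integral_divide[OF this, of "L + \<epsilon>"] have "(q has_integral 1) {0..1}"
        unfolding q_def[abs_def] using Le by simp
      then show ?thesis by (rule integral_unique)
    qed
    define th where "th t = integral {0..t} q" for t
    have th0: "th 0 = 0" "th 1 = 1" by (auto simp: th_def iq1)
    have thmono: "th a \<le> th b" if "0 \<le> a" "a \<le> b" "b \<le> 1" for a b
      unfolding th_def
      by (rule integral_subset_le) (use that q0 iq in \<open>auto intro: integrable_on_subinterval less_imp_le\<close>)
    have th01: "th t \<in> {0..1}" if "t \<in> {0..1}" for t
      using thmono[of 0 t] thmono[of t 1] that th0 by auto
    have thc: "continuous_on {0..1} th"
      unfolding th_def by (rule indefinite_integral_continuous_1[OF iq])
    have dth: "(th has_vector_derivative q t) (at t)" if t: "t \<in> {0<..<1} - T" for t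
    proof -
      have "(th has_vector_derivative q t) (at t within {0..1} - {})"
        unfolding th_def
        using t piecewise_cont_isCont[OF pwq t] by (intro integral_has_vector_derivative_continuous_at iq) (auto simp: continuous_at_imp_continuous_at_within)
      then show ?thesis using t at_within_Icc_at[of 0 t 1] by simp
    qed
    have uth: "((\<lambda>t. u (th t)) has_vector_derivative q t *\<^sub>R w (th t)) (at t)"
      and wth: "((\<lambda>t. w (th t)) has_vector_derivative q t *\<^sub>R (- christoffel_form G (u (th t)) (w (th t)) (w (th t)))) (at t)"
      if t: "t \<in> {0<..<1} - T" for t
    proof -
      have t1: "t \<in> {0..1}" and i: "at t within {0..1} = at t" using t at_within_Icc_at[of 0 t 1] by auto
      have d: "(th has_vector_derivative q t) (at t within {0..1})" using dth[OF t] by (rule has_vector_derivative_at_within)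
      have sub: "th ` {0..1} \<subseteq> {0..1}" using th01 by auto
      show "((\<lambda>t. u (th t)) has_vector_derivative q t *\<^sub>R w (th t)) (at t)"
        using vector_diff_chain_within[OF d has_vector_derivative_within_subset[OF du[OF th01[OF t1]] sub]] i by (simp add: o_def)
      show "((\<lambda>t. w (th t)) has_vector_derivative q t *\<^sub>R (- christoffel_form G (u (th t)) (w (th t)) (w (th t)))) (at t)"
        using vector_diff_chain_within[OF d has_vector_derivative_within_subset[OF dw[OF th01[OF t1]] sub]] i by (simp add: o_def)
    qed
    \<comment> \<open>The geodesic run in step with \<open>z\<close>, and the deviation of
      \<open>z\<close> from it.\<close>
    define U p \<eta> \<eta>d where "U t = u (th t)" and "p t = w (th t)" and "\<eta> t = z t - U t" and "\<eta>d t = zd t - q t *\<^sub>R p t" for t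
    \<comment> \<open>\<open>Bd\<close> will be the part of the energy difference that is linear in
      the deviation. It is the derivative of \<open>B\<close>, which vanishes at both ends because
      \<eta> does.\<close>
    define B where "B t = 2 * ip (U t) (p t) (\<eta> t)" for t
    define Bd where "Bd t = q t * metric_deriv G (U t) (\<eta> t) (p t) (p t) + 2 * ip (U t) (p t) (\<eta>d t)" for t
    have UK: "U t \<in> K" "U t \<in> S" "norm (p t) \<le> m" "ip (U t) (p t) (p t) = E" if "t \<in> {0..1}" for t
      using uK[OF th01[OF that]] K(2) wm[OF th01[OF that]] E[OF th01[OF that]] by (auto simp: U_def p_def)
    have d\<eta>: "(\<eta> has_vector_derivative \<eta>d t) (at t)" if "t \<in> {0<..<1} - T" for t
      unfolding \<eta>_def \<eta>d_def U_def p_def by (rule has_vector_derivative_diff[OF dz[OF that] uth[OF that]])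
    have dB: "(B has_vector_derivative Bd t) (at t)" if t: "t \<in> {0<..<1} - T" for t
    proof -
      have t1: "t \<in> {0..1}" using t by auto
      note x = UK(2)[OF t1]
      have "(B has_vector_derivative 2 * (metric_deriv G (U t) (q t *\<^sub>R p t) (p t) (\<eta> t) + ip (U t) (q t *\<^sub>R (- christoffel_form G (U t) (p t) (p t))) (\<eta> t) + ip (U t) (p t) (\<eta>d t))) (at t)"
        unfolding B_def
        by (rule has_vector_derivative_mult_right, rule ip_curve)
           (use uth[OF t] wth[OF t] d\<eta>[OF t] x in \<open>auto simp: U_def p_def\<close>)
      also have "2 * (metric_deriv G (U t) (q t *\<^sub>R p t) (p t) (\<eta> t) + ip (U t) (q t *\<^sub>R (- christoffel_form G (U t) (p t) (p t))) (\<eta> t) + ip (U t) (p t) (\<eta>d t)) = Bd t"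
        using ip_sym[OF x, of "christoffel_form G (U t) (p t) (\<eta> t)" "p t"] christoffel_form_sym[OF x, of "\<eta> t" "p t"]
        by (simp add: Bd_def christoffel_form_compat[OF x] ip_simps christoffel_form_simps algebra_simps)
      finally show ?thesis .
    qed
    have uc: "continuous_on {0..1} u" by (rule continuous_on_vector_derivative) (rule du)
    have wc: "continuous_on {0..1} w" by (rule continuous_on_vector_derivative) (rule dw)
    have Uc: "continuous_on {0..1} U" unfolding U_def using th01 by (intro continuous_on_compose2[OF uc thc]) auto
    have pc: "continuous_on {0..1} p" unfolding p_def using th01 by (intro continuous_on_compose2[OF wc thc]) auto
    have \<eta>c: "continuous_on {0..1} \<eta>" unfolding \<eta>_def by (intro continuous_intros zc Uc)
    have Bc: "continuous_on {0..1} B"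
      unfolding B_def using UK(2) by (intro continuous_intros continuous_on_ip Uc pc \<eta>c) auto
    have hB: "(Bd has_integral B 1 - B 0) {0..1}"
      by (rule fundamental_theorem_of_calculus_interior_strong[OF fin _ dB Bc]) auto
    have B01: "B 1 - B 0 = 0" by (simp add: B_def \<eta>_def U_def th0 ends ip_simps)
    \<comment> \<open>The weight as a function of time and velocity; it is jointly continuous, so
      that \<open>piecewise_cont_compose\<close> covers all integrands below.\<close>
    define qq where "qq t y = (sqrt (ip (z t) y y) + \<epsilon>) / (L + \<epsilon>)" for t and y :: "real^'n"
    have q_qq: "q t = qq t (zd t)" for t by (simp add: q_def qq_def s_def)
    have qqc: "continuous_on ({0..1} \<times> UNIV) (\<lambda>x. qq (fst x) (snd x))"
      unfolding qq_def using ipc Le by (intro continuous_intros) auto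
    have qq0: "qq t y > 0" if "t \<in> {0..1}" for t y
    proof -
      have "0 \<le> ip (z t) y y" using ip_nonneg zK[OF that] K(2) by blast
      then show ?thesis unfolding qq_def using eps Le by (simp add: add_nonneg_pos)
    qed
    have c1: "continuous_on ({0..1} \<times> UNIV) (\<lambda>x. f (fst x))" if "continuous_on {0..1} f" for f :: "real \<Rightarrow> real^'n"
      by (rule continuous_on_compose2[OF that]) (auto intro: continuous_intros)
    define N where "N t = (norm (\<eta>d t))\<^sup>2 / q t" for t
    have "piecewise_cont 0 1 N T"
      unfolding N_def \<eta>d_def q_qq using qq0
      by (intro piecewise_cont_compose[OF pw, where F = "\<lambda>t y. (norm (y - qq t y *\<^sub>R p t))\<^sup>2 / qq t y"])
         (auto simp: case_prod_unfold intro!: continuous_intros qqc c1 pc less_imp_neq[OF qq0, symmetric])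
    then have iN: "N integrable_on {0..1}" by (rule piecewise_cont_integrable)
    define A where "A t = ip (z t) (zd t) (zd t) / q t" for t
    have "piecewise_cont 0 1 A T"
      unfolding A_def q_qq using qq0
      by (intro piecewise_cont_compose[OF pw, where F = "\<lambda>t y. ip (z t) y y / qq t y"])
         (auto simp: case_prod_unfold intro!: continuous_intros qqc ipc less_imp_neq[OF qq0, symmetric])
    then have iA: "A integrable_on {0..1}" by (rule piecewise_cont_integrable)
    define H where "H t = q t * (norm (\<eta> t))\<^sup>2" for t
    have "piecewise_cont 0 1 H T"
      unfolding H_def q_qq
      by (intro piecewise_cont_compose[OF pw, where F = "\<lambda>t y. qq t y * (norm (\<eta> t))\<^sup>2"])
         (auto simp: case_prod_unfold intro!: continuous_intros qqc c1 \<eta>c)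
    then have iH: "H integrable_on {0..1}" by (rule piecewise_cont_integrable)
    define Q where "Q = integral {0..1} N"
    have N0: "N t \<ge> 0" if "t \<in> {0..1}" for t using q0[OF that] by (simp add: N_def)
    have Q0: "Q \<ge> 0" unfolding Q_def by (rule integral_nonneg[OF iN N0])
    have "piecewise_cont 0 1 \<eta>d T"
      unfolding \<eta>d_def q_qq
      by (intro piecewise_cont_compose[OF pw, where F = "\<lambda>t y. y - qq t y *\<^sub>R p t"])
         (auto simp: case_prod_unfold intro!: continuous_intros qqc c1 pc)
    then have i\<eta>d: "\<eta>d integrable_on {0..1}" by (rule piecewise_cont_integrable)
    \<comment> \<open>Weighted Poincare inequality:
      \<open>2 * norm (\<eta>d r) \<le> N r / n + n * q r\<close> integrates to
      \<open>n \<le> (Q / n + n) / 2\<close>, because the weight has integral 1.\<close>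
    have poincare: "(norm (\<eta> t))\<^sup>2 \<le> Q" if t: "t \<in> {0..1}" for t
    proof (cases "\<eta> t = 0")
      case False
      define n where "n = norm (\<eta> t)"
      have n: "n > 0" using False by (simp add: n_def)
      have hM: "((\<lambda>t. (N t / n + n * q t) / 2) has_integral (Q / n + n * 1) / 2) {0..1}"
        using integrable_integral[OF iN] integrable_integral[OF iq]
        by (intro has_integral_divide has_integral_add has_integral_mult_right) (auto simp: Q_def iq1)
      have sub: "{0..t} \<subseteq> {0..1}" using t by auto
      have h: "(\<eta>d has_integral \<eta> t - \<eta> 0) {0..t}"
        by (rule fundamental_theorem_of_calculus_interior_strong[OF fin])
           (use t in \<open>auto intro!: d\<eta> continuous_on_subset[OF \<eta>c]\<close>)
      have "\<eta> 0 = 0" by (simp add: \<eta>_def U_def th0 ends)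
      then have "n = norm (integral {0..t} \<eta>d)" using h by (simp add: n_def integral_unique)
      also have "\<dots> \<le> integral {0..t} (\<lambda>t. (N t / n + n * q t) / 2)"
      proof (rule Henstock_Kurzweil_Integration.integral_norm_bound_integral)
        show "\<eta>d integrable_on {0..t}" using h by blast
        show "(\<lambda>t. (N t / n + n * q t) / 2) integrable_on {0..t}"
          by (rule integrable_on_subinterval[OF has_integral_integrable[OF hM] sub])
        fix r assume "r \<in> {0..t}"
        then have q: "q r > 0" using q0 sub by blast
        have "0 \<le> (norm (\<eta>d r) - n * q r)\<^sup>2 / (n * q r)" using n q by simp
        also have "\<dots> = N r / n + n * q r - 2 * norm (\<eta>d r)"
          using n q by (simp add: N_def field_simps power2_eq_square)
        finally show "norm (\<eta>d r) \<le> (N r / n + n * q r) / 2" by simp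
      qed
      also have "\<dots> \<le> integral {0..1} (\<lambda>t. (N t / n + n * q t) / 2)"
        by (rule integral_subset_le[OF sub integrable_on_subinterval[OF has_integral_integrable[OF hM] sub] has_integral_integrable[OF hM]])
           (use N0 q0 n in \<open>auto intro!: add_nonneg_nonneg simp: less_imp_le\<close>)
      also have "\<dots> = (Q / n + n) / 2"
        using integral_unique[OF hM] by simp
      finally show ?thesis using n unfolding n_def[symmetric] by (simp add: field_simps power2_eq_square)
    qed (simp add: Q0)
    have HQ: "integral {0..1} H \<le> Q"
    proof -
      have "integral {0..1} H \<le> integral {0..1} (\<lambda>t. Q * q t)"
        by (rule integral_le[OF iH])
           (use poincare q0 iq in \<open>auto simp: H_def mult.commute[of Q] less_imp_le intro!: mult_left_mono integrable_on_mult_left\<close>)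
      then show ?thesis by (simp add: iq1)
    qed
    define k where "k = C * m\<^sup>2 + C * m"
    have k0: "k \<ge> 0" using C0 m(1) by (simp add: k_def)
    \<comment> \<open>The Taylor bound for the metric costs \<open>C * m\<^sup>2 * H t\<close>,
      replacing \<open>z t\<close> by \<open>U t\<close> in the mixed term costs
      \<open>C * m * (H t + N t)\<close>, and the lower bound on the metric contributes
      \<open>lam * N t\<close>.\<close>
    have main: "q t * E + Bd t + (lam - C * m) * N t - k * H t \<le> A t" if t: "t \<in> {0..1}" for t
    proof -
      note q = q0[OF t] and x = UK(2)[OF t]
      have zd: "zd t = q t *\<^sub>R p t + \<eta>d t" by (simp add: \<eta>d_def)
      have zt: "z t = U t + \<eta> t" by (simp add: \<eta>_def)
      have zS: "z t \<in> S" using zK[OF t] K(2) by blast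
      have A: "A t = q t * ip (z t) (p t) (p t) + 2 * ip (z t) (p t) (\<eta>d t) + ip (z t) (\<eta>d t) (\<eta>d t) / q t"
        using q ip_sym[OF zS, of "\<eta>d t" "p t"] unfolding A_def zd
        by (simp add: ip_simps field_simps)
      have pm: "0 \<le> norm (p t)" "norm (p t) \<le> m" using UK(3)[OF t] by auto
      have pm2: "(norm (p t))\<^sup>2 \<le> m\<^sup>2" using pm by (intro power_mono) auto
      have 1: "q t * E + q t * metric_deriv G (U t) (\<eta> t) (p t) (p t) - C * m\<^sup>2 * H t \<le> q t * ip (z t) (p t) (p t)"
      proof -
        have "E + metric_deriv G (U t) (\<eta> t) (p t) (p t) - C * (norm (\<eta> t))\<^sup>2 * (norm (p t))\<^sup>2 \<le> ip (z t) (p t) (p t)"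
          unfolding zt UK(4)[OF t, symmetric]
          by (rule metric_taylor[OF K UK(1)[OF t] _ C2 C0]) (use zK[OF t] zt in auto)
        moreover have "C * (norm (\<eta> t))\<^sup>2 * (norm (p t))\<^sup>2 \<le> C * (norm (\<eta> t))\<^sup>2 * m\<^sup>2"
          using pm2 C0 by (intro mult_left_mono) auto
        ultimately have "E + metric_deriv G (U t) (\<eta> t) (p t) (p t) - C * (norm (\<eta> t))\<^sup>2 * m\<^sup>2 \<le> ip (z t) (p t) (p t)" by linarith
        from mult_left_mono[OF this less_imp_le[OF q]] show ?thesis by (simp add: H_def algebra_simps)
      qed
      have 2: "2 * ip (U t) (p t) (\<eta>d t) - C * m * (H t + N t) \<le> 2 * ip (z t) (p t) (\<eta>d t)"
      proof -
        have "\<bar>ip (z t) (p t) (\<eta>d t) - ip (U t) (p t) (\<eta>d t)\<bar> \<le> C * norm (\<eta> t) * norm (p t) * norm (\<eta>d t)"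
          using C1[OF zK[OF t] UK(1)[OF t]] by (simp add: \<eta>_def)
        also have "\<dots> \<le> C * norm (\<eta> t) * m * norm (\<eta>d t)"
          using pm C0 by (intro mult_right_mono mult_left_mono) auto
        finally have a: "2 * \<bar>ip (z t) (p t) (\<eta>d t) - ip (U t) (p t) (\<eta>d t)\<bar> \<le> C * m * (2 * norm (\<eta> t) * norm (\<eta>d t))"
          by (simp add: mult_ac)
        have "0 \<le> (q t * norm (\<eta> t) - norm (\<eta>d t))\<^sup>2 / q t" using q by simp
        also have "\<dots> = H t + N t - 2 * norm (\<eta> t) * norm (\<eta>d t)"
          using q by (simp add: H_def N_def field_simps power2_eq_square)
        finally have "C * m * (2 * norm (\<eta> t) * norm (\<eta>d t)) \<le> C * m * (H t + N t)"
          using C0 m(1) by (intro mult_left_mono) auto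
        note order_trans[OF a this]
        moreover have "2 * b - r \<le> 2 * a" if "2 * \<bar>a - b\<bar> \<le> r" for a b r :: real using abs_ge_minus_self[of "a - b"] that by (simp add: algebra_simps)
        ultimately show ?thesis by blast
      qed
      have 3: "lam * N t \<le> ip (z t) (\<eta>d t) (\<eta>d t) / q t"
        using lam[OF zK[OF t], of "\<eta>d t"] q by (simp add: N_def divide_right_mono)
      show ?thesis unfolding A Bd_def k_def using 1 2 3 by (simp add: algebra_simps)
    qed
    have "integral {0..1} (\<lambda>t. q t * E + Bd t + (lam - C * m) * N t - k * H t) \<le> integral {0..1} A"
      by (rule integral_le[OF _ iA main])
         (use hB iq iN iH in \<open>auto intro!: integrable_add integrable_diff integrable_on_mult_left integrable_on_mult_right\<close>)
    also have "integral {0..1} (\<lambda>t. q t * E + Bd t + (lam - C * m) * N t - k * H t)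
       = E + (B 1 - B 0) + (lam - C * m) * Q - k * integral {0..1} H"
    proof (rule integral_unique)
      show "((\<lambda>t. q t * E + Bd t + (lam - C * m) * N t - k * H t) has_integral E + (B 1 - B 0) + (lam - C * m) * Q - k * integral {0..1} H) {0..1}"
        using has_integral_mult_left[OF integrable_integral[OF iq], of E] hB integrable_integral[OF iN] integrable_integral[OF iH]
        by (intro has_integral_add has_integral_diff has_integral_mult_right) (auto simp: iq1 Q_def)
    qed
    also have "integral {0..1} A \<le> integral {0..1} (\<lambda>t. (L + \<epsilon>) * s t)"
    proof (rule integral_le[OF iA])
      show "(\<lambda>t. (L + \<epsilon>) * s t) integrable_on {0..1}" using si by (rule integrable_on_mult_right)
      fix t :: real assume t: "t \<in> {0..1}"
      have "A t = (L + \<epsilon>) * (s t * s t / (s t + \<epsilon>))"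
        using s0[OF t] by (simp add: A_def q_def)
      also have "\<dots> \<le> (L + \<epsilon>) * s t"
        using s0(1)[OF t] eps Le by (intro mult_left_mono) (auto simp: field_simps)
      finally show "A t \<le> (L + \<epsilon>) * s t" .
    qed
    also have "\<dots> = (L + \<epsilon>) * L" by (simp add: L_def)
    finally have "E + (lam - C * m) * Q - k * integral {0..1} H \<le> (L + \<epsilon>) * L" using B01 by simp
    moreover have "k * integral {0..1} H \<le> k * Q" using HQ k0 by (rule mult_left_mono)
    \<comment> \<open>Here the second part of hypothesis \<open>m\<close> enters: it says
      \<open>lam - C * m \<ge> k\<close>, so the quadratic terms are absorbed.\<close>
    moreover have "0 \<le> (lam - (2 * C * m + C * m\<^sup>2)) * Q" using m(2) Q0 by simp
    ultimately show ?thesis by (simp add: k_def algebra_simps)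
  qed
  then have "E \<le> L * L + \<delta>" if "\<delta> > 0" for \<delta>
  proof -
    \<comment> \<open>This choice makes the surplus at most \<delta>, also for
      \<open>L = 0\<close>.\<close>
    have "E \<le> (L + \<delta> / (L + 1)) * L" using that L0 \<open>\<And>\<epsilon>. \<epsilon> > 0 \<Longrightarrow> E \<le> (L + \<epsilon>) * L\<close> by simp
    also have "\<dots> \<le> L * L + \<delta>" using L0 that by (simp add: field_simps)
    finally show ?thesis .
  qed
  then have "E \<le> L * L" by (rule field_le_epsilon)
  then show ?thesis by (simp add: E_def L_def s_def[abs_def] power2_eq_square)
qed

end

section \<open>Curves on the manifold\<close>

text \<open>The factor is \<open>\<bar>m\<bar>\<close> so that reversal of a curve, with
  \<open>m < 0\<close>, is included.\<close>

lemma has_integral_affine_real: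
  fixes f :: "real \<Rightarrow> real"
  assumes f: "(f has_integral I) {p..q}" and m: "m \<noteq> 0" and im: "(\<lambda>t. m * t + k) ` {a..b} = {p..q}"
  shows "((\<lambda>t. \<bar>m\<bar> * f (m * t + k)) has_integral I) {a..b}"
proof -
  have "(\<lambda>x. (1 / m) *\<^sub>R x + - ((1 / m) *\<^sub>R k)) ` cbox p q = {a..b}"
  proof -
    have "(\<lambda>x. (1 / m) *\<^sub>R x + - ((1 / m) *\<^sub>R k)) ` (\<lambda>t. m * t + k) ` {a..b} = {a..b}"
      unfolding image_image using m by (simp add: field_simps)
    then show ?thesis using im by simp
  qed
  with has_integral_affinity[of f I p q m k] f m
  have "((\<lambda>x. f (m * x + k)) has_integral (1 / \<bar>m\<bar>) * I) {a..b}" by simp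
  from has_integral_mult_right[OF this, of "\<bar>m\<bar>"] m show ?thesis by simp
qed

text \<open>\<open>v < u\<close> is allowed and runs the piece backwards, so
  \<open>subcurve 1 0\<close> is the reversal.\<close>

definition subcurve :: "real \<Rightarrow> real \<Rightarrow> (real \<Rightarrow> 'b) \<Rightarrow> real \<Rightarrow> 'b" where
  "subcurve u v \<gamma> t = \<gamma> ((v - u) * t + u)"

lemma subcurve_arg_in:
  assumes "u \<in> {0..1}" "v \<in> {0..1}" "t \<in> {0..1::real}"
  shows "(v - u) * t + u \<in> {0..1}"
proof -
  have "(v - u) * t + u = (1 - t) * u + t * v" by (simp add: algebra_simps)
  moreover have "(1 - t) * u + t * v \<le> (1 - t) * 1 + t * 1" using assms by (intro add_mono mult_left_mono) auto
  ultimately show ?thesis using assms by simp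
qed

lemma path_subcurve:
  assumes "path \<gamma>" "u \<in> {0..1}" "v \<in> {0..1}"
  shows "path (subcurve u v \<gamma>)"
  unfolding path_def subcurve_def[abs_def]
proof (rule continuous_on_compose2[OF assms(1)[unfolded path_def]])
  show "continuous_on {0..1} (\<lambda>t. (v - u) * t + u)" by (intro continuous_intros)
  show "(\<lambda>t. (v - u) * t + u) ` {0..1} \<subseteq> {0..1}" using subcurve_arg_in[OF assms(2,3)] by blast
qed

text \<open>At \<open>t = 1/2\<close> the join takes its value from the first path, hence the
  matching of ends; \<open>2 * t + - 1\<close> is the affine form expected by the reparametrisation
  lemmas.\<close>

lemma join_eq:
  assumes "pathfinish \<gamma> = pathstart \<delta>" "1/2 \<le> t"
  shows "(\<gamma> +++ \<delta>) t = \<delta> (2 * t + - 1)"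
proof (cases "t = 1/2")
  case True
  then show ?thesis unfolding True using assms(1) by (simp add: joinpaths_def pathfinish_def pathstart_def)
qed (use assms in \<open>simp add: joinpaths_def\<close>)

section \<open>Charts and piecewise continuously differentiable curves\<close>

context smooth_manifold
begin

lemma chart_inv_map: "c \<in> A \<Longrightarrow> p \<in> chart_dom c \<Longrightarrow> chart_inv c (chart_map c p) = p"
  using chart_homeomorphism[of c] by (simp add: homeomorphism_def)

lemma chart_map_inv: "c \<in> A \<Longrightarrow> x \<in> chart_img c \<Longrightarrow> chart_map c (chart_inv c x) = x"
  using chart_homeomorphism[of c] by (simp add: homeomorphism_def)

lemma chart_inv_in: "c \<in> A \<Longrightarrow> x \<in> chart_img c \<Longrightarrow> chart_inv c x \<in> chart_dom c"
  using chart_homeomorphism[of c] by (auto simp: homeomorphism_def)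

lemma chart_map_in: "p \<in> chart_dom c \<Longrightarrow> chart_map c p \<in> chart_img c"
  by (simp add: chart_img_def)

lemma continuous_chart_map: "c \<in> A \<Longrightarrow> continuous_on (chart_dom c) (chart_map c)"
  using chart_homeomorphism[of c] by (simp add: homeomorphism_def)

lemma continuous_chart_inv: "c \<in> A \<Longrightarrow> continuous_on (chart_img c) (chart_inv c)"
  using chart_homeomorphism[of c] by (simp add: homeomorphism_def)

lemma overlap_iff: "c \<in> A \<Longrightarrow> x \<in> overlap c c' \<longleftrightarrow> x \<in> chart_img c \<and> chart_inv c x \<in> chart_dom c'"
  unfolding overlap_def chart_img_def using chart_inv_map[of c] by fastforce

lemma overlap_sub: "overlap c c' \<subseteq> chart_img c"
  by (auto simp: overlap_def chart_img_def)

lemma open_overlap: "c \<in> A \<Longrightarrow> c' \<in> A \<Longrightarrow> open (overlap c c')"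
proof -
  assume c: "c \<in> A" "c' \<in> A"
  have "overlap c c' = chart_img c \<inter> chart_inv c -` chart_dom c'"
    using overlap_iff[OF c(1)] by blast
  then show ?thesis
    using continuous_open_preimage[OF continuous_chart_inv[OF c(1)] open_img[OF c(1)] open_dom[OF c(2)]] by simp
qed

lemma open_chart_inv_image: "c \<in> A \<Longrightarrow> open V \<Longrightarrow> V \<subseteq> chart_img c \<Longrightarrow> open (chart_inv c ` V)"
proof -
  assume c: "c \<in> A" and V: "open V" "V \<subseteq> chart_img c"
  have "chart_inv c ` V = chart_dom c \<inter> chart_map c -` V"
  proof
    show "chart_inv c ` V \<subseteq> chart_dom c \<inter> chart_map c -` V"
    proof
      fix y assume "y \<in> chart_inv c ` V"
      then obtain x where x: "x \<in> V" "y = chart_inv c x" by blast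
      then have "x \<in> chart_img c" using V(2) by blast
      then show "y \<in> chart_dom c \<inter> chart_map c -` V"
        using chart_map_inv[OF c] chart_inv_in[OF c] x by simp
    qed
    show "chart_dom c \<inter> chart_map c -` V \<subseteq> chart_inv c ` V"
    proof
      fix y assume "y \<in> chart_dom c \<inter> chart_map c -` V"
      then have "y = chart_inv c (chart_map c y)" "chart_map c y \<in> V" using chart_inv_map[OF c] by simp_all
      then show "y \<in> chart_inv c ` V" by (rule image_eqI)
    qed
  qed
  then show ?thesis
    using continuous_open_preimage[OF continuous_chart_map[OF c] open_dom[OF c] V(1)] by simp
qed

lemma chart_at: "\<exists>c\<in>A. p \<in> chart_dom c"
  using covers by blast

lemma transition_in: "c \<in> A \<Longrightarrow> x \<in> overlap c c' \<Longrightarrow> transition c c' x \<in> chart_img c'"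
  by (simp add: overlap_iff transition_def chart_map_in)

lemma some_chart: "some_chart A p \<in> A" "p \<in> chart_dom (some_chart A p)"
proof -
  have "some_chart A p \<in> A \<and> p \<in> chart_dom (some_chart A p)"
    unfolding some_chart_def by (rule someI_ex) (use chart_at[of p] in blast)
  then show "some_chart A p \<in> A" "p \<in> chart_dom (some_chart A p)" by simp_all
qed

text \<open>The common source for restriction, reversal and joining of curves.\<close>

lemma C1_curve_on_affine:
  assumes C: "C1_curve_on A a' b' \<gamma>" and sub: "(\<lambda>t. m * t + k) ` {a..b} \<subseteq> {a'..b'}"
    and eq: "\<And>t. t \<in> {a..b} \<Longrightarrow> \<delta> t = \<gamma> (m * t + k)"
  shows "C1_curve_on A a b \<delta>"
  unfolding C1_curve_on_def
proof
  fix c assume "c \<in> A"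
  then obtain D where D: "continuous_on {t\<in>{a'..b'}. \<gamma> t \<in> chart_dom c} D"
    "\<And>t. t \<in> {a'..b'} \<Longrightarrow> \<gamma> t \<in> chart_dom c \<Longrightarrow> ((chart_map c \<circ> \<gamma>) has_vector_derivative D t) (at t within {a'..b'})"
    using C unfolding C1_curve_on_def by meson
  let ?f = "\<lambda>t. m * t + k"
  have fin: "?f t \<in> {a'..b'}" if "t \<in> {a..b}" for t using sub that by blast
  have "continuous_on {t\<in>{a..b}. \<delta> t \<in> chart_dom c} (\<lambda>t. m *\<^sub>R D (?f t))"
    using fin eq by (intro continuous_intros continuous_on_compose2[OF D(1)]) auto
  moreover have "((chart_map c \<circ> \<delta>) has_vector_derivative m *\<^sub>R D (?f t)) (at t within {a..b})"
    if t: "t \<in> {a..b}" "\<delta> t \<in> chart_dom c" for t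
  proof -
    have f: "(?f has_vector_derivative m) (at t within {a..b})"
      by (auto intro!: derivative_eq_intros)
    have "((chart_map c \<circ> \<gamma>) has_vector_derivative D (?f t)) (at (?f t) within ?f ` {a..b})"
      using D(2)[of "?f t"] fin[OF t(1)] t eq[OF t(1)] by (intro has_vector_derivative_within_subset[OF _ sub]) auto
    from vector_diff_chain_within[OF f this] show ?thesis
      by (rule has_vector_derivative_transform[OF t(1), rotated]) (simp add: eq)
  qed
  ultimately show "\<exists>D. continuous_on {t\<in>{a..b}. \<delta> t \<in> chart_dom c} D \<and>
      (\<forall>t\<in>{a..b}. \<delta> t \<in> chart_dom c \<longrightarrow> ((chart_map c \<circ> \<delta>) has_vector_derivative D t) (at t within {a..b}))"
    by (intro exI[of _ "\<lambda>t. m *\<^sub>R D (?f t)"]) blast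
qed

lemma piecewise_C1_path_const: "piecewise_C1_path A (\<lambda>t. p)"
  unfolding piecewise_C1_path_def C1_curve_on_def path_def
  by (auto intro!: exI[of _ "{}"] exI[of _ "\<lambda>t. 0"] simp: o_def)

text \<open>Break points are pulled back by the affine map; it degenerates for \<open>u = v\<close>,
  where the subcurve is constant.\<close>

lemma piecewise_C1_path_subcurve:
  assumes "piecewise_C1_path A \<gamma>" and u: "u \<in> {0..1}" and v: "v \<in> {0..1}"
  shows "piecewise_C1_path A (subcurve u v \<gamma>)"
proof (cases "u = v")
  case True
  then show ?thesis using piecewise_C1_path_const[of "\<gamma> v"] by (simp add: subcurve_def[abs_def])
next
  case False
  obtain T where T: "finite T" "\<And>a b. 0 \<le> a \<Longrightarrow> a < b \<Longrightarrow> b \<le> 1 \<Longrightarrow> {a<..<b} \<inter> T = {} \<Longrightarrow> C1_curve_on A a b \<gamma>"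
    and p: "path \<gamma>" using assms(1) unfolding piecewise_C1_path_def by blast
  let ?f = "\<lambda>t. (v - u) * t + u"
  have "C1_curve_on A a b (subcurve u v \<gamma>)"
    if ab: "0 \<le> a" "a < b" "b \<le> 1" and dis: "{a<..<b} \<inter> (\<lambda>t. (t - u) / (v - u)) ` T = {}" for a b
  proof (rule C1_curve_on_affine)
    \<comment> \<open>The affine map may be decreasing, hence minimum and maximum.\<close>
    let ?a = "min (?f a) (?f b)" and ?b = "max (?f a) (?f b)"
    have cvx: "?f t \<in> {0..1}" if "t \<in> {0..1}" for t
      by (rule subcurve_arg_in[OF u v that])
    have mm: "min x y < max x y" if "x \<noteq> y" for x y :: real using that by (auto simp: min_def max_def)
    have ne: "?a < ?b" using False ab by (intro mm) simp
    have pre: "{?a<..<?b} \<inter> T = {}"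
    proof -
      have False if s: "s \<in> T" "?a < s" "s < ?b" for s
      proof -
        have "(s - u) / (v - u) \<in> {a<..<b}"
        proof (cases "u < v")
          case True
          then have "?f a < ?f b" using ab by simp
          then have "a * (v - u) < s - u" "s - u < b * (v - u)" using s(2,3) by (simp_all add: min_def max_def mult.commute)
          then show ?thesis using True by (simp add: pos_less_divide_eq pos_divide_less_eq)
        next
          case False
          then have uv: "v < u" using \<open>u \<noteq> v\<close> by simp
          then have "?f b < ?f a" using ab by simp
          then have "s - u < a * (v - u)" "b * (v - u) < s - u" using s(2,3) by (simp_all add: min_def max_def mult.commute)
          then show ?thesis using uv by (simp add: neg_less_divide_eq neg_divide_less_eq)
        qed
        then show False using dis s(1) by blast
      qed
      then show ?thesis by force
    qed
    show "C1_curve_on A ?a ?b \<gamma>"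
      using cvx[of a] cvx[of b] ab ne pre by (intro T(2)) auto
    show "?f ` {a..b} \<subseteq> {?a..?b}"
    proof
      fix y assume "y \<in> ?f ` {a..b}"
      then obtain t where t: "t \<in> {a..b}" "y = ?f t" by blast
      show "y \<in> {?a..?b}"
        using t mult_left_mono[of a t "v - u"] mult_left_mono[of t b "v - u"]
          mult_left_mono_neg[of a t "v - u"] mult_left_mono_neg[of t b "v - u"]
        by (cases "u \<le> v") auto
    qed
  qed (simp add: subcurve_def)
  moreover have "path (subcurve u v \<gamma>)" using p u v by (rule path_subcurve)
  ultimately show ?thesis
    unfolding piecewise_C1_path_def using T(1) by (intro conjI exI[of _ "(\<lambda>t. (t - u) / (v - u)) ` T"]) auto
qed

lemma piecewise_C1_path_join:
  assumes "piecewise_C1_path A \<gamma>" "piecewise_C1_path A \<delta>" "pathfinish \<gamma> = pathstart \<delta>"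
  shows "piecewise_C1_path A (\<gamma> +++ \<delta>)"
proof -
  obtain T where T: "finite T" "\<And>a b. 0 \<le> a \<Longrightarrow> a < b \<Longrightarrow> b \<le> 1 \<Longrightarrow> {a<..<b} \<inter> T = {} \<Longrightarrow> C1_curve_on A a b \<gamma>"
    and p: "path \<gamma>" using assms(1) unfolding piecewise_C1_path_def by blast
  obtain T' where T': "finite T'" "\<And>a b. 0 \<le> a \<Longrightarrow> a < b \<Longrightarrow> b \<le> 1 \<Longrightarrow> {a<..<b} \<inter> T' = {} \<Longrightarrow> C1_curve_on A a b \<delta>"
    and p': "path \<delta>" using assms(2) unfolding piecewise_C1_path_def by blast
  let ?T = "insert (1/2) ((\<lambda>t. t / 2) ` T \<union> (\<lambda>t. (t + 1) / 2) ` T')"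
  have "C1_curve_on A a b (\<gamma> +++ \<delta>)"
    if ab: "0 \<le> a" "a < b" "b \<le> 1" and dis: "{a<..<b} \<inter> ?T = {}" for a b
  proof -
    \<comment> \<open>\<open>1/2\<close> belongs to \<open>?T\<close>, so the interval lies in one
      half.\<close>
    have half: "b \<le> 1/2 \<or> 1/2 \<le> a" using dis ab by force
    show ?thesis
    proof (cases "b \<le> 1/2")
      case True
      show ?thesis
      proof (rule C1_curve_on_affine)
        have False if "s \<in> T" "2 * a < s" "s < 2 * b" for s
        proof -
          have "s / 2 \<in> {a<..<b} \<inter> ?T" using that by auto
          then show False using dis by blast
        qed
        then show "C1_curve_on A (2 * a) (2 * b) \<gamma>" using ab True by (intro T(2)) force+
        show "(\<lambda>t. 2 * t + 0) ` {a..b} \<subseteq> {2 * a..2 * b}" by auto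
      qed (use True in \<open>auto simp: joinpaths_def\<close>)
    next
      case False
      show ?thesis
      proof (rule C1_curve_on_affine)
        have False if "s \<in> T'" "2 * a - 1 < s" "s < 2 * b - 1" for s
        proof -
          have "(s + 1) / 2 \<in> {a<..<b} \<inter> ?T" using that by auto
          then show False using dis by blast
        qed
        then show "C1_curve_on A (2 * a - 1) (2 * b - 1) \<delta>" using ab False half by (intro T'(2)) force+
        show "(\<lambda>t. 2 * t + - 1) ` {a..b} \<subseteq> {2 * a - 1..2 * b - 1}" by auto
      next
        fix t assume "t \<in> {a..b}"
        then have "1/2 \<le> t" using False half by auto
        then show "(\<gamma> +++ \<delta>) t = \<delta> (2 * t + - 1)"
          using assms(3) join_eq[of \<gamma> \<delta> t] by simp
      qed
    qed
  qed
  moreover have "path (\<gamma> +++ \<delta>)" using p p' assms(3) by simp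
  ultimately show ?thesis
    unfolding piecewise_C1_path_def using T(1) T'(1) by (intro conjI exI[of _ ?T]) auto
qed

lemma C1_path_derivative:
  assumes C: "\<And>a b. 0 \<le> a \<Longrightarrow> a < b \<Longrightarrow> b \<le> 1 \<Longrightarrow> {a<..<b} \<inter> T = {} \<Longrightarrow> C1_curve_on A a b \<gamma>"
    and T: "finite T" and c: "c \<in> A" and t: "t \<in> {0<..<1} - T" "\<gamma> t \<in> chart_dom c"
  shows "((chart_map c \<circ> \<gamma>) has_vector_derivative vector_derivative (chart_map c \<circ> \<gamma>) (at t)) (at t)"
proof -
  have "finite (insert 0 (insert 1 T))" using T by simp
  then obtain d where d: "d > 0" "\<And>x. x \<in> insert 0 (insert 1 T) \<Longrightarrow> x \<noteq> t \<Longrightarrow> d \<le> dist t x"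
    using finite_set_avoid[of "insert 0 (insert 1 T)" t] by metis
  have dis: "{t - d<..<t + d} \<inter> T = {}" using d(2) t(1) by (force simp: dist_real_def)
  have ab: "0 \<le> t - d" "t + d \<le> 1" using d(2)[of 0] d(2)[of 1] t(1) by (auto simp: dist_real_def)
  have "C1_curve_on A (t - d) (t + d) \<gamma>" using d(1) by (intro C ab dis) auto
  then obtain D where "((chart_map c \<circ> \<gamma>) has_vector_derivative D t) (at t within {t - d..t + d})"
    using c t(2) d(1) unfolding C1_curve_on_def by force
  then have "((chart_map c \<circ> \<gamma>) has_vector_derivative D t) (at t)"
    using d(1) by (simp add: at_within_Icc_at)
  then show ?thesis by (simp add: vector_derivative_at)
qed

lemma C1_path_piecewise_cont:
  assumes C: "\<And>a b. 0 \<le> a \<Longrightarrow> a < b \<Longrightarrow> b \<le> 1 \<Longrightarrow> {a<..<b} \<inter> T = {} \<Longrightarrow> C1_curve_on A a b \<gamma>"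
    and T: "finite T" and c: "c \<in> A" and ab: "0 \<le> a" "b \<le> 1" "\<gamma> ` {a..b} \<subseteq> chart_dom c"
  shows "piecewise_cont a b (\<lambda>t. vector_derivative (chart_map c \<circ> \<gamma>) (at t)) T"
  unfolding piecewise_cont_def
proof (intro conjI allI impI T)
  fix p q assume pq: "a \<le> p \<and> p < q \<and> q \<le> b \<and> {p<..<q} \<inter> T = {}"
  then have "C1_curve_on A p q \<gamma>" using ab by (intro C) auto
  then obtain D where D: "continuous_on {t\<in>{p..q}. \<gamma> t \<in> chart_dom c} D"
    "\<forall>t\<in>{p..q}. \<gamma> t \<in> chart_dom c \<longrightarrow> ((chart_map c \<circ> \<gamma>) has_vector_derivative D t) (at t within {p..q})"
    using c unfolding C1_curve_on_def by meson
  have in_dom: "\<gamma> t \<in> chart_dom c" if "t \<in> {p..q}" for t using ab(3) pq that by auto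
  then have "{t\<in>{p..q}. \<gamma> t \<in> chart_dom c} = {p..q}" by blast
  moreover have "vector_derivative (chart_map c \<circ> \<gamma>) (at t) = D t" if "t \<in> {p<..<q}" for t
  proof (rule vector_derivative_at)
    have "((chart_map c \<circ> \<gamma>) has_vector_derivative D t) (at t within {p..q})"
      using D(2) in_dom that by auto
    then show "((chart_map c \<circ> \<gamma>) has_vector_derivative D t) (at t)"
      using that by (simp add: at_within_Icc_at)
  qed
  ultimately show "\<exists>h. continuous_on {p..q} h \<and> (\<forall>t\<in>{p<..<q}. vector_derivative (chart_map c \<circ> \<gamma>) (at t) = h t)"
    using D(1) by (intro exI[of _ D]) simp
qed

lemma transition_chart_eq: "c \<in> A \<Longrightarrow> p \<in> chart_dom c \<Longrightarrow> transition c c' (chart_map c p) = chart_map c' p"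
  by (simp add: transition_def chart_inv_map)

lemma chart_map_in_overlap: "p \<in> chart_dom c \<Longrightarrow> p \<in> chart_dom c' \<Longrightarrow> chart_map c p \<in> overlap c c'"
  by (simp add: overlap_def)

end

section \<open>Speed and length\<close>

context riemannian_manifold
begin

lemma local_metric: "c \<in> A \<Longrightarrow> local_metric (chart_img c) (g c)"
  by unfold_locales (auto intro: open_img metric_smooth metric_symmetric metric_positive)

lemma transition_isometry:
  assumes c: "c \<in> A" "c' \<in> A" and x: "x \<in> overlap c c'"
  shows "metric_inner (g c) x u v = metric_inner (g c') (transition c c' x) (dir_deriv (transition c c') u x) (dir_deriv (transition c c') v x)"
proof -
  let ?J = "jacobian_matrix (transition c c') x"
  have "linear (\<lambda>v. dir_deriv (transition c c') v x)" by (rule linear_dir_deriv[OF smooth_transition[OF c] x])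
  from fun_cong[OF matrix_vector_mul(2)[OF this]]
  have J: "?J *v u = dir_deriv (transition c c') u x" for u
    by (simp add: jacobian_matrix_def dir_deriv_def)
  have "metric_inner (g c) x u v = u \<bullet> (transpose ?J *v (g c' (transition c c' x) *v (?J *v v)))"
    unfolding metric_inner_def metric_transform[OF c x] by (simp only: matrix_vector_mul_assoc matrix_mul_assoc)
  also have "\<dots> = (?J *v u) \<bullet> (g c' (transition c c' x) *v (?J *v v))"
    by (metis dot_lmul_matrix inner_commute transpose_matrix_vector)
  finally show ?thesis unfolding metric_inner_def J .
qed

text \<open>Independence of the chart picked by \<open>some_chart\<close>: the velocity transforms
  by the differential of the transition map, which is an isometry. Continuity keeps the curve inside
  \<open>c\<close> near \<open>t\<close>, where the transition map applies.\<close>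

lemma speed_eq:
  assumes c: "c \<in> A" and p: "\<gamma> t \<in> chart_dom c" and cont: "isCont \<gamma> t"
    and d: "((chart_map c \<circ> \<gamma>) has_vector_derivative v) (at t)"
  shows "speed A g \<gamma> t = sqrt (metric_inner (g c) (chart_map c (\<gamma> t)) v v)"
proof -
  define c' where "c' = some_chart A (\<gamma> t)"
  have c': "c' \<in> A" "\<gamma> t \<in> chart_dom c'" using some_chart by (auto simp: c'_def)
  let ?\<tau> = "transition c c'" and ?x = "chart_map c (\<gamma> t)"
  have x: "?x \<in> overlap c c'" using p c'(2) by (rule chart_map_in_overlap)
  obtain T where T: "open T" "t \<in> T" "\<And>s. s \<in> T \<Longrightarrow> \<gamma> s \<in> chart_dom c"
    using cont open_dom[OF c] p unfolding continuous_at_open by metis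
  have x': "(chart_map c \<circ> \<gamma>) t \<in> overlap c c'" using x by simp
  have "((\<lambda>s. ?\<tau> (chart_map c (\<gamma> s))) has_vector_derivative dir_deriv ?\<tau> v ?x) (at t)"
    using dir_deriv_curve[OF smooth_transition[OF c c'(1)] x' d] by (simp only: o_apply)
  then have "((chart_map c' \<circ> \<gamma>) has_vector_derivative dir_deriv ?\<tau> v ?x) (at t)"
    by (rule has_vector_derivative_transform_within_open[OF _ T(1,2)]) (auto simp: transition_chart_eq[OF c] T(3))
  then have "vector_derivative (chart_map c' \<circ> \<gamma>) (at t) = dir_deriv ?\<tau> v ?x" by (rule vector_derivative_at)
  then show ?thesis
    using transition_isometry[OF c c'(1) x, of v v] transition_chart_eq[OF c p, of c']
    by (simp add: speed_def Let_def c'_def)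
qed

lemma speed_nonneg: "speed A g \<gamma> t \<ge> 0"
proof -
  interpret L: local_metric "chart_img (some_chart A (\<gamma> t))" "g (some_chart A (\<gamma> t))"
    by (rule local_metric[OF some_chart(1)])
  show ?thesis unfolding speed_def Let_def
    by (intro real_sqrt_ge_zero L.ip_nonneg chart_map_in some_chart(2))
qed

text \<open>The formula holds off the break points and the ends. This suffices for the integral: the
  coordinate expression is piecewise continuous, and finitely many values may be changed.\<close>

lemma speed_pw:
  assumes C: "\<And>a b. 0 \<le> a \<Longrightarrow> a < b \<Longrightarrow> b \<le> 1 \<Longrightarrow> {a<..<b} \<inter> T = {} \<Longrightarrow> C1_curve_on A a b \<gamma>"
    and T: "finite T" and p: "path \<gamma>" and c: "c \<in> A" and ab: "0 \<le> a" "b \<le> 1" "\<gamma> ` {a..b} \<subseteq> chart_dom c"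
  shows "\<And>t. t \<in> {a<..<b} - T \<Longrightarrow> speed A g \<gamma> t = sqrt (metric_inner (g c) (chart_map c (\<gamma> t))
     (vector_derivative (chart_map c \<circ> \<gamma>) (at t)) (vector_derivative (chart_map c \<circ> \<gamma>) (at t)))"
    "speed A g \<gamma> integrable_on {a..b}"
proof -
  interpret L: local_metric "chart_img c" "g c" by (rule local_metric[OF c])
  let ?v = "\<lambda>t. vector_derivative (chart_map c \<circ> \<gamma>) (at t)"
  show eq: "speed A g \<gamma> t = sqrt (L.ip (chart_map c (\<gamma> t)) (?v t) (?v t))" if t: "t \<in> {a<..<b} - T" for t
  proof (rule speed_eq[OF c])
    show "\<gamma> t \<in> chart_dom c" using t ab(3) by auto
    have "continuous_on {0<..<1} \<gamma>" using p unfolding path_def by (rule continuous_on_subset) auto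
    then show "isCont \<gamma> t" using t ab by (simp add: continuous_on_eq_continuous_at)
    show "((chart_map c \<circ> \<gamma>) has_vector_derivative ?v t) (at t)"
      using t ab by (intro C1_path_derivative[OF C T c]) auto
  qed
  have "continuous_on {a..b} \<gamma>"
    using p unfolding path_def by (rule continuous_on_subset) (use ab in auto)
  then have zc: "continuous_on {a..b} (\<lambda>t. chart_map c (\<gamma> t))"
    by (rule continuous_on_compose2[OF continuous_chart_map[OF c] _ ab(3)])
  have z: "chart_map c (\<gamma> t) \<in> chart_img c" if "t \<in> {a..b}" for t
    using ab(3) that by (intro chart_map_in) auto
  have "continuous_on ({a..b} \<times> UNIV) (\<lambda>x. chart_map c (\<gamma> (fst x)))"
    by (rule continuous_on_compose2[OF zc]) (auto intro: continuous_intros)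
  then have "continuous_on ({a..b} \<times> UNIV) (\<lambda>x. L.ip (chart_map c (\<gamma> (fst x))) (snd x) (snd x))"
    using z by (intro L.continuous_on_ip continuous_intros) auto
  then have "continuous_on ({a..b} \<times> UNIV) (\<lambda>(t, y). sqrt (L.ip (chart_map c (\<gamma> t)) y y))"
    unfolding case_prod_unfold by (rule continuous_on_real_sqrt)
  from piecewise_cont_compose[OF C1_path_piecewise_cont[OF C T c ab] this]
  have "piecewise_cont a b (\<lambda>t. sqrt (L.ip (chart_map c (\<gamma> t)) (?v t) (?v t))) T" .
  then have "(\<lambda>t. sqrt (L.ip (chart_map c (\<gamma> t)) (?v t) (?v t))) integrable_on {a..b}"
    by (rule piecewise_cont_integrable)
  then show "speed A g \<gamma> integrable_on {a..b}"
    by (rule integrable_spike_finite[rotated 2, of _ _ "insert a (insert b T)"]) (use T eq in auto)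
qed

lemma path_in_chart_nearby:
  assumes p: "path \<gamma>" and x: "x \<in> {0..1}" and c: "c \<in> A" "\<gamma> x \<in> chart_dom c"
  obtains d where "d > 0" "\<And>s. s \<in> {0..1} \<Longrightarrow> \<bar>s - x\<bar> < d \<Longrightarrow> \<gamma> s \<in> chart_dom c"
proof -
  have "openin (top_of_set {0..1}) ({0..1} \<inter> \<gamma> -` chart_dom c)"
    using continuous_openin_preimage_gen[OF p[unfolded path_def] open_dom[OF c(1)]] .
  then obtain d where "d > 0" "ball x d \<inter> {0..1} \<subseteq> {0..1} \<inter> \<gamma> -` chart_dom c"
    using x c(2) unfolding openin_contains_ball by blast
  then show thesis by (intro that[of d]) (auto simp: ball_def dist_real_def abs_minus_commute)
qed

text \<open>A curve need not lie in a single chart, so integrability inside charts is assembled by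
  bisection of the interval.\<close>

lemma speed_integrable:
  assumes "piecewise_C1_path A \<gamma>"
  shows "speed A g \<gamma> integrable_on {0..1}"
proof -
  obtain T where T: "finite T" "\<And>a b. 0 \<le> a \<Longrightarrow> a < b \<Longrightarrow> b \<le> 1 \<Longrightarrow> {a<..<b} \<inter> T = {} \<Longrightarrow> C1_curve_on A a b \<gamma>"
    and p: "path \<gamma>" using assms(1) unfolding piecewise_C1_path_def by blast
  define P where "P a b \<longleftrightarrow> (0 \<le> a \<and> b \<le> 1 \<longrightarrow> speed A g \<gamma> integrable_on {a..b})" for a b
  have "P 0 1"
  proof (rule Bolzano)
    fix a b c assume "P a b" "P b c" "a \<le> b" "b \<le> c"
    then show "P a c"
      unfolding P_def by (auto intro: Henstock_Kurzweil_Integration.integrable_combine[of a b c])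
  next
    fix x :: real assume x: "0 \<le> x" "x \<le> 1"
    obtain c where c: "c \<in> A" "\<gamma> x \<in> chart_dom c" using chart_at by metis
    obtain d where d: "d > 0" "\<And>s. s \<in> {0..1} \<Longrightarrow> \<bar>s - x\<bar> < d \<Longrightarrow> \<gamma> s \<in> chart_dom c"
      using path_in_chart_nearby[OF p _ c] x by auto
    have "speed A g \<gamma> integrable_on {a..b}" if "a \<le> x" "x \<le> b" "b - a < d" "0 \<le> a" "b \<le> 1" for a b
      by (rule speed_pw(2)[OF T(2) T(1) p c(1)]) (use that d(2) in auto)
    then show "\<exists>d>0. \<forall>a b. a \<le> x \<and> x \<le> b \<and> b - a < d \<longrightarrow> P a b"
      unfolding P_def using d(1) by (intro exI[of _ d]) simp
  qed simp
  then show ?thesis by (simp add: P_def)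
qed

text \<open>Agreement of \<delta> with the reparametrised \<gamma> is asked only near
  \<open>t\<close>, since a join agrees with either path on one half.\<close>

lemma speed_affine:
  assumes C: "\<And>a b. 0 \<le> a \<Longrightarrow> a < b \<Longrightarrow> b \<le> 1 \<Longrightarrow> {a<..<b} \<inter> T = {} \<Longrightarrow> C1_curve_on A a b \<gamma>"
    and T: "finite T" and p: "path \<gamma>" and s: "m * t + k \<in> {0<..<1} - T"
    and U: "open U" "t \<in> U" "\<And>r. r \<in> U \<Longrightarrow> \<delta> r = \<gamma> (m * r + k)"
  shows "speed A g \<delta> t = \<bar>m\<bar> * speed A g \<gamma> (m * t + k)"
proof -
  let ?s = "m * t + k"
  obtain c where c: "c \<in> A" "\<gamma> ?s \<in> chart_dom c" using chart_at by metis
  interpret L: local_metric "chart_img c" "g c" by (rule local_metric[OF c(1)])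
  define v where "v = vector_derivative (chart_map c \<circ> \<gamma>) (at ?s)"
  have d: "((chart_map c \<circ> \<gamma>) has_vector_derivative v) (at ?s)"
    unfolding v_def by (rule C1_path_derivative[OF C T c(1) s c(2)])
  have "continuous_on {0<..<1} \<gamma>" using p unfolding path_def by (rule continuous_on_subset) auto
  then have cont: "isCont \<gamma> ?s" using s by (simp add: continuous_on_eq_continuous_at)
  have f: "((\<lambda>r. m * r + k) has_vector_derivative m) (at t)" by (auto intro!: derivative_eq_intros)
  have "((chart_map c \<circ> \<gamma>) \<circ> (\<lambda>r. m * r + k) has_vector_derivative m *\<^sub>R v) (at t)"
    by (rule vector_diff_chain_at[OF f d])
  then have "((chart_map c \<circ> \<delta>) has_vector_derivative m *\<^sub>R v) (at t)"
    by (rule has_vector_derivative_transform_within_open[OF _ U(1,2)]) (simp add: U(3))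
  moreover have "isCont \<delta> t"
  proof -
    have "isCont (\<lambda>r. m * r + k) t" by (intro continuous_intros)
    then have 1: "isCont (\<lambda>r. \<gamma> (m * r + k)) t" using cont by (rule isCont_o2)
    have "\<forall>\<^sub>F r in nhds t. \<delta> r = \<gamma> (m * r + k)" using U unfolding eventually_nhds by blast
    from isCont_cong[OF this] show ?thesis using 1 by simp
  qed
  ultimately have "speed A g \<delta> t = sqrt (L.ip (chart_map c (\<delta> t)) (m *\<^sub>R v) (m *\<^sub>R v))"
    using c U by (intro speed_eq) auto
  also have "\<dots> = \<bar>m\<bar> * sqrt (L.ip (chart_map c (\<gamma> ?s)) v v)"
    using U(2,3) by (simp add: ip_simps real_sqrt_mult mult.assoc[symmetric] flip: power2_eq_square)
  also have "sqrt (L.ip (chart_map c (\<gamma> ?s)) v v) = speed A g \<gamma> ?s"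
    by (rule speed_eq[OF c cont d, symmetric])
  finally show ?thesis .
qed

lemma speed_affine_integral:
  assumes "piecewise_C1_path A \<gamma>" and m: "m \<noteq> 0"
    and im: "(\<lambda>t. m * t + k) ` {a..b} = {p..q}" "{p..q} \<subseteq> {0..1}"
    and eq: "\<And>t. t \<in> {a..b} \<Longrightarrow> \<delta> t = \<gamma> (m * t + k)"
  shows "(speed A g \<delta> has_integral integral {p..q} (speed A g \<gamma>)) {a..b}"
proof -
  obtain T where T: "finite T" "\<And>a b. 0 \<le> a \<Longrightarrow> a < b \<Longrightarrow> b \<le> 1 \<Longrightarrow> {a<..<b} \<inter> T = {} \<Longrightarrow> C1_curve_on A a b \<gamma>"
    and pth: "path \<gamma>" using assms(1) unfolding piecewise_C1_path_def by blast
  have "(speed A g \<gamma> has_integral integral {p..q} (speed A g \<gamma>)) {p..q}"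
    using integrable_on_subinterval[OF speed_integrable[OF assms(1)] im(2)] by (rule integrable_integral)
  from has_integral_affine_real[OF this m im(1)]
  have h: "((\<lambda>t. \<bar>m\<bar> * speed A g \<gamma> (m * t + k)) has_integral integral {p..q} (speed A g \<gamma>)) {a..b}" .
  let ?E = "insert a (insert b ((\<lambda>s. (s - k) / m) ` insert 0 (insert 1 T)))"
  show ?thesis
  proof (rule has_integral_spike_finite[of ?E _ _ "\<lambda>t. \<bar>m\<bar> * speed A g \<gamma> (m * t + k)"])
    fix t assume t: "t \<in> {a..b} - ?E"
    then have tt: "t \<in> {a<..<b}" by auto
    have "m * t + k \<notin> insert 0 (insert 1 T)"
    proof
      assume "m * t + k \<in> insert 0 (insert 1 T)"
      then have "(m * t + k - k) / m \<in> (\<lambda>s. (s - k) / m) ` insert 0 (insert 1 T)" by (rule imageI)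
      then show False using m t by simp
    qed
    moreover have "m * t + k \<in> {p..q}" unfolding im(1)[symmetric] by (rule imageI) (use t in blast)
    then have "m * t + k \<in> {0..1}" using im(2) by blast
    ultimately have r: "m * t + k \<in> {0<..<1} - T" by auto
    show "speed A g \<delta> t = \<bar>m\<bar> * speed A g \<gamma> (m * t + k)"
      by (rule speed_affine[OF _ T(1) pth r open_greaterThanLessThan tt]) (use T(2) in blast, use eq in auto)
  next
    show "finite ?E" using T(1) by simp
  qed (rule h)
qed

lemma curve_length_subcurve:
  assumes "piecewise_C1_path A \<gamma>" "0 \<le> u" "u < v" "v \<le> 1"
  shows "curve_length A g (subcurve u v \<gamma>) = integral {u..v} (speed A g \<gamma>)"
    "curve_length A g (subcurve v u \<gamma>) = integral {u..v} (speed A g \<gamma>)"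
proof -
  have "(\<lambda>t. (v - u) * t + u) ` {0..1} = {u..v}"
    using assms by (subst image_affinity_atLeastAtMost[of "v - u" u 0 1]) (auto simp: algebra_simps)
  from speed_affine_integral[OF assms(1) _ this, of "subcurve u v \<gamma>"] assms
  show "curve_length A g (subcurve u v \<gamma>) = integral {u..v} (speed A g \<gamma>)"
    by (simp add: curve_length_def subcurve_def integral_unique)
  have "(\<lambda>t. (u - v) * t + v) ` {0..1} = {u..v}"
    using assms by (subst image_affinity_atLeastAtMost[of "u - v" v 0 1]) (auto simp: algebra_simps)
  from speed_affine_integral[OF assms(1) _ this, of "subcurve v u \<gamma>"] assms
  show "curve_length A g (subcurve v u \<gamma>) = integral {u..v} (speed A g \<gamma>)"
    by (simp add: curve_length_def subcurve_def integral_unique)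
qed

lemma curve_length_join:
  assumes "piecewise_C1_path A \<gamma>" "piecewise_C1_path A \<delta>" "pathfinish \<gamma> = pathstart \<delta>"
  shows "curve_length A g (\<gamma> +++ \<delta>) = curve_length A g \<gamma> + curve_length A g \<delta>"
proof -
  have i1: "(\<lambda>t. 2 * t + 0) ` {0..1/2} = {0..1::real}"
    by (subst image_affinity_atLeastAtMost[of 2 0 0 "1/2"]) auto
  have i2: "(\<lambda>t. 2 * t + - 1) ` {1/2..1} = {0..1::real}"
    by (subst image_affinity_atLeastAtMost[of 2 "-1" "1/2" 1]) auto
  have "(speed A g (\<gamma> +++ \<delta>) has_integral integral {0..1} (speed A g \<gamma>)) {0..1/2}"
    by (rule speed_affine_integral[OF assms(1) _ i1]) (auto simp: joinpaths_def)
  moreover have "(speed A g (\<gamma> +++ \<delta>) has_integral integral {0..1} (speed A g \<delta>)) {1/2..1}"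
  proof (rule speed_affine_integral[OF assms(2) _ i2])
    fix t :: real assume "t \<in> {1/2..1}"
    then show "(\<gamma> +++ \<delta>) t = \<delta> (2 * t + - 1)"
      using assms(3) join_eq[of \<gamma> \<delta> t] by simp
  qed auto
  ultimately have "(speed A g (\<gamma> +++ \<delta>) has_integral (integral {0..1} (speed A g \<gamma>) + integral {0..1} (speed A g \<delta>))) {0..1}"
    by (intro has_integral_combine[of 0 "1/2" 1]) auto
  then show ?thesis by (simp add: curve_length_def integral_unique)
qed

text \<open>The bridge from coordinates: a continuously differentiable coordinate curve is regular
  in every other chart it meets, by smoothness of the transition maps, and its length can be
  computed in \<open>c\<close>.\<close>

lemma chart_curve:
  assumes c: "c \<in> A" and x: "\<And>t. t \<in> {0..1} \<Longrightarrow> x t \<in> chart_img c"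
    and dx: "\<And>t. t \<in> {0..1} \<Longrightarrow> (x has_vector_derivative x' t) (at t within {0..1})"
    and cx: "continuous_on {0..1} x'"
  shows "piecewise_C1_path A (chart_inv c \<circ> x)"
    "curve_length A g (chart_inv c \<circ> x) = integral {0..1} (\<lambda>t. sqrt (metric_inner (g c) (x t) (x' t) (x' t)))"
proof -
  have xc: "continuous_on {0..1} x" by (rule continuous_on_vector_derivative) (rule dx)
  have p: "path (chart_inv c \<circ> x)"
    unfolding path_def o_def using x by (intro continuous_on_compose2[OF continuous_chart_inv[OF c] xc]) auto
  have C: "C1_curve_on A a b (chart_inv c \<circ> x)" if ab: "0 \<le> a" "a < b" "b \<le> 1" for a b
    unfolding C1_curve_on_def
  proof
    fix c' assume c': "c' \<in> A"
    let ?\<tau> = "transition c c'" and ?S = "{t\<in>{a..b}. (chart_inv c \<circ> x) t \<in> chart_dom c'}"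
    have ov: "x t \<in> overlap c c'" if "t \<in> ?S" for t using that x[of t] ab by (auto simp: overlap_iff[OF c])
    have "continuous_on ?S (\<lambda>t. dir_deriv ?\<tau> (x' t) (x t))"
      using ov ab by (intro continuous_on_dir_deriv[OF smooth_transition[OF c c']] continuous_on_subset[OF xc] continuous_on_subset[OF cx]) auto
    moreover have "((chart_map c' \<circ> (chart_inv c \<circ> x)) has_vector_derivative dir_deriv ?\<tau> (x' t) (x t)) (at t within {a..b})"
      if "t \<in> ?S" for t
    proof -
      have "(x has_vector_derivative x' t) (at t within {a..b})"
        using that ab by (intro has_vector_derivative_within_subset[OF dx]) auto
      from dir_deriv_curve[OF smooth_transition[OF c c'] ov[OF that] this] show ?thesis
        by (simp add: transition_def o_def)
    qed
    ultimately show "\<exists>D. continuous_on ?S D \<and>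
      (\<forall>t\<in>{a..b}. (chart_inv c \<circ> x) t \<in> chart_dom c' \<longrightarrow> ((chart_map c' \<circ> (chart_inv c \<circ> x)) has_vector_derivative D t) (at t within {a..b}))"
      by (intro exI[of _ "\<lambda>t. dir_deriv ?\<tau> (x' t) (x t)"]) blast
  qed
  show "piecewise_C1_path A (chart_inv c \<circ> x)"
    unfolding piecewise_C1_path_def using p C by blast
  show "curve_length A g (chart_inv c \<circ> x) = integral {0..1} (\<lambda>t. sqrt (metric_inner (g c) (x t) (x' t) (x' t)))"
    unfolding curve_length_def
  proof (rule integral_spike[of "{0, 1}"])
    fix t :: real assume t: "t \<in> {0..1} - {0, 1}"
    then have t': "t \<in> {0<..<1}" by auto
    have "continuous_on {0<..<1} (chart_inv c \<circ> x)" using p unfolding path_def by (rule continuous_on_subset) auto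
    then have cont: "isCont (chart_inv c \<circ> x) t" using t' by (simp add: continuous_on_eq_continuous_at o_def)
    have "(x has_vector_derivative x' t) (at t)" using dx[of t] t' by (simp add: at_within_Icc_at)
    then have "((chart_map c \<circ> (chart_inv c \<circ> x)) has_vector_derivative x' t) (at t)"
    proof (rule has_vector_derivative_transform_within_open[of _ _ _ "{0<..<1}"])
      fix s :: real assume "s \<in> {0<..<1}"
      then show "x s = (chart_map c \<circ> (chart_inv c \<circ> x)) s" by (simp add: chart_map_inv[OF c] x)
    qed (use t' in simp_all)
    from speed_eq[OF c _ cont this] t'
    show "sqrt (metric_inner (g c) (x t) (x' t) (x' t)) = speed A g (chart_inv c \<circ> x) t"
      by (simp add: chart_inv_in[OF c] x chart_map_inv[OF c])
  qed simp
qed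

end

section \<open>The Riemannian distance\<close>

text \<open>The integral of the square of \<open>f - m\<close>, with \<open>m\<close> the mean, is
  nonnegative. It compares length with energy.\<close>

lemma integral_square_le:
  fixes f :: "real \<Rightarrow> real"
  assumes "continuous_on {0..1} f"
  shows "(integral {0..1} f)\<^sup>2 \<le> integral {0..1} (\<lambda>t. (f t)\<^sup>2)"
proof -
  define m where "m = integral {0..1} f"
  have f: "f integrable_on {0..1}" "(\<lambda>t. (f t)\<^sup>2) integrable_on {0..1}"
    using assms by (auto intro!: integrable_continuous_real continuous_intros)
  have "((\<lambda>t. (f t)\<^sup>2 - 2 * m * f t + m\<^sup>2) has_integral (integral {0..1} (\<lambda>t. (f t)\<^sup>2) - 2 * m * m + m\<^sup>2)) {0..1}"
    using f has_integral_const_real[of "m\<^sup>2" 0 1]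
    by (intro has_integral_add has_integral_diff has_integral_mult_right) (auto simp: m_def)
  moreover have "(f t)\<^sup>2 - 2 * m * f t + m\<^sup>2 \<ge> 0" for t
    using zero_le_power2[of "f t - m"] by (simp add: power2_eq_square algebra_simps)
  ultimately have "0 \<le> integral {0..1} (\<lambda>t. (f t)\<^sup>2) - 2 * m * m + m\<^sup>2"
    using has_integral_nonneg by blast
  then show ?thesis by (simp add: m_def power2_eq_square)
qed

lemma ball_in: "cball x r \<subseteq> S \<Longrightarrow> y \<in> ball x r \<Longrightarrow> y \<in> S"
  using ball_subset_cball by blast

section \<open>Lengths compared with coordinate distances\<close>

context riemannian_manifold
begin

lemma curve_length_nonneg: "piecewise_C1_path A \<gamma> \<Longrightarrow> 0 \<le> curve_length A g \<gamma>"
  unfolding curve_length_def by (rule integral_nonneg[OF speed_integrable]) (auto simp: speed_nonneg)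

lemma riem_dist_le:
  assumes "piecewise_C1_path A \<gamma>" "pathstart \<gamma> = p" "pathfinish \<gamma> = q"
  shows "riem_dist A g p q \<le> curve_length A g \<gamma>"
  unfolding riem_dist_def
  by (rule cInf_lower) (use assms in \<open>auto intro!: bdd_belowI[of _ 0] curve_length_nonneg\<close>)

text \<open>The coordinate segment; it joins nearby points and bounds their distance from
  above.\<close>

lemma chart_segment:
  assumes c: "c \<in> A" and K: "convex K" "K \<subseteq> chart_img c" "x \<in> K" "y \<in> K"
    and Lam: "0 \<le> Lam" "\<And>x v. x \<in> K \<Longrightarrow> metric_inner (g c) x v v \<le> (Lam * norm v)\<^sup>2"
  obtains \<gamma> where "piecewise_C1_path A \<gamma>" "pathstart \<gamma> = chart_inv c x" "pathfinish \<gamma> = chart_inv c y"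
    "curve_length A g \<gamma> \<le> Lam * norm (y - x)"
proof
  interpret L: local_metric "chart_img c" "g c" by (rule local_metric[OF c])
  let ?x = "\<lambda>t. x + t *\<^sub>R (y - x)"
  have xK: "?x t \<in> K" if "t \<in> {0..1}" for t
    using convexD_alt[OF K(1,3,4), of t] that by (simp add: algebra_simps)
  have d: "(?x has_vector_derivative (y - x)) (at t within {0..1})" for t
    by (auto intro!: derivative_eq_intros)
  have xi: "?x t \<in> chart_img c" if "t \<in> {0..1}" for t using xK[OF that] K(2) by blast
  note C = chart_curve[OF c xi d continuous_on_const]
  show "piecewise_C1_path A (chart_inv c \<circ> ?x)" by (rule C(1))
  show "pathstart (chart_inv c \<circ> ?x) = chart_inv c x" "pathfinish (chart_inv c \<circ> ?x) = chart_inv c y"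
    by (simp_all add: pathstart_def pathfinish_def)
  have "curve_length A g (chart_inv c \<circ> ?x) = integral {0..1} (\<lambda>t. sqrt (L.ip (?x t) (y - x) (y - x)))"
    by (rule C(2))
  also have "\<dots> \<le> integral {0..1} (\<lambda>t::real. Lam * norm (y - x))"
  proof (rule integral_le)
    have "continuous_on {0..1} (\<lambda>t. L.ip (?x t) (y - x) (y - x))"
      using xi by (intro L.continuous_on_ip continuous_intros) auto
    then show "(\<lambda>t. sqrt (L.ip (?x t) (y - x) (y - x))) integrable_on {0..1}"
      by (intro integrable_continuous_real continuous_on_real_sqrt)
    fix t :: real assume t: "t \<in> {0..1}"
    show "sqrt (L.ip (?x t) (y - x) (y - x)) \<le> Lam * norm (y - x)"
      by (rule real_le_lsqrt) (use Lam L.ip_nonneg[OF xi[OF t]] xK[OF t] in auto)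
  qed (rule integrable_const_ivl)
  finally show "curve_length A g (chart_inv c \<circ> ?x) \<le> Lam * norm (y - x)" by simp
qed

text \<open>Length in coordinates, with the velocity \<open>vd\<close> as explicit data;
  \<open>geodesic_minimal\<close> and the lower bound below take a curve in this form.\<close>

lemma chart_length_eq:
  assumes "piecewise_C1_path A \<gamma>" and c: "c \<in> A" and b: "0 < b" "b \<le> 1" "\<gamma> ` {0..b} \<subseteq> chart_dom c"
  obtains T vd where "finite T" "piecewise_cont 0 b vd T"
    "\<And>t. t \<in> {0<..<b} - T \<Longrightarrow> ((\<lambda>t. chart_map c (\<gamma> t)) has_vector_derivative vd t) (at t)"
    "continuous_on {0..b} (\<lambda>t. chart_map c (\<gamma> t))"
    "((\<lambda>t. sqrt (metric_inner (g c) (chart_map c (\<gamma> t)) (vd t) (vd t))) has_integral integral {0..b} (speed A g \<gamma>)) {0..b}"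
proof -
  obtain T where T: "finite T" "\<And>a b. 0 \<le> a \<Longrightarrow> a < b \<Longrightarrow> b \<le> 1 \<Longrightarrow> {a<..<b} \<inter> T = {} \<Longrightarrow> C1_curve_on A a b \<gamma>"
    and p: "path \<gamma>" using assms(1) unfolding piecewise_C1_path_def by blast
  let ?vd = "\<lambda>t. vector_derivative (chart_map c \<circ> \<gamma>) (at t)"
  have zero: "(0::real) \<le> 0" by simp
  have dom: "\<gamma> t \<in> chart_dom c" if "t \<in> {0<..<b}" for t using b(3) that by auto
  show thesis
  proof (rule that[of T ?vd])
    show "piecewise_cont 0 b ?vd T" by (rule C1_path_piecewise_cont[OF T(2) T(1) c zero b(2,3)])
    show "((\<lambda>t. chart_map c (\<gamma> t)) has_vector_derivative ?vd t) (at t)" if "t \<in> {0<..<b} - T" for t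
    proof -
      have t: "t \<in> {0<..<1} - T" "\<gamma> t \<in> chart_dom c" using that b dom by auto
      have "((chart_map c \<circ> \<gamma>) has_vector_derivative ?vd t) (at t)"
        by (rule C1_path_derivative[where \<gamma> = \<gamma> and t = t, OF T(2) T(1) c t])
      then show ?thesis by (simp only: o_def)
    qed
    have "continuous_on {0..b} \<gamma>"
      using p unfolding path_def by (rule continuous_on_subset) (use b in auto)
    then show "continuous_on {0..b} (\<lambda>t. chart_map c (\<gamma> t))"
      by (rule continuous_on_compose2[OF continuous_chart_map[OF c] _ b(3)])
    show "((\<lambda>t. sqrt (metric_inner (g c) (chart_map c (\<gamma> t)) (?vd t) (?vd t))) has_integral integral {0..b} (speed A g \<gamma>)) {0..b}"
    proof (rule has_integral_spike_finite[of "insert 0 (insert b T)"])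
      show "(speed A g \<gamma> has_integral integral {0..b} (speed A g \<gamma>)) {0..b}"
        by (rule integrable_integral[OF speed_pw(2)[OF T(2) T(1) p c zero b(2,3)]])
      fix t assume "t \<in> {0..b} - insert 0 (insert b T)"
      then have t: "t \<in> {0<..<b} - T" by auto
      show "sqrt (metric_inner (g c) (chart_map c (\<gamma> t)) (?vd t) (?vd t)) = speed A g \<gamma> t"
        by (rule speed_pw(1)[OF T(2) T(1) p c zero b(2,3) t, symmetric])
    qed (use T(1) in simp)
  qed (rule T(1))
qed

text \<open>The displacement is the integral of the velocity, and the norm of the velocity is at
  most the speed divided by \<open>lam\<close>.\<close>

lemma chart_length_lower:
  assumes pw: "piecewise_C1_path A \<gamma>" and c: "c \<in> A" and b: "0 < b" "b \<le> 1" "\<gamma> ` {0..b} \<subseteq> chart_inv c ` K"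
    and K: "K \<subseteq> chart_img c" and lam: "0 < lam" "\<And>x v. x \<in> K \<Longrightarrow> (lam * norm v)\<^sup>2 \<le> metric_inner (g c) x v v"
  shows "lam * norm (chart_map c (\<gamma> b) - chart_map c (\<gamma> 0)) \<le> integral {0..b} (speed A g \<gamma>)"
proof -
  have "chart_inv c ` K \<subseteq> chart_dom c" using chart_inv_in[OF c] K by auto
  then have dom: "\<gamma> ` {0..b} \<subseteq> chart_dom c" using b(3) by (rule order_trans[rotated])
  have zK: "chart_map c (\<gamma> t) \<in> K" if t: "t \<in> {0..b}" for t
  proof -
    have "\<gamma> t \<in> chart_inv c ` K" using b(3) t by blast
    then obtain y where "y \<in> K" "\<gamma> t = chart_inv c y" by blast
    then show ?thesis using chart_map_inv[OF c, of y] K by auto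
  qed
  obtain T vd where T: "finite T" "piecewise_cont 0 b vd T"
    "\<And>t. t \<in> {0<..<b} - T \<Longrightarrow> ((\<lambda>t. chart_map c (\<gamma> t)) has_vector_derivative vd t) (at t)"
    "continuous_on {0..b} (\<lambda>t. chart_map c (\<gamma> t))"
    "((\<lambda>t. sqrt (metric_inner (g c) (chart_map c (\<gamma> t)) (vd t) (vd t))) has_integral integral {0..b} (speed A g \<gamma>)) {0..b}"
    by (rule chart_length_eq[OF pw c b(1,2) dom]) (rule that; assumption)
  have h: "(vd has_integral (chart_map c (\<gamma> b) - chart_map c (\<gamma> 0))) {0..b}"
    by (rule fundamental_theorem_of_calculus_interior_strong[OF T(1) _ T(3,4)]) (use b in auto)
  have "norm (integral {0..b} vd) \<le> integral {0..b} (\<lambda>t. sqrt (metric_inner (g c) (chart_map c (\<gamma> t)) (vd t) (vd t)) / lam)"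
  proof (rule Henstock_Kurzweil_Integration.integral_norm_bound_integral)
    show "vd integrable_on {0..b}" using h by blast
    show "(\<lambda>t. sqrt (metric_inner (g c) (chart_map c (\<gamma> t)) (vd t) (vd t)) / lam) integrable_on {0..b}"
      using has_integral_divide[OF T(5), of lam] by blast
    fix t assume "t \<in> {0..b}"
    from lam(2)[OF zK[OF this], of "vd t"] show "norm (vd t) \<le> sqrt (metric_inner (g c) (chart_map c (\<gamma> t)) (vd t) (vd t)) / lam"
      using lam(1) by (simp add: field_simps real_le_rsqrt)
  qed
  also have "\<dots> = integral {0..b} (speed A g \<gamma>) / lam"
    by (rule integral_unique[OF has_integral_divide[OF T(5)]])
  finally show ?thesis using integral_unique[OF h] lam(1) by (simp add: field_simps)
qed

text \<open>The times spent outside the open ball form a compact set; \<open>b\<close> is the least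
  of them. Up to \<open>b\<close> the curve is in the image of the closed ball, which is compact and
  therefore closed, and at \<open>b\<close> it is on the sphere.\<close>

lemma first_exit:
  assumes c: "c \<in> A" and R: "cball x0 R \<subseteq> chart_img c" and p: "path \<gamma>" "\<gamma> 0 = chart_inv c x" "x \<in> ball x0 R"
    and out: "\<not> \<gamma> ` {0..1} \<subseteq> chart_inv c ` ball x0 R"
  obtains b where "0 < b" "b \<le> 1" "\<gamma> ` {0..b} \<subseteq> chart_inv c ` cball x0 R" "norm (chart_map c (\<gamma> b) - x0) = R"
proof -
  let ?U = "chart_inv c ` ball x0 R" and ?K = "chart_inv c ` cball x0 R"
  have bR: "ball x0 R \<subseteq> chart_img c" using R ball_subset_cball by blast
  have oU: "open ?U" by (rule open_chart_inv_image[OF c open_ball bR])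
  have cK: "closed ?K"
    by (rule compact_imp_closed, rule compact_continuous_image[OF continuous_on_subset[OF continuous_chart_inv[OF c] R] compact_cball])
  define S where "S = {0..1} \<inter> \<gamma> -` (- ?U)"
  have "closed S"
    unfolding S_def by (rule continuous_closed_preimage[OF p(1)[unfolded path_def]]) (use oU in auto)
  then have "compact S" unfolding S_def by (metis bounded_Int bounded_closed_interval compact_eq_bounded_closed)
  moreover have "S \<noteq> {}" using out by (auto simp: S_def)
  ultimately obtain b where b: "b \<in> S" "\<And>t. t \<in> S \<Longrightarrow> b \<le> t" using compact_attains_inf by metis
  have before: "\<gamma> t \<in> ?U" if "0 \<le> t" "t < b" for t
    using b(2)[of t] b(1) that by (auto simp: S_def)
  have b0: "b \<noteq> 0" using b(1) p(2,3) by (auto simp: S_def)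
  have b01: "0 < b" "b \<le> 1" using b(1) b0 by (auto simp: S_def)
  have "\<gamma> b \<in> ?K"
  proof -
    have "\<gamma> ` closure {0..<b} \<subseteq> closure (\<gamma> ` {0..<b})"
    proof (rule continuous_image_closure_subset)
      show "continuous_on {0..1} \<gamma>" using p(1) by (simp add: path_def)
      show "closure {0..<b} \<subseteq> {0..1}" using b01 by (simp add: closure_atLeastLessThan)
    qed
    moreover have "closure (\<gamma> ` {0..<b}) \<subseteq> ?K"
      by (rule closure_minimal[OF _ cK]) (use before in fastforce)
    moreover have "b \<in> closure {0..<b}" using b01 by (simp add: closure_atLeastLessThan)
    ultimately show ?thesis by blast
  qed
  then obtain y where y: "y \<in> cball x0 R" "\<gamma> b = chart_inv c y" by blast
  have "y \<notin> ball x0 R" using b(1) y(2) by (auto simp: S_def)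
  then have "norm (y - x0) = R" using y(1) by (simp add: dist_norm norm_minus_commute)
  then have fin: "norm (chart_map c (\<gamma> b) - x0) = R" using y R chart_map_inv[OF c, of y] by auto
  have "\<gamma> t \<in> ?K" if "t \<in> {0..b}" for t
  proof (cases "t = b")
    case False
    then have "\<gamma> t \<in> ?U" using before that by auto
    then show ?thesis using ball_subset_cball by blast
  qed (use \<open>\<gamma> b \<in> ?K\<close> in simp)
  then show thesis using that[OF b01 _ fin] by blast
qed

text \<open>To leave the ball a curve must reach the sphere, at Euclidean distance at least
  \<open>R - norm (x - x0)\<close>; this costs at least \<open>lam\<close> times that
  distance.\<close>

lemma short_curve_in_chart:
  assumes pw: "piecewise_C1_path A \<gamma>" and c: "c \<in> A" and R: "cball x0 R \<subseteq> chart_img c"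
    and lam: "0 < lam" "\<And>x v. x \<in> cball x0 R \<Longrightarrow> (lam * norm v)\<^sup>2 \<le> metric_inner (g c) x v v"
    and s: "\<gamma> 0 = chart_inv c x" "x \<in> ball x0 R"
    and len: "curve_length A g \<gamma> < lam * (R - norm (x - x0))"
  shows "\<gamma> ` {0..1} \<subseteq> chart_inv c ` ball x0 R"
proof (rule ccontr)
  assume out: "\<not> \<gamma> ` {0..1} \<subseteq> chart_inv c ` ball x0 R"
  have p: "path \<gamma>" using pw by (simp add: piecewise_C1_path_def)
  obtain b where b: "0 < b" "b \<le> 1" "\<gamma> ` {0..b} \<subseteq> chart_inv c ` cball x0 R" "norm (chart_map c (\<gamma> b) - x0) = R"
    using first_exit[OF c R p s out] by metis
  have x: "chart_map c (\<gamma> 0) = x" using s R chart_map_inv[OF c ball_in[OF R s(2)]] by simp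
  have "lam * (R - norm (x - x0)) \<le> lam * norm (chart_map c (\<gamma> b) - chart_map c (\<gamma> 0))"
    using b(4) lam(1) norm_triangle_ineq[of "chart_map c (\<gamma> b) - x" "x - x0"] unfolding x by (intro mult_left_mono) auto
  also have "\<dots> \<le> integral {0..b} (speed A g \<gamma>)"
    by (rule chart_length_lower[OF pw c b(1-3) R lam])
  also have "\<dots> \<le> curve_length A g \<gamma>"
    unfolding curve_length_def
    by (rule integral_subset_le)
       (use b speed_integrable[OF pw] speed_nonneg in \<open>auto intro: integrable_on_subinterval\<close>)
  finally show False using len by simp
qed

lemma chart_ball:
  assumes "c \<in> A" "x0 \<in> chart_img c"
  obtains R where "R > 0" "cball x0 R \<subseteq> chart_img c"
  using open_img[OF assms(1)] assms(2) open_contains_cball by metis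

lemma chart_comparison:
  assumes c: "c \<in> A" and R: "cball x0 R \<subseteq> chart_img c"
  obtains lam Lam where "0 < lam" "0 < Lam"
    "\<And>x v. x \<in> cball x0 R \<Longrightarrow> (lam * norm v)\<^sup>2 \<le> metric_inner (g c) x v v"
    "\<And>x v. x \<in> cball x0 R \<Longrightarrow> metric_inner (g c) x v v \<le> (Lam * norm v)\<^sup>2"
proof -
  interpret L: local_metric "chart_img c" "g c" by (rule local_metric[OF c])
  obtain a where a: "a > 0" "\<And>x v. x \<in> cball x0 R \<Longrightarrow> a * (norm v)\<^sup>2 \<le> L.ip x v v"
    using L.ip_lower_bound[OF compact_cball R] by metis
  obtain b where b: "b > 0" "\<And>x v. x \<in> cball x0 R \<Longrightarrow> L.ip x v v \<le> b * (norm v)\<^sup>2"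
    using L.ip_upper_bound[OF compact_cball R] by metis
  show thesis
    by (rule that[of "sqrt a" "sqrt b"]) (use a b in \<open>auto simp: power_mult_distrib\<close>)
qed

end

section \<open>The manifold as a locally compact length space\<close>

locale connected_riemannian_manifold = riemannian_manifold A g
  for A :: "('a::{t2_space, second_countable_topology}, 'n::finite) chart set" and g +
  assumes conn: "connected (UNIV :: 'a set)"
begin

abbreviation "d \<equiv> riem_dist A g"

text \<open>Being joined by a curve is an equivalence relation with open classes, since coordinate
  segments join the points of a coordinate ball to its centre. It makes the sets of lengths in
  \<open>riem_dist\<close> nonempty, so that their infimum is meaningful.\<close>

lemma curve_exists: "\<exists>\<gamma>. piecewise_C1_path A \<gamma> \<and> pathstart \<gamma> = p \<and> pathfinish \<gamma> = q"
proof (rule connected_equivalence_relation[OF conn UNIV_I UNIV_I])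
  fix x y :: 'a assume "\<exists>\<gamma>. piecewise_C1_path A \<gamma> \<and> pathstart \<gamma> = x \<and> pathfinish \<gamma> = y"
  then obtain \<gamma> where "piecewise_C1_path A \<gamma>" "pathstart \<gamma> = x" "pathfinish \<gamma> = y" by blast
  then show "\<exists>\<gamma>. piecewise_C1_path A \<gamma> \<and> pathstart \<gamma> = y \<and> pathfinish \<gamma> = x"
    using piecewise_C1_path_subcurve[of \<gamma> 1 0]
    by (intro exI[of _ "subcurve 1 0 \<gamma>"]) (simp add: pathstart_def pathfinish_def subcurve_def)
next
  fix x y z :: 'a assume "\<exists>\<gamma>. piecewise_C1_path A \<gamma> \<and> pathstart \<gamma> = x \<and> pathfinish \<gamma> = y"
    "\<exists>\<gamma>. piecewise_C1_path A \<gamma> \<and> pathstart \<gamma> = y \<and> pathfinish \<gamma> = z"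
  then show "\<exists>\<gamma>. piecewise_C1_path A \<gamma> \<and> pathstart \<gamma> = x \<and> pathfinish \<gamma> = z"
    by (metis piecewise_C1_path_join pathstart_join pathfinish_join)
next
  fix p :: 'a
  obtain c where c: "c \<in> A" "p \<in> chart_dom c" using chart_at by metis
  obtain R where R: "R > 0" "cball (chart_map c p) R \<subseteq> chart_img c"
    using chart_ball[OF c(1) chart_map_in[OF c(2)]] by metis
  obtain lam Lam where Lam: "0 < Lam" "\<And>x v. x \<in> cball (chart_map c p) R \<Longrightarrow> metric_inner (g c) x v v \<le> (Lam * norm v)\<^sup>2"
    using chart_comparison[OF c(1) R(2)] by metis
  let ?V = "chart_inv c ` ball (chart_map c p) R"
  have "open ?V"
    by (rule open_chart_inv_image[OF c(1) open_ball]) (use R(2) ball_subset_cball in blast)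
  moreover have "p \<in> ?V"
    using chart_inv_map[OF c] R(1) by (intro image_eqI[of _ _ "chart_map c p"]) auto
  moreover have "\<exists>\<gamma>. piecewise_C1_path A \<gamma> \<and> pathstart \<gamma> = p \<and> pathfinish \<gamma> = q" if "q \<in> ?V" for q
  proof -
    obtain y where y: "y \<in> ball (chart_map c p) R" "q = chart_inv c y" using \<open>q \<in> ?V\<close> by blast
    then have yc: "y \<in> cball (chart_map c p) R" "chart_map c p \<in> cball (chart_map c p) R" using R(1) by auto
    obtain \<gamma> where "piecewise_C1_path A \<gamma>" "pathstart \<gamma> = chart_inv c (chart_map c p)" "pathfinish \<gamma> = chart_inv c y"
      using chart_segment[OF c(1) convex_cball R(2) yc(2,1) less_imp_le[OF Lam(1)] Lam(2)] by blast
    then show ?thesis using chart_inv_map[OF c] y(2) by auto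
  qed
  ultimately show "\<exists>T. openin (top_of_set UNIV) T \<and> p \<in> T \<and> (\<forall>x\<in>T. \<exists>\<gamma>. piecewise_C1_path A \<gamma> \<and> pathstart \<gamma> = p \<and> pathfinish \<gamma> = x)"
    by (intro exI[of _ ?V]) auto
qed

lemma d_greatest: "(\<And>\<gamma>. piecewise_C1_path A \<gamma> \<Longrightarrow> pathstart \<gamma> = p \<Longrightarrow> pathfinish \<gamma> = q \<Longrightarrow> r \<le> curve_length A g \<gamma>) \<Longrightarrow> r \<le> d p q"
  unfolding riem_dist_def using curve_exists[of p q] by (intro cInf_greatest) auto

lemma d_less:
  assumes "d p q < r"
  obtains \<gamma> where "piecewise_C1_path A \<gamma>" "pathstart \<gamma> = p" "pathfinish \<gamma> = q" "curve_length A g \<gamma> < r"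
  using d_greatest[of p q r] assms by (meson not_le)

lemma d_nonneg: "0 \<le> d p q"
  by (rule d_greatest) (rule curve_length_nonneg)

lemma d_le_sym: "d p q \<le> d q p"
proof (rule d_greatest)
  fix \<gamma> assume \<gamma>: "piecewise_C1_path A \<gamma>" "pathstart \<gamma> = q" "pathfinish \<gamma> = p"
  have "d p q \<le> curve_length A g (subcurve 1 0 \<gamma>)"
    using \<gamma> by (intro riem_dist_le piecewise_C1_path_subcurve) (simp_all add: pathstart_def pathfinish_def subcurve_def)
  then show "d p q \<le> curve_length A g \<gamma>"
    using curve_length_subcurve(2)[OF \<gamma>(1), of 0 1] by (simp add: curve_length_def)
qed

lemma d_sym: "d p q = d q p"
  using d_le_sym[of p q] d_le_sym[of q p] by simp

lemma d_triangle: "d p r \<le> d p q + d q r"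
proof (rule field_le_epsilon)
  fix e :: real assume e: "e > 0"
  obtain \<gamma> where \<gamma>: "piecewise_C1_path A \<gamma>" "pathstart \<gamma> = p" "pathfinish \<gamma> = q" "curve_length A g \<gamma> < d p q + e/2"
    using d_less[of p q "d p q + e/2"] e by auto
  obtain \<delta> where \<delta>: "piecewise_C1_path A \<delta>" "pathstart \<delta> = q" "pathfinish \<delta> = r" "curve_length A g \<delta> < d q r + e/2"
    using d_less[of q r "d q r + e/2"] e by auto
  have "d p r \<le> curve_length A g (\<gamma> +++ \<delta>)"
    using \<gamma> \<delta> by (intro riem_dist_le piecewise_C1_path_join) simp_all
  also have "\<dots> = curve_length A g \<gamma> + curve_length A g \<delta>"
    using \<gamma> \<delta> by (intro curve_length_join) simp_all
  finally show "d p r \<le> d p q + d q r + e" using \<gamma>(4) \<delta>(4) by linarith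
qed

lemma d_refl: "d p p = 0"
proof -
  have "d p p \<le> curve_length A g (subcurve 0 0 (\<lambda>t. p))"
    by (intro riem_dist_le piecewise_C1_path_subcurve piecewise_C1_path_const) (simp_all add: pathstart_def pathfinish_def subcurve_def)
  also have "curve_length A g (subcurve 0 0 (\<lambda>t. p)) = 0"
  proof -
    interpret L: local_metric "chart_img (some_chart A p)" "g (some_chart A p)"
      by (rule local_metric[OF some_chart(1)])
    have "speed A g (subcurve 0 0 (\<lambda>t. p)) = (\<lambda>t. 0)"
      by (simp add: speed_def[abs_def] subcurve_def[abs_def] Let_def o_def ip_simps)
    then show ?thesis by (simp add: curve_length_def)
  qed
  finally show ?thesis using d_nonneg[of p p] by simp
qed

lemma d_upper:
  assumes c: "c \<in> A" and R: "cball x0 R \<subseteq> chart_img c" and xy: "x \<in> cball x0 R" "y \<in> cball x0 R"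
    and Lam: "0 < Lam" "\<And>x v. x \<in> cball x0 R \<Longrightarrow> metric_inner (g c) x v v \<le> (Lam * norm v)\<^sup>2"
  shows "d (chart_inv c x) (chart_inv c y) \<le> Lam * norm (y - x)"
proof -
  obtain \<gamma> where "piecewise_C1_path A \<gamma>" "pathstart \<gamma> = chart_inv c x" "pathfinish \<gamma> = chart_inv c y"
      "curve_length A g \<gamma> \<le> Lam * norm (y - x)"
    using chart_segment[OF c(1) convex_cball R xy less_imp_le[OF Lam(1)] Lam(2)] by blast
  then show ?thesis using riem_dist_le by fastforce
qed

text \<open>A distance below the cost of leaving the ball is almost realised by a curve inside it,
  and there length dominates \<open>lam\<close> times the coordinate distance.\<close>

lemma d_lower:
  assumes c: "c \<in> A" and R: "cball x0 R \<subseteq> chart_img c" and x: "x \<in> ball x0 R"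
    and lam: "0 < lam" "\<And>x v. x \<in> cball x0 R \<Longrightarrow> (lam * norm v)\<^sup>2 \<le> metric_inner (g c) x v v"
    and dq: "d (chart_inv c x) q < lam * (R - norm (x - x0))"
  shows "q \<in> chart_inv c ` ball x0 R" "lam * norm (chart_map c q - x) \<le> d (chart_inv c x) q"
proof -
  \<comment> \<open>\<open>r\<close> lies strictly between the distance and the cost of exit; at the
    end it tends to the distance.\<close>
  have *: "q \<in> chart_inv c ` ball x0 R \<and> lam * norm (chart_map c q - x) \<le> r"
    if r: "d (chart_inv c x) q < r" "r < lam * (R - norm (x - x0))" for r
  proof -
    obtain \<gamma> where \<gamma>: "piecewise_C1_path A \<gamma>" "pathstart \<gamma> = chart_inv c x" "pathfinish \<gamma> = q" "curve_length A g \<gamma> < r"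
      using d_less[OF r(1)] by blast
    have g0: "\<gamma> 0 = chart_inv c x" "\<gamma> 1 = q" using \<gamma> by (simp_all add: pathstart_def pathfinish_def)
    have sub: "\<gamma> ` {0..1} \<subseteq> chart_inv c ` ball x0 R"
      by (rule short_curve_in_chart[OF \<gamma>(1) c R lam g0(1) x]) (use \<gamma>(4) r in auto)
    then have "\<gamma> ` {0..1} \<subseteq> chart_inv c ` cball x0 R" using ball_subset_cball by blast
    from chart_length_lower[OF \<gamma>(1) c _ _ this R lam]
    have "lam * norm (chart_map c (\<gamma> 1) - chart_map c (\<gamma> 0)) \<le> curve_length A g \<gamma>" by (simp add: curve_length_def)
    moreover have "chart_map c (\<gamma> 0) = x" using g0 chart_map_inv[OF c ball_in[OF R x]] by simp
    ultimately have "lam * norm (chart_map c q - x) \<le> r" using \<gamma>(4) g0(2) by simp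
    moreover have "q \<in> chart_inv c ` ball x0 R" using sub g0(2) by auto
    ultimately show ?thesis by blast
  qed
  obtain r where "d (chart_inv c x) q < r" "r < lam * (R - norm (x - x0))" using dense[OF dq] by blast
  with * show "q \<in> chart_inv c ` ball x0 R" by blast
  show "lam * norm (chart_map c q - x) \<le> d (chart_inv c x) q"
    by (rule dense_ge_bounded[OF dq]) (use * in blast)
qed

text \<open>By \<open>d_lower\<close> a point at distance 0 from \<open>p\<close> lies in the chart
  around \<open>p\<close> and has the same coordinates.\<close>

lemma d_eq_0: "d p q = 0 \<longleftrightarrow> p = q"
proof
  assume 0: "d p q = 0"
  obtain c where c: "c \<in> A" "p \<in> chart_dom c" using chart_at by metis
  let ?x = "chart_map c p"
  obtain R where R: "R > 0" "cball ?x R \<subseteq> chart_img c" using chart_ball[OF c(1) chart_map_in[OF c(2)]] by metis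
  obtain lam Lam where lam: "0 < lam" "\<And>x v. x \<in> cball ?x R \<Longrightarrow> (lam * norm v)\<^sup>2 \<le> metric_inner (g c) x v v"
    using chart_comparison[OF c(1) R(2)] by metis
  have x: "?x \<in> ball ?x R" using R by simp
  have "d (chart_inv c ?x) q < lam * (R - norm (?x - ?x))" using 0 R lam by (simp add: chart_inv_map[OF c])
  from d_lower[OF c(1) R(2) x lam this] 0 lam(1)
  have "q \<in> chart_inv c ` ball ?x R" "chart_map c q = ?x"
    by (auto simp: chart_inv_map[OF c] mult_le_0_iff)
  then have "q \<in> chart_dom c" using chart_inv_in[OF c(1)] R(2) ball_subset_cball by blast
  then show "p = q" using chart_inv_map[OF c(1)] c(2) \<open>chart_map c q = ?x\<close> by metis
qed (simp add: d_refl)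

sublocale Metric_space UNIV d
  by unfold_locales (auto simp: d_nonneg d_sym d_eq_0 d_triangle)

lemma chart_mball:
  obtains c x0 R lam Lam where "c \<in> A" "p \<in> chart_dom c" "x0 = chart_map c p" "R > 0" "cball x0 R \<subseteq> chart_img c" "0 < lam" "0 < Lam"
    "\<And>x v. x \<in> cball x0 R \<Longrightarrow> (lam * norm v)\<^sup>2 \<le> metric_inner (g c) x v v"
    "\<And>x v. x \<in> cball x0 R \<Longrightarrow> metric_inner (g c) x v v \<le> (Lam * norm v)\<^sup>2"
proof -
  obtain c where c: "c \<in> A" "p \<in> chart_dom c" using chart_at by metis
  let ?x = "chart_map c p"
  obtain R where R: "R > 0" "cball ?x R \<subseteq> chart_img c" using chart_ball[OF c(1) chart_map_in[OF c(2)]] by metis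
  obtain lam Lam where "0 < lam" "0 < Lam" "\<And>x v. x \<in> cball ?x R \<Longrightarrow> (lam * norm v)\<^sup>2 \<le> metric_inner (g c) x v v"
    "\<And>x v. x \<in> cball ?x R \<Longrightarrow> metric_inner (g c) x v v \<le> (Lam * norm v)\<^sup>2"
    using chart_comparison[OF c(1) R(2)] by metis
  with that[OF c refl R] show thesis by blast
qed

text \<open>Hopf--Rinow concerns the metric topology, the compactness claimed in the theorem that of
  the manifold. In small coordinate balls \<open>d\<close> is squeezed between multiples of the
  Euclidean distance to the centre.\<close>

lemma openin_mtopology_iff: "openin mtopology U \<longleftrightarrow> open U"
proof
  assume U: "openin mtopology U"
  show "open U"
  proof (rule open_subopen[THEN iffD2], rule ballI)
    fix p assume "p \<in> U"
    then obtain r where r: "r > 0" "mball p r \<subseteq> U" using U unfolding openin_mtopology by blast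
    obtain c x0 R lam Lam where c: "c \<in> A" "p \<in> chart_dom c" "x0 = chart_map c p" and R: "R > 0" "cball x0 R \<subseteq> chart_img c"
      and Lam: "0 < Lam" "\<And>x v. x \<in> cball x0 R \<Longrightarrow> metric_inner (g c) x v v \<le> (Lam * norm v)\<^sup>2"
      using chart_mball[of p] by metis
    let ?V = "chart_inv c ` ball x0 (min R (r / Lam))"
    have "open ?V"
      by (rule open_chart_inv_image[OF c(1) open_ball]) (use R(2) in \<open>auto simp: subset_iff\<close>)
    moreover have "p \<in> ?V"
      using chart_inv_map[OF c(1,2)] R(1) r(1) Lam(1) c(3) by (intro image_eqI[of _ _ x0]) auto
    moreover have "?V \<subseteq> U"
    proof
      fix q assume "q \<in> ?V"
      then obtain y where y: "y \<in> ball x0 (min R (r / Lam))" "q = chart_inv c y" by blast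
      have "d (chart_inv c x0) q \<le> Lam * norm (y - x0)"
        unfolding y(2) by (rule d_upper[OF c(1) R(2) _ _ Lam]) (use R(1) y(1) in auto)
      also have "\<dots> < r" using y(1) Lam(1) by (simp add: dist_norm norm_minus_commute field_simps)
      finally have "q \<in> mball p r" using chart_inv_map[OF c(1,2)] c(3) by simp
      then show "q \<in> U" using r(2) by blast
    qed
    ultimately show "\<exists>T. open T \<and> p \<in> T \<and> T \<subseteq> U" by blast
  qed
next
  assume U: "open U"
  show "openin mtopology U"
    unfolding openin_mtopology
  proof (intro conjI ballI allI impI subset_UNIV)
    fix p assume p: "p \<in> U"
    obtain c where c: "c \<in> A" "p \<in> chart_dom c" using chart_at by metis
    let ?x = "chart_map c p"
    have "open (chart_img c \<inter> chart_inv c -` U)"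
      by (rule continuous_open_preimage[OF continuous_chart_inv[OF c(1)] open_img[OF c(1)] U])
    moreover have "?x \<in> chart_img c \<inter> chart_inv c -` U" using chart_map_in[OF c(2)] chart_inv_map[OF c] p by simp
    ultimately obtain R where R: "R > 0" "cball ?x R \<subseteq> chart_img c \<inter> chart_inv c -` U"
      using open_contains_cball by metis
    then have R2: "cball ?x R \<subseteq> chart_img c" by blast
    obtain lam Lam where lam: "0 < lam" "\<And>x v. x \<in> cball ?x R \<Longrightarrow> (lam * norm v)\<^sup>2 \<le> metric_inner (g c) x v v"
      using chart_comparison[OF c(1) R2] by metis
    have "mball p (lam * R) \<subseteq> U"
    proof
      fix q assume "q \<in> mball p (lam * R)"
      then have "d (chart_inv c ?x) q < lam * (R - norm (?x - ?x))" by (simp add: chart_inv_map[OF c])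
      from d_lower(1)[OF c(1) R2 _ lam this] R(1) have "q \<in> chart_inv c ` ball ?x R" by simp
      then show "q \<in> U" using R(2) ball_subset_cball by blast
    qed
    then show "\<exists>r>0. mball p r \<subseteq> U" using lam(1) R(1) by (meson mult_pos_pos)
  qed
qed

lemma mtopology_eq: "mtopology = euclidean"
  by (simp add: topology_eq openin_mtopology_iff)

text \<open>A closed ball whose radius is half the cost of exit lies in the compact image of a
  coordinate ball.\<close>

lemma locally_compact: "\<exists>r>0. compactin mtopology (mcball p r)"
proof -
  obtain c x0 R lam Lam where c: "c \<in> A" "p \<in> chart_dom c" "x0 = chart_map c p" and R: "R > 0" "cball x0 R \<subseteq> chart_img c"
    and lam: "0 < lam" "\<And>x v. x \<in> cball x0 R \<Longrightarrow> (lam * norm v)\<^sup>2 \<le> metric_inner (g c) x v v"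
    using chart_mball[of p] by metis
  have "compact (chart_inv c ` cball x0 R)"
    by (rule compact_continuous_image[OF continuous_on_subset[OF continuous_chart_inv[OF c(1)] R(2)] compact_cball])
  then have "compactin mtopology (chart_inv c ` cball x0 R)" by (simp add: mtopology_eq)
  moreover have "mcball p (lam * R / 2) \<subseteq> chart_inv c ` cball x0 R"
  proof
    fix q assume "q \<in> mcball p (lam * R / 2)"
    then have "d (chart_inv c x0) q \<le> lam * R / 2" by (simp add: chart_inv_map[OF c(1,2)] c(3))
    also have "\<dots> < lam * (R - norm (x0 - x0))" using lam(1) R(1) by simp
    finally have "d (chart_inv c x0) q < lam * (R - norm (x0 - x0))" .
    from d_lower(1)[OF c(1) R(2) _ lam this] R(1) have "q \<in> chart_inv c ` ball x0 R" by simp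
    then show "q \<in> chart_inv c ` cball x0 R" using ball_subset_cball by blast
  qed
  ultimately have "compactin mtopology (mcball p (lam * R / 2))"
    by (rule closed_compactin) (rule closedin_mcball)
  then show ?thesis using lam(1) R(1) by (intro exI[of _ "lam * R / 2"]) simp
qed

lemma intermediate_point:
  assumes r: "0 \<le> r" "r \<le> d p q" and e: "e > 0"
  shows "\<exists>z. d p z \<le> r \<and> d z q < d p q - r + e"
proof -
  obtain \<gamma> where \<gamma>: "piecewise_C1_path A \<gamma>" "pathstart \<gamma> = p" "pathfinish \<gamma> = q" "curve_length A g \<gamma> < d p q + e"
    using d_less[of p q "d p q + e"] e by auto
  have g0: "\<gamma> 0 = p" "\<gamma> 1 = q" using \<gamma> by (simp_all add: pathstart_def pathfinish_def)
  have si: "speed A g \<gamma> integrable_on {0..1}" by (rule speed_integrable[OF \<gamma>(1)])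
  have dL: "d p q \<le> curve_length A g \<gamma>" by (rule riem_dist_le[OF \<gamma>(1-3)])
  have "\<exists>t\<ge>0. t \<le> 1 \<and> integral {0..t} (speed A g \<gamma>) = r"
  proof (rule IVT')
    show "r \<le> integral {0..1} (speed A g \<gamma>)" using r dL by (simp add: curve_length_def)
    show "continuous_on {0..1} (\<lambda>t. integral {0..t} (speed A g \<gamma>))" by (rule indefinite_integral_continuous_1[OF si])
  qed (use r in auto)
  then obtain t where t: "0 \<le> t" "t \<le> 1" "integral {0..t} (speed A g \<gamma>) = r" by blast
  have 1: "d p (\<gamma> t) \<le> r"
  proof (cases "t = 0")
    case True
    then show ?thesis using r(1) g0 by (simp add: d_refl)
  next
    case False
    have "d p (\<gamma> t) \<le> curve_length A g (subcurve 0 t \<gamma>)"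
      using t g0 by (intro riem_dist_le piecewise_C1_path_subcurve \<gamma>(1)) (simp_all add: pathstart_def pathfinish_def subcurve_def)
    also have "\<dots> = r" using curve_length_subcurve(1)[OF \<gamma>(1), of 0 t] t False by simp
    finally show ?thesis .
  qed
  have 2: "d (\<gamma> t) q < d p q - r + e"
  proof (cases "t = 1")
    case True
    then show ?thesis using r e g0 by (simp add: d_refl)
  next
    case False
    have "d (\<gamma> t) q \<le> curve_length A g (subcurve t 1 \<gamma>)"
      using t g0 by (intro riem_dist_le piecewise_C1_path_subcurve \<gamma>(1)) (simp_all add: pathstart_def pathfinish_def subcurve_def)
    also have "\<dots> = integral {t..1} (speed A g \<gamma>)" using curve_length_subcurve(1)[OF \<gamma>(1), of t 1] t False by simp
    also have "\<dots> = curve_length A g \<gamma> - r"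
      using Henstock_Kurzweil_Integration.integral_combine[OF t(1,2) si] t(3) by (simp add: curve_length_def)
    finally show ?thesis using \<gamma>(4) by linarith
  qed
  from 1 2 show ?thesis by blast
qed

text \<open>The bound on the Christoffel symbols makes the integral operator of parallel transport along
  the segment a contraction.\<close>

definition geodesic_segment :: "('a, 'n) chart \<Rightarrow> (real \<Rightarrow> real^'n) \<Rightarrow> (real \<Rightarrow> real^'n) \<Rightarrow> 'a \<Rightarrow> 'a \<Rightarrow> bool" where
  "geodesic_segment c u w x y \<longleftrightarrow> c \<in> A \<and> (\<forall>t\<in>{0..1}. u t \<in> chart_img c \<and>
     (u has_vector_derivative w t) (at t within {0..1}) \<and>
     (w has_vector_derivative - christoffel_form (g c) (u t) (w t) (w t)) (at t within {0..1}) \<and>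
     (\<forall>v. norm (christoffel_form (g c) (u t) (w t) v) \<le> norm v / 2)) \<and>
     chart_inv c (u 0) = x \<and> chart_inv c (u 1) = y \<and> metric_inner (g c) (u 0) (w 0) (w 0) = (d x y)\<^sup>2"

text \<open>The boundary value problem supplies the geodesic, and its length bounds the distance
  from above. From below, a competitor that stays in the coordinate ball is handled by
  \<open>geodesic_minimal\<close>, one that leaves it by the cost of exit.\<close>

lemma geodesic_segment_exists: "\<exists>r>0. \<forall>x y. d p x < r \<longrightarrow> d p y < r \<longrightarrow> (\<exists>c u w. geodesic_segment c u w x y)"
proof -
  obtain c x0 R lam Lam where c: "c \<in> A" "p \<in> chart_dom c" "x0 = chart_map c p" and R: "R > 0" "cball x0 R \<subseteq> chart_img c"
    and l0: "0 < lam" and L0: "0 < Lam" and lam: "\<And>x v. x \<in> cball x0 R \<Longrightarrow> (lam * norm v)\<^sup>2 \<le> metric_inner (g c) x v v"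
    and Lam: "\<And>x v. x \<in> cball x0 R \<Longrightarrow> metric_inner (g c) x v v \<le> (Lam * norm v)\<^sup>2"
    using chart_mball[of p] by metis
  interpret L: local_metric "chart_img c" "g c" by (rule local_metric[OF c(1)])
  let ?K = "cball x0 R"
  obtain C where C: "C \<ge> 0" "\<And>x u v. x \<in> ?K \<Longrightarrow> norm (christoffel_form (g c) x u v) \<le> C * norm u * norm v"
    "\<And>x y u v. x \<in> ?K \<Longrightarrow> y \<in> ?K \<Longrightarrow> norm (christoffel_form (g c) x u v - christoffel_form (g c) y u v) \<le> C * norm (x - y) * norm u * norm v"
    using L.christoffel_form_bounds[OF compact_cball convex_cball R(2)] by metis
  obtain C' where C': "C' \<ge> 0" "\<And>x y u v. x \<in> ?K \<Longrightarrow> y \<in> ?K \<Longrightarrow> \<bar>L.ip x u v - L.ip y u v\<bar> \<le> C' * norm (x - y) * norm u * norm v"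
    "\<And>x y h u v. x \<in> ?K \<Longrightarrow> y \<in> ?K \<Longrightarrow> \<bar>metric_deriv (g c) x h u v - metric_deriv (g c) y h u v\<bar> \<le> C' * norm (x - y) * norm h * norm u * norm v"
    using L.metric_lipschitz[OF compact_cball convex_cball R(2)] by metis
  \<comment> \<open>In order: the geodesic stays inside \<open>?K\<close>; the boundary value
    problem contracts for points at coordinate distance at most \<open>2 * r\<close>; linear terms
    dominate quadratic ones; hypothesis \<open>m\<close> of \<open>geodesic_minimal\<close> holds; a
    curve that leaves \<open>?K\<close> is at least as long as the geodesic.\<close>
  define r where "r = min (R / 8) (min (1 / (64 * (C + 1))) (min (1 / 8) (min (lam\<^sup>2 / (12 * (C' + 1))) (lam * R / (8 * Lam)))))"
  have r0: "r > 0" unfolding r_def using R(1) C(1) C'(1) l0 L0 by simp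
  have rR: "8 * r \<le> R" by (simp add: r_def)
  have rC: "64 * (C * r) \<le> 1"
  proof -
    have "r \<le> 1 / (64 * (C + 1))" by (simp add: r_def)
    then have "r * (64 * (C + 1)) \<le> 1" using C(1) by (simp add: field_simps)
    then show ?thesis using r0 by (simp add: algebra_simps)
  qed
  have r1: "8 * r \<le> 1" by (simp add: r_def)
  have rC': "12 * (C' * r) \<le> lam\<^sup>2"
  proof -
    have "r \<le> lam\<^sup>2 / (12 * (C' + 1))" by (simp add: r_def)
    then have "r * (12 * (C' + 1)) \<le> lam\<^sup>2" using C'(1) by (simp add: field_simps)
    then show ?thesis using r0 by (simp add: algebra_simps)
  qed
  have rL: "8 * (Lam * r) \<le> lam * R"
  proof -
    have "r \<le> lam * R / (8 * Lam)" by (simp add: r_def)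
    then show ?thesis using L0 by (simp add: field_simps)
  qed
  have sub: "cball x0 r \<subseteq> ?K" using rR r0 by (simp add: subset_cball)
  have near: "\<exists>a. x = chart_inv c a \<and> a \<in> ball x0 r" if "d p x < lam * r" for x
  proof -
    have "d (chart_inv c x0) x < lam * (r - norm (x0 - x0))" using that by (simp add: chart_inv_map[OF c(1,2)] c(3))
    then have "x \<in> chart_inv c ` ball x0 r"
      using lam sub r0 by (intro d_lower(1)[OF c(1) subset_trans[OF sub R(2)] _ l0, where x = x0]) auto
    then show ?thesis by blast
  qed
  have "\<exists>u w. geodesic_segment c u w x y" if xy: "d p x < lam * r" "d p y < lam * r" for x y
  proof -
    obtain a where a: "x = chart_inv c a" "a \<in> ball x0 r" using near[OF xy(1)] by blast
    obtain b where b: "y = chart_inv c b" "b \<in> ball x0 r" using near[OF xy(2)] by blast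
    define e where "e = norm (b - a)"
    have e: "0 \<le> e" "e \<le> 2 * r"
    proof -
      have "norm (b - a) \<le> dist x0 a + dist x0 b" by norm
      then show "e \<le> 2 * r" using a(2) b(2) by (simp add: e_def)
    qed (simp add: e_def)
    have K: "cball a (2 * e) \<subseteq> ?K"
    proof
      fix v assume "v \<in> cball a (2 * e)"
      then have "dist x0 v \<le> r + 2 * e" using a(2) dist_triangle[of x0 v a] by simp
      then show "v \<in> ?K" using e rR r0 by simp
    qed
    have Ce: "C * e \<le> 2 * (C * r)" using mult_left_mono[OF e(2) C(1)] by simp
    have bvp: "16 * C * norm (b - a) * (1 + norm (b - a)) \<le> 1"
    proof -
      have "16 * (C * e) * (1 + e) \<le> 16 * (C * e) * 2"
        using C(1) e r1 by (intro mult_left_mono) auto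
      then show ?thesis using Ce rC by (simp add: e_def mult.assoc)
    qed
    obtain u w where u: "u 0 = a" "u 1 = b" "\<And>t. t \<in> {0..1} \<Longrightarrow> u t \<in> cball a (2 * e)"
      "\<And>t. t \<in> {0..1} \<Longrightarrow> (u has_vector_derivative w t) (at t within {0..1})"
      "\<And>t. t \<in> {0..1} \<Longrightarrow> (w has_vector_derivative - christoffel_form (g c) (u t) (w t) (w t)) (at t within {0..1})"
      "\<And>t. t \<in> {0..1} \<Longrightarrow> norm (w t) \<le> 2 * e"
      using L.geodesic_bvp[OF C K[unfolded e_def] R(2) bvp, folded e_def] by blast
    have uK: "u t \<in> ?K" if "t \<in> {0..1}" for t using u(3)[OF that] K by blast
    have uS: "u t \<in> chart_img c" if "t \<in> {0..1}" for t using uK[OF that] R(2) by blast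
    define E where "E = L.ip (u 0) (w 0) (w 0)"
    have E: "L.ip (u t) (w t) (w t) = E" if "t \<in> {0..1}" for t
      unfolding E_def by (rule L.geodesic_constant_speed[OF u(4,5,5,5) uS that])
    have E0: "0 \<le> E" unfolding E_def by (rule L.ip_nonneg[OF uS]) simp
    have wc: "continuous_on {0..1} w" by (rule continuous_on_vector_derivative) (rule u(5))
    have "d x y \<le> curve_length A g (chart_inv c \<circ> u)"
      using chart_curve(1)[OF c(1) uS u(4) wc] a(1) b(1) u(1,2)
      by (intro riem_dist_le) (simp_all add: pathstart_def pathfinish_def)
    also have "\<dots> = integral {0..1} (\<lambda>t. sqrt (L.ip (u t) (w t) (w t)))"
      by (rule chart_curve(2)[OF c(1) uS u(4) wc])
    also have "\<dots> = integral {0..1} (\<lambda>t::real. sqrt E)"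
      by (rule integral_cong) (simp add: E)
    finally have up: "d x y \<le> sqrt E" by simp
    have "sqrt E \<le> d x y"
    proof (rule d_greatest)
      fix \<gamma> assume \<gamma>: "piecewise_C1_path A \<gamma>" "pathstart \<gamma> = x" "pathfinish \<gamma> = y"
      have g0: "\<gamma> 0 = chart_inv c a" "\<gamma> 1 = chart_inv c b" using \<gamma> a(1) b(1) by (simp_all add: pathstart_def pathfinish_def)
      have aR: "a \<in> ball x0 R" "b \<in> ball x0 R" using a(2) b(2) rR r0 by auto
      show "sqrt E \<le> curve_length A g \<gamma>"
      proof (cases "curve_length A g \<gamma> < lam * (R - norm (a - x0))")
        case True
        have sub: "\<gamma> ` {0..1} \<subseteq> chart_inv c ` ball x0 R"
          by (rule short_curve_in_chart[OF \<gamma>(1) c(1) R(2) l0 lam g0(1) aR(1) True])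
        have bi: "ball x0 R \<subseteq> chart_img c" using R(2) ball_subset_cball by blast
        have "chart_inv c ` ball x0 R \<subseteq> chart_dom c" using chart_inv_in[OF c(1)] bi by auto
        then have dom: "\<gamma> ` {0..1} \<subseteq> chart_dom c" using sub by (rule order_trans[rotated])
        have zK: "chart_map c (\<gamma> t) \<in> ?K" if "t \<in> {0..1}" for t
        proof -
          have "\<gamma> t \<in> chart_inv c ` ball x0 R" using sub that by blast
          then obtain v where v: "v \<in> ball x0 R" "\<gamma> t = chart_inv c v" by blast
          then have "chart_map c (\<gamma> t) = v" using chart_map_inv[OF c(1)] bi by auto
          then show ?thesis using v(1) by simp
        qed
        obtain T vd where T: "finite T" "piecewise_cont 0 1 vd T"
          "\<And>t. t \<in> {0<..<1} - T \<Longrightarrow> ((\<lambda>t. chart_map c (\<gamma> t)) has_vector_derivative vd t) (at t)"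
          "continuous_on {0..1} (\<lambda>t. chart_map c (\<gamma> t))"
          "((\<lambda>t. sqrt (L.ip (chart_map c (\<gamma> t)) (vd t) (vd t))) has_integral integral {0..1} (speed A g \<gamma>)) {0..1}"
          by (rule chart_length_eq[OF \<gamma>(1) c(1) zero_less_one order_refl dom]) (rule that; assumption)
        have m: "2 * C' * (2 * e) + C' * (2 * e)\<^sup>2 \<le> lam\<^sup>2"
        proof -
          have 1: "2 * e \<le> 1" using e r1 by simp
          have "C' * (2 * e)\<^sup>2 \<le> C' * ((2 * e) * 1)"
            unfolding power2_eq_square using e 1 C'(1) by (intro mult_left_mono) auto
          moreover have "C' * e \<le> 2 * (C' * r)" using mult_left_mono[OF e(2) C'(1)] by simp
          ultimately show ?thesis using rC' by simp
        qed
        have "E \<le> (integral {0..1} (\<lambda>t. sqrt (L.ip (chart_map c (\<gamma> t)) (vd t) (vd t))))\<^sup>2"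
          unfolding E_def
        proof (rule L.geodesic_minimal[OF convex_cball R(2) _ C' _ m uK u(4,5,6) zK T(4,2,3)])
          show "lam\<^sup>2 * (norm v)\<^sup>2 \<le> L.ip x v v" if "x \<in> ?K" for x v
            using lam[OF that, of v] by (simp add: power_mult_distrib)
          show "chart_map c (\<gamma> 0) = u 0" "chart_map c (\<gamma> 1) = u 1"
            using g0 aR bi u(1,2) chart_map_inv[OF c(1)] by auto
        qed (use e in auto)
        also have "integral {0..1} (\<lambda>t. sqrt (L.ip (chart_map c (\<gamma> t)) (vd t) (vd t))) = curve_length A g \<gamma>"
          unfolding curve_length_def by (rule integral_unique[OF T(5)])
        finally show ?thesis using curve_length_nonneg[OF \<gamma>(1)] by (simp add: real_le_lsqrt)
      next
        case False
        have "sqrt E \<le> Lam * norm (w 0)"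
          by (rule real_le_lsqrt) (use Lam[OF uK[of 0], of "w 0"] E0 L0 in \<open>auto simp: E_def\<close>)
        also have "\<dots> \<le> Lam * (4 * r)" using u(6)[of 0] e L0 by (intro mult_left_mono) auto
        also have "\<dots> \<le> lam * (R / 2)" using rL by simp
        also have "\<dots> \<le> lam * (R - norm (a - x0))"
          using a(2) rR r0 l0 by (intro mult_left_mono) (auto simp: dist_norm norm_minus_commute)
        finally show ?thesis using False by simp
      qed
    qed
    with up have "E = (d x y)\<^sup>2" using E0 by simp
    moreover have "norm (christoffel_form (g c) (u t) (w t) v) \<le> norm v / 2" if t: "t \<in> {0..1}" for t v
    proof -
      have "norm (christoffel_form (g c) (u t) (w t) v) \<le> C * norm (w t) * norm v" by (rule C(2)[OF uK[OF t]])
      also have "\<dots> \<le> C * (2 * e) * norm v"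
        using u(6)[OF t] C(1) by (intro mult_right_mono mult_left_mono) auto
      also have "\<dots> \<le> (1/2) * norm v" using Ce rC by (intro mult_right_mono) auto
      finally show ?thesis by simp
    qed
    ultimately have "geodesic_segment c u w x y"
      unfolding geodesic_segment_def using c(1) uS u(1,2,4,5) a(1) b(1) by (simp add: E_def)
    then show ?thesis by blast
  qed
  then have "\<forall>x y. d p x < lam * r \<longrightarrow> d p y < lam * r \<longrightarrow> (\<exists>c u w. geodesic_segment c u w x y)" by blast
  then show ?thesis using mult_pos_pos[OF l0 r0] by blast
qed

end

section \<open>Hopf--Rinow for complete locally compact length spaces\<close>

text \<open>Let \<rho> be the supremum of the radii of compact balls. Smaller balls are compact and,
  by \<open>len\<close>, come close to every point of the closed ball of radius \<rho>, which is
  thus totally bounded and, by completeness, compact. Finitely many compact balls around its points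
  then cover a ball of radius \<open>\<rho> + \<delta>\<close>, a contradiction.\<close>

lemma (in Metric_space) hopf_rinow:
  assumes complete: "mcomplete"
    and loc: "\<And>x. x \<in> M \<Longrightarrow> \<exists>r>0. compactin mtopology (mcball x r)"
    and len: "\<And>x y r e. x \<in> M \<Longrightarrow> y \<in> M \<Longrightarrow> 0 \<le> r \<Longrightarrow> r \<le> d x y \<Longrightarrow> e > 0 \<Longrightarrow> \<exists>z\<in>M. d x z \<le> r \<and> d z y < d x y - r + e"
    and p: "p \<in> M"
  shows "compactin mtopology (mcball p R)"
proof (rule ccontr)
  assume not: "\<not> compactin mtopology (mcball p R)"
  define S where "S = {r. compactin mtopology (mcball p r)}"
  have down: "s \<in> S" if "r \<in> S" "s \<le> r" for r s
  proof -
    have "compactin mtopology (mcball p r)" using that(1) by (simp add: S_def)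
    then have "compactin mtopology (mcball p s)"
      by (rule closed_compactin[OF _ mcball_subset_concentric[OF that(2)] closedin_mcball])
    then show ?thesis by (simp add: S_def)
  qed
  have ub: "r \<le> R" if "r \<in> S" for r
    using down[OF that, of R] not by (cases "R \<le> r") (auto simp: S_def)
  obtain r0 where r0: "r0 > 0" "r0 \<in> S" using loc[OF p] by (auto simp: S_def)
  define \<rho> where "\<rho> = Sup S"
  have bdd: "bdd_above S" by (rule bdd_aboveI[of S R]) (rule ub)
  have \<rho>0: "\<rho> > 0" using cSup_upper[OF r0(2) bdd] r0(1) by (simp add: \<rho>_def)
  have below: "s \<in> S" if s: "s < \<rho>" for s
  proof -
    obtain r where "r \<in> S" "s < r" using s less_cSup_iff[of S s] bdd r0(2) unfolding \<rho>_def by blast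
    then show ?thesis using down[of r s] by simp
  qed
  have tb: "mtotally_bounded (mcball p \<rho>)"
    unfolding mtotally_bounded_def
  proof (intro allI impI)
    fix e :: real assume e: "e > 0"
    \<comment> \<open>Close enough to \<rho> for every point of the larger ball to be within
      \<open>e / 2\<close> of the smaller one; the maximum keeps the radius nonnegative.\<close>
    define s where "s = max 0 (\<rho> - e / 4)"
    have s: "0 \<le> s" "s < \<rho>" "\<rho> - s \<le> e / 4" using \<rho>0 e by (auto simp: s_def max_def)
    have "mtotally_bounded (mcball p s)"
      using below[OF s(2)] by (intro compactin_imp_mtotally_bounded) (simp add: S_def)
    then obtain K where K: "finite K" "K \<subseteq> mcball p s" "mcball p s \<subseteq> (\<Union>x\<in>K. mball x (e / 4))"
      using e unfolding mtotally_bounded_def by (meson divide_pos_pos zero_less_numeral)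
    have "mcball p \<rho> \<subseteq> (\<Union>x\<in>K. mball x e)"
    proof
      fix y assume y: "y \<in> mcball p \<rho>"
      obtain z where z: "z \<in> mcball p s" "d z y \<le> e / 2"
      proof (cases "d p y \<le> s")
        case True
        then show ?thesis using that[of y] y e by (auto simp: in_mcball)
      next
        case False
        then obtain z where "z \<in> M" "d p z \<le> s" "d z y < d p y - s + e / 4"
          using len[of p y s "e / 4"] p y s(1) e by (auto simp: in_mcball)
        then show ?thesis using that[of z] y s(3) p by (auto simp: in_mcball)
      qed
      then obtain x where x: "x \<in> K" "z \<in> mball x (e / 4)" using K(3) by blast
      have m: "x \<in> M" "y \<in> M" "z \<in> M" using x(2) y z(1) by (auto simp: in_mcball)
      have "d x y \<le> d x z + d z y" by (rule triangle[OF m(1,3,2)])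
      also have "\<dots> < e" using x(2) z(2) e by simp
      finally have "y \<in> mball x e" using m by simp
      then show "y \<in> (\<Union>x\<in>K. mball x e)" using x(1) by blast
    qed
    moreover have "K \<subseteq> mcball p \<rho>"
      using K(2) s(2) mcball_subset_concentric[of s \<rho> p] by auto
    ultimately show "\<exists>K. finite K \<and> K \<subseteq> mcball p \<rho> \<and> mcball p \<rho> \<subseteq> (\<Union>x\<in>K. mball x e)"
      using K(1) by blast
  qed
  have comp: "compactin mtopology (mcball p \<rho>)"
  proof -
    have "compactin mtopology (mtopology closure_of (mcball p \<rho>))"
      using mtotally_bounded_eq_compact_closure_of[OF complete] tb by blast
    then show ?thesis by (simp add: closure_of_closedin)
  qed
  have "\<exists>r>0. compactin mtopology (mcball x r)" if "x \<in> mcball p \<rho>" for x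
    using loc[of x] that by (simp add: in_mcball)
  then obtain r where r: "\<And>x. x \<in> mcball p \<rho> \<Longrightarrow> r x > 0 \<and> compactin mtopology (mcball x (r x))"
    by metis
  \<comment> \<open>Half the radii cover already; the other half is the room for enlarging the
    ball.\<close>
  have cover: "mcball p \<rho> \<subseteq> \<Union>((\<lambda>x. mball x (r x / 2)) ` mcball p \<rho>)"
    using r by (auto simp: in_mcball)
  let ?C = "(\<lambda>x. mball x (r x / 2)) ` mcball p \<rho>"
  have op: "\<forall>V\<in>?C. openin mtopology V" by auto
  have "\<forall>\<C>. (\<forall>V\<in>\<C>. openin mtopology V) \<and> mcball p \<rho> \<subseteq> \<Union>\<C> \<longrightarrow> (\<exists>\<F>. finite \<F> \<and> \<F> \<subseteq> \<C> \<and> mcball p \<rho> \<subseteq> \<Union>\<F>)"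
    using comp unfolding compactin_def by (rule conjunct2)
  from spec[OF this, of ?C] op cover have "\<exists>\<F>. finite \<F> \<and> \<F> \<subseteq> ?C \<and> mcball p \<rho> \<subseteq> \<Union>\<F>" by (simp only: simp_thms)
  then obtain \<F> where \<F>: "finite \<F>" "\<F> \<subseteq> ?C" "mcball p \<rho> \<subseteq> \<Union>\<F>" by (elim exE conjE)
  obtain F where F: "finite F" "F \<subseteq> mcball p \<rho>" "\<F> = (\<lambda>x. mball x (r x / 2)) ` F"
    using finite_subset_image[OF \<F>(1,2)] by blast
  have "p \<in> mcball p \<rho>" using p \<rho>0 by (simp add: in_mcball)
  then have "p \<in> \<Union>\<F>" by (rule subsetD[OF \<F>(3)])
  then have Fne: "F \<noteq> {}" using F(3) by auto
  \<comment> \<open>A point of the enlarged ball is within \<open>2 * \<delta>\<close>, at most half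
    of any \<open>r x\<close>, of a point covered by the half-radius balls.\<close>
  define \<delta> where "\<delta> = Min (r ` F) / 4"
  have \<delta>: "\<delta> > 0" "\<And>x. x \<in> F \<Longrightarrow> 4 * \<delta> \<le> r x"
  proof -
    have "0 < r x" if "x \<in> F" for x using r[of x] F(2) that by blast
    then show "\<delta> > 0" using F(1) Fne by (simp add: \<delta>_def)
    show "4 * \<delta> \<le> r x" if "x \<in> F" for x using F(1) that by (simp add: \<delta>_def)
  qed
  have "mcball p (\<rho> + \<delta>) \<subseteq> (\<Union>x\<in>F. mcball x (r x))"
  proof
    fix y assume y: "y \<in> mcball p (\<rho> + \<delta>)"
    obtain z where z: "z \<in> mcball p \<rho>" "d z y \<le> 2 * \<delta>"
    proof (cases "d p y \<le> \<rho>")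
      case True
      then show ?thesis using that[of y] y \<delta>(1) by (auto simp: in_mcball)
    next
      case False
      then obtain z where "z \<in> M" "d p z \<le> \<rho>" "d z y < d p y - \<rho> + \<delta>"
        using len[of p y \<rho> \<delta>] p y \<rho>0 \<delta>(1) by (auto simp: in_mcball)
      then show ?thesis using that[of z] y p by (auto simp: in_mcball)
    qed
    then obtain x where x: "x \<in> F" "z \<in> mball x (r x / 2)" using \<F>(3) F(3) by blast
    have m: "x \<in> M" "y \<in> M" "z \<in> M" using x(2) y z(1) by (auto simp: in_mcball)
    have "d x y \<le> d x z + d z y" by (rule triangle[OF m(1,3,2)])
    also have "\<dots> \<le> r x" using x(2) z(2) \<delta>(2)[OF x(1)] by simp
    finally show "y \<in> (\<Union>x\<in>F. mcball x (r x))" using x(1) m by (auto simp: in_mcball)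
  qed
  moreover have "compactin mtopology (\<Union>x\<in>F. mcball x (r x))"
    using F r by (intro compactin_Union) auto
  ultimately have "compactin mtopology (mcball p (\<rho> + \<delta>))"
    by (intro closed_compactin[OF _ _ closedin_mcball])
  then have "\<rho> + \<delta> \<in> S" by (simp add: S_def)
  then have "\<rho> + \<delta> \<le> \<rho>" unfolding \<rho>_def by (rule cSup_upper[OF _ bdd])
  then show False using \<delta>(1) by simp
qed

text \<open>Almost intermediate points accumulate in the compact ball, and the triangle inequality
  turns the two limiting inequalities into equations.\<close>

lemma (in Metric_space) intermediate_point_exact:
  assumes comp: "compactin mtopology (mcball x r)"
    and len: "\<And>e. e > 0 \<Longrightarrow> \<exists>z\<in>M. d x z \<le> r \<and> d z y < d x y - r + e"
    and xy: "x \<in> M" "y \<in> M" "0 \<le> r"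
  obtains z where "z \<in> M" "d x z = r" "d z y = d x y - r"
proof -
  have "\<exists>z. z \<in> mcball x r \<and> d z y < d x y - r + inverse (Suc n)" for n
    using len[of "inverse (Suc n)"] xy by (auto simp: in_mcball)
  then obtain z where z: "\<And>n. z n \<in> mcball x r" "\<And>n. d (z n) y < d x y - r + inverse (Suc n)" by metis
  obtain l s where l: "l \<in> mcball x r" "strict_mono s" "limitin mtopology (z \<circ> s) l sequentially"
    using comp z(1) unfolding compactin_sequentially by (meson image_subsetI)
  have lM: "l \<in> M" using l(1) by (simp add: in_mcball)
  have "d l y \<le> d x y - r + e" if e: "e > 0" for e
  proof -
    have "\<forall>\<^sub>F n in sequentially. (z \<circ> s) n \<in> M \<and> d ((z \<circ> s) n) l < e / 2"
      using l(3) half_gt_zero[OF e] unfolding limitin_metric by blast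
    moreover have "\<forall>\<^sub>F n in sequentially. inverse (real (Suc n)) < e / 2"
      using Archimedean_eventually_inverse half_gt_zero[OF e] by blast
    ultimately have "\<forall>\<^sub>F n in sequentially. (z \<circ> s) n \<in> M \<and> d ((z \<circ> s) n) l < e / 2 \<and> inverse (real (Suc n)) < e / 2"
      by eventually_elim simp
    then obtain n where n: "z (s n) \<in> M" "d (z (s n)) l < e / 2" "inverse (real (Suc n)) < e / 2"
      using eventually_happens'[OF sequentially_bot] by auto
    have "inverse (real (Suc (s n))) \<le> inverse (real (Suc n))"
      using strict_mono_imp_increasing[OF l(2), of n] by simp
    moreover have "d l y \<le> d (z (s n)) l + d (z (s n)) y"
      using triangle[OF lM n(1) xy(2)] commute[of l "z (s n)"] by simp
    ultimately show ?thesis using z(2)[of "s n"] n by linarith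
  qed
  then have 1: "d l y \<le> d x y - r" by (rule field_le_epsilon)
  have 2: "d x l \<le> r" using l(1) by (simp add: in_mcball)
  have "d x y \<le> d x l + d l y" by (rule triangle[OF xy(1) lM xy(2)])
  with 1 2 that[OF lM] show thesis by simp
qed

section \<open>Variations of geodesic chains\<close>

text \<open>If \<open>F2 < 0\<close>, then \<open>F1\<close> is negative just to the right of 0 and
  by the mean value theorem \<open>F\<close> falls below \<open>F 0\<close>. \<open>F1\<close> is
  differentiated at 0 only.\<close>

lemma second_derivative_nonneg_at_min:
  fixes F F1 :: "real \<Rightarrow> real"
  assumes s: "s > 0" and F: "\<And>r. \<bar>r\<bar> < s \<Longrightarrow> (F has_real_derivative F1 r) (at r)"
    and F1: "(F1 has_real_derivative F2) (at 0)" and min: "\<And>r. \<bar>r\<bar> < s \<Longrightarrow> F 0 \<le> F r"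
  shows "F1 0 = 0" "0 \<le> F2"
proof -
  show 0: "F1 0 = 0"
    by (rule DERIV_local_min[OF F[of 0] s]) (use s min in auto)
  show "0 \<le> F2"
  proof (rule ccontr)
    assume "\<not> 0 \<le> F2"
    then obtain e where e: "e > 0" "\<And>h. 0 < h \<Longrightarrow> h < e \<Longrightarrow> F1 (0 + h) < F1 0"
      using DERIV_neg_dec_right[OF F1] by auto
    define b where "b = min e s / 2"
    have b: "0 < b" "b < e" "b < s" using e(1) s by (auto simp: b_def)
    have "\<exists>z>0. z < b \<and> F b - F 0 = (b - 0) * F1 z"
      using b by (intro MVT2) (auto intro: F)
    then obtain z where z: "0 < z" "z < b" "F b - F 0 = b * F1 z" by auto
    have "F1 z < 0" using e(2)[of z] z b 0 by simp
    then have "b * F1 z < 0" by (rule mult_pos_neg[OF b(1)])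
    then show False using min[of b] b z(3) by simp
  qed
qed

text \<open>A curve with prescribed 2-jet at 0, twice continuously differentiable nearby. Of a
  moving end point only this 2-jet affects the first and second variation.\<close>

definition C2_at_0 :: "(real \<Rightarrow> 'b::real_normed_vector) \<Rightarrow> 'b \<Rightarrow> 'b \<Rightarrow> 'b \<Rightarrow> bool" where
  "C2_at_0 f x v a \<longleftrightarrow> (\<exists>r>0. \<exists>f1 f2. (\<forall>s. \<bar>s\<bar> < r \<longrightarrow> (f has_vector_derivative f1 s) (at s) \<and> (f1 has_vector_derivative f2 s) (at s))
     \<and> continuous_on {-r<..<r} f2 \<and> f 0 = x \<and> f1 0 = v \<and> f2 0 = a)"

lemma C2_at_0_poly: "C2_at_0 (\<lambda>s. x + s *\<^sub>R v + (s\<^sup>2 / 2) *\<^sub>R a) x v a"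
proof -
  have "((\<lambda>s. x + s *\<^sub>R v + (s\<^sup>2 / 2) *\<^sub>R a) has_vector_derivative v + s *\<^sub>R a) (at s)"
    "((\<lambda>s. v + s *\<^sub>R a) has_vector_derivative a) (at s)" for s
    by (auto intro!: derivative_eq_intros)
  then show ?thesis unfolding C2_at_0_def
    by (intro exI[of _ 1] conjI exI[of _ "\<lambda>s. v + s *\<^sub>R a"] exI[of _ "\<lambda>s. a"]) auto
qed

section \<open>First and second variation of the energy of one segment\<close>

context local_metric
begin

text \<open>The variation \<open>u + s V - (s\<^sup>2/2) \<Gamma>(V, V)\<close> is corrected affinely in \<open>t\<close> so that its end points
  follow \<open>\<sigma>0\<close> and \<open>\<sigma>1\<close>; the correction vanishes to second order at \<open>s = 0\<close>.\<close>

lemma segment_variation: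
  assumes uS: "\<And>t. t \<in> {0..1} \<Longrightarrow> u t \<in> S"
    and du: "\<And>t. t \<in> {0..1} \<Longrightarrow> (u has_vector_derivative w t) (at t within {0..1})"
    and wc: "continuous_on {0..1} w"
    and dV: "\<And>t. t \<in> {0..1} \<Longrightarrow> (V has_vector_derivative Vd t) (at t within {0..1})"
    and Vdc: "continuous_on {0..1} Vd"
    and s0: "C2_at_0 \<sigma>0 (u 0) (V 0) (- christoffel_form G (u 0) (V 0) (V 0))"
    and s1: "C2_at_0 \<sigma>1 (u 1) (V 1) (- christoffel_form G (u 1) (V 1) (V 1))"
  obtains r y yt E E1 where "r > 0"
    "\<And>s t. \<bar>s\<bar> < r \<Longrightarrow> t \<in> {0..1} \<Longrightarrow> y s t \<in> S"
    "\<And>s t. \<bar>s\<bar> < r \<Longrightarrow> t \<in> {0..1} \<Longrightarrow> (y s has_vector_derivative yt s t) (at t within {0..1})"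
    "\<And>s. \<bar>s\<bar> < r \<Longrightarrow> continuous_on {0..1} (yt s)"
    "\<And>s. \<bar>s\<bar> < r \<Longrightarrow> y s 0 = \<sigma>0 s" "\<And>s. \<bar>s\<bar> < r \<Longrightarrow> y s 1 = \<sigma>1 s"
    "\<And>s. \<bar>s\<bar> < r \<Longrightarrow> E s = integral {0..1} (\<lambda>t. ip (y s t) (yt s t) (yt s t))"
    "\<And>s. \<bar>s\<bar> < r \<Longrightarrow> (E has_real_derivative E1 s) (at s)"
    "(E1 has_real_derivative integral {0..1} (\<lambda>t. 2 * ip (u t) (Vd t + christoffel_form G (u t) (w t) (V t)) (Vd t + christoffel_form G (u t) (w t) (V t))
        - 2 * ip (u t) (riemann_curv G (u t) (V t) (w t) (w t)) (V t))) (at 0)"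
    "E 0 = integral {0..1} (\<lambda>t. ip (u t) (w t) (w t))"
    "E1 0 = integral {0..1} (\<lambda>t. metric_deriv G (u t) (V t) (w t) (w t) + 2 * ip (u t) (Vd t) (w t))"
proof -
  obtain r0 f1 f2 where r0: "r0 > 0" and f: "\<And>s. \<bar>s\<bar> < r0 \<Longrightarrow> (\<sigma>0 has_vector_derivative f1 s) (at s)"
    "\<And>s. \<bar>s\<bar> < r0 \<Longrightarrow> (f1 has_vector_derivative f2 s) (at s)" "continuous_on {-r0<..<r0} f2"
    "\<sigma>0 0 = u 0" "f1 0 = V 0" "f2 0 = - christoffel_form G (u 0) (V 0) (V 0)"
    using s0 unfolding C2_at_0_def by metis
  obtain r1 g1 g2 where r1: "r1 > 0" and g: "\<And>s. \<bar>s\<bar> < r1 \<Longrightarrow> (\<sigma>1 has_vector_derivative g1 s) (at s)"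
    "\<And>s. \<bar>s\<bar> < r1 \<Longrightarrow> (g1 has_vector_derivative g2 s) (at s)" "continuous_on {-r1<..<r1} g2"
    "\<sigma>1 0 = u 1" "g1 0 = V 1" "g2 0 = - christoffel_form G (u 1) (V 1) (V 1)"
    using s1 unfolding C2_at_0_def by metis
  define m where "m = min r0 r1"
  have m: "m > 0" "m \<le> r0" "m \<le> r1" using r0 r1 by (auto simp: m_def)
  have uc: "continuous_on {0..1} u" by (rule continuous_on_vector_derivative) (rule du)
  have Vc: "continuous_on {0..1} V" by (rule continuous_on_vector_derivative) (rule dV)
  define Q where "Q t = - christoffel_form G (u t) (V t) (V t)" for t
  define Qd where "Qd t = - christoffel_form_deriv G (u t) (w t) (V t) (V t) - 2 *\<^sub>R christoffel_form G (u t) (V t) (Vd t)" for t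
  have uS': "u ` {0..1} \<subseteq> S" using uS by blast
  have dQ: "(Q has_vector_derivative Qd t) (at t within {0..1})" if t: "t \<in> {0..1}" for t
  proof -
    have "(Q has_vector_derivative - (christoffel_form_deriv G (u t) (w t) (V t) (V t) + christoffel_form G (u t) (Vd t) (V t) + christoffel_form G (u t) (V t) (Vd t))) (at t within {0..1})"
      unfolding Q_def by (rule has_vector_derivative_minus[OF christoffel_form_curve[OF du[OF t] dV[OF t] dV[OF t] uS[OF t]]])
    then show ?thesis
      using christoffel_form_sym[OF uS[OF t], of "Vd t" "V t"] by (simp add: Qd_def scaleR_2 algebra_simps)
  qed
  have Qc: "continuous_on {0..1} Q" by (rule continuous_on_vector_derivative) (rule dQ)
  have Qdc: "continuous_on {0..1} Qd"
    unfolding Qd_def by (intro continuous_intros continuous_on_christoffel_form_deriv continuous_on_christoffel_form uc wc Vc Vdc uS')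
  define p0 where "p0 s = \<sigma>0 s - (u 0 + s *\<^sub>R V 0 + (s\<^sup>2 / 2) *\<^sub>R Q 0)" for s
  define p01 where "p01 s = f1 s - (V 0 + s *\<^sub>R Q 0)" for s
  define p02 where "p02 s = f2 s - Q 0" for s
  define p1 where "p1 s = \<sigma>1 s - (u 1 + s *\<^sub>R V 1 + (s\<^sup>2 / 2) *\<^sub>R Q 1)" for s
  define p11 where "p11 s = g1 s - (V 1 + s *\<^sub>R Q 1)" for s
  define p12 where "p12 s = g2 s - Q 1" for s
  have poly: "((\<lambda>s. x + s *\<^sub>R v + (s\<^sup>2 / 2) *\<^sub>R a) has_vector_derivative v + s *\<^sub>R a) (at s)"
    "((\<lambda>s. v + s *\<^sub>R a) has_vector_derivative a) (at s)" for x v a :: "real^'n" and s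
    by (auto intro!: derivative_eq_intros)
  have dp: "(p0 has_vector_derivative p01 s) (at s)" "(p01 has_vector_derivative p02 s) (at s)"
    "(p1 has_vector_derivative p11 s) (at s)" "(p11 has_vector_derivative p12 s) (at s)" if "\<bar>s\<bar> < m" for s
    unfolding p0_def p01_def p02_def p1_def p11_def p12_def
    using that m by (auto intro!: has_vector_derivative_diff poly f g)
  have p00: "p0 0 = 0" "p01 0 = 0" "p02 0 = 0" "p1 0 = 0" "p11 0 = 0" "p12 0 = 0"
    using f(4-6) g(4-6) by (auto simp: p0_def p01_def p02_def p1_def p11_def p12_def Q_def)
  have pc: "continuous_on {-m<..<m} p0" "continuous_on {-m<..<m} p01" "continuous_on {-m<..<m} p02"
    "continuous_on {-m<..<m} p1" "continuous_on {-m<..<m} p11" "continuous_on {-m<..<m} p12"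
  proof -
    have c: "continuous_on {-m<..<m} h" if "\<And>s. \<bar>s\<bar> < m \<Longrightarrow> (h has_vector_derivative h' s) (at s)" for h h' :: "real \<Rightarrow> real^'n"
      by (rule continuous_on_vector_derivative[of _ _ h'], rule has_vector_derivative_at_within, rule that) (auto simp: abs_less_iff)
    show "continuous_on {-m<..<m} p0" by (rule c) (rule dp(1))
    show "continuous_on {-m<..<m} p01" by (rule c) (rule dp(2))
    show "continuous_on {-m<..<m} p1" by (rule c) (rule dp(3))
    show "continuous_on {-m<..<m} p11" by (rule c) (rule dp(4))
    show "continuous_on {-m<..<m} p02" unfolding p02_def
      by (intro continuous_intros continuous_on_subset[OF f(3)]) (use m in auto)
    show "continuous_on {-m<..<m} p12" unfolding p12_def
      by (intro continuous_intros continuous_on_subset[OF g(3)]) (use m in auto)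
  qed
  define y where "y s t = u t + s *\<^sub>R V t + (s\<^sup>2 / 2) *\<^sub>R Q t + (1 - t) *\<^sub>R p0 s + t *\<^sub>R p1 s" for s t
  \<comment> \<open>The suffixes \<open>t\<close> and \<open>s\<close> stand for partial derivatives
    of \<open>y\<close> in the two variables.\<close>
  define yt where "yt s t = w t + s *\<^sub>R Vd t + (s\<^sup>2 / 2) *\<^sub>R Qd t + (p1 s - p0 s)" for s t
  define ys where "ys s t = V t + s *\<^sub>R Q t + (1 - t) *\<^sub>R p01 s + t *\<^sub>R p11 s" for s t
  define yss where "yss s t = Q t + (1 - t) *\<^sub>R p02 s + t *\<^sub>R p12 s" for s t
  define yts where "yts s t = Vd t + s *\<^sub>R Qd t + (p11 s - p01 s)" for s t
  define ytss where "ytss s t = Qd t + (p12 s - p02 s)" for s t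
  have ct: "continuous_on ({-m<..<m} \<times> {0..1}) (\<lambda>z. h (snd z))" if "continuous_on {0..1} h" for h :: "real \<Rightarrow> real^'n"
    by (rule continuous_on_compose2[OF that]) (auto intro: continuous_intros)
  have cs: "continuous_on ({-m<..<m} \<times> {0..1::real}) (\<lambda>z. h (fst z))" if "continuous_on {-m<..<m} h" for h :: "real \<Rightarrow> real^'n"
    by (rule continuous_on_compose2[OF that]) (auto intro: continuous_intros)
  have yc: "continuous_on ({-m<..<m} \<times> {0..1}) (\<lambda>z. y (fst z) (snd z))"
    unfolding y_def by (intro continuous_intros ct cs pc uc Vc Qc) auto
  have ytc: "continuous_on ({-m<..<m} \<times> {0..1}) (\<lambda>z. yt (fst z) (snd z))"
    unfolding yt_def by (intro continuous_intros ct cs pc wc Vdc Qdc) auto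
  have ysc: "continuous_on ({-m<..<m} \<times> {0..1}) (\<lambda>z. ys (fst z) (snd z))"
    unfolding ys_def by (intro continuous_intros ct cs pc Vc Qc)
  have yssc: "continuous_on ({-m<..<m} \<times> {0..1}) (\<lambda>z. yss (fst z) (snd z))"
    unfolding yss_def by (intro continuous_intros ct cs pc Qc)
  have ytsc: "continuous_on ({-m<..<m} \<times> {0..1}) (\<lambda>z. yts (fst z) (snd z))"
    unfolding yts_def by (intro continuous_intros ct cs pc Vdc Qdc)
  have ytssc: "continuous_on ({-m<..<m} \<times> {0..1}) (\<lambda>z. ytss (fst z) (snd z))"
    unfolding ytss_def by (intro continuous_intros ct cs pc Qdc)
  \<comment> \<open>Compactness of the unit interval gives one range of \<open>s\<close> for which
    the whole varied segment stays in \<open>S\<close>.\<close>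
  obtain r where r: "0 < r" "r < m" and yS: "\<And>s t. \<bar>s\<bar> < r \<Longrightarrow> t \<in> {0..1} \<Longrightarrow> y s t \<in> S"
  proof -
    obtain e where e: "e > 0" "(\<Union>x\<in>u ` {0..1}. ball x e) \<subseteq> S"
      using compact_subset_open_imp_ball_epsilon_subset[OF compact_continuous_image[OF uc compact_Icc] open_S uS'] by blast
    have "compact ({-m/2..m/2} \<times> {0..1::real})" by (intro compact_Times compact_Icc)
    moreover have "continuous_on ({-m/2..m/2} \<times> {0..1}) (\<lambda>z. y (fst z) (snd z))"
      by (rule continuous_on_subset[OF yc]) (use m in auto)
    ultimately have "uniformly_continuous_on ({-m/2..m/2} \<times> {0..1}) (\<lambda>z. y (fst z) (snd z))"
      by (rule compact_uniformly_continuous[rotated])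
    then obtain k where k: "k > 0" "\<And>z z'. z \<in> {-m/2..m/2} \<times> {0..1} \<Longrightarrow> z' \<in> {-m/2..m/2} \<times> {0..1} \<Longrightarrow> dist z' z < k
       \<Longrightarrow> dist (y (fst z') (snd z')) (y (fst z) (snd z)) < e"
      using e(1) unfolding uniformly_continuous_on_def by metis
    show thesis
    proof (rule that[of "min k (m / 2)"])
      fix s t :: real assume s: "\<bar>s\<bar> < min k (m / 2)" and t: "t \<in> {0..1}"
      have "-m / 2 \<le> s" "s \<le> m / 2" using s by auto
      then have "dist (y s t) (y 0 t) < e"
        using k(2)[of "(0, t)" "(s, t)"] s t m by (auto simp: dist_Pair_Pair dist_real_def abs_less_iff)
      then have "y s t \<in> ball (u t) e" by (simp add: y_def[of 0] p00 dist_commute)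
      then show "y s t \<in> S" using e(2) t by blast
    qed (use k m in auto)
  qed
  let ?U = "{-r<..<r}"
  have Um: "\<bar>s\<bar> < m" if "s \<in> ?U" for s using that r by auto
  have Ur: "s \<in> ?U \<longleftrightarrow> \<bar>s\<bar> < r" for s by auto
  have sub: "?U \<times> {0..1::real} \<subseteq> {-m<..<m} \<times> {0..1}" using r by auto
  note cont = yc[THEN continuous_on_subset[OF _ sub]] ytc[THEN continuous_on_subset[OF _ sub]]
     ysc[THEN continuous_on_subset[OF _ sub]] yssc[THEN continuous_on_subset[OF _ sub]]
     ytsc[THEN continuous_on_subset[OF _ sub]] ytssc[THEN continuous_on_subset[OF _ sub]]
  have yim: "(\<lambda>z. y (fst z) (snd z)) ` (?U \<times> {0..1}) \<subseteq> S"
  proof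
    fix x assume "x \<in> (\<lambda>z. y (fst z) (snd z)) ` (?U \<times> {0..1})"
    then obtain s t where "s \<in> ?U" "t \<in> {0..1}" "x = y s t" by auto
    then show "x \<in> S" using yS[of s t] by auto
  qed
  have dyt: "(y s has_vector_derivative yt s t) (at t within {0..1})" if t: "t \<in> {0..1}" for s t
  proof -
    have 1: "((\<lambda>t. (1 - t) *\<^sub>R p0 s) has_vector_derivative - p0 s) (at t within {0..1})"
      "((\<lambda>t. t *\<^sub>R p1 s) has_vector_derivative p1 s) (at t within {0..1})"
      by (auto intro!: derivative_eq_intros)
    have sc: "((\<lambda>t. k *\<^sub>R h t) has_vector_derivative k *\<^sub>R h') (at t within {0..1})"
      if "(h has_vector_derivative h') (at t within {0..1})" for k and h :: "real \<Rightarrow> real^'n" and h'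
      by (rule bounded_linear.has_vector_derivative[OF bounded_linear_scaleR_right that])
    have "(y s has_vector_derivative (w t + s *\<^sub>R Vd t + (s\<^sup>2 / 2) *\<^sub>R Qd t + - p0 s + p1 s)) (at t within {0..1})"
      unfolding y_def by (intro has_vector_derivative_add 1 sc du dV dQ t)
    then show ?thesis by (simp add: yt_def algebra_simps)
  qed
  have dys: "((\<lambda>s. y s t) has_vector_derivative ys s t) (at s within ?U)"
    "((\<lambda>s. ys s t) has_vector_derivative yss s t) (at s within ?U)"
    "((\<lambda>s. yt s t) has_vector_derivative yts s t) (at s within ?U)"
    "((\<lambda>s. yts s t) has_vector_derivative ytss s t) (at s within ?U)" if s: "s \<in> ?U" for s t
  proof -
    have sc: "((\<lambda>s. k *\<^sub>R h s) has_vector_derivative k *\<^sub>R h') (at s)"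
      if "(h has_vector_derivative h') (at s)" for k and h :: "real \<Rightarrow> real^'n" and h'
      by (rule bounded_linear.has_vector_derivative[OF bounded_linear_scaleR_right that])
    note dp' = dp[OF Um[OF s]]
    have "((\<lambda>s. y s t) has_vector_derivative ys s t) (at s)"
      unfolding y_def ys_def by (intro has_vector_derivative_add poly sc dp')
    then show "((\<lambda>s. y s t) has_vector_derivative ys s t) (at s within ?U)" by (rule has_vector_derivative_at_within)
    have "((\<lambda>s. ys s t) has_vector_derivative yss s t) (at s)"
      unfolding ys_def yss_def by (intro has_vector_derivative_add poly sc dp')
    then show "((\<lambda>s. ys s t) has_vector_derivative yss s t) (at s within ?U)" by (rule has_vector_derivative_at_within)
    have "((\<lambda>s. yt s t) has_vector_derivative (Vd t + s *\<^sub>R Qd t + (p11 s - p01 s))) (at s)"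
      unfolding yt_def by (intro has_vector_derivative_add has_vector_derivative_diff poly dp')
    then show "((\<lambda>s. yt s t) has_vector_derivative yts s t) (at s within ?U)"
      unfolding yts_def by (rule has_vector_derivative_at_within)
    have "((\<lambda>s. yts s t) has_vector_derivative ytss s t) (at s)"
      unfolding yts_def ytss_def by (intro has_vector_derivative_add has_vector_derivative_diff poly dp')
    then show "((\<lambda>s. yts s t) has_vector_derivative ytss s t) (at s within ?U)" by (rule has_vector_derivative_at_within)
  qed
  have yS': "y s t \<in> S" if "s \<in> ?U" "t \<in> {0..1}" for s t using that yS by auto
  define e0 where "e0 s t = ip (y s t) (yt s t) (yt s t)" for s t
  define e1 where "e1 s t = metric_deriv G (y s t) (ys s t) (yt s t) (yt s t) + 2 * ip (y s t) (yts s t) (yt s t)" for s t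
  define e2 where "e2 s t = metric_deriv2 G (y s t) (ys s t) (ys s t) (yt s t) (yt s t) + metric_deriv G (y s t) (yss s t) (yt s t) (yt s t)
     + 4 * metric_deriv G (y s t) (ys s t) (yts s t) (yt s t) + 2 * ip (y s t) (ytss s t) (yt s t) + 2 * ip (y s t) (yts s t) (yts s t)" for s t
  have de0: "((\<lambda>s. e0 s t) has_vector_derivative e1 s t) (at s within ?U)" if s: "s \<in> ?U" and t: "t \<in> {0..1}" for s t
  proof -
    have "((\<lambda>s. e0 s t) has_vector_derivative (metric_deriv G (y s t) (ys s t) (yt s t) (yt s t) + ip (y s t) (yts s t) (yt s t) + ip (y s t) (yt s t) (yts s t))) (at s within ?U)"
      unfolding e0_def by (rule ip_curve[OF dys(1,3,3)[OF s] yS'[OF s t]])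
    then show ?thesis using ip_sym[OF yS'[OF s t], of "yt s t" "yts s t"] by (simp add: e1_def add_ac)
  qed
  have de1: "((\<lambda>s. e1 s t) has_vector_derivative e2 s t) (at s within ?U)" if s: "s \<in> ?U" and t: "t \<in> {0..1}" for s t
  proof -
    note yst = yS'[OF s t]
    have "((\<lambda>s. e1 s t) has_vector_derivative 
        ((metric_deriv2 G (y s t) (ys s t) (ys s t) (yt s t) (yt s t) + metric_deriv G (y s t) (yss s t) (yt s t) (yt s t)
          + metric_deriv G (y s t) (ys s t) (yts s t) (yt s t) + metric_deriv G (y s t) (ys s t) (yt s t) (yts s t))
        + 2 * (metric_deriv G (y s t) (ys s t) (yts s t) (yt s t) + ip (y s t) (ytss s t) (yt s t) + ip (y s t) (yts s t) (yts s t)))) (at s within ?U)"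
      unfolding e1_def
      by (rule has_vector_derivative_add[OF metric_deriv_curve[OF dys(1,2,3,3)[OF s] s yS'[OF _ t]]
            has_vector_derivative_mult_right[OF ip_curve[OF dys(1,4,3)[OF s] yst]]])
    then show ?thesis
      using metric_deriv_sym[OF yst, of "ys s t" "yt s t" "yts s t"] by (simp add: e2_def algebra_simps)
  qed
  have c0: "continuous_on (?U \<times> {0..1}) (\<lambda>(s, t). e0 s t)"
    unfolding e0_def case_prod_unfold by (intro continuous_intros continuous_on_ip cont yim)
  have c1: "continuous_on (?U \<times> {0..1}) (\<lambda>(s, t). e1 s t)"
    unfolding e1_def case_prod_unfold by (intro continuous_intros continuous_on_ip continuous_on_metric_deriv cont yim)
  have c2: "continuous_on (?U \<times> {0..1}) (\<lambda>(s, t). e2 s t)"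
    unfolding e2_def case_prod_unfold by (intro continuous_intros continuous_on_ip continuous_on_metric_deriv continuous_on_metric_deriv2 cont yim)
  have slice: "h s integrable_on {0..1}" if "continuous_on (?U \<times> {0..1}) (\<lambda>(s, t). h s t)" "s \<in> ?U" for h :: "real \<Rightarrow> real \<Rightarrow> real" and s
  proof (rule integrable_continuous_real)
    have "continuous_on {0..1} (\<lambda>t. (\<lambda>(s, t). h s t) (s, t))"
      by (rule continuous_on_compose2[OF that(1)]) (use that(2) in \<open>auto intro!: continuous_intros\<close>)
    then show "continuous_on {0..1} (h s)" by simp
  qed
  define E where "E s = integral {0..1} (e0 s)" for s
  define E1 where "E1 s = integral {0..1} (e1 s)" for s
  have leib: "((\<lambda>s. integral {0..1} (h s)) has_real_derivative integral {0..1} (h' s)) (at s)"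
    if "\<And>s t. s \<in> ?U \<Longrightarrow> t \<in> {0..1} \<Longrightarrow> ((\<lambda>s. h s t) has_vector_derivative h' s t) (at s within ?U)"
      "continuous_on (?U \<times> {0..1}) (\<lambda>(s, t). h s t)" "continuous_on (?U \<times> {0..1}) (\<lambda>(s, t). h' s t)" "s \<in> ?U"
    for h h' :: "real \<Rightarrow> real \<Rightarrow> real" and s
  proof -
    have "((\<lambda>s. integral (cbox 0 1) (h s)) has_vector_derivative integral (cbox 0 1) (h' s)) (at s within ?U)"
      by (rule leibniz_rule_vector_derivative) (use that slice[OF that(2)] in \<open>auto simp: cbox_interval\<close>)
    then show ?thesis
      using that(4) by (simp add: has_real_derivative_iff_has_vector_derivative at_within_open[of s ?U])
  qed
  have zU: "0 \<in> ?U" using r by simp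
  have y0: "y 0 t = u t" "yt 0 t = w t" "ys 0 t = V t" "yss 0 t = Q t" "yts 0 t = Vd t" "ytss 0 t = Qd t" for t
    by (simp_all add: y_def yt_def ys_def yss_def yts_def ytss_def p00)
  show thesis
  proof (rule that[of r y yt E E1])
    show "0 < r" by (rule r(1))
    show "y s t \<in> S" if "\<bar>s\<bar> < r" "t \<in> {0..1}" for s t by (rule yS[OF that])
    show "(y s has_vector_derivative yt s t) (at t within {0..1})" if "\<bar>s\<bar> < r" "t \<in> {0..1}" for s t by (rule dyt[OF that(2)])
    show "continuous_on {0..1} (yt s)" if "\<bar>s\<bar> < r" for s
      unfolding yt_def by (intro continuous_intros wc Vdc Qdc)
    show "y s 0 = \<sigma>0 s" "y s 1 = \<sigma>1 s" for s by (simp_all add: y_def p0_def p1_def)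
    show "E s = integral {0..1} (\<lambda>t. ip (y s t) (yt s t) (yt s t))" for s by (simp add: E_def e0_def[abs_def])
    show "(E has_real_derivative E1 s) (at s)" if "\<bar>s\<bar> < r" for s
      unfolding E_def[abs_def] E1_def by (rule leib[OF de0 c0 c1]) (use that in auto)
    have "(E1 has_real_derivative integral {0..1} (e2 0)) (at 0)"
      unfolding E1_def[abs_def] by (rule leib[OF de1 c1 c2 zU])
    \<comment> \<open>At \<open>s = 0\<close> the integrand is the left-hand side of
      \<open>second_variation_identity\<close> with \<open>p = w t\<close> and
      \<open>W = Vd t\<close>.\<close>
    moreover have "integral {0..1} (e2 0) = integral {0..1} (\<lambda>t. 2 * ip (u t) (Vd t + christoffel_form G (u t) (w t) (V t)) (Vd t + christoffel_form G (u t) (w t) (V t))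
        - 2 * ip (u t) (riemann_curv G (u t) (V t) (w t) (w t)) (V t))"
    proof (rule integral_cong)
      fix t :: real assume t: "t \<in> {0..1}"
      note x = uS[OF t]
      show "e2 0 t = 2 * ip (u t) (Vd t + christoffel_form G (u t) (w t) (V t)) (Vd t + christoffel_form G (u t) (w t) (V t))
        - 2 * ip (u t) (riemann_curv G (u t) (V t) (w t) (w t)) (V t)"
        unfolding second_variation_identity[OF x, symmetric] e2_def y0
        using ip_sym[OF x, of "w t" "Qd t"] metric_deriv_sym[OF x, of "V t" "w t" "Vd t"] by (simp add: Q_def Qd_def)
    qed
    ultimately show "(E1 has_real_derivative integral {0..1} (\<lambda>t. 2 * ip (u t) (Vd t + christoffel_form G (u t) (w t) (V t)) (Vd t + christoffel_form G (u t) (w t) (V t))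
        - 2 * ip (u t) (riemann_curv G (u t) (V t) (w t) (w t)) (V t))) (at 0)" by simp
    show "E 0 = integral {0..1} (\<lambda>t. ip (u t) (w t) (w t))" by (simp add: E_def e0_def[abs_def] y0)
    show "E1 0 = integral {0..1} (\<lambda>t. metric_deriv G (u t) (V t) (w t) (w t) + 2 * ip (u t) (Vd t) (w t))"
      by (simp add: E1_def e1_def[abs_def] y0)
  qed
qed

text \<open>By the geodesic equation the integrand is the derivative of
  \<open>2 * ip (u t) (V t) (w t)\<close>, so only the field at the two ends counts.\<close>

lemma first_variation_boundary:
  assumes uS: "\<And>t. t \<in> {0..1} \<Longrightarrow> u t \<in> S"
    and du: "\<And>t. t \<in> {0..1} \<Longrightarrow> (u has_vector_derivative w t) (at t within {0..1})"
    and dw: "\<And>t. t \<in> {0..1} \<Longrightarrow> (w has_vector_derivative - christoffel_form G (u t) (w t) (w t)) (at t within {0..1})"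
    and dV: "\<And>t. t \<in> {0..1} \<Longrightarrow> (V has_vector_derivative Vd t) (at t within {0..1})"
  shows "integral {0..1} (\<lambda>t. metric_deriv G (u t) (V t) (w t) (w t) + 2 * ip (u t) (Vd t) (w t))
    = 2 * ip (u 1) (V 1) (w 1) - 2 * ip (u 0) (V 0) (w 0)"
proof (rule integral_unique, rule fundamental_theorem_of_calculus)
  fix t :: real assume t: "t \<in> {0..1}"
  note x = uS[OF t]
  have "((\<lambda>t. 2 * ip (u t) (V t) (w t)) has_vector_derivative 2 * (metric_deriv G (u t) (w t) (V t) (w t) + ip (u t) (Vd t) (w t)
      + ip (u t) (V t) (- christoffel_form G (u t) (w t) (w t)))) (at t within {0..1})"
    by (rule has_vector_derivative_mult_right[OF ip_curve[OF du[OF t] dV[OF t] dw[OF t] x]])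
  also have "2 * (metric_deriv G (u t) (w t) (V t) (w t) + ip (u t) (Vd t) (w t) + ip (u t) (V t) (- christoffel_form G (u t) (w t) (w t)))
     = metric_deriv G (u t) (V t) (w t) (w t) + 2 * ip (u t) (Vd t) (w t)"
    using christoffel_form_sym[OF x, of "V t" "w t"] ip_sym[OF x, of "w t" "christoffel_form G (u t) (w t) (V t)"]
    by (simp add: christoffel_form_compat[OF x] ip_simps)
  finally show "((\<lambda>t. 2 * ip (u t) (V t) (w t)) has_vector_derivative metric_deriv G (u t) (V t) (w t) (w t) + 2 * ip (u t) (Vd t) (w t)) (at t within {0..1})" .
qed simp

end

context riemannian_manifold
begin

text \<open>That a curve has vanishing covariant acceleration at \<open>0\<close> does not depend on the chart; this lets
  the variations of adjacent segments share their end points.\<close>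

lemma transition_variation:
  fixes V :: "real^'n"
  assumes c: "c \<in> A" "c' \<in> A" and x: "x \<in> overlap c c'"
  defines "\<kappa> \<equiv> \<lambda>s. x + s *\<^sub>R V + (s\<^sup>2 / 2) *\<^sub>R (- christoffel_form (g c) x V V)"
  shows "C2_at_0 (\<lambda>s. transition c c' (\<kappa> s)) (transition c c' x) (dir_deriv (transition c c') V x)
     (- christoffel_form (g c') (transition c c' x) (dir_deriv (transition c c') V x) (dir_deriv (transition c c') V x))"
    "\<exists>r>0. \<forall>s. \<bar>s\<bar> < r \<longrightarrow> \<kappa> s \<in> overlap c c'"
proof -
  let ?\<tau> = "transition c c'" and ?a = "- christoffel_form (g c) x V V"
  note sm = smooth_transition[OF c]
  have oo: "open (overlap c c')" by (rule open_overlap[OF c])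
  have \<kappa>c: "continuous_on UNIV \<kappa>" unfolding \<kappa>_def by (intro continuous_intros) auto
  have "open (\<kappa> -` overlap c c')" by (rule open_vimage[OF oo \<kappa>c])
  moreover have "0 \<in> \<kappa> -` overlap c c'" using x by (simp add: \<kappa>_def)
  ultimately obtain r where r: "r > 0" "ball 0 r \<subseteq> \<kappa> -` overlap c c'" using open_contains_ball by metis
  have ov: "\<kappa> s \<in> overlap c c'" if "\<bar>s\<bar> < r" for s using r(2) that by (auto simp: ball_def dist_real_def)
  then show "\<exists>r>0. \<forall>s. \<bar>s\<bar> < r \<longrightarrow> \<kappa> s \<in> overlap c c'" using r(1) by blast
  define k1 where "k1 s = V + s *\<^sub>R ?a" for s
  have dk: "(\<kappa> has_vector_derivative k1 s) (at s within W)" "(k1 has_vector_derivative ?a) (at s within W)" for s W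
    unfolding \<kappa>_def k1_def by (auto intro!: derivative_eq_intros)
  let ?W = "{-r<..<r}"
  have ovW: "\<kappa> s \<in> overlap c c'" if "s \<in> ?W" for s using that by (intro ov) auto
  have d1: "((\<lambda>s. ?\<tau> (\<kappa> s)) has_vector_derivative dir_deriv ?\<tau> (k1 s) (\<kappa> s)) (at s)" if "\<bar>s\<bar> < r" for s
    by (rule dir_deriv_curve[OF sm ov[OF that] dk(1)])
  have d2: "((\<lambda>s. dir_deriv ?\<tau> (k1 s) (\<kappa> s)) has_vector_derivative dir_deriv ?\<tau> ?a (\<kappa> s) + dir_deriv (dir_deriv ?\<tau> (k1 s)) (k1 s) (\<kappa> s)) (at s)" if "\<bar>s\<bar> < r" for s
  proof -
    have sW: "s \<in> ?W" using that by auto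
    have "((\<lambda>s. dir_deriv ?\<tau> (k1 s) (\<kappa> s)) has_vector_derivative dir_deriv ?\<tau> ?a (\<kappa> s) + dir_deriv (dir_deriv ?\<tau> (k1 s)) (k1 s) (\<kappa> s)) (at s within ?W)"
      by (rule dir_deriv_moving_curve[OF oo sm ov[OF that] dk sW ovW])
    then show ?thesis using sW by (simp add: at_within_open[of s ?W])
  qed
  have cont: "continuous_on ?W (\<lambda>s. dir_deriv ?\<tau> ?a (\<kappa> s) + dir_deriv (dir_deriv ?\<tau> (k1 s)) (k1 s) (\<kappa> s))"
  proof -
    have "continuous_on ?W \<kappa>" by (rule continuous_on_subset[OF \<kappa>c]) simp
    moreover have "continuous_on ?W k1" unfolding k1_def by (intro continuous_intros)
    moreover have "\<kappa> ` ?W \<subseteq> overlap c c'" using ovW by blast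
    ultimately show ?thesis
      by (intro continuous_on_add continuous_on_dir_deriv[OF sm] continuous_on_dir_deriv_dir_deriv[OF oo sm] continuous_on_const)
  qed
  \<comment> \<open>The inhomogeneous term of the transformation law is cancelled by the second
    derivative of the transition map along the curve, so the acceleration in \<open>c'\<close> is
    again minus \<Gamma>.\<close>
  have "dir_deriv ?\<tau> (christoffel_form (g c) x V V) x = christoffel_form (g c') (?\<tau> x) (dir_deriv ?\<tau> V x) (dir_deriv ?\<tau> V x) + dir_deriv (dir_deriv ?\<tau> V) V x"
    by (rule christoffel_form_transform[OF local_metric[OF c(1)] local_metric[OF c(2)] oo overlap_sub transition_in[OF c(1)] sm transition_isometry[OF c] x])
  moreover have "dir_deriv ?\<tau> ?a x = - dir_deriv ?\<tau> (christoffel_form (g c) x V V) x"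
  proof -
    interpret linear "\<lambda>v. dir_deriv ?\<tau> v x" by (rule linear_dir_deriv[OF sm x])
    show ?thesis by (rule neg)
  qed
  ultimately have 0: "dir_deriv ?\<tau> ?a x + dir_deriv (dir_deriv ?\<tau> V) V x = - christoffel_form (g c') (?\<tau> x) (dir_deriv ?\<tau> V x) (dir_deriv ?\<tau> V x)" by simp
  have \<kappa>0: "\<kappa> 0 = x" "k1 0 = V" by (simp_all add: \<kappa>_def k1_def)
  show "C2_at_0 (\<lambda>s. ?\<tau> (\<kappa> s)) (?\<tau> x) (dir_deriv ?\<tau> V x) (- christoffel_form (g c') (?\<tau> x) (dir_deriv ?\<tau> V x) (dir_deriv ?\<tau> V x))"
    unfolding C2_at_0_def
  proof (intro exI conjI allI impI)
    show "r > 0" by (rule r(1))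
    show "((\<lambda>s. ?\<tau> (\<kappa> s)) has_vector_derivative dir_deriv ?\<tau> (k1 s) (\<kappa> s)) (at s)" if "\<bar>s\<bar> < r" for s by (rule d1[OF that])
    show "((\<lambda>s. dir_deriv ?\<tau> (k1 s) (\<kappa> s)) has_vector_derivative dir_deriv ?\<tau> ?a (\<kappa> s) + dir_deriv (dir_deriv ?\<tau> (k1 s)) (k1 s) (\<kappa> s)) (at s)"
      if "\<bar>s\<bar> < r" for s by (rule d2[OF that])
    show "continuous_on ?W (\<lambda>s. dir_deriv ?\<tau> ?a (\<kappa> s) + dir_deriv (dir_deriv ?\<tau> (k1 s)) (k1 s) (\<kappa> s))" by (rule cont)
  qed (simp_all only: \<kappa>0 0)
qed

end

text \<open>Used for boundary terms: the term at the end of a segment equals the one at the start of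
  the next, so only the two outer ones remain.\<close>

lemma sum_telescope_nodes:
  fixes p q :: "nat \<Rightarrow> 'b::ab_group_add"
  assumes "\<And>i. Suc i < N \<Longrightarrow> p i = q (Suc i)" "0 < N"
  shows "(\<Sum>i<N. p i - q i) = p (N - 1) - q 0"
  using assms
proof (induction N)
  case (Suc N)
  show ?case
  proof (cases "N = 0")
    case False
    then have "p (N - 1) = q N" using Suc.prems(1)[of "N - 1"] by simp
    moreover have "(\<Sum>i<N. p i - q i) = p (N - 1) - q 0" using False Suc by simp
    ultimately show ?thesis by simp
  qed simp
qed simp

text \<open>Each segment has speed \<open>L\<close> on the unit interval, so the chain is a curve on
  \<open>[0, N]\<close>. \<open>total\<close> says that it realises the distance between its ends;
  that it has no corners is a consequence.\<close>

locale geodesic_chain = connected_riemannian_manifold A g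
  for A :: "('a::{t2_space, second_countable_topology}, 'n::finite) chart set" and g +
  fixes N :: nat and x :: "nat \<Rightarrow> 'a" and c :: "nat \<Rightarrow> ('a, 'n) chart"
    and u w :: "nat \<Rightarrow> real \<Rightarrow> real^'n" and L :: real
  assumes N: "0 < N" and L: "0 < L"
    and seg: "i < N \<Longrightarrow> geodesic_segment (c i) (u i) (w i) (x i) (x (Suc i))"
    and step: "i < N \<Longrightarrow> d (x i) (x (Suc i)) = L"
    and total: "d (x 0) (x N) = real N * L"
begin

text \<open>The differential of the change of charts at node \<open>i + 1\<close>: it carries
  components of tangent vectors at the end of segment \<open>i\<close> to those at the start of the
  next one.\<close>

definition J :: "nat \<Rightarrow> real^'n \<Rightarrow> real^'n" where
  "J i v = dir_deriv (transition (c i) (c (Suc i))) v (u i 1)"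

lemma seg_props:
  assumes "i < N"
  shows "c i \<in> A" "\<And>t. t \<in> {0..1} \<Longrightarrow> u i t \<in> chart_img (c i)"
    "\<And>t. t \<in> {0..1} \<Longrightarrow> (u i has_vector_derivative w i t) (at t within {0..1})"
    "\<And>t. t \<in> {0..1} \<Longrightarrow> (w i has_vector_derivative - christoffel_form (g (c i)) (u i t) (w i t) (w i t)) (at t within {0..1})"
    "\<And>t v. t \<in> {0..1} \<Longrightarrow> norm (christoffel_form (g (c i)) (u i t) (w i t) v) \<le> norm v / 2"
    "chart_inv (c i) (u i 0) = x i" "chart_inv (c i) (u i 1) = x (Suc i)"
    "metric_inner (g (c i)) (u i 0) (w i 0) (w i 0) = L\<^sup>2"
    "local_metric (chart_img (c i)) (g (c i))"
  using seg[OF assms] step[OF assms] local_metric[of "c i"] unfolding geodesic_segment_def by auto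

lemma seg_cont: "i < N \<Longrightarrow> continuous_on {0..1} (u i)" "i < N \<Longrightarrow> continuous_on {0..1} (w i)"
  by (rule continuous_on_vector_derivative, rule seg_props(3), assumption+)
     (rule continuous_on_vector_derivative, rule seg_props(4), assumption+)

lemma node_overlap:
  assumes i: "Suc i < N"
  shows "u i 1 \<in> overlap (c i) (c (Suc i))" "transition (c i) (c (Suc i)) (u i 1) = u (Suc i) 0"
proof -
  have i': "i < N" using i by simp
  have "chart_inv (c i) (u i 1) = chart_inv (c (Suc i)) (u (Suc i) 0)"
    using seg_props(7)[OF i'] seg_props(6)[OF i] by simp
  moreover have "u (Suc i) 0 \<in> chart_img (c (Suc i))" "u i 1 \<in> chart_img (c i)"
    using seg_props(2)[OF i, of 0] seg_props(2)[OF i', of 1] by simp_all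
  ultimately show "u i 1 \<in> overlap (c i) (c (Suc i))" "transition (c i) (c (Suc i)) (u i 1) = u (Suc i) 0"
    using chart_inv_in[OF seg_props(1)[OF i]] chart_map_inv[OF seg_props(1)[OF i]]
    by (simp_all add: overlap_iff[OF seg_props(1)[OF i']] transition_def)
qed

lemma node_isometry:
  assumes i: "Suc i < N"
  shows "metric_inner (g (c i)) (u i 1) X Y = metric_inner (g (c (Suc i))) (u (Suc i) 0) (J i X) (J i Y)"
proof -
  have i': "i < N" using i by simp
  show ?thesis
    using transition_isometry[OF seg_props(1)[OF i'] seg_props(1)[OF i] node_overlap(1)[OF i], of X Y] node_overlap(2)[OF i]
    by (simp add: J_def)
qed

lemma J_linear: "Suc i < N \<Longrightarrow> linear (J i)"
  unfolding J_def[abs_def]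
  by (rule linear_dir_deriv[OF smooth_transition node_overlap(1)]) (auto intro: seg_props(1))

lemma J_surj: 
  assumes i: "Suc i < N"
  shows "surj (J i)"
proof -
  have i': "i < N" using i by simp
  have 1: "u i 1 \<in> chart_img (c i)" using seg_props(2)[OF i', of 1] by simp
  show ?thesis
    unfolding J_def[abs_def]
    by (rule dir_deriv_inj_of_isometry(2)[OF seg_props(9)[OF i'] 1 smooth_transition[OF seg_props(1)[OF i'] seg_props(1)[OF i]] node_overlap(1)[OF i]])
       (rule transition_isometry[OF seg_props(1)[OF i'] seg_props(1)[OF i] node_overlap(1)[OF i]])
qed

lemma parallel_inner_constant:
  assumes i: "i < N" and t: "t \<in> {0..1}"
    and P: "\<And>t. t \<in> {0..1} \<Longrightarrow> (P has_vector_derivative - christoffel_form (g (c i)) (u i t) (w i t) (P t)) (at t within {0..1})"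
    and Q: "\<And>t. t \<in> {0..1} \<Longrightarrow> (Q has_vector_derivative - christoffel_form (g (c i)) (u i t) (w i t) (Q t)) (at t within {0..1})"
  shows "metric_inner (g (c i)) (u i t) (P t) (Q t) = metric_inner (g (c i)) (u i 0) (P 0) (Q 0)"
proof -
  interpret M: local_metric "chart_img (c i)" "g (c i)" by (rule seg_props(9)[OF i])
  show ?thesis by (rule M.geodesic_constant_speed[OF seg_props(3)[OF i] seg_props(4)[OF i] P Q seg_props(2)[OF i] t])
qed

text \<open>Vector fields along the whole chain that vanish at its ends. At a node the components
  may jump with the chart; \<open>J\<close> expresses that the vector itself does not.\<close>

definition admissible :: "(nat \<Rightarrow> real \<Rightarrow> real^'n) \<Rightarrow> (nat \<Rightarrow> real \<Rightarrow> real^'n) \<Rightarrow> bool" where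
  "admissible V Vd \<longleftrightarrow> (\<forall>i<N. (\<forall>t\<in>{0..1}. (V i has_vector_derivative Vd i t) (at t within {0..1})) \<and> continuous_on {0..1} (Vd i))
     \<and> (\<forall>i. Suc i < N \<longrightarrow> V (Suc i) 0 = J i (V i 1)) \<and> V 0 0 = 0 \<and> V (N - 1) 1 = 0"

text \<open>The energies of the varied segments bound the squared distances of the varied nodes, whose sum
  is minimal at \<open>s = 0\<close> by the Cauchy--Schwarz inequality.\<close>

lemma variation_inequality:
  assumes adm: "admissible V Vd"
  shows "(\<Sum>i<N. 2 * metric_inner (g (c i)) (u i 1) (V i 1) (w i 1) - 2 * metric_inner (g (c i)) (u i 0) (V i 0) (w i 0)) = 0"
    "0 \<le> (\<Sum>i<N. integral {0..1} (\<lambda>t. 2 * metric_inner (g (c i)) (u i t) (Vd i t + christoffel_form (g (c i)) (u i t) (w i t) (V i t)) (Vd i t + christoffel_form (g (c i)) (u i t) (w i t) (V i t))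
        - 2 * metric_inner (g (c i)) (u i t) (riemann_curv (g (c i)) (u i t) (V i t) (w i t) (w i t)) (V i t)))"
proof -
  have dV: "\<And>t. t \<in> {0..1} \<Longrightarrow> (V i has_vector_derivative Vd i t) (at t within {0..1})"
    and Vdc: "continuous_on {0..1} (Vd i)" if "i < N" for i
    using adm that by (auto simp: admissible_def)
  have match: "V (Suc i) 0 = J i (V i 1)" if "Suc i < N" for i using adm that by (simp add: admissible_def)
  have ends: "V 0 0 = 0" "V (N - 1) 1 = 0" using adm by (simp_all add: admissible_def)
  \<comment> \<open>\<open>\<kappa> i\<close> moves node \<open>i + 1\<close> in the chart of
    segment \<open>i\<close>, \<open>\<sigma> i\<close> moves node \<open>i\<close> in the same
    chart, and \<open>P i\<close> is node \<open>i\<close> on the manifold. Node 0 is fixed by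
    definition, node \<open>N\<close> because the field vanishes there.\<close>
  define \<kappa> where "\<kappa> i s = u i 1 + s *\<^sub>R V i 1 + (s\<^sup>2 / 2) *\<^sub>R (- christoffel_form (g (c i)) (u i 1) (V i 1) (V i 1))" for i s
  define P where "P i s = (case i of 0 \<Rightarrow> x 0 | Suc j \<Rightarrow> chart_inv (c j) (\<kappa> j s))" for i s
  define \<sigma> where "\<sigma> i s = (case i of 0 \<Rightarrow> u 0 0 | Suc j \<Rightarrow> transition (c j) (c (Suc j)) (\<kappa> j s))" for i s
  define B where "B i = 2 * metric_inner (g (c i)) (u i 1) (V i 1) (w i 1) - 2 * metric_inner (g (c i)) (u i 0) (V i 0) (w i 0)" for i
  define I where "I i = integral {0..1} (\<lambda>t. 2 * metric_inner (g (c i)) (u i t) (Vd i t + christoffel_form (g (c i)) (u i t) (w i t) (V i t)) (Vd i t + christoffel_form (g (c i)) (u i t) (w i t) (V i t))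
        - 2 * metric_inner (g (c i)) (u i t) (riemann_curv (g (c i)) (u i t) (V i t) (w i t) (w i t)) (V i t))" for i
  have one: "(1::real) \<in> {0..1}" "(0::real) \<in> {0..1}" by simp_all
  have \<sigma>C: "C2_at_0 (\<sigma> i) (u i 0) (V i 0) (- christoffel_form (g (c i)) (u i 0) (V i 0) (V i 0)) \<and>
      (\<exists>r>0. \<forall>s. \<bar>s\<bar> < r \<longrightarrow> chart_inv (c i) (\<sigma> i s) = P i s)" if i: "i < N" for i
  proof (cases i)
    case 0
    have "C2_at_0 (\<lambda>s. u 0 0 + s *\<^sub>R 0 + (s\<^sup>2 / 2) *\<^sub>R 0) (u 0 0) 0 0" by (rule C2_at_0_poly)
    then have "C2_at_0 (\<sigma> 0) (u 0 0) (V 0 0) (- christoffel_form (g (c 0)) (u 0 0) (V 0 0) (V 0 0))"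
      by (simp add: \<sigma>_def[abs_def] ends christoffel_form_simps)
    moreover have "chart_inv (c 0) (\<sigma> 0 s) = P 0 s" for s
      using seg_props(6)[OF N] by (simp add: \<sigma>_def P_def)
    ultimately show ?thesis unfolding 0 using zero_less_one by blast
  next
    case (Suc j)
    have j: "j < N" "Suc j < N" using Suc i by auto
    note T = transition_variation[OF seg_props(1)[OF j(1)] seg_props(1)[OF j(2)] node_overlap(1)[OF j(2)], where V = "V j 1"]
    have "C2_at_0 (\<lambda>s. transition (c j) (c (Suc j)) (\<kappa> j s)) (u (Suc j) 0) (V (Suc j) 0) (- christoffel_form (g (c (Suc j))) (u (Suc j) 0) (V (Suc j) 0) (V (Suc j) 0))"
      using T(1) unfolding \<kappa>_def match[OF j(2)] J_def node_overlap(2)[OF j(2)] .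
    then have "C2_at_0 (\<sigma> (Suc j)) (u (Suc j) 0) (V (Suc j) 0) (- christoffel_form (g (c (Suc j))) (u (Suc j) 0) (V (Suc j) 0) (V (Suc j) 0))"
      by (simp add: \<sigma>_def[abs_def])
    moreover obtain r where r: "r > 0" "\<And>s. \<bar>s\<bar> < r \<Longrightarrow> \<kappa> j s \<in> overlap (c j) (c (Suc j))"
      using T(2) unfolding \<kappa>_def by blast
    have "chart_inv (c (Suc j)) (\<sigma> (Suc j) s) = P (Suc j) s" if "\<bar>s\<bar> < r" for s
    proof -
      have "chart_inv (c j) (\<kappa> j s) \<in> chart_dom (c (Suc j))"
        using r(2)[OF that] by (simp add: overlap_iff[OF seg_props(1)[OF j(1)]])
      then show ?thesis by (simp add: \<sigma>_def P_def transition_def chart_inv_map[OF seg_props(1)[OF j(2)]])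
    qed
    ultimately show ?thesis unfolding Suc using r(1) by blast
  qed
  \<comment> \<open>The energy \<open>E\<close> of a varied segment bounds the squared distance of
    its ends, with equality at \<open>s = 0\<close>; \<open>B i\<close> and \<open>I i\<close> are
    its first two derivatives there.\<close>
  define Q where "Q i r E E1 \<longleftrightarrow> r > 0 \<and> (\<forall>s. \<bar>s\<bar> < r \<longrightarrow> (d (P i s) (P (Suc i) s))\<^sup>2 \<le> E s \<and> (E has_real_derivative E1 s) (at s))
      \<and> (E1 has_real_derivative I i) (at 0) \<and> E 0 = L\<^sup>2 \<and> E1 0 = B i" for i r E E1
  have "\<exists>r E E1. Q i r E E1" if i: "i < N" for i
  proof -
    interpret M: local_metric "chart_img (c i)" "g (c i)" by (rule seg_props(9)[OF i])
    note cA = seg_props(1)[OF i]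
    have kC: "C2_at_0 (\<kappa> i) (u i 1) (V i 1) (- christoffel_form (g (c i)) (u i 1) (V i 1) (V i 1))"
      unfolding \<kappa>_def[abs_def] by (rule C2_at_0_poly)
    obtain r' where r': "r' > 0" "\<And>s. \<bar>s\<bar> < r' \<Longrightarrow> chart_inv (c i) (\<sigma> i s) = P i s" using \<sigma>C[OF i] by blast
    obtain r y yt E E1 where r: "r > 0"
      and yS: "\<And>s t. \<bar>s\<bar> < r \<Longrightarrow> t \<in> {0..1} \<Longrightarrow> y s t \<in> chart_img (c i)"
      and dy: "\<And>s t. \<bar>s\<bar> < r \<Longrightarrow> t \<in> {0..1} \<Longrightarrow> (y s has_vector_derivative yt s t) (at t within {0..1})"
      and ytc: "\<And>s. \<bar>s\<bar> < r \<Longrightarrow> continuous_on {0..1} (yt s)"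
      and y01: "\<And>s. \<bar>s\<bar> < r \<Longrightarrow> y s 0 = \<sigma> i s" "\<And>s. \<bar>s\<bar> < r \<Longrightarrow> y s 1 = \<kappa> i s"
      and E: "\<And>s. \<bar>s\<bar> < r \<Longrightarrow> E s = integral {0..1} (\<lambda>t. M.ip (y s t) (yt s t) (yt s t))"
        "\<And>s. \<bar>s\<bar> < r \<Longrightarrow> (E has_real_derivative E1 s) (at s)"
        "(E1 has_real_derivative integral {0..1} (\<lambda>t. 2 * M.ip (u i t) (Vd i t + christoffel_form (g (c i)) (u i t) (w i t) (V i t)) (Vd i t + christoffel_form (g (c i)) (u i t) (w i t) (V i t))
        - 2 * M.ip (u i t) (riemann_curv (g (c i)) (u i t) (V i t) (w i t) (w i t)) (V i t))) (at 0)"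
        "E 0 = integral {0..1} (\<lambda>t. M.ip (u i t) (w i t) (w i t))"
        "E1 0 = integral {0..1} (\<lambda>t. metric_deriv (g (c i)) (u i t) (V i t) (w i t) (w i t) + 2 * M.ip (u i t) (Vd i t) (w i t))"
      by (rule M.segment_variation[OF seg_props(2,3)[OF i] seg_cont(2)[OF i] dV[OF i] Vdc[OF i] conjunct1[OF \<sigma>C[OF i]] kC]) (assumption | (rule that; assumption))+
    have E0: "E 0 = L\<^sup>2"
    proof -
      have "E 0 = integral {0..1} (\<lambda>t::real. L\<^sup>2)"
        unfolding E(4)
      proof (rule integral_cong)
        fix t :: real assume t: "t \<in> {0..1}"
        show "M.ip (u i t) (w i t) (w i t) = L\<^sup>2"
          using parallel_inner_constant[OF i t seg_props(4)[OF i] seg_props(4)[OF i]] seg_props(8)[OF i] by simp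
      qed
      then show ?thesis by simp
    qed
    have E10: "E1 0 = B i"
      unfolding E(5) B_def by (rule M.first_variation_boundary[OF seg_props(2,3,4)[OF i] dV[OF i]])
    have dE: "(d (P i s) (P (Suc i) s))\<^sup>2 \<le> E s" if s: "\<bar>s\<bar> < min r r'" for s
    proof -
      have sr: "\<bar>s\<bar> < r" "\<bar>s\<bar> < r'" using s by auto
      note C = chart_curve[OF cA yS[OF sr(1)] dy[OF sr(1)] ytc[OF sr(1)]]
      \<comment> \<open>Distance is at most length, and squared length is at most energy.\<close>
      have "d (P i s) (P (Suc i) s) \<le> curve_length A g (chart_inv (c i) \<circ> y s)"
      proof (rule riem_dist_le[OF C(1)])
        show "pathstart (chart_inv (c i) \<circ> y s) = P i s" using y01(1)[OF sr(1)] r'(2)[OF sr(2)] by (simp add: pathstart_def)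
        show "pathfinish (chart_inv (c i) \<circ> y s) = P (Suc i) s" using y01(2)[OF sr(1)] by (simp add: pathfinish_def P_def)
      qed
      also have "\<dots> = integral {0..1} (\<lambda>t. sqrt (M.ip (y s t) (yt s t) (yt s t)))" by (rule C(2))
      finally have "(d (P i s) (P (Suc i) s))\<^sup>2 \<le> (integral {0..1} (\<lambda>t. sqrt (M.ip (y s t) (yt s t) (yt s t))))\<^sup>2"
        by (rule power_mono) (rule d_nonneg)
      also have "\<dots> \<le> integral {0..1} (\<lambda>t. (sqrt (M.ip (y s t) (yt s t) (yt s t)))\<^sup>2)"
      proof (rule integral_square_le)
        have "continuous_on {0..1} (y s)" by (rule continuous_on_vector_derivative) (rule dy[OF sr(1)])
        then show "continuous_on {0..1} (\<lambda>t. sqrt (M.ip (y s t) (yt s t) (yt s t)))"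
          using yS[OF sr(1)] ytc[OF sr(1)] by (intro continuous_on_real_sqrt M.continuous_on_ip) auto
      qed
      also have "\<dots> = E s"
        unfolding E(1)[OF sr(1)] by (rule integral_cong) (simp add: M.ip_nonneg[OF yS[OF sr(1)]])
      finally show ?thesis .
    qed
    show ?thesis
      using r r'(1) dE E(2,3) E0 E10 unfolding Q_def I_def
      by (intro exI[of _ "min r r'"] exI[of _ E] exI[of _ E1]) simp
  qed
  then obtain r E E1 where Q: "\<And>i. i < N \<Longrightarrow> Q i (r i) (E i) (E1 i)" by metis
  have r: "\<And>i. i < N \<Longrightarrow> r i > 0"
    and E: "\<And>i s. i < N \<Longrightarrow> \<bar>s\<bar> < r i \<Longrightarrow> (d (P i s) (P (Suc i) s))\<^sup>2 \<le> E i s"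
      "\<And>i s. i < N \<Longrightarrow> \<bar>s\<bar> < r i \<Longrightarrow> (E i has_real_derivative E1 i s) (at s)"
      "\<And>i. i < N \<Longrightarrow> (E1 i has_real_derivative I i) (at 0)" "\<And>i. i < N \<Longrightarrow> E i 0 = L\<^sup>2" "\<And>i. i < N \<Longrightarrow> E1 i 0 = B i"
    using Q unfolding Q_def by simp_all
  define m where "m = Min (r ` {..<N})"
  have "{..<N} \<noteq> {}" using N by auto
  then have m: "m > 0" "\<And>i. i < N \<Longrightarrow> m \<le> r i" using r by (auto simp: m_def Min_gr_iff)
  define F where "F s = (\<Sum>i<N. E i s)" for s
  define F1 where "F1 s = (\<Sum>i<N. E1 i s)" for s
  have dF: "(F has_real_derivative F1 s) (at s)" if "\<bar>s\<bar> < m" for s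
    unfolding F_def F1_def by (rule DERIV_sum) (use that m(2) in \<open>force intro: E(2)\<close>)
  have dF1: "(F1 has_real_derivative (\<Sum>i<N. I i)) (at 0)"
    unfolding F1_def[abs_def] by (rule DERIV_sum) (use E(3) in auto)
  have F0: "F 0 = real N * L\<^sup>2" using E(4) by (simp add: F_def)
  have endP: "P N s = x N" for s
  proof -
    obtain j where j: "N = Suc j" using N by (cases N) auto
    then have "V j 1 = 0" using ends(2) by simp
    then show ?thesis using seg_props(7)[of j] j by (simp add: P_def \<kappa>_def christoffel_form_simps)
  qed
  have min: "F 0 \<le> F s" if s: "\<bar>s\<bar> < m" for s
  proof -
    have tri: "d (P 0 s) (P k s) \<le> (\<Sum>i<k. d (P i s) (P (Suc i) s))" for k
    proof (induction k)
      case (Suc k)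
      then show ?case using d_triangle[of "P 0 s" "P (Suc k) s" "P k s"] by simp
    qed (simp add: d_refl)
    have "real N * L \<le> (\<Sum>i<N. d (P i s) (P (Suc i) s))"
      using tri[of N] total endP by (simp add: P_def)
    then have "(real N * L)\<^sup>2 \<le> (\<Sum>i<N. d (P i s) (P (Suc i) s))\<^sup>2"
      using L by (intro power_mono) auto
    also have "\<dots> \<le> (\<Sum>i<N. (d (P i s) (P (Suc i) s))\<^sup>2) * real N"
      using sum_squared_le_sum_of_squares[of "\<lambda>i. d (P i s) (P (Suc i) s)" "{..<N}"] by simp
    also have "\<dots> \<le> F s * real N"
      unfolding F_def using E(1) m(2) s by (intro mult_right_mono sum_mono) force+
    finally have "real N * (real N * L\<^sup>2) \<le> real N * F s" by (simp add: power2_eq_square mult_ac)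
    then show ?thesis using N F0 by simp
  qed
  note S = second_derivative_nonneg_at_min[OF m(1) dF dF1 min]
  have "(\<Sum>i<N. B i) = 0" using S(1) E(5) by (simp add: F1_def)
  then show "(\<Sum>i<N. 2 * metric_inner (g (c i)) (u i 1) (V i 1) (w i 1) - 2 * metric_inner (g (c i)) (u i 0) (V i 0) (w i 0)) = 0"
    by (simp only: B_def)
  show "0 \<le> (\<Sum>i<N. integral {0..1} (\<lambda>t. 2 * metric_inner (g (c i)) (u i t) (Vd i t + christoffel_form (g (c i)) (u i t) (w i t) (V i t)) (Vd i t + christoffel_form (g (c i)) (u i t) (w i t) (V i t))
        - 2 * metric_inner (g (c i)) (u i t) (riemann_curv (g (c i)) (u i t) (V i t) (w i t) (w i t)) (V i t)))"
    using S(2) by (simp only: I_def)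
qed

text \<open>The first variation along a field supported on the two segments at the node pairs the
  jump of the velocity with an arbitrary vector \<open>J k X\<close>, so the jump vanishes.\<close>

lemma no_corner:
  assumes k: "Suc k < N"
  shows "w (Suc k) 0 = J k (w k 1)"
proof -
  have k': "k < N" using k by simp
  interpret M: local_metric "chart_img (c (Suc k))" "g (c (Suc k))" by (rule seg_props(9)[OF k])
  have uS: "u (Suc k) 0 \<in> chart_img (c (Suc k))" using seg_props(2)[OF k, of 0] by simp
  have eq: "M.ip (u (Suc k) 0) (J k X) (J k (w k 1)) = M.ip (u (Suc k) 0) (J k X) (w (Suc k) 0)" for X
  proof -
    \<comment> \<open>A hat field: it rises to \<open>X\<close> at the end of segment
      \<open>k\<close> and falls from \<open>J k X\<close> to 0 on the next segment.\<close>
    define V where "V i t = (if i = k then t *\<^sub>R X else if i = Suc k then (1 - t) *\<^sub>R J k X else 0)" for i and t :: real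
    define Vd where "Vd i t = (if i = k then X else if i = Suc k then - J k X else 0)" for i and t :: real
    have dV: "(V i has_vector_derivative Vd i t) (at t within {0..1})" for i t
    proof -
      have "((\<lambda>t. t *\<^sub>R X) has_vector_derivative X) (at t within {0..1})"
        "((\<lambda>t. (1 - t) *\<^sub>R J k X) has_vector_derivative - J k X) (at t within {0..1})"
        by (auto intro!: derivative_eq_intros)
      then show ?thesis unfolding V_def[abs_def] Vd_def by auto
    qed
    have Jz: "J i 0 = 0" if "Suc i < N" for i by (rule linear_0[OF J_linear[OF that]])
    have "admissible V Vd"
      unfolding admissible_def
      using dV k Jz by (auto simp: Vd_def[abs_def] V_def)
    note variation_inequality(1)[OF this, symmetric]
    also have "(\<Sum>i<N. 2 * metric_inner (g (c i)) (u i 1) (V i 1) (w i 1) - 2 * metric_inner (g (c i)) (u i 0) (V i 0) (w i 0))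
      = (\<Sum>i<N. (if i = k then 2 * metric_inner (g (c k)) (u k 1) X (w k 1) else 0) - (if i = Suc k then 2 * M.ip (u (Suc k) 0) (J k X) (w (Suc k) 0) else 0))"
      by (rule sum.cong[OF refl]) (auto simp: V_def ip_simps)
    also have "\<dots> = 2 * metric_inner (g (c k)) (u k 1) X (w k 1) - 2 * M.ip (u (Suc k) 0) (J k X) (w (Suc k) 0)"
      using k by (simp add: sum_subtractf)
    finally show ?thesis using node_isometry[OF k, of X "w k 1"] by simp
  qed
  have sj: "surj (J k)" by (rule J_surj[OF k])
  have "M.ip (u (Suc k) 0) (w (Suc k) 0) Y = M.ip (u (Suc k) 0) (J k (w k 1)) Y" for Y
  proof -
    obtain X where X: "Y = J k X" using sj by (rule surjE)
    show ?thesis using eq[of X] M.ip_sym[OF uS, of Y] unfolding X by simp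
  qed
  then show ?thesis by (rule M.ip_eqI[OF uS])
qed

text \<open>On each segment the frame starts at the \<open>J\<close>-image of the end of the
  previous one. \<open>J\<close> preserves inner products and the velocity has no corners, so
  orthonormality and the components \<open>k\<close> of the velocity persist along the whole
  chain.\<close>

lemma parallel_frame_exists:
  obtains e :: "nat \<Rightarrow> 'n \<Rightarrow> real \<Rightarrow> real^'n" and k :: "'n \<Rightarrow> real" where
    "\<And>i a t. i < N \<Longrightarrow> t \<in> {0..1} \<Longrightarrow> (e i a has_vector_derivative - christoffel_form (g (c i)) (u i t) (w i t) (e i a t)) (at t within {0..1})"
    "\<And>i a. Suc i < N \<Longrightarrow> e (Suc i) a 0 = J i (e i a 1)"
    "\<And>i a b t. i < N \<Longrightarrow> t \<in> {0..1} \<Longrightarrow> metric_inner (g (c i)) (u i t) (e i a t) (e i b t) = (if a = b then 1 else 0)"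
    "\<And>i a t. i < N \<Longrightarrow> t \<in> {0..1} \<Longrightarrow> metric_inner (g (c i)) (u i t) (e i a t) (w i t) = k a"
proof -
  let ?par = "\<lambda>i W. \<forall>t\<in>{0..1}. (W has_vector_derivative - christoffel_form (g (c i)) (u i t) (w i t) (W t)) (at t within {0..1})"
  have pt: "\<exists>f. \<forall>a. f a 0 = z a \<and> ?par i (f a)" if i: "i < N" for i and z :: "'n \<Rightarrow> real^'n"
  proof -
    interpret M: local_metric "chart_img (c i)" "g (c i)" by (rule seg_props(9)[OF i])
    have "\<exists>W. W 0 = W0 \<and> ?par i W" for W0
    proof -
      show ?thesis
      proof (rule M.parallel_transport_exists[of "u i" "w i" W0, OF seg_cont(1)[OF i] _ seg_cont(2)[OF i] seg_props(5)[OF i]])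
        show "u i ` {0..1} \<subseteq> chart_img (c i)" using seg_props(2)[OF i] by blast
        show ?thesis if "W 0 = W0" "\<And>t. t \<in> {0..1} \<Longrightarrow> (W has_vector_derivative - christoffel_form (g (c i)) (u i t) (w i t) (W t)) (at t within {0..1})" for W
          using that by blast
      qed
    qed
    then have "\<forall>a. \<exists>W. W 0 = z a \<and> ?par i W" by blast
    then show ?thesis by (rule choice)
  qed
  define Pr where "Pr i f \<longleftrightarrow> (i < N \<longrightarrow> (\<forall>a. ?par i (f a))) \<and>
    (i = 0 \<longrightarrow> (\<forall>a b. metric_inner (g (c 0)) (u 0 0) (f a 0) (f b 0) = (if a = b then 1 else 0)))" for i and f :: "'n \<Rightarrow> real \<Rightarrow> real^'n"
  have "\<exists>e. \<forall>i. Pr i (e i) \<and> (Suc i < N \<longrightarrow> (\<forall>a. e (Suc i) a 0 = J i (e i a 1)))"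
  \<comment> \<open>The frame on segment \<open>i + 1\<close> depends on the one chosen on segment
    \<open>i\<close>; beyond the chain \<open>Pr\<close> demands nothing.\<close>
  proof (rule dependent_nat_choice)
    interpret M: local_metric "chart_img (c 0)" "g (c 0)" by (rule seg_props(9)[OF N])
    have u0: "u 0 0 \<in> chart_img (c 0)" using seg_props(2)[OF N, of 0] by simp
    obtain z :: "'n \<Rightarrow> real^'n" where "\<And>a b. M.ip (u 0 0) (z a) (z b) = (if a = b then 1 else 0)"
      using M.orthonormal_frame_exists[OF u0] by blast
    moreover obtain f where "\<forall>a. f a 0 = z a \<and> ?par 0 (f a)" using pt[OF N] by blast
    ultimately show "\<exists>f. Pr 0 f" unfolding Pr_def by (intro exI[of _ f]) simp
  next
    fix f i assume "Pr i f"
    show "\<exists>h. Pr (Suc i) h \<and> (Suc i < N \<longrightarrow> (\<forall>a. h a 0 = J i (f a 1)))"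
    proof (cases "Suc i < N")
      case True
      obtain h where "\<forall>a. h a 0 = J i (f a 1) \<and> ?par (Suc i) (h a)" using pt[OF True, of "\<lambda>a. J i (f a 1)"] by blast
      then show ?thesis unfolding Pr_def by (intro exI[of _ h]) simp
    qed (auto simp: Pr_def)
  qed
  then obtain e where e: "\<And>i. Pr i (e i)" "\<And>i a. Suc i < N \<Longrightarrow> e (Suc i) a 0 = J i (e i a 1)" by blast
  have par: "(e i a has_vector_derivative - christoffel_form (g (c i)) (u i t) (w i t) (e i a t)) (at t within {0..1})"
    if "i < N" "t \<in> {0..1}" for i a t
    using e(1)[of i] that by (simp add: Pr_def)
  have const: "metric_inner (g (c i)) (u i t) (e i a t) (e i b t) = metric_inner (g (c i)) (u i 0) (e i a 0) (e i b 0)"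
    "metric_inner (g (c i)) (u i t) (e i a t) (w i t) = metric_inner (g (c i)) (u i 0) (e i a 0) (w i 0)"
    if "i < N" "t \<in> {0..1}" for i a b t
    using that par seg_props(4)[OF that(1)] by (auto intro!: parallel_inner_constant)
  define k where "k a = metric_inner (g (c 0)) (u 0 0) (e 0 a 0) (w 0 0)" for a
  have "(\<forall>a b. metric_inner (g (c i)) (u i 0) (e i a 0) (e i b 0) = (if a = b then 1 else 0))
     \<and> (\<forall>a. metric_inner (g (c i)) (u i 0) (e i a 0) (w i 0) = k a)" if "i < N" for i
    using that
  proof (induction i)
    case 0
    then show ?case using e(1)[of 0] by (simp add: Pr_def k_def)
  next
    case (Suc i)
    then have i: "i < N" by simp
    show ?case
      unfolding e(2)[OF Suc.prems] no_corner[OF Suc.prems] node_isometry[OF Suc.prems, symmetric]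
      using Suc.IH[OF i] const[OF i, of 1] by simp
  qed
  note start = this
  show thesis
  proof (rule that[of e k])
    fix i a b and t :: real assume it: "i < N" "t \<in> {0..1}"
    show "(e i a has_vector_derivative - christoffel_form (g (c i)) (u i t) (w i t) (e i a t)) (at t within {0..1})" by (rule par[OF it])
    show "metric_inner (g (c i)) (u i t) (e i a t) (e i b t) = (if a = b then 1 else 0)"
      unfolding const(1)[OF it] using start[OF it(1)] by blast
    show "metric_inner (g (c i)) (u i t) (e i a t) (w i t) = k a"
      unfolding const(2)[OF it] using start[OF it(1)] by blast
  qed (rule e(2))
qed

end

section \<open>The diameter bound\<close>

lemma sum_unit_integrals:
  fixes F :: "real \<Rightarrow> real"
  assumes "continuous_on UNIV F"
  shows "(\<Sum>i<N. integral {0..1} (\<lambda>t. F (real i + t))) = integral {0..real N} F"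
proof (induction N)
  case (Suc N)
  have i: "F integrable_on {a..b}" for a b
    by (rule integrable_continuous_real[OF continuous_on_subset[OF assms]]) simp
  have "(\<lambda>t. 1 * t + real N) ` {0..1} = {real N..real (Suc N)}"
    by (subst image_affinity_atLeastAtMost[of 1 "real N" 0 1]) auto
  from has_integral_affine_real[OF integrable_integral[OF i] _ this]
  have "integral {0..1} (\<lambda>t. F (real N + t)) = integral {real N..real (Suc N)} F"
    by (simp add: integral_unique add.commute)
  then show ?case
    using Suc Henstock_Kurzweil_Integration.integral_combine[of 0 "real N" "real (Suc N)" F] i by simp
qed simp

text \<open>Over the full period the cosine changes sign at \<open>T / 4\<close> and
  \<open>3 * T / 4\<close>; the three pieces contribute \<open>T / (2 * pi)\<close>,
  \<open>T / pi\<close> and \<open>T / (2 * pi)\<close>.\<close>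

lemma abs_cos_integral:
  assumes T: "T > 0"
  shows "integral {0..T} (\<lambda>r. \<bar>cos (2 * pi * r / T)\<bar>) = 2 * T / pi"
proof -
  let ?s = "\<lambda>r. T / (2 * pi) * sin (2 * pi * r / T)"
  have ds: "(?s has_vector_derivative cos (2 * pi * r / T)) (at r within W)" for r W
    using T by (auto intro!: derivative_eq_intros simp: has_real_derivative_iff_has_vector_derivative[symmetric])
  have pos: "((\<lambda>r. \<bar>cos (2 * pi * r / T)\<bar>) has_integral (?s b - ?s a)) {a..b}"
    if ab: "a \<le> b" and nn: "\<And>r. r \<in> {a..b} \<Longrightarrow> 0 \<le> cos (2 * pi * r / T)" for a b
  proof (rule has_integral_eq[rotated])
    show "((\<lambda>r. cos (2 * pi * r / T)) has_integral (?s b - ?s a)) {a..b}"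
      by (rule fundamental_theorem_of_calculus[OF ab ds])
  qed (use nn in auto)
  have neg: "((\<lambda>r. \<bar>cos (2 * pi * r / T)\<bar>) has_integral - (?s b - ?s a)) {a..b}"
    if ab: "a \<le> b" and nn: "\<And>r. r \<in> {a..b} \<Longrightarrow> cos (2 * pi * r / T) \<le> 0" for a b
  proof (rule has_integral_eq[rotated])
    show "((\<lambda>r. - cos (2 * pi * r / T)) has_integral - (?s b - ?s a)) {a..b}"
      by (rule has_integral_neg[OF fundamental_theorem_of_calculus[OF ab ds]])
  qed (use nn in auto)
  have 1: "((\<lambda>r. \<bar>cos (2 * pi * r / T)\<bar>) has_integral (?s (T/4) - ?s 0)) {0..T/4}"
  proof (rule pos)
    fix r assume r: "r \<in> {0..T/4}"
    have "2 * pi * r / T \<le> pi / 2" "0 \<le> 2 * pi * r / T" using r T by (auto simp: field_simps)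
    then show "0 \<le> cos (2 * pi * r / T)" by (intro cos_ge_zero) auto
  qed (use T in simp)
  have 2: "((\<lambda>r. \<bar>cos (2 * pi * r / T)\<bar>) has_integral - (?s (3*T/4) - ?s (T/4))) {T/4..3*T/4}"
  proof (rule neg)
    fix r assume r: "r \<in> {T/4..3*T/4}"
    have "pi / 2 \<le> 2 * pi * r / T" "2 * pi * r / T \<le> 3 * pi / 2" using r T by (auto simp: field_simps)
    then have "0 \<le> cos (2 * pi * r / T - pi)" by (intro cos_ge_zero) auto
    then show "cos (2 * pi * r / T) \<le> 0" by (simp add: cos_diff)
  qed (use T in simp)
  have 3: "((\<lambda>r. \<bar>cos (2 * pi * r / T)\<bar>) has_integral (?s T - ?s (3*T/4))) {3*T/4..T}"
  proof (rule pos)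
    fix r assume r: "r \<in> {3*T/4..T}"
    have "3 * pi / 2 \<le> 2 * pi * r / T" "2 * pi * r / T \<le> 2 * pi" using r T by (auto simp: field_simps)
    then have "0 \<le> cos (2 * pi * r / T - 2 * pi)" by (intro cos_ge_zero) auto
    then show "0 \<le> cos (2 * pi * r / T)" by (simp add: cos_diff)
  qed (use T in simp)
  have v: "?s 0 = 0" "?s (T/4) = T / (2 * pi)" "?s T = 0" "?s (3*T/4) = - (T / (2 * pi))"
  proof -
    have "2 * pi * (3 * T / 4) / T = pi / 2 + pi" "2 * pi * (T / 4) / T = pi / 2" "2 * pi * T / T = 2 * pi" using T by simp_all
    then show "?s 0 = 0" "?s (T/4) = T / (2 * pi)" "?s T = 0" "?s (3*T/4) = - (T / (2 * pi))"
      by (simp_all only: sin_add sin_two_pi cos_pi sin_pi_half cos_pi_half sin_pi) simp_all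
  qed
  have "((\<lambda>r. \<bar>cos (2 * pi * r / T)\<bar>) has_integral ((?s (T/4) - ?s 0) + - (?s (3*T/4) - ?s (T/4))) + (?s T - ?s (3*T/4))) {0..T}"
    by (rule has_integral_combine[OF _ _ has_integral_combine[OF _ _ 1 2] 3]) (use T in auto)
  then show ?thesis unfolding v by (simp add: integral_unique)
qed

section \<open>The traced second variation and the bound on the length of a chain\<close>

context geodesic_chain
begin

text \<open>The second variations in the directions \<open>\<phi> *\<^sub>R Z a\<close> are added
  up, where \<open>Z a\<close> is the frame vector with its tangential part removed. Projecting all
  vectors of the frame spares the choice of a frame that contains the velocity.\<close>

lemma index_inequality:
  fixes \<phi> \<phi>d :: "real \<Rightarrow> real"
  assumes d\<phi>: "\<And>r. (\<phi> has_real_derivative \<phi>d r) (at r)" and \<phi>dc: "continuous_on UNIV \<phi>d"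
    and ends: "\<phi> 0 = 0" "\<phi> (real N) = 0"
  defines "q \<equiv> \<lambda>i t. (real CARD('n) - 1) * (\<phi>d (real i + t))\<^sup>2 - (\<phi> (real i + t))\<^sup>2 * ricci (g (c i)) (u i t) (w i t) (w i t)"
  shows "\<And>i. i < N \<Longrightarrow> q i integrable_on {0..1}" "0 \<le> (\<Sum>i<N. integral {0..1} (q i))"
proof -
  obtain e :: "nat \<Rightarrow> 'n \<Rightarrow> real \<Rightarrow> real^'n" and k :: "'n \<Rightarrow> real" where e: "\<And>i a t. i < N \<Longrightarrow> t \<in> {0..1} \<Longrightarrow> (e i a has_vector_derivative - christoffel_form (g (c i)) (u i t) (w i t) (e i a t)) (at t within {0..1})"
    "\<And>i a. Suc i < N \<Longrightarrow> e (Suc i) a 0 = J i (e i a 1)"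
    "\<And>i a b t. i < N \<Longrightarrow> t \<in> {0..1} \<Longrightarrow> metric_inner (g (c i)) (u i t) (e i a t) (e i b t) = (if a = b then 1 else 0)"
    "\<And>i a t. i < N \<Longrightarrow> t \<in> {0..1} \<Longrightarrow> metric_inner (g (c i)) (u i t) (e i a t) (w i t) = k a"
    by (rule parallel_frame_exists) (rule that; assumption)
  define Z where "Z a i t = e i a t - (k a / L\<^sup>2) *\<^sub>R w i t" for a i t
  define V where "V a i t = \<phi> (real i + t) *\<^sub>R Z a i t" for a i t
  define Vd where "Vd a i t = \<phi> (real i + t) *\<^sub>R (- christoffel_form (g (c i)) (u i t) (w i t) (Z a i t)) + \<phi>d (real i + t) *\<^sub>R Z a i t" for a i t
  have \<phi>c: "continuous_on UNIV \<phi>"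
    using d\<phi> by (meson DERIV_continuous_on has_field_derivative_at_within)
  have shift: "continuous_on {0..1} (\<lambda>t. h (real i + t))" if "continuous_on UNIV h" for h :: "real \<Rightarrow> real" and i
    by (rule continuous_on_compose2[OF that]) (auto intro: continuous_intros)
  have dZ: "(Z a i has_vector_derivative - christoffel_form (g (c i)) (u i t) (w i t) (Z a i t)) (at t within {0..1})" if "i < N" "t \<in> {0..1}" for a i t
  proof -
    have "(Z a i has_vector_derivative (- christoffel_form (g (c i)) (u i t) (w i t) (e i a t) - (k a / L\<^sup>2) *\<^sub>R (- christoffel_form (g (c i)) (u i t) (w i t) (w i t)))) (at t within {0..1})"
      unfolding Z_def
      by (rule has_vector_derivative_diff[OF e(1)[OF that] bounded_linear.has_vector_derivative[OF bounded_linear_scaleR_right seg_props(4)[OF that]]])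
    then show ?thesis by (simp add: Z_def christoffel_form_simps)
  qed
  have Zc: "continuous_on {0..1} (Z a i)" if "i < N" for a i
    by (rule continuous_on_vector_derivative) (rule dZ[OF that])
  have adm: "admissible (V a) (Vd a)" for a
    unfolding admissible_def
  proof (intro conjI allI impI ballI)
    fix i and t :: real assume i: "i < N" and t: "t \<in> {0..1}"
    have "((\<lambda>t. \<phi> (real i + t)) has_field_derivative \<phi>d (real i + t)) (at t within {0..1})"
      by (rule has_field_derivative_at_within)
         (use DERIV_shift[of \<phi> "\<phi>d (real i + t)" t "real i"] d\<phi>[of "real i + t"] in \<open>simp add: add.commute\<close>)
    then show "(V a i has_vector_derivative Vd a i t) (at t within {0..1})"
      unfolding V_def Vd_def by (rule has_vector_derivative_scaleR[OF _ dZ[OF i t]])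
  next
    fix i assume i: "i < N"
    interpret M: local_metric "chart_img (c i)" "g (c i)" by (rule seg_props(9)[OF i])
    show "continuous_on {0..1} (Vd a i)"
      unfolding Vd_def
      by (intro continuous_intros shift \<phi>c \<phi>dc M.continuous_on_christoffel_form seg_cont i Zc) (use seg_props(2)[OF i] in blast)
  next
    fix i assume i: "Suc i < N"
    interpret l: linear "J i" by (rule J_linear[OF i])
    show "V a (Suc i) 0 = J i (V a i 1)"
      by (simp add: V_def Z_def e(2)[OF i] no_corner[OF i] l.diff l.scale add.commute)
  next
    show "V a 0 0 = 0" by (simp add: V_def ends)
    have "real (N - 1) + 1 = real N" using N by simp
    then show "V a (N - 1) 1 = 0" by (simp add: V_def ends)
  qed
  define qa where "qa a i t = (\<phi>d (real i + t))\<^sup>2 * metric_inner (g (c i)) (u i t) (Z a i t) (Z a i t)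
     - (\<phi> (real i + t))\<^sup>2 * metric_inner (g (c i)) (u i t) (riemann_curv (g (c i)) (u i t) (Z a i t) (w i t) (w i t)) (Z a i t)" for a i t
  have qc: "continuous_on {0..1} (qa a i)" if i: "i < N" for a i
  proof -
    interpret M: local_metric "chart_img (c i)" "g (c i)" by (rule seg_props(9)[OF i])
    have im: "u i ` {0..1} \<subseteq> chart_img (c i)" using seg_props(2)[OF i] by blast
    show ?thesis
      unfolding qa_def riemann_curv_christoffel_form
      by (intro continuous_intros shift \<phi>c \<phi>dc M.continuous_on_ip M.continuous_on_christoffel_form M.continuous_on_christoffel_form_deriv seg_cont i Zc im)
  qed
  have sum_qa: "(\<Sum>a\<in>UNIV. qa a i t) = q i t" if i: "i < N" and t: "t \<in> {0..1}" for i t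
  proof -
    interpret M: local_metric "chart_img (c i)" "g (c i)" by (rule seg_props(9)[OF i])
    note x = seg_props(2)[OF i t]
    have ww: "M.ip (u i t) (w i t) (w i t) = L\<^sup>2"
      using parallel_inner_constant[OF i t seg_props(4)[OF i] seg_props(4)[OF i]] seg_props(8)[OF i] by simp
    have kk: "(\<Sum>a\<in>UNIV. (k a)\<^sup>2) = L\<^sup>2"
      using M.frame_norm[OF x e(3)[OF i t], of "w i t"] e(4)[OF i t] ww by simp
    \<comment> \<open>The squared components \<open>(k a)\<^sup>2\<close> add up to
      \<open>L\<^sup>2\<close>, so the projections lose one unit in total: their squared lengths add
      up to \<open>n - 1\<close>.\<close>
    have ZZ: "M.ip (u i t) (Z a i t) (Z a i t) = 1 - (k a)\<^sup>2 / L\<^sup>2" for a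
      using L M.ip_sym[OF x, of "w i t" "e i a t"]
      by (simp add: Z_def ip_simps e(3)[OF i t] e(4)[OF i t] ww power2_eq_square)
    have sZZ: "(\<Sum>a\<in>UNIV. M.ip (u i t) (Z a i t) (Z a i t)) = real CARD('n) - 1"
      using L kk by (simp add: ZZ sum_subtractf sum_divide_distrib[symmetric])
    interpret l: linear "\<lambda>v. riemann_curv (g (c i)) (u i t) v (w i t) (w i t)" by (rule M.linear_riemann[OF x])
    \<comment> \<open>The tangential parts drop out: the curvature vanishes when its first two
      arguments agree, and its values here are orthogonal to the velocity. The sum is therefore the
      full trace.\<close>
    have RZ: "M.ip (u i t) (riemann_curv (g (c i)) (u i t) (Z a i t) (w i t) (w i t)) (Z a i t)
       = M.ip (u i t) (riemann_curv (g (c i)) (u i t) (e i a t) (w i t) (w i t)) (e i a t)" for a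
      by (simp add: Z_def l.diff l.scale M.riemann_same[OF x] ip_simps M.riemann_skew0[OF x])
    show ?thesis
      unfolding qa_def q_def RZ sum_subtractf sum_distrib_left[symmetric] sZZ M.ricci_frame[OF x e(3)[OF i t]] by simp
  qed
  show iq: "q i integrable_on {0..1}" if i: "i < N" for i
  proof -
    have "(\<lambda>t. \<Sum>a\<in>UNIV. qa a i t) integrable_on {0..1}"
      by (intro integrable_continuous_real continuous_on_sum qc i)
    then show ?thesis by (rule integrable_eq) (rule sum_qa[OF i])
  qed
  have "0 \<le> (\<Sum>i<N. integral {0..1} (qa a i))" for a
  proof -
    have "0 \<le> (\<Sum>i<N. integral {0..1} (\<lambda>t. 2 * metric_inner (g (c i)) (u i t) (Vd a i t + christoffel_form (g (c i)) (u i t) (w i t) (V a i t)) (Vd a i t + christoffel_form (g (c i)) (u i t) (w i t) (V a i t))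
        - 2 * metric_inner (g (c i)) (u i t) (riemann_curv (g (c i)) (u i t) (V a i t) (w i t) (w i t)) (V a i t)))"
      by (rule variation_inequality(2)[OF adm])
    also have "\<dots> = (\<Sum>i<N. integral {0..1} (\<lambda>t. 2 * qa a i t))"
    proof (intro sum.cong refl integral_cong)
      fix i and t :: real assume "i \<in> {..<N}" and t: "t \<in> {0..1}"
      then have i: "i < N" by simp
      interpret M: local_metric "chart_img (c i)" "g (c i)" by (rule seg_props(9)[OF i])
      note x = seg_props(2)[OF i t]
      interpret l: linear "\<lambda>v. riemann_curv (g (c i)) (u i t) v (w i t) (w i t)" by (rule M.linear_riemann[OF x])
      \<comment> \<open>\<open>Z\<close> is parallel, so the covariant derivative of the field only
        sees \<phi>.\<close>
      have 1: "Vd a i t + christoffel_form (g (c i)) (u i t) (w i t) (V a i t) = \<phi>d (real i + t) *\<^sub>R Z a i t"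
        by (simp add: Vd_def V_def christoffel_form_simps)
      show "2 * M.ip (u i t) (Vd a i t + christoffel_form (g (c i)) (u i t) (w i t) (V a i t)) (Vd a i t + christoffel_form (g (c i)) (u i t) (w i t) (V a i t))
        - 2 * M.ip (u i t) (riemann_curv (g (c i)) (u i t) (V a i t) (w i t) (w i t)) (V a i t) = 2 * qa a i t"
        unfolding 1 by (simp add: V_def l.scale ip_simps qa_def power2_eq_square mult_ac)
    qed
    also have "\<dots> = 2 * (\<Sum>i<N. integral {0..1} (qa a i))" by (simp add: sum_distrib_left)
    finally show ?thesis by simp
  qed
  then have "0 \<le> (\<Sum>a\<in>UNIV. \<Sum>i<N. integral {0..1} (qa a i))" by (rule sum_nonneg)
  also have "\<dots> = (\<Sum>i<N. \<Sum>a\<in>UNIV. integral {0..1} (qa a i))" by (rule sum.swap)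
  also have "\<dots> = (\<Sum>i<N. integral {0..1} (q i))"
  proof (rule sum.cong[OF refl])
    fix i assume "i \<in> {..<N}"
    then have i: "i < N" by simp
    have "(\<Sum>a\<in>UNIV. integral {0..1} (qa a i)) = integral {0..1} (\<lambda>t. \<Sum>a\<in>UNIV. qa a i t)"
      by (subst Henstock_Kurzweil_Integration.integral_sum) (auto intro: integrable_continuous_real qc i)
    also have "\<dots> = integral {0..1} (q i)" by (rule integral_cong) (rule sum_qa[OF i])
    finally show "(\<Sum>a\<in>UNIV. integral {0..1} (qa a i)) = integral {0..1} (q i)" .
  qed
  finally show "0 \<le> (\<Sum>i<N. integral {0..1} (q i))" .
qed

text \<open>Time runs over \<open>[0, N]\<close> at speed \<open>L\<close>, so the length is
  \<open>real N * L\<close> and the test function is half a sine wave over the whole chain, not over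
  a single segment.\<close>

lemma length_bound:
  assumes n: "CARD('n) \<ge> 2" and f: "smooth_function A f"
    and ric: "\<forall>c\<in>A. \<forall>x\<in>chart_img c. \<forall>v. ricci (g c) x v v + hessian (g c) (f \<circ> chart_inv c) x v v
             \<ge> (real CARD('n) - 1) * H * metric_inner (g c) x v v"
    and k: "\<forall>p. \<bar>f p\<bar> \<le> k"
  shows "H * (real N * L)\<^sup>2 \<le> pi\<^sup>2 + 8 * k * pi / (real CARD('n) - 1)"
proof -
  define n1 where "n1 = real CARD('n) - 1"
  have n1: "n1 > 0" using n by (simp add: n1_def)
  define T where "T = real N"
  have T: "T > 0" using N by (simp add: T_def)
  define a where "a = pi / T"
  have a: "a > 0" "a * T = pi" using T by (simp_all add: a_def)
  define \<phi> where "\<phi> r = sin (a * r)" for r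
  define \<phi>d where "\<phi>d r = a * cos (a * r)" for r
  define \<psi> where "\<psi> r = (\<phi> r)\<^sup>2" for r
  define \<psi>d where "\<psi>d r = a * sin (2 * a * r)" for r
  define \<psi>d2 where "\<psi>d2 r = 2 * a\<^sup>2 * cos (2 * a * r)" for r
  have d\<phi>: "(\<phi> has_real_derivative \<phi>d r) (at r)" for r
    unfolding \<phi>_def \<phi>d_def by (auto intro!: derivative_eq_intros)
  have d\<psi>: "(\<psi> has_real_derivative \<psi>d r) (at r)" for r
  proof -
    have "(\<psi> has_real_derivative 2 * sin (a * r) * (a * cos (a * r))) (at r)"
      unfolding \<psi>_def \<phi>_def by (auto intro!: derivative_eq_intros)
    moreover have "sin (2 * a * r) = 2 * sin (a * r) * cos (a * r)"
      using sin_double[of "a * r"] by (simp add: mult.assoc)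
    ultimately show ?thesis by (simp add: \<psi>d_def mult_ac)
  qed
  have d\<psi>d: "(\<psi>d has_real_derivative \<psi>d2 r) (at r)" for r
    unfolding \<psi>d_def \<psi>d2_def by (auto intro!: derivative_eq_intros simp: power2_eq_square)
  have cont: "continuous_on UNIV \<phi>" "continuous_on UNIV \<phi>d" "continuous_on UNIV \<psi>d2"
    unfolding \<phi>_def \<phi>d_def \<psi>d2_def by (intro continuous_intros)+
  have ends: "\<phi> 0 = 0" "\<phi> T = 0" "\<psi>d 0 = 0" "\<psi>d T = 0"
    using a by (simp_all add: \<phi>_def \<psi>d_def mult.assoc)
  note ix = index_inequality[OF d\<phi> cont(2) ends(1) ends(2)[unfolded T_def], folded n1_def]
  define F where "F i = f \<circ> chart_inv (c i)" for i
  define h where "h i t = F i (u i t)" for i t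
  define hd where "hd i t = dir_deriv (F i) (w i t) (u i t)" for i t
  define hdd where "hdd i t = hessian (g (c i)) (F i) (u i t) (w i t) (w i t)" for i t
  have smF: "smooth_on (chart_img (c i)) (F i)" if "i < N" for i
    using f seg_props(1)[OF that] by (simp add: smooth_function_def F_def)
  have dh: "(h i has_real_derivative hd i t) (at t within {0..1})" if "i < N" "t \<in> {0..1}" for i t
    unfolding h_def[abs_def] hd_def has_real_derivative_iff_has_vector_derivative
    by (rule dir_deriv_curve[OF smF[OF that(1)] seg_props(2,3)[OF that]])
  have dhd: "(hd i has_real_derivative hdd i t) (at t within {0..1})" if i: "i < N" and t: "t \<in> {0..1}" for i t
  proof -
    interpret M: local_metric "chart_img (c i)" "g (c i)" by (rule seg_props(9)[OF i])
    note x = seg_props(2)[OF i t]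
    interpret l: linear "\<lambda>v. dir_deriv (F i) v (u i t)" by (rule linear_dir_deriv[OF smF[OF i] x])
    have "(hd i has_vector_derivative dir_deriv (F i) (- christoffel_form (g (c i)) (u i t) (w i t) (w i t)) (u i t) + dir_deriv (dir_deriv (F i) (w i t)) (w i t) (u i t)) (at t within {0..1})"
      unfolding hd_def[abs_def]
      by (rule dir_deriv_moving_curve[OF M.open_S smF[OF i] x seg_props(3,4)[OF i t] t seg_props(2)[OF i]])
    then show ?thesis
      by (simp add: hdd_def M.hessian_eq[OF smF[OF i] x] l.neg has_real_derivative_iff_has_vector_derivative)
  qed
  \<comment> \<open>The values match because the segments share the node, the derivatives because
    there is no corner. Otherwise the integrations by parts would leave terms at the nodes.\<close>
  have hnode: "h i 1 = h (Suc i) 0" "hd i 1 = hd (Suc i) 0" if i: "Suc i < N" for i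
  proof -
    have i': "i < N" using i by simp
    note cA = seg_props(1)[OF i'] seg_props(1)[OF i]
    show "h i 1 = h (Suc i) 0"
      using seg_props(7)[OF i'] seg_props(6)[OF i] by (simp add: h_def F_def)
    let ?\<tau> = "transition (c i) (c (Suc i))"
    note ov = node_overlap[OF i]
    have "(F (Suc i) has_derivative (\<lambda>v. dir_deriv (F (Suc i)) v (?\<tau> (u i 1)))) (at (?\<tau> (u i 1)))"
      by (rule smooth_on_has_derivative[OF smF[OF i] transition_in[OF cA(1) ov(1)]])
    from diff_chain_at[OF smooth_on_has_derivative[OF smooth_transition[OF cA] ov(1)] this]
    have "(F (Suc i) \<circ> ?\<tau> has_derivative (\<lambda>v. dir_deriv (F (Suc i)) (dir_deriv ?\<tau> v (u i 1)) (?\<tau> (u i 1)))) (at (u i 1))"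
      by (simp only: o_def)
    then have "(F i has_derivative (\<lambda>v. dir_deriv (F (Suc i)) (dir_deriv ?\<tau> v (u i 1)) (?\<tau> (u i 1)))) (at (u i 1))"
    proof (rule has_derivative_transform_within_open[OF _ open_overlap[OF cA] ov(1)])
      fix y assume "y \<in> overlap (c i) (c (Suc i))"
      then show "(F (Suc i) \<circ> ?\<tau>) y = F i y"
        by (simp add: F_def transition_def overlap_iff[OF cA(1)] chart_inv_map[OF cA(2)])
    qed
    from dir_deriv_unique[OF this, of "w i 1"] show "hd i 1 = hd (Suc i) 0"
      unfolding hd_def no_corner[OF i] J_def ov(2) .
  qed
  \<comment> \<open>The primitive for two integrations by parts at once: the derivative of
    \<open>B i\<close> at \<open>t\<close> is \<open>\<psi> (real i + t) * hdd i t - \<psi>d2 (real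
    i + t) * h i t\<close>.\<close>
  define B where "B i t = \<psi> (real i + t) * hd i t - \<psi>d (real i + t) * h i t" for i t
  have shiftd: "((\<lambda>t. p (real i + t)) has_real_derivative p' (real i + t)) (at t within {0..1})"
    if "\<And>r. (p has_real_derivative p' r) (at r)" for p p' :: "real \<Rightarrow> real" and i :: nat and t
    by (rule has_field_derivative_at_within)
       (use DERIV_shift[of p "p' (real i + t)" t "real i"] that[of "real i + t"] in \<open>simp add: add.commute\<close>)
  have shift: "continuous_on {0..1} (\<lambda>t. p (real i + t))" if "continuous_on UNIV p" for p :: "real \<Rightarrow> real" and i
    by (rule continuous_on_compose2[OF that]) (auto intro: continuous_intros)
  have hB: "((\<lambda>t. \<psi> (real i + t) * hdd i t - \<psi>d2 (real i + t) * h i t) has_integral (B i 1 - B i 0)) {0..1}" if i: "i < N" for i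
  proof (rule fundamental_theorem_of_calculus)
    fix t :: real assume t: "t \<in> {0..1}"
    have "(B i has_real_derivative (\<psi> (real i + t) * hdd i t - \<psi>d2 (real i + t) * h i t)) (at t within {0..1})"
      unfolding B_def
      by (rule derivative_eq_intros shiftd[OF d\<psi>] shiftd[OF d\<psi>d] dh[OF i t] dhd[OF i t] | simp)+
    then show "(B i has_vector_derivative (\<psi> (real i + t) * hdd i t - \<psi>d2 (real i + t) * h i t)) (at t within {0..1})"
      by (simp add: has_real_derivative_iff_has_vector_derivative)
  qed simp
  have "(\<Sum>i<N. B i 1 - B i 0) = B (N - 1) 1 - B 0 0"
    by (rule sum_telescope_nodes[OF _ N]) (simp add: B_def hnode add.commute)
  also have "\<dots> = 0"
  proof -
    have "real (N - 1) + 1 = T" using N by (simp add: T_def)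
    then show ?thesis using ends by (simp add: B_def \<psi>_def)
  qed
  finally have sB: "(\<Sum>i<N. B i 1 - B i 0) = 0" .
  \<comment> \<open>The bound for the index integrand up to the derivative of \<open>B i\<close>. It
    involves no chart any more, so the segments merge into one integral over
    \<open>{0..T}\<close>.\<close>
  define R where "R r = n1 * (\<phi>d r)\<^sup>2 - n1 * H * L\<^sup>2 * (\<phi> r)\<^sup>2 + k * \<bar>\<psi>d2 r\<bar>" for r
  have Rc: "continuous_on UNIV R"
    unfolding R_def by (intro continuous_intros cont)
  have le: "integral {0..1} (\<lambda>t. n1 * (\<phi>d (real i + t))\<^sup>2 - (\<phi> (real i + t))\<^sup>2 * ricci (g (c i)) (u i t) (w i t) (w i t))
     \<le> integral {0..1} (\<lambda>t. R (real i + t)) + (B i 1 - B i 0)" if i: "i < N" for i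
  proof -
    have iR: "(\<lambda>t. R (real i + t)) integrable_on {0..1}" by (rule integrable_continuous_real[OF shift[OF Rc]])
    have "integral {0..1} (\<lambda>t. n1 * (\<phi>d (real i + t))\<^sup>2 - (\<phi> (real i + t))\<^sup>2 * ricci (g (c i)) (u i t) (w i t) (w i t))
      \<le> integral {0..1} (\<lambda>t. R (real i + t) + (\<psi> (real i + t) * hdd i t - \<psi>d2 (real i + t) * h i t))"
    proof (rule integral_le[OF ix(1)[OF i] integrable_add[OF iR]])
      show "(\<lambda>t. \<psi> (real i + t) * hdd i t - \<psi>d2 (real i + t) * h i t) integrable_on {0..1}" using hB[OF i] by blast
      fix t :: real assume t: "t \<in> {0..1}"
      have ww: "metric_inner (g (c i)) (u i t) (w i t) (w i t) = L\<^sup>2"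
        using parallel_inner_constant[OF i t seg_props(4)[OF i] seg_props(4)[OF i]] seg_props(8)[OF i] by simp
      have "n1 * H * L\<^sup>2 - hdd i t \<le> ricci (g (c i)) (u i t) (w i t) (w i t)"
        using ric[rule_format, OF seg_props(1)[OF i] seg_props(2)[OF i t], of "w i t"] ww
        by (simp add: hdd_def F_def n1_def)
      from mult_left_mono[OF this, of "\<psi> (real i + t)"]
      have 1: "\<psi> (real i + t) * (n1 * H * L\<^sup>2) - \<psi> (real i + t) * hdd i t \<le> \<psi> (real i + t) * ricci (g (c i)) (u i t) (w i t) (w i t)"
        by (simp add: \<psi>_def right_diff_distrib)
      \<comment> \<open>The bound on \<open>f\<close> is used here; \<open>\<psi>d2\<close> changes
        sign, hence the absolute value in \<open>R\<close>.\<close>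
      have "\<psi>d2 (real i + t) * h i t \<le> \<bar>\<psi>d2 (real i + t)\<bar> * \<bar>h i t\<bar>" by (metis abs_ge_self abs_mult)
      also have "\<dots> \<le> \<bar>\<psi>d2 (real i + t)\<bar> * k" using k by (intro mult_left_mono) (auto simp: h_def F_def)
      finally show "n1 * (\<phi>d (real i + t))\<^sup>2 - (\<phi> (real i + t))\<^sup>2 * ricci (g (c i)) (u i t) (w i t) (w i t)
         \<le> R (real i + t) + (\<psi> (real i + t) * hdd i t - \<psi>d2 (real i + t) * h i t)"
        using 1 by (simp add: R_def \<psi>_def mult_ac)
    qed
    also have "\<dots> = integral {0..1} (\<lambda>t. R (real i + t)) + (B i 1 - B i 0)"
      by (rule integral_unique[OF has_integral_add[OF integrable_integral[OF iR] hB[OF i]]])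
    finally show ?thesis .
  qed
  have "0 \<le> (\<Sum>i<N. integral {0..1} (\<lambda>t. n1 * (\<phi>d (real i + t))\<^sup>2 - (\<phi> (real i + t))\<^sup>2 * ricci (g (c i)) (u i t) (w i t) (w i t)))"
    by (rule ix(2))
  also have "\<dots> \<le> (\<Sum>i<N. integral {0..1} (\<lambda>t. R (real i + t)) + (B i 1 - B i 0))"
    by (rule sum_mono) (use le in simp)
  also have "\<dots> = integral {0..T} R"
    using sum_unit_integrals[OF Rc, of N] sB by (simp only: sum.distrib T_def add_0_right)
  also have "\<dots> = n1 * (a\<^sup>2 * (T / 2)) - n1 * H * L\<^sup>2 * (T / 2) + k * (2 * a\<^sup>2 * (2 * T / pi))"
  proof (rule integral_unique)
    have c2: "(\<phi>d r)\<^sup>2 = a\<^sup>2 * (1/2 + cos (2 * a * r) / 2)" "(\<phi> r)\<^sup>2 = 1/2 - cos (2 * a * r) / 2" for r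
    proof -
      have "cos (2 * a * r) = 2 * (cos (a * r))\<^sup>2 - 1" "cos (2 * a * r) = 1 - 2 * (sin (a * r))\<^sup>2"
        using cos_double_cos[of "a * r"] cos_double_sin[of "a * r"] sin_cos_squared_add[of "a * r"]
        by (simp_all only: mult.assoc)
      then have "(cos (a * r))\<^sup>2 = 1/2 + cos (2 * a * r) / 2" "(sin (a * r))\<^sup>2 = 1/2 - cos (2 * a * r) / 2" by linarith+
      then show "(\<phi>d r)\<^sup>2 = a\<^sup>2 * (1/2 + cos (2 * a * r) / 2)" "(\<phi> r)\<^sup>2 = 1/2 - cos (2 * a * r) / 2"
        by (simp_all only: \<phi>d_def \<phi>_def power_mult_distrib)
    qed
    have d1: "((\<lambda>r. a\<^sup>2 * (r / 2 + sin (2 * a * r) / (4 * a))) has_real_derivative a\<^sup>2 * (1/2 + cos (2 * a * r) / 2)) (at r within W)"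
      "((\<lambda>r. r / 2 - sin (2 * a * r) / (4 * a)) has_real_derivative 1/2 - cos (2 * a * r) / 2) (at r within W)" for r W
      using a(1) by (auto intro!: derivative_eq_intros)
    have s0: "sin (2 * a * T) = 0" using a(2) by (simp add: mult.assoc)
    have i1: "((\<lambda>r. (\<phi>d r)\<^sup>2) has_integral (a\<^sup>2 * (T / 2))) {0..T}"
      using fundamental_theorem_of_calculus[of 0 T "\<lambda>r. a\<^sup>2 * (r / 2 + sin (2 * a * r) / (4 * a))" "\<lambda>r. a\<^sup>2 * (1/2 + cos (2 * a * r) / 2)"]
        d1(1) T s0 unfolding c2 by (simp add: has_real_derivative_iff_has_vector_derivative)
    have i2: "((\<lambda>r. (\<phi> r)\<^sup>2) has_integral (T / 2)) {0..T}"
      using fundamental_theorem_of_calculus[of 0 T "\<lambda>r. r / 2 - sin (2 * a * r) / (4 * a)" "\<lambda>r. 1/2 - cos (2 * a * r) / 2"]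
        d1(2) T s0 unfolding c2 by (simp add: has_real_derivative_iff_has_vector_derivative)
    have "((\<lambda>r. \<bar>cos (2 * a * r)\<bar>) has_integral (2 * T / pi)) {0..T}"
    proof -
      have "(\<lambda>r. \<bar>cos (2 * pi * r / T)\<bar>) integrable_on {0..T}"
        by (intro integrable_continuous_real continuous_intros) (use T in auto)
      from integrable_integral[OF this] show ?thesis unfolding abs_cos_integral[OF T] by (simp add: a_def mult_ac)
    qed
    from has_integral_mult_right[OF this, of "2 * a\<^sup>2"]
    have i3: "((\<lambda>r. \<bar>\<psi>d2 r\<bar>) has_integral (2 * a\<^sup>2 * (2 * T / pi))) {0..T}"
      by (simp add: \<psi>d2_def abs_mult)
    show "(R has_integral n1 * (a\<^sup>2 * (T / 2)) - n1 * H * L\<^sup>2 * (T / 2) + k * (2 * a\<^sup>2 * (2 * T / pi))) {0..T}"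
      unfolding R_def by (intro has_integral_add has_integral_diff has_integral_mult_right i1 i2 i3)
  qed
  finally have fin: "0 \<le> n1 * (a\<^sup>2 * (T / 2)) - n1 * H * L\<^sup>2 * (T / 2) + k * (2 * a\<^sup>2 * (2 * T / pi))" .
  \<comment> \<open>The factor turns the first coefficient into \<open>(a * T)\<^sup>2\<close>,
    which is \<open>pi\<^sup>2\<close>.\<close>
  have "0 \<le> (2 * T / n1) * (n1 * (a\<^sup>2 * (T / 2)) - n1 * H * L\<^sup>2 * (T / 2) + k * (2 * a\<^sup>2 * (2 * T / pi)))"
    using fin T n1 by simp
  also have "\<dots> = (a * T)\<^sup>2 - H * (T * L)\<^sup>2 + 8 * k * (a * T)\<^sup>2 / (n1 * pi)"
    using n1 by (simp add: field_simps power2_eq_square)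
  also have "\<dots> = pi\<^sup>2 - H * (T * L)\<^sup>2 + 8 * k * pi / n1"
    unfolding a(2) using n1 by (simp add: power2_eq_square)
  finally show ?thesis by (simp add: T_def n1_def)
qed

end

section \<open>Chains between arbitrary points and the conclusion\<close>

context connected_riemannian_manifold
begin

text \<open>Closed balls are compact by Hopf--Rinow. The ball around \<open>p\<close> of radius
  \<open>d p q\<close> has a Lebesgue number for the cover by neighbourhoods whose points are joined
  by geodesic segments; with steps below it, consecutive nodes are joined by such segments.\<close>

lemma diameter_bound:
  assumes complete: "riem_complete A g" and n: "CARD('n) \<ge> 2" and f: "smooth_function A f"
    and ric: "\<forall>c\<in>A. \<forall>x\<in>chart_img c. \<forall>v. ricci (g c) x v v + hessian (g c) (f \<circ> chart_inv c) x v v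
             \<ge> (real CARD('n) - 1) * H * metric_inner (g c) x v v"
    and k: "\<forall>p. \<bar>f p\<bar> \<le> k" and k0: "0 \<le> k" and H: "0 < H"
  shows "compactin mtopology (mcball p r)"
    "d p q \<le> pi / sqrt H * sqrt (1 + 8 * k / ((real CARD('n) - 1) * pi))"
proof -
  have mc: "mcomplete" using complete by (simp add: riem_complete_def)
  have comp: "compactin mtopology (mcball p r)" for p r
    by (rule hopf_rinow[OF mc]) (use locally_compact intermediate_point in auto)
  then show "compactin mtopology (mcball p r)" .
  define n1 where "n1 = real CARD('n) - 1"
  have n1: "n1 > 0" using n by (simp add: n1_def)
  define B where "B = pi / sqrt H * sqrt (1 + 8 * k / (n1 * pi))"
  have B0: "0 \<le> B" unfolding B_def using H k0 n1 by simp
  have B2: "B\<^sup>2 = (pi\<^sup>2 + 8 * k * pi / n1) / H"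
  proof -
    have "0 \<le> 1 + 8 * k / (n1 * pi)" using k0 n1 by simp
    then have "B\<^sup>2 = pi\<^sup>2 / H * (1 + 8 * k / (n1 * pi))"
      unfolding B_def using H by (simp add: power_mult_distrib power_divide)
    also have "\<dots> = (pi\<^sup>2 + 8 * k * pi / n1) / H" using n1 H by (simp add: field_simps power2_eq_square)
    finally show ?thesis .
  qed
  have "d p q \<le> B"
  \<comment> \<open>A chain needs steps of positive length, so coinciding points are treated
    apart.\<close>
  proof (cases "d p q = 0")
    case False
    define l where "l = d p q"
    have l: "l > 0" using False d_nonneg[of p q] by (simp add: l_def)
    obtain r where r: "\<And>y. r y > 0" "\<And>y a b. d y a < r y \<Longrightarrow> d y b < r y \<Longrightarrow> \<exists>c u w. geodesic_segment c u w a b"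
      using geodesic_segment_exists by metis
    have "mcball p l \<subseteq> \<Union>((\<lambda>y. mball y (r y)) ` mcball p l)"
      using r(1) by (auto simp: d_refl)
    moreover have "\<And>U. U \<in> (\<lambda>y. mball y (r y)) ` mcball p l \<Longrightarrow> openin mtopology U" by auto
    ultimately have "\<exists>\<epsilon>>0. \<forall>y\<in>mcball p l. \<exists>U\<in>(\<lambda>y. mball y (r y)) ` mcball p l. mball y \<epsilon> \<subseteq> U"
      by (rule lebesgue_number[OF comp])
    then obtain \<epsilon> where \<epsilon>: "\<epsilon> > 0"
      "\<And>y. y \<in> mcball p l \<Longrightarrow> \<exists>U\<in>(\<lambda>y. mball y (r y)) ` mcball p l. mball y \<epsilon> \<subseteq> U" by blast
    obtain N :: nat where N: "l / \<epsilon> < real N" using reals_Archimedean2 by blast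
    have N0: "N > 0" using N l \<epsilon>(1) by (metis divide_pos_pos gr0I less_asym of_nat_0)
    define L where "L = l / real N"
    have L: "L > 0" "L < \<epsilon>" "real N * L = l" using l \<epsilon>(1) N N0 by (simp_all add: L_def field_simps)
    \<comment> \<open>The nodes are chosen one after the other, each at distance \<open>L\<close>
      from the previous one and \<open>L\<close> closer to \<open>q\<close>; beyond \<open>N\<close>
      nothing is demanded.\<close>
    have "\<exists>x. \<forall>i. (if i = 0 then x i = p else True) \<and> (i \<le> N \<longrightarrow> d (x i) q = l - real i * L) \<and> (Suc i \<le> N \<longrightarrow> d (x i) (x (Suc i)) = L)"
    proof -
      define P where "P i y \<longleftrightarrow> (if i = 0 then y = p else True) \<and> (i \<le> N \<longrightarrow> d y q = l - real i * L)" for i y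
      have "\<exists>x. \<forall>i. P i (x i) \<and> (Suc i \<le> N \<longrightarrow> d (x i) (x (Suc i)) = L)"
      proof (rule dependent_nat_choice)
        show "\<exists>y. P 0 y" by (simp add: P_def l_def)
        fix y i assume y: "P i y"
        show "\<exists>z. P (Suc i) z \<and> (Suc i \<le> N \<longrightarrow> d y z = L)"
        proof (cases "Suc i \<le> N")
          case True
          then have dy: "d y q = l - real i * L" using y by (simp add: P_def)
          have "real (Suc i) * L \<le> real N * L" using True L(1) by (intro mult_right_mono) auto
          then have Ly: "L \<le> d y q" using dy L(3) by (simp add: distrib_right)
          obtain z where "d y z = L" "d z q = d y q - L"
            using intermediate_point_exact[OF comp _ UNIV_I UNIV_I less_imp_le[OF L(1)], of y q]
              intermediate_point[OF less_imp_le[OF L(1)] Ly] by auto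
          then show ?thesis using dy by (intro exI[of _ z]) (simp add: P_def distrib_right)
        qed (simp add: P_def)
      qed
      then show ?thesis by (simp only: P_def conj_assoc)
    qed
    then obtain x where x: "x 0 = p" "\<And>i. i \<le> N \<Longrightarrow> d (x i) q = l - real i * L" "\<And>i. i < N \<Longrightarrow> d (x i) (x (Suc i)) = L"
      by (metis Suc_leI)
    have xN: "x N = q" using x(2)[of N] L(3) d_eq_0[of "x N" q] by simp
    have xK: "d p (x i) \<le> real i * L" if "i \<le> N" for i
      using that
    proof (induction i)
      case (Suc i)
      then have "d p (x (Suc i)) \<le> d p (x i) + d (x i) (x (Suc i))" by (intro d_triangle)
      then show ?case using Suc x(3)[of i] by (simp add: distrib_right)
    qed (simp add: x(1) d_refl)
    have "\<exists>c u w. geodesic_segment c u w (x i) (x (Suc i))" if i: "i < N" for i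
    proof -
      have "real i * L \<le> real N * L" using i L(1) by (intro mult_right_mono) auto
      then have "x i \<in> mcball p l" using xK[of i] i L(3) by simp
      then obtain y where "mball (x i) \<epsilon> \<subseteq> mball y (r y)" using \<epsilon>(2) by blast
      moreover have "x i \<in> mball (x i) \<epsilon>" "x (Suc i) \<in> mball (x i) \<epsilon>"
        using \<epsilon>(1) x(3)[OF i] L(2) by (simp_all add: d_refl)
      ultimately have "x i \<in> mball y (r y)" "x (Suc i) \<in> mball y (r y)" by blast+
      then show ?thesis using r(2)[of y "x i" "x (Suc i)"] by simp
    qed
    then obtain c u w where seg: "\<And>i. i < N \<Longrightarrow> geodesic_segment (c i) (u i) (w i) (x i) (x (Suc i))" by metis
    have lN: "real N * L = l" by (rule L(3))
    interpret geodesic_chain A g N x c u w L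
      by unfold_locales (use N0 L seg x xN in \<open>auto simp: l_def\<close>)
    have "H * l\<^sup>2 \<le> pi\<^sup>2 + 8 * k * pi / n1"
      using length_bound[OF n f ric k] lN by (simp add: n1_def)
    then have "l\<^sup>2 \<le> B\<^sup>2" unfolding B2 using H by (simp add: field_simps)
    then have "l \<le> B" using B0 by (rule power2_le_imp_le)
    then show ?thesis by (simp add: l_def)
  qed (use B0 in simp)
  then show "d p q \<le> pi / sqrt H * sqrt (1 + 8 * k / ((real CARD('n) - 1) * pi))"
    by (simp add: B_def n1_def)
qed

end

theorem theorem1p5:
  fixes A :: "('a::{t2_space, second_countable_topology}, 'n::finite) chart set"
    and g :: "('a, 'n) metric_tensor"
    and f :: "'a \<Rightarrow> real"
    and H k :: real
  assumes "CARD('n) \<ge> 2"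
    and "riemannian_manifold A g"
    and "connected (UNIV :: 'a set)"
    and "riem_complete A g"
    and "smooth_function A f"
    and "H > 0"
    and "\<forall>c\<in>A. \<forall>x\<in>chart_img c. \<forall>v.
           ricci (g c) x v v + hessian (g c) (f \<circ> chart_inv c) x v v
             \<ge> (real CARD('n) - 1) * H * metric_inner (g c) x v v"
    and "k \<ge> 0"
    and "\<forall>p. \<bar>f p\<bar> \<le> k"
  shows "compact (UNIV :: 'a set) \<and>
         riem_diameter A g
           \<le> ereal (pi / sqrt H * sqrt (1 + 8 * k / ((real CARD('n) - 1) * pi)))"
proof -
  interpret riemannian_manifold A g by fact
  interpret connected_riemannian_manifold A g by unfold_locales fact
  note D = diameter_bound[OF assms(4,1,5,7,9,8,6)]
  define B where "B = pi / sqrt H * sqrt (1 + 8 * k / ((real CARD('n) - 1) * pi))"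
  \<comment> \<open>Any centre will do: a closed ball of radius \<open>B\<close> is the whole
    manifold, and closed balls are compact.\<close>
  have "mcball undefined B = UNIV" using D(2)[of undefined] by (auto simp: B_def)
  with D(1)[of undefined B] have "compact (UNIV :: 'a set)" by (simp add: mtopology_eq)
  moreover have "riem_diameter A g \<le> ereal B"
    unfolding riem_diameter_def by (intro SUP_least) (use D(2) in \<open>simp add: B_def\<close>)
  ultimately show ?thesis by (simp add: B_def)
qed

end
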